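(* Consider the two-class homoscedastic normal model in $\mathbb{R}^p$ with Mahalanobis distance $\Delta>0$ between the classes, and with class labels missing according to the logistic missing-label model $\mathrm{pr}\{M=1\mid Y=y,Z=z\}=\exp\{\xi_0+\xi_1 d(y;\beta)^2\}/[1+\exp\{\xi_0+\xi_1 d(y;\beta)^2\}]$, as described in the context. In the case $\pi_1=\pi_2$, the asymptotic relative efficiency of the estimated Bayes' rule $\hat R_{\rm PC}^{(\rm ig)}$ (obtained from the partially classified sample by maximizing the likelihood that ignores the missingness mechanism) compared to the estimated Bayes' rule $\hat R_{\rm CC}$ (obtained from the completely classified sample) is, for all $p$, $$\mathrm{ARE}(\hat R_{\rm PC}^{(\rm ig)})=1-(\Delta^2+4)\,\gamma\, d_0,$$ where $$d_0=\int_{-\infty}^{\infty}\tau_1(y_1)\,\tau_2(y_1)\,q_1(y_1)\,\gamma^{-1}f_{y_1}(y_1)\,dy_1,$$ with $\gamma=E\{q(Y;\Psi)\}$ the expected proportion of missing labels and $\tau_1,\tau_2,q_1,f_{y_1}$ the functions defined in the context.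
   Context: Model. Let $p\ge 1$. The pair $(Y,Z)$ has $Z\in\{1,2\}$, $\mathrm{pr}(Z=i)=\pi_i$ with $\pi_1,\pi_2>0$, $\pi_1+\pi_2=1$, and $Y\mid Z=i\sim N(\mu_i,\Sigma)$ in $\mathbb{R}^p$, with $\Sigma$ positive definite and $\mu_1\ne\mu_2$; all of $\pi_1,\mu_1,\mu_2,\Sigma$ are unknown and are estimated (also when the true priors are equal). Collect them in $\theta$. Let $f_i$ denote the $N(\mu_i,\Sigma)$ density and $\Delta^2=(\mu_1-\mu_2)^T\Sigma^{-1}(\mu_1-\mu_2)$. Put $\beta=(\beta_0,\beta_1^T)^T$ with $\beta_1=\Sigma^{-1}(\mu_1-\mu_2)$ and $\beta_0=\log(\pi_1/\pi_2)-\tfrac12(\mu_1+\mu_2)^T\Sigma^{-1}(\mu_1-\mu_2)$, and $d(y;\beta)=\beta_0+\beta_1^Ty$. The Bayes' rule $R(y;\beta)$ assigns $y$ to Class 1 if $d(y;\beta)>0$ and to Class 2 if $d(y;\beta)<0$. Missing labels. $\xi=(\xi_0,\xi_1)^T\in\mathbb{R}^2$ is a parameter distinct from $\theta$; $\Psi=(\theta^T,\xi^T)^T$. $(Y_j,Z_j,M_j)$, $j=1,\dots,n$, are i.i.d. copies of $(Y,Z,M)$, where $M\in\{0,1\}$ is the missing-label indicator ($M=1$ means missing) and $\mathrm{pr}\{M=1\mid Y=y,Z=z\}=q(y;\Psi)=\exp\{\xi_0+\xi_1 d(y;\beta)^2\}/[1+\exp\{\xi_0+\xi_1 d(y;\beta)^2\}]$.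 The completely classified sample $x_{\rm CC}$ consists of all $(Y_j,Z_j)$; the partially classified sample $x_{\rm PC}$ consists of $(Y_j,Z_j)$ for $M_j=0$ and $Y_j$ only for $M_j=1$. Estimators. With $z_{ij}=1$ if $z_j=i$ and $0$ otherwise, $$\log L_{\rm PC}^{(\rm ig)}(\theta)=\sum_{j=1}^n(1-m_j)\sum_{i=1}^2 z_{ij}\log\{\pi_if_i(y_j)\}+\sum_{j=1}^n m_j\log\sum_{i=1}^2\pi_if_i(y_j),$$ and $\log L_{\rm CC}(\theta)$ is the same with all $m_j=0$. Let $\hat\beta_{\rm PC}^{(\rm ig)}$ and $\hat\beta_{\rm CC}$ be the maximum likelihood estimators of $\beta$ from $L_{\rm PC}^{(\rm ig)}$ and $L_{\rm CC}$, and $\hat R_{\rm PC}^{(\rm ig)}=R(y;\hat\beta_{\rm PC}^{(\rm ig)})$, $\hat R_{\rm CC}=R(y;\hat\beta_{\rm CC})$. Error rates and ARE. For an estimator $\hat\beta$, the conditional error rate on a new independent $(Y,Z)$ is $\mathrm{err}(\hat\beta;\beta)=1-\sum_{i=1}^2\pi_i\,\mathrm{pr}\{R(Y;\hat\beta)=i\mid\hat\beta,Z=i\}$; the optimal error rate $\mathrm{err}(\beta)$ is obtained by replacing $\hat\beta$ by $\beta$. $AE\{\mathrm{err}(\hat\beta;\beta)\}$ denotes the expansion of $E\{\mathrm{err}(\hat\beta;\beta)\}$ up to and including terms of first order in $1/n$. Then $$\mathrm{ARE}(\hat R_{\rm PC}^{(\rm ig)})=\frac{AE\{\mathrm{err}(\hat\beta_{\rm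 CC};\beta)\}-\mathrm{err}(\beta)}{AE\{\mathrm{err}(\hat\beta_{\rm PC}^{(\rm ig)};\beta)\}-\mathrm{err}(\beta)}.$$ Functions in the formula (these refer to the canonical form $\Sigma=I_p$, $\mu_1=(\Delta/2,0,\dots,0)^T$, $\mu_2=-\mu_1$, $\pi_1=\pi_2=1/2$, in which $d(y;\beta)=\Delta y_1$ with $y_1$ the first coordinate of $y$): $\tau_i(y_1)=\mathrm{pr}\{Z=i\mid (Y)_1=y_1\}$ ($i=1,2$), i.e. $\tau_1(y_1)=e^{\Delta y_1}/(1+e^{\Delta y_1})$ and $\tau_2=1-\tau_1$; $q_1(y_1)=\mathrm{pr}\{M=1\mid (Y)_1=y_1\}=\exp(\xi_0+\xi_1\Delta^2y_1^2)/\{1+\exp(\xi_0+\xi_1\Delta^2y_1^2)\}$; $f_{y_1}(y_1)=\tfrac12\phi(y_1;\Delta/2,1)+\tfrac12\phi(y_1;-\Delta/2,1)$, where $\phi(\cdot;m,1)$ is the $N(m,1)$ density; $\gamma=\int q_1(y_1)f_{y_1}(y_1)\,dy_1$. *)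

theory Defs
  imports "HOL-Probability.Probability" "HOL-Library.Landau_Symbols"
begin

datatype label = Class1 | Class2

lemma UNIV_label: "(UNIV :: label set) = {Class1, Class2}"
  using label.exhaust by auto

instance label :: finite
  by standard (simp add: UNIV_label)

datatype 'p params =
  Params (prior1: real) (mean1: "real ^ ('p :: finite)") (mean2: "real ^ 'p") (cov: "real ^ 'p ^ 'p")

fun prior :: "('p :: finite) params \<Rightarrow> label \<Rightarrow> real" where
  "prior \<theta> Class1 = prior1 \<theta>"
| "prior \<theta> Class2 = 1 - prior1 \<theta>"

fun mean :: "('p :: finite) params \<Rightarrow> label \<Rightarrow> real ^ 'p" where
  "mean \<theta> Class1 = mean1 \<theta>"
| "mean \<theta> Class2 = mean2 \<theta>"

definition pos_def_matrix :: "real ^ 'p ^ ('p :: finite) \<Rightarrow> bool" where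
  "pos_def_matrix A \<longleftrightarrow> transpose A = A \<and> (\<forall>x. x \<noteq> 0 \<longrightarrow> x \<bullet> (A *v x) > 0)"

definition param_space :: "('p :: finite) params set" where
  "param_space = {\<theta>. (\<forall>i. prior \<theta> i > 0) \<and> pos_def_matrix (cov \<theta>) \<and> mean \<theta> Class1 \<noteq> mean \<theta> Class2}"

definition mvn_density :: "real ^ 'p \<Rightarrow> real ^ 'p ^ ('p :: finite) \<Rightarrow> real ^ 'p \<Rightarrow> real" where
  "mvn_density \<mu> \<Sigma> y =
     exp (- (1/2) * ((y - \<mu>) \<bullet> (matrix_inv \<Sigma> *v (y - \<mu>)))) / sqrt ((2 * pi) ^ CARD('p) * det \<Sigma>)"

definition mvn :: "real ^ 'p \<Rightarrow> real ^ 'p ^ ('p :: finite) \<Rightarrow> (real ^ 'p) measure" where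
  "mvn \<mu> \<Sigma> = density lborel (\<lambda>y. ennreal (mvn_density \<mu> \<Sigma> y))"

abbreviation class_density :: "('p :: finite) params \<Rightarrow> label \<Rightarrow> real ^ 'p \<Rightarrow> real" where
  "class_density \<theta> i \<equiv> mvn_density (mean \<theta> i) (cov \<theta>)"

definition mahalanobis :: "('p :: finite) params \<Rightarrow> real" where
  "mahalanobis \<theta> =
     sqrt ((mean \<theta> Class1 - mean \<theta> Class2) \<bullet> (matrix_inv (cov \<theta>) *v (mean \<theta> Class1 - mean \<theta> Class2)))"

definition beta :: "('p :: finite) params \<Rightarrow> real \<times> (real ^ 'p)" where
  "beta \<theta> =
     (let b1 = matrix_inv (cov \<theta>) *v (mean \<theta> Class1 - mean \<theta> Class2)
      in (ln (prior \<theta> Class1 / prior \<theta> Class2) - (1/2) * ((mean \<theta> Class1 + mean \<theta> Class2) \<bullet> b1), b1))"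

definition discr :: "real \<times> (real ^ ('p :: finite)) \<Rightarrow> real ^ 'p \<Rightarrow> real" where
  "discr b y = fst b + snd b \<bullet> y"

text \<open>A point on the decision boundary is assigned to no class.\<close>
definition bayes_rule :: "real \<times> (real ^ ('p :: finite)) \<Rightarrow> real ^ 'p \<Rightarrow> label option" where
  "bayes_rule b y =
     (if discr b y > 0 then Some Class1 else if discr b y < 0 then Some Class2 else None)"

text \<open>
  The error rate of the rule with coefficients \<open>b\<close> when the true parameter is \<open>\<theta>\<close>. Evaluated at
  the value of an estimator it is the error rate conditional on the estimator, since the new
  observation is independent of the sample.
\<close>
definition err :: "('p :: finite) params \<Rightarrow> real \<times> (real ^ 'p) \<Rightarrow> real" where
  "err \<theta> b =
     1 - (\<Sum>i\<in>UNIV. prior \<theta> i * measure (mvn (mean \<theta> i) (cov \<theta>)) {y. bayes_rule b y = Some i})"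

definition opt_err :: "('p :: finite) params \<Rightarrow> real" where
  "opt_err \<theta> = err \<theta> (beta \<theta>)"

text \<open>
  An observation is a triple \<open>(Y, Z, M)\<close>, where \<open>M\<close> is true iff the label is missing. It always
  carries \<open>Z\<close>; the partially classified likelihood below does not look at \<open>Z\<close> when \<open>M\<close> is true.
\<close>
type_synonym 'p obs = "(real ^ 'p) \<times> label \<times> bool"

abbreviation obs_space :: "('p :: finite) obs measure" where
  "obs_space \<equiv> lborel \<Otimes>\<^sub>M (count_space UNIV \<Otimes>\<^sub>M count_space UNIV)"

definition missing_prob :: "('p :: finite) params \<Rightarrow> real \<times> real \<Rightarrow> real ^ 'p \<Rightarrow> real" where
  "missing_prob \<theta> \<xi> y =
     (let u = fst \<xi> + snd \<xi> * (discr (beta \<theta>) y)\<^sup>2 in exp u / (1 + exp u))"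

text \<open>
  Joint density of \<open>(Y, Z, M)\<close>: \<open>Z\<close> has the prior distribution, \<open>Y\<close> given \<open>Z = i\<close> is normal,
  and \<open>M\<close> given \<open>(Y, Z)\<close> is Bernoulli with parameter \<open>missing_prob\<close>.
\<close>
definition obs_density :: "('p :: finite) params \<Rightarrow> real \<times> real \<Rightarrow> 'p obs \<Rightarrow> real" where
  "obs_density \<theta> \<xi> = (\<lambda>(y, z, m). prior \<theta> z * class_density \<theta> z y *
     (if m then missing_prob \<theta> \<xi> y else 1 - missing_prob \<theta> \<xi> y))"

definition log_lik_PC_ig :: "nat \<Rightarrow> (nat \<Rightarrow> ('p :: finite) obs) \<Rightarrow> 'p params \<Rightarrow> real" where
  "log_lik_PC_ig n x \<theta> =
     (\<Sum>j<n. case x j of (y, z, m) \<Rightarrow>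
        (1 - of_bool m) * (\<Sum>i\<in>UNIV. of_bool (z = i) * ln (prior \<theta> i * class_density \<theta> i y))) +
     (\<Sum>j<n. case x j of (y, z, m) \<Rightarrow>
        of_bool m * ln (\<Sum>i\<in>UNIV. prior \<theta> i * class_density \<theta> i y))"

definition log_lik_CC :: "nat \<Rightarrow> (nat \<Rightarrow> ('p :: finite) obs) \<Rightarrow> 'p params \<Rightarrow> real" where
  "log_lik_CC n x = log_lik_PC_ig n (\<lambda>j. case x j of (y, z, m) \<Rightarrow> (y, z, False))"

text \<open>
  \<open>b\<close> is a maximum likelihood estimator of \<open>\<beta>\<close> for the random log-likelihood \<open>L\<close>: a random
  variable that is almost surely the image under \<open>beta\<close> of a global maximizer over the parameter
  space. For small samples (for instance if all labels agree) there may be no maximizer; on that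
  event the estimator is unconstrained.
\<close>
definition is_mle_beta ::
    "'w measure \<Rightarrow> ('w \<Rightarrow> ('p :: finite) params \<Rightarrow> real) \<Rightarrow> ('w \<Rightarrow> real \<times> (real ^ 'p)) \<Rightarrow> bool" where
  "is_mle_beta P L b \<longleftrightarrow>
     b \<in> borel_measurable P \<and>
     (AE \<omega> in P. (\<exists>\<theta>. is_arg_max (L \<omega>) (\<lambda>\<theta>. \<theta> \<in> param_space) \<theta>) \<longrightarrow>
        (\<exists>\<theta>. is_arg_max (L \<omega>) (\<lambda>\<theta>. \<theta> \<in> param_space) \<theta> \<and> b \<omega> = beta \<theta>))"

definition first_order_expansion :: "(nat \<Rightarrow> real) \<Rightarrow> (nat \<Rightarrow> real) \<Rightarrow> bool" where
  "first_order_expansion e A \<longleftrightarrow>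
     (\<exists>a c. (\<forall>n. A n = a + c / real n)) \<and> (\<lambda>n. e n - A n) \<in> o(\<lambda>n. 1 / real n)"

lemma first_order_expansion_unique:
  assumes "first_order_expansion e A" "first_order_expansion e B"
  shows "A = B"
proof -
  obtain a c a' c' where A: "\<And>n. A n = a + c / real n" and B: "\<And>n. B n = a' + c' / real n"
    using assms by (auto simp: first_order_expansion_def)
  have "(\<lambda>n. (e n - A n) - (e n - B n)) \<in> o(\<lambda>n. 1 / real n)"
    by (rule sum_in_smallo) (use assms in \<open>simp_all only: first_order_expansion_def\<close>)
  hence "(\<lambda>n. (B n - A n) / (1 / real n)) \<longlonglongrightarrow> 0"
    by (intro smalloD_tendsto) simp
  hence lim: "(\<lambda>n. (B n - A n) * real n) \<longlonglongrightarrow> 0"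
    by simp
  have "\<forall>\<^sub>F n in sequentially. (B n - A n) * real n * (1 / real n) = B n - A n"
    using eventually_gt_at_top[of 0] by eventually_elim simp
  with tendsto_mult[OF lim lim_1_over_n] have *: "(\<lambda>n. B n - A n) \<longlonglongrightarrow> 0"
    by (auto intro: Lim_transform_eventually)
  have "(\<lambda>n. (a' + c' * (1 / real n)) - (a + c * (1 / real n))) \<longlonglongrightarrow> (a' + c' * 0) - (a + c * 0)"
    by (intro tendsto_intros lim_1_over_n)
  with * have aa: "a = a'"
    using LIMSEQ_unique[of "\<lambda>n. B n - A n" 0 "a' - a"] by (simp add: A B)
  have "(\<lambda>n. c' - c) \<longlonglongrightarrow> 0"
  proof (rule Lim_transform_eventually[OF lim])
    show "\<forall>\<^sub>F n in sequentially. (B n - A n) * real n = c' - c"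
      using eventually_gt_at_top[of 0]
      by eventually_elim (auto simp: A B aa field_simps)
  qed
  hence "c = c'"
    by (simp add: LIMSEQ_const_iff)
  thus ?thesis
    using aa A B by (intro ext) simp
qed

text \<open>
  Relative efficiency is formed from the truncated expansions \<open>A\<^sub>1 n\<close> and \<open>A\<^sub>2 n\<close>, which are unique
  by the previous lemma; the ratio must be the same number for every sample size.
  \<open>e\<^sub>1\<close> and \<open>e\<^sub>2\<close> are expected error rates as functions of the sample size and \<open>e\<^sub>0\<close> is the optimal
  error rate. The efficiency is that of the second rule relative to the first.
\<close>
definition has_ARE :: "(nat \<Rightarrow> real) \<Rightarrow> (nat \<Rightarrow> real) \<Rightarrow> real \<Rightarrow> real \<Rightarrow> bool" where
  "has_ARE e\<^sub>1 e\<^sub>2 e\<^sub>0 r \<longleftrightarrow>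
     (\<exists>A\<^sub>1 A\<^sub>2. first_order_expansion e\<^sub>1 A\<^sub>1 \<and> first_order_expansion e\<^sub>2 A\<^sub>2 \<and>
        (\<forall>n>0. A\<^sub>2 n - e\<^sub>0 \<noteq> 0 \<and> (A\<^sub>1 n - e\<^sub>0) / (A\<^sub>2 n - e\<^sub>0) = r))"

text \<open>
  The remaining definitions are functions of \<open>\<Delta>\<close> and \<open>\<xi>\<close> only. They describe the case of identity covariance, means
  \<open>\<plusminus>(\<Delta>/2, 0, \<dots>, 0)\<close> and equal priors, where the discriminant function is \<open>\<Delta> * y\<^sub>1\<close>.
\<close>

fun tau :: "real \<Rightarrow> label \<Rightarrow> real \<Rightarrow> real" where
  "tau \<Delta> Class1 y = exp (\<Delta> * y) / (1 + exp (\<Delta> * y))"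
| "tau \<Delta> Class2 y = 1 - exp (\<Delta> * y) / (1 + exp (\<Delta> * y))"

definition q1 :: "real \<Rightarrow> real \<times> real \<Rightarrow> real \<Rightarrow> real" where
  "q1 \<Delta> \<xi> y = exp (fst \<xi> + snd \<xi> * \<Delta>\<^sup>2 * y\<^sup>2) / (1 + exp (fst \<xi> + snd \<xi> * \<Delta>\<^sup>2 * y\<^sup>2))"

definition fy1 :: "real \<Rightarrow> real \<Rightarrow> real" where
  "fy1 \<Delta> y = (1/2) * normal_density (\<Delta> / 2) 1 y + (1/2) * normal_density (- (\<Delta> / 2)) 1 y"

definition gamma :: "real \<Rightarrow> real \<times> real \<Rightarrow> real" where
  "gamma \<Delta> \<xi> = (\<integral>y. q1 \<Delta> \<xi> y * fy1 \<Delta> y \<partial>lborel)"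

definition d0 :: "real \<Rightarrow> real \<times> real \<Rightarrow> real" where
  "d0 \<Delta> \<xi> = (\<integral>y. tau \<Delta> Class1 y * tau \<Delta> Class2 y * q1 \<Delta> \<xi> y * inverse (gamma \<Delta> \<xi>) * fy1 \<Delta> y \<partial>lborel)"

end

theory Submission
  imports Defs
begin

text \<open>
  The error rate and the likelihood are equivariant under affine maps of the feature space, so one may
  assume identity covariance, means \<open>\<plusminus>(\<Delta>/2) e\<^sub>k\<close> and equal priors. The completely classified sample is the
  case where the missing probability is \<open>0\<close>.

  A maximizer of the likelihood is a fixed point of the EM step, and eliminating means and covariance
  from the fixed point equation leaves equations for the discriminant coefficients alone, in which the data
  enter through averages. Linearized at the truth, each coefficient other than that of \<open>y\<^sub>k\<close> satisfies
  \<open>(1 - (4 + \<Delta>\<^sup>2) I\<^sub>0) b\<^sub>l = S\<^sub>l\<close> up to second order, where \<open>I\<^sub>0 = \<integral> \<tau>\<^sub>1 \<tau>\<^sub>2 q\<^sub>1 f = \<gamma> d\<^sub>0\<close> and \<open>S\<^sub>l\<close> is an average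
  of centred terms of variance \<open>(4 + \<Delta>\<^sup>2) (1 - (4 + \<Delta>\<^sup>2) I\<^sub>0)\<close>. Rescaling \<open>b\<close> does not change the rule, and the
  excess error is \<open>\<kappa> \<Sum> b\<^sub>l\<^sup>2\<close> over these \<open>p\<close> coefficients up to third order. Hence the term of order \<open>1/n\<close> is
  proportional to \<open>1 / (1 - (4 + \<Delta>\<^sup>2) I\<^sub>0)\<close>.

  All remainders, and the error rate on the event that there is no maximizer, are bounded by a
  multiple of the cube of the deviation of finitely many averages from their means; its expectation is
  \<open>O(n\<^bsup>-3/2\<^esup>)\<close>.
\<close>

section \<open>Positive definite matrices\<close>

text \<open>An expansion of expected error rates needs more than a limit law of the estimator.
  Probability therefore enters only at the end: before that, all statements are deterministic and
  concern samples of which finitely many averages are near their expectations. The parameter space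
  is not compact and the likelihood equations may have further roots. One EM step leads from any
  parameter into a fixed compact set; this gives existence, confines all maximizers and allows a
  compactness proof of consistency. In 4 + \<Delta>^2 = 4 (1 + \<Delta>^2/4) the 4 is the inverse of
  W (1 - W) at equal priors, and 1 + \<Delta>^2/4, the variance of the coordinate \<open>k\<close>,
  is the limit of the factor 1 + sum C_j b_j in the EM equations. The difference 1 - (4 +
  \<Delta>^2) I0 is proportional to the residual variance of the class weight after linear
  regression on that coordinate. The constant 1 and the coordinates other than \<open>k\<close> all
  have second moment 1 given coordinate \<open>k\<close>, label and missing indicator. The p
  coefficients thus have the same variance and p cancels in the ratio.\<close>

lemma inner_matrix_vector_transpose:
  fixes A :: "real^'n^'m"
  shows "(A *v x) \<bullet> y = x \<bullet> (transpose A *v y)"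
  by (metis dot_lmul_matrix inner_commute transpose_matrix_vector)

lemma symmetric_inner:
  fixes A :: "real^'n^'n"
  assumes "transpose A = A"
  shows "(A *v x) \<bullet> y = x \<bullet> (A *v y)"
  by (metis assms inner_matrix_vector_transpose)

text \<open>A maximizer \<open>x\<close> of the quadratic form on the unit sphere of
  \<open>W\<close> is an eigenvector: invariance puts the residual
  \<open>C *v x - c *\<^sub>R x\<close> into \<open>W\<close>, and moving \<open>x\<close> a little
  along a nonzero residual would raise the Rayleigh quotient above its maximum.\<close>

lemma symmetric_eigenvector_in_invariant_subspace:
  fixes C :: "real^'n^'n"
  assumes sym: "transpose C = C" and W: "subspace W" and inv: "\<And>x. x \<in> W \<Longrightarrow> C *v x \<in> W"
    and ne: "\<exists>x\<in>W. x \<noteq> 0"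
  shows "\<exists>x\<in>W. norm x = 1 \<and> (\<exists>c. C *v x = c *\<^sub>R x)"
proof -
  let ?S = "sphere 0 1 \<inter> W"
  have "compact ?S"
    by (intro closed_Int_compact compact_Int_closed compact_sphere closed_subspace W)
  moreover obtain x0 where x0: "x0 \<in> W" "x0 \<noteq> 0" using ne by blast
  have "x0 /\<^sub>R norm x0 \<in> ?S"
    using x0 W by (auto simp: subspace_scale)
  hence "?S \<noteq> {}" by blast
  moreover have "continuous_on ?S (\<lambda>x. x \<bullet> (C *v x))"
    by (intro continuous_intros)
  ultimately obtain x where x: "x \<in> ?S" and mx: "\<And>y. y \<in> ?S \<Longrightarrow> y \<bullet> (C *v y) \<le> x \<bullet> (C *v x)"
    using continuous_attains_sup[of ?S "\<lambda>x. x \<bullet> (C *v x)"] by blast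
  define c where "c = x \<bullet> (C *v x)"
  have xx: "x \<bullet> x = 1" and xW: "x \<in> W" using x by (auto simp: norm_eq_1)
  have bound: "y \<bullet> (C *v y) \<le> c * (y \<bullet> y)" if "y \<in> W" for y
  proof (cases "y = 0")
    case False
    have "(y /\<^sub>R norm y) \<bullet> (C *v (y /\<^sub>R norm y)) \<le> c"
      unfolding c_def using that False W by (intro mx) (auto simp: subspace_scale)
    hence "(y \<bullet> (C *v y)) / (norm y)\<^sup>2 \<le> c"
      by (simp add: matrix_vector_mult_scaleR power2_eq_square divide_inverse mult_ac)
    thus ?thesis using False by (simp add: divide_le_eq power2_norm_eq_inner)
  qed simp
  define v where "v = C *v x - c *\<^sub>R x"
  have vW: "v \<in> W" unfolding v_def by (intro subspace_diff subspace_scale W inv xW)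
  have xv: "x \<bullet> v = 0" by (simp add: v_def inner_diff_right c_def xx)
  have vC: "v \<bullet> (C *v x) = v \<bullet> v"
    using xv by (simp add: v_def inner_diff_right inner_diff_left inner_commute)
  have q: "2 * t * (v \<bullet> v) + t\<^sup>2 * (v \<bullet> (C *v v) - c * (v \<bullet> v)) \<le> 0" for t
  proof -
    have "(x + t *\<^sub>R v) \<bullet> (C *v (x + t *\<^sub>R v)) \<le> c * ((x + t *\<^sub>R v) \<bullet> (x + t *\<^sub>R v))"
      by (intro bound subspace_add subspace_scale W xW vW)
    moreover have "x \<bullet> (C *v v) = v \<bullet> v"
      using vC symmetric_inner[OF sym, of x v] by (simp add: inner_commute)
    ultimately show ?thesis
      using vC xv xx
      by (simp add: matrix_vector_right_distrib matrix_vector_mult_scaleR inner_add_left inner_add_right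
          c_def[symmetric] inner_commute[of v x] algebra_simps power2_eq_square)
  qed
  have "v \<bullet> v = 0"
  proof (rule ccontr)
    assume nz: "v \<bullet> v \<noteq> 0"
    hence pos: "v \<bullet> v > 0" by (metis inner_ge_zero order_le_less)
    define k where "k = \<bar>v \<bullet> (C *v v) - c * (v \<bullet> v)\<bar> + 1"
    \<comment> \<open>With this step the quadratic term is at most half of the linear term
      \<open>2 * t * (v \<bullet> v)\<close>, which contradicts the upper bound 0 in
      \<open>q\<close>.\<close>
    define t where "t = (v \<bullet> v) / k"
    have k: "k > 0" by (simp add: k_def)
    have t: "t > 0" using pos k by (simp add: t_def)
    have "2 * t * (v \<bullet> v) - t\<^sup>2 * k \<le> 2 * t * (v \<bullet> v) + t\<^sup>2 * (v \<bullet> (C *v v) - c * (v \<bullet> v))"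
    proof -
      have "- k \<le> v \<bullet> (C *v v) - c * (v \<bullet> v)" unfolding k_def by linarith
      from mult_left_mono[OF this, of "t\<^sup>2"] show ?thesis by simp
    qed
    also have "\<dots> \<le> 0" by (rule q)
    also have "t\<^sup>2 * k = t * (v \<bullet> v)" using k by (simp add: t_def power2_eq_square)
    finally show False using t pos mult_pos_pos[OF t pos] by simp
  qed
  hence "C *v x = c *\<^sub>R x" by (simp add: v_def)
  with x show ?thesis by auto
qed

definition diag_matrix :: "('n \<Rightarrow> real) \<Rightarrow> real^'n^'n" where
  "diag_matrix d = (\<chi> i j. if i = j then d i else 0)"

lemma diag_matrix_mult_vec: "diag_matrix d *v x = (\<chi> i. d i * x $ i)"
  by (simp add: diag_matrix_def matrix_vector_mult_def vec_eq_iff if_distrib if_distribR cong: if_cong)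

lemma det_diag_matrix: "det (diag_matrix d) = (\<Prod>i\<in>UNIV. d i)"
  by (subst det_diagonal) (simp_all add: diag_matrix_def)

lemma trace_diag_matrix: "trace (diag_matrix d) = (\<Sum>i\<in>UNIV. d i)"
  by (simp add: trace_def diag_matrix_def)

lemma transpose_diag_matrix [simp]: "transpose (diag_matrix d) = diag_matrix d"
  by (auto simp: diag_matrix_def transpose_def vec_eq_iff)

lemma diag_matrix_mult: "diag_matrix d ** diag_matrix e = diag_matrix (\<lambda>i. d i * e i)"
  by (rule iffD2[OF matrix_eq])
     (simp add: matrix_vector_mul_assoc[symmetric] diag_matrix_mult_vec vec_eq_iff mult.assoc)

lemma diag_matrix_1: "diag_matrix (\<lambda>_. 1) = mat 1"
  by (simp add: diag_matrix_def mat_def)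

text \<open>An orthonormal set of eigenvectors of largest cardinality spans the space: otherwise its
  orthogonal complement is a nonzero invariant subspace, and a unit eigenvector in it would enlarge
  the set.\<close>

theorem symmetric_matrix_diagonalization:
  fixes C :: "real^'n^'n"
  assumes sym: "transpose C = C"
  obtains U d where "orthogonal_matrix U" "C = U ** diag_matrix d ** transpose U"
proof -
  define good where "good V \<longleftrightarrow> pairwise orthogonal V \<and>
    (\<forall>v\<in>V. norm v = 1 \<and> (\<exists>c. C *v v = c *\<^sub>R v))" for V :: "(real^'n) set"
  have indep: "independent V" if "good V" for V
    using that by (intro pairwise_orthogonal_independent) (auto simp: good_def)
  have cardV: "card V \<le> CARD('n)" if "good V" for V
    using independent_bound[OF indep[OF that]] by simp
  have "\<exists>V. good V \<and> (\<forall>V'. good V' \<longrightarrow> card V' \<le> card V)"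
    using ex_has_greatest_nat[of good "{}" card "CARD('n) + 1"] cardV
    by (auto simp: good_def less_Suc_eq_le)
  then obtain V where V: "good V" and mx: "\<And>V'. good V' \<Longrightarrow> card V' \<le> card V" by blast
  have finV: "finite V" using indep[OF V] by (rule independent_imp_finite)
  have spanV: "span V = UNIV"
  proof (rule ccontr)
    assume nu: "span V \<noteq> UNIV"
    define W where "W = {x. \<forall>v\<in>V. orthogonal v x}"
    have sW: "subspace W" unfolding W_def by (rule subspace_orthogonal_to_vectors)
    from nu have "span V \<subset> span UNIV" by auto
    then obtain x where x: "x \<noteq> 0" "\<And>y. y \<in> span V \<Longrightarrow> orthogonal x y"
      using orthogonal_to_subspace_exists_gen[of V UNIV] by auto
    have "x \<in> W" using x(2) by (auto simp: W_def orthogonal_commute span_base)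
    moreover have "C *v y \<in> W" if "y \<in> W" for y
    proof -
      have "v \<bullet> (C *v y) = 0" if v: "v \<in> V" for v
      proof -
        obtain c where c: "C *v v = c *\<^sub>R v" using V v by (auto simp: good_def)
        have "v \<bullet> (C *v y) = (C *v v) \<bullet> y" by (simp add: symmetric_inner[OF sym])
        also have "\<dots> = c * (v \<bullet> y)" by (simp add: c)
        also have "v \<bullet> y = 0" using \<open>y \<in> W\<close> v by (auto simp: W_def orthogonal_def)
        finally show ?thesis by simp
      qed
      thus ?thesis by (auto simp: W_def orthogonal_def)
    qed
    ultimately obtain u c where u: "u \<in> W" "norm u = 1" "C *v u = c *\<^sub>R u"
      using symmetric_eigenvector_in_invariant_subspace[OF sym sW] x(1) by metis
    have "u \<notin> V" using u by (auto simp: W_def orthogonal_def norm_eq_1)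
    have "good (insert u V)"
      using V u by (auto simp: good_def pairwise_insert W_def orthogonal_commute)
    from mx[OF this] show False using \<open>u \<notin> V\<close> finV by simp
  qed
  have "card V = CARD('n)"
    using dim_eq_card[of V UNIV] indep[OF V] spanV by simp
  then obtain f where f: "bij_betw f (UNIV :: 'n set) V"
    using finite_same_card_bij[of "UNIV :: 'n set" V] finV by auto
  have fV: "f j \<in> V" for j using f by (auto simp: bij_betw_def)
  define d where "d j = (SOME c. C *v f j = c *\<^sub>R f j)" for j
  have d: "C *v f j = d j *\<^sub>R f j" for j
    unfolding d_def using V fV[of j] by (intro someI_ex[of "\<lambda>c. C *v f j = c *\<^sub>R f j"]) (auto simp: good_def)
  define U :: "real^'n^'n" where "U = (\<chi> i j. f j $ i)"
  have col: "column j U = f j" for j by (simp add: U_def column_def)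
  have oU: "orthogonal_matrix U"
    unfolding orthogonal_matrix_orthonormal_columns col
  proof (intro conjI allI impI)
    show "norm (f i) = 1" for i using V fV by (auto simp: good_def)
    show "orthogonal (f i) (f j)" if "i \<noteq> j" for i j
      using V fV[of i] fV[of j] that f unfolding good_def pairwise_def bij_betw_def inj_on_def by blast
  qed
  have "C ** U = U ** diag_matrix d"
  proof -
    have "(C ** U) $ i $ j = (C *v f j) $ i" for i j
      by (simp add: U_def matrix_matrix_mult_def matrix_vector_mult_def)
    moreover have "(U ** diag_matrix d) $ i $ j = d j * f j $ i" for i j
      by (simp add: U_def diag_matrix_def matrix_matrix_mult_def if_distrib mult.commute cong: if_cong)
    ultimately show ?thesis by (simp add: vec_eq_iff d)
  qed
  hence "C ** (U ** transpose U) = U ** diag_matrix d ** transpose U"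
    by (simp add: matrix_mul_assoc)
  hence "C = U ** diag_matrix d ** transpose U"
    using oU by (simp add: orthogonal_matrix_def)
  with oU show thesis by (rule that)
qed

lemma pos_def_matrix_diagonalization:
  fixes C :: "real^'n^'n"
  assumes "pos_def_matrix C"
  obtains U d where "orthogonal_matrix U" "C = U ** diag_matrix d ** transpose U" "\<And>i. d i > 0"
proof -
  from assms have sym: "transpose C = C" by (simp add: pos_def_matrix_def)
  obtain U d where U: "orthogonal_matrix U" and C: "C = U ** diag_matrix d ** transpose U"
    using symmetric_matrix_diagonalization[OF sym] by blast
  have "d i > 0" for i
  proof -
    have TU: "transpose U ** U = mat 1" using U by (simp add: orthogonal_matrix_def)
    let ?x = "U *v axis i 1"
    have tx: "transpose U *v ?x = axis i 1"
      unfolding matrix_vector_mul_assoc TU by simp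
    have "?x \<noteq> 0" using tx
      by (metis axis_eq_0_iff matrix_vector_mult_0_right zero_neq_one)
    hence "0 < ?x \<bullet> (C *v ?x)" using assms by (auto simp: pos_def_matrix_def)
    also have "C *v ?x = U *v (diag_matrix d *v (transpose U *v ?x))"
      unfolding C by (simp only: matrix_vector_mul_assoc matrix_mul_assoc)
    also have "?x \<bullet> \<dots> = (transpose U *v ?x) \<bullet> (diag_matrix d *v (transpose U *v ?x))"
      by (metis inner_matrix_vector_transpose transpose_transpose)
    also have "\<dots> = d i"
      unfolding tx by (simp add: diag_matrix_mult_vec inner_axis')
    finally show ?thesis .
  qed
  with U C show thesis by (rule that)
qed

section \<open>Inverses, determinants and factorizations of positive definite matrices\<close>

lemma matrix_inv_props:
  fixes A :: "real^'n^'n"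
  assumes "invertible A"
  shows matrix_inv_right: "A ** matrix_inv A = mat 1"
    and matrix_inv_left: "matrix_inv A ** A = mat 1"
  using someI_ex[of "\<lambda>A'. A ** A' = mat 1 \<and> A' ** A = mat 1"] assms
  unfolding matrix_inv_def invertible_def by blast+

lemma matrix_inv_unique:
  fixes A :: "real^'n^'n"
  assumes "A ** B = mat 1"
  shows "matrix_inv A = B"
proof -
  have "invertible A" using assms matrix_left_right_inverse unfolding invertible_def by blast
  hence "matrix_inv A ** A = mat 1" by (rule matrix_inv_left)
  thus ?thesis by (metis assms matrix_mul_assoc matrix_mul_lid matrix_mul_rid)
qed

lemma pos_def_matrix_invertible:
  fixes A :: "real^'n^'n"
  assumes "pos_def_matrix A"
  shows "invertible A"
proof -
  have "A *v x \<noteq> 0" if "x \<noteq> 0" for x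
    using assms that by (force simp: pos_def_matrix_def)
  hence "\<exists>B. B ** A = mat 1" unfolding matrix_left_invertible_ker by blast
  thus ?thesis by (simp add: invertible_left_inverse)
qed

lemma matrix_inv_matrix_inv:
  fixes A :: "real^'n^'n"
  assumes "invertible A"
  shows "matrix_inv (matrix_inv A) = A"
  by (rule matrix_inv_unique) (rule matrix_inv_left[OF assms])

lemma pos_def_matrix_inv:
  fixes A :: "real^'n^'n"
  assumes A: "pos_def_matrix A"
  shows "pos_def_matrix (matrix_inv A)"
proof -
  note inv = matrix_inv_props[OF pos_def_matrix_invertible[OF A]]
  have sym: "transpose A = A" using A by (simp add: pos_def_matrix_def)
  have "A ** transpose (matrix_inv A) = mat 1"
    by (metis inv(2) matrix_transpose_mul sym transpose_mat)
  hence t: "transpose (matrix_inv A) = matrix_inv A" using matrix_inv_unique by metis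
  have "x \<bullet> (matrix_inv A *v x) > 0" if "x \<noteq> 0" for x
  proof -
    let ?y = "matrix_inv A *v x"
    have x: "x = A *v ?y" by (simp add: matrix_vector_mul_assoc inv)
    hence "?y \<noteq> 0" using that by (metis matrix_vector_mult_0_right)
    hence "0 < ?y \<bullet> (A *v ?y)" using A by (simp add: pos_def_matrix_def)
    thus ?thesis using x by (simp add: inner_commute)
  qed
  with t show ?thesis by (simp add: pos_def_matrix_def)
qed

lemma det_orthogonal_squared:
  fixes U :: "real^'n^'n"
  assumes "orthogonal_matrix U"
  shows "det U * det U = 1"
  using det_orthogonal_matrix[OF assms] by auto

lemma det_pos_def_matrix:
  fixes A :: "real^'n^'n"
  assumes "pos_def_matrix A"
  shows "det A > 0"
proof -
  obtain U d where U: "orthogonal_matrix U" "A = U ** diag_matrix d ** transpose U" "\<And>i. d i > 0"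
    using pos_def_matrix_diagonalization[OF assms] by blast
  have "det A = (\<Prod>i\<in>UNIV. d i) * (det U * det U)"
    by (simp add: U(2) det_mul det_diag_matrix)
  thus ?thesis using det_orthogonal_squared[OF U(1)] U(3) by (simp add: prod_pos)
qed

lemma pos_def_matrix_sqrt:
  fixes A :: "real^'n^'n"
  assumes "pos_def_matrix A"
  obtains R :: "real^'n^'n" where "A = R ** transpose R" "invertible R"
proof -
  obtain U d where U: "orthogonal_matrix U" "A = U ** diag_matrix d ** transpose U" "\<And>i. d i > 0"
    using pos_def_matrix_diagonalization[OF assms] by blast
  define R where "R = U ** diag_matrix (\<lambda>i. sqrt (d i))"
  have "diag_matrix (\<lambda>i. sqrt (d i)) ** diag_matrix (\<lambda>i. sqrt (d i)) = diag_matrix d"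
    using U(3) by (simp add: diag_matrix_mult less_imp_le)
  hence RR: "R ** transpose R = A"
    unfolding R_def U(2) matrix_transpose_mul transpose_diag_matrix
    by (metis matrix_mul_assoc)
  moreover have "invertible R"
    using det_pos_def_matrix[OF assms] RR[symmetric] by (auto simp: invertible_det_nz det_mul)
  ultimately show thesis using that by metis
qed

lemma pos_def_congruence:
  fixes A R :: "real^'n^'n"
  assumes A: "pos_def_matrix A" and R: "invertible R"
  shows "pos_def_matrix (transpose R ** A ** R)"
  unfolding pos_def_matrix_def
proof (intro conjI allI impI)
  show "transpose (transpose R ** A ** R) = transpose R ** A ** R"
    using A by (simp add: pos_def_matrix_def matrix_transpose_mul matrix_mul_assoc)
  fix x :: "real^'n" assume "x \<noteq> 0"
  hence "R *v x \<noteq> 0"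
    using inj_matrix_vector_mult[OF R] by (metis injD matrix_vector_mult_0_right)
  hence "0 < (R *v x) \<bullet> (A *v (R *v x))" using A by (simp add: pos_def_matrix_def)
  also have "\<dots> = x \<bullet> ((transpose R ** A ** R) *v x)"
    by (simp only: inner_matrix_vector_transpose matrix_vector_mul_assoc matrix_mul_assoc)
  finally show "0 < x \<bullet> ((transpose R ** A ** R) *v x)" .
qed

text \<open>The equality case identifies the covariance estimate.\<close>
lemma trace_minus_ln_det:
  fixes A B :: "real^'n^'n"
  assumes A: "pos_def_matrix A" and B: "pos_def_matrix B"
  shows "real CARD('n) \<le> trace (A ** B) - ln (det A * det B)"
    and "real CARD('n) = trace (A ** B) - ln (det A * det B) \<Longrightarrow> A ** B = mat 1"
proof -
  obtain R :: "real^'n^'n" where R: "B = R ** transpose R" "invertible R"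
    using pos_def_matrix_sqrt[OF B] by blast
  \<comment> \<open>\<open>C\<close> has the trace and determinant of \<open>A ** B\<close> but is
    symmetric, so both become functions of its eigenvalues, and the scalar inequality d - 1 - ln d
    >= 0 applies to each eigenvalue.\<close>
  define C where "C = transpose R ** A ** R"
  have "pos_def_matrix C" unfolding C_def by (rule pos_def_congruence[OF A R(2)])
  then obtain U d where U: "orthogonal_matrix U" "C = U ** diag_matrix d ** transpose U" "\<And>i. d i > 0"
    using pos_def_matrix_diagonalization[of C] by blast
  have TU: "transpose U ** U = mat 1" "U ** transpose U = mat 1"
    using U(1) by (simp_all add: orthogonal_matrix_def)
  have "trace (A ** B) = trace C"
    unfolding R C_def by (metis matrix_mul_assoc trace_mul_sym)
  also have "\<dots> = trace (diag_matrix d)"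
    unfolding U(2) by (metis TU(1) matrix_mul_assoc matrix_mul_lid trace_mul_sym)
  finally have tr: "trace (A ** B) = (\<Sum>i\<in>UNIV. d i)" by (simp add: trace_diag_matrix)
  have "det A * det B = det C" by (simp add: R(1) C_def det_mul)
  also have "\<dots> = (\<Prod>i\<in>UNIV. d i) * (det U * det U)"
    by (simp add: U(2) det_mul det_diag_matrix)
  finally have "ln (det A * det B) = (\<Sum>i\<in>UNIV. ln (d i))"
    using det_orthogonal_squared[OF U(1)] U(3) by (simp add: ln_prod less_imp_neq[symmetric])
  hence eq: "trace (A ** B) - ln (det A * det B) - real CARD('n) = (\<Sum>i\<in>UNIV. d i - 1 - ln (d i))"
    by (simp add: tr sum_subtractf)
  have nn: "d i - 1 - ln (d i) \<ge> 0" for i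
    using ln_le_minus_one[OF U(3)[of i]] by simp
  show "real CARD('n) \<le> trace (A ** B) - ln (det A * det B)"
    using eq sum_nonneg[of UNIV "\<lambda>i. d i - 1 - ln (d i)"] nn by simp
  assume "real CARD('n) = trace (A ** B) - ln (det A * det B)"
  with eq have "(\<Sum>i\<in>UNIV. d i - 1 - ln (d i)) = 0" by simp
  hence "d i - 1 - ln (d i) = 0" for i
    using nn by (subst (asm) sum_nonneg_eq_0_iff) auto
  hence "d i = 1" for i
    using ln_eq_minus_one[OF U(3)[of i]] by (metis diff_eq_eq diff_zero eq_iff_diff_eq_0)
  hence "d = (\<lambda>_. 1)" by auto
  hence "C = mat 1" using U(2) TU by (simp add: diag_matrix_1)
  hence "transpose R ** (A ** R) = mat 1" by (simp add: C_def matrix_mul_assoc)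
  hence "(A ** R) ** transpose R = mat 1" by (simp add: matrix_left_right_inverse)
  thus "A ** B = mat 1" by (simp add: R(1) matrix_mul_assoc)
qed

section \<open>Lebesgue measure under linear maps\<close>

text \<open>Integrate \<open>indicator B y * indicator A (x + y)\<close> in both orders. Invariance
  of \<open>N\<close> in \<open>x\<close> gives the left side; shifting \<open>y\<close> first and
  then using invariance of \<open>N\<close> on the reflected \<open>B\<close> gives the right side.
  For symmetric \<open>B\<close> of finite positive volume this makes \<open>N\<close> a multiple of
  Lebesgue measure.\<close>

lemma translation_invariant_measure_unique:
  fixes N :: "'a::euclidean_space measure"
  assumes [simp, measurable_cong]: "sets N = sets borel" and sf: "sigma_finite_measure N"
    and inv: "\<And>y A. A \<in> sets borel \<Longrightarrow> emeasure N {x. x + y \<in> A} = emeasure N A"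
    and A: "A \<in> sets borel" and B: "B \<in> sets borel"
  shows "emeasure N A * emeasure lborel B = emeasure lborel A * emeasure N (uminus -` B)"
proof -
  interpret N: sigma_finite_measure N by fact
  interpret pair_sigma_finite N "lborel :: 'a measure" ..
  note [measurable] = A B
  have spN: "space N = UNIV" using sets_eq_imp_space_eq[of N borel] by simp
  have "emeasure N A * emeasure lborel B = (\<integral>\<^sup>+y. indicator B y * emeasure N A \<partial>lborel)"
    by (simp add: nn_integral_multc mult.commute)
  also have "\<dots> = (\<integral>\<^sup>+y. \<integral>\<^sup>+x. indicator B y * indicator A (x + y) \<partial>N \<partial>lborel)"
  proof (rule nn_integral_cong)
    fix y
    have "{x. x + y \<in> A} \<in> sets N"
      using measurable_sets[of "\<lambda>x. x + y" borel borel A] A by (simp add: vimage_def)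
    from nn_integral_indicator[OF this] have "(\<integral>\<^sup>+x. indicator A (x + y) \<partial>N) = emeasure N A"
      using inv[OF A, of y] by (simp add: indicator_def)
    thus "indicator B y * emeasure N A = (\<integral>\<^sup>+x. indicator B y * indicator A (x + y) \<partial>N)"
      by (simp add: nn_integral_cmult)
  qed
  also have "\<dots> = (\<integral>\<^sup>+x. \<integral>\<^sup>+y. indicator B y * indicator A (x + y) \<partial>lborel \<partial>N)"
    by (rule Fubini') measurable
  also have "\<dots> = (\<integral>\<^sup>+x. \<integral>\<^sup>+y. indicator B (y - x) * indicator A y \<partial>lborel \<partial>N)"
  proof (rule nn_integral_cong)
    fix x :: 'a
    have "(\<integral>\<^sup>+y. indicator B (y - x) * indicator A y \<partial>lborel) =
        (\<integral>\<^sup>+y. indicator B (y - x) * indicator A y \<partial>distr lborel borel ((+) x))"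
      by (simp only: lborel_distr_plus)
    thus "(\<integral>\<^sup>+y. indicator B y * indicator A (x + y) \<partial>lborel) =
        (\<integral>\<^sup>+y. indicator B (y - x) * indicator A y \<partial>lborel)"
      by (simp add: nn_integral_distr)
  qed
  also have "\<dots> = (\<integral>\<^sup>+y. \<integral>\<^sup>+x. indicator B (y - x) * indicator A y \<partial>N \<partial>lborel)"
    by (rule Fubini'[symmetric]) measurable
  also have "\<dots> = (\<integral>\<^sup>+y. indicator A y * emeasure N (uminus -` B) \<partial>lborel)"
  proof (rule nn_integral_cong)
    fix y :: 'a
    have mB: "uminus -` B \<in> sets borel"
      using measurable_sets[of "uminus :: 'a \<Rightarrow> 'a" borel borel B] B by simp
    have "{x. x + (- y) \<in> uminus -` B} \<in> sets N"
      using measurable_sets[of "\<lambda>x. x + (- y)" borel borel "uminus -` B"] mB by (simp add: vimage_def)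
    from nn_integral_indicator[OF this] have "(\<integral>\<^sup>+x. indicator B (y - x) \<partial>N) = emeasure N (uminus -` B)"
      using inv[OF mB, of "- y"] by (simp add: indicator_def)
    thus "(\<integral>\<^sup>+x. indicator B (y - x) * indicator A y \<partial>N) = indicator A y * emeasure N (uminus -` B)"
      by (simp add: nn_integral_multc) (simp add: mult.commute)
  qed
  also have "\<dots> = emeasure lborel A * emeasure N (uminus -` B)"
    by (simp add: nn_integral_multc)
  finally show ?thesis .
qed

text \<open>The image measure is again translation invariant, hence a multiple of Lebesgue measure.
  An orthogonal map preserves the unit ball, which is symmetric and has finite positive volume, so
  the multiple is 1.\<close>

lemma lborel_distr_orthogonal:
  fixes U :: "real^'n^'n"
  assumes U: "orthogonal_matrix U"
  shows "distr lborel borel (\<lambda>x. U *v x) = lborel"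
proof (rule measure_eqI)
  let ?N = "distr lborel borel (\<lambda>x. U *v x)"
  have [measurable]: "(\<lambda>x. A *v x) \<in> borel_measurable borel" for A :: "real^'n^'n"
    by (intro borel_measurable_continuous_onI continuous_intros)
  have TU: "transpose U *v (U *v x) = x" "U *v (transpose U *v x) = x" for x
    using U by (simp_all add: orthogonal_matrix_def matrix_vector_mul_assoc del: transpose_matrix_vector)
  have nU: "norm (U *v x) = norm x" for x
    using TU(1)[of x] by (simp only: norm_eq_sqrt_inner inner_matrix_vector_transpose)
  have em: "emeasure ?N A = emeasure lborel {x. U *v x \<in> A}" if "A \<in> sets borel" for A
    using that by (subst emeasure_distr) (auto simp: vimage_def)
  have ball: "emeasure ?N (ball 0 r) = emeasure lborel (ball (0::real^'n) r)" for r
    by (subst em) (auto simp: nU ball_def intro!: arg_cong[where f="emeasure lborel"])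
  have sf: "sigma_finite_measure ?N"
  proof
    let ?A = "range (\<lambda>n::nat. ball (0 :: real^'n) (real n))"
    have "emeasure ?N (ball 0 (real n)) \<noteq> \<infinity>" for n
      unfolding ball using emeasure_bounded_finite[OF bounded_ball] by (metis infinity_ennreal_def less_irrefl)
    moreover have "\<Union>?A = UNIV"
      using reals_Archimedean2 by (auto simp: set_eq_iff)
    ultimately show "\<exists>A. countable A \<and> A \<subseteq> sets ?N \<and> \<Union> A = space ?N \<and> (\<forall>a\<in>A. emeasure ?N a \<noteq> \<infinity>)"
      by (intro exI[of _ ?A]) auto
  qed
  have inv: "emeasure ?N {x. x + y \<in> A} = emeasure ?N A" if A: "A \<in> sets borel" for y A
  proof -
    have "{x. x + y \<in> A} \<in> sets borel"
      using measurable_sets[of "\<lambda>x. x + y" borel borel A] A by (simp add: vimage_def)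
    hence "emeasure ?N {x. x + y \<in> A} = emeasure lborel {x. U *v x + y \<in> A}"
      by (subst em) auto
    also have "{x. U *v x + y \<in> A} = {x. transpose U *v y + x \<in> {x. U *v x \<in> A}}"
      by (simp only: mem_Collect_eq matrix_vector_right_distrib TU add.commute)
    also have "emeasure lborel \<dots> = emeasure (distr lborel borel ((+) (transpose U *v y))) {x. U *v x \<in> A}"
    proof -
      have "{x. U *v x \<in> A} \<in> sets borel"
        using measurable_sets[of "\<lambda>x. U *v x" borel borel A] A by (simp add: vimage_def)
      thus ?thesis by (subst emeasure_distr) (auto simp: vimage_def)
    qed
    also have "\<dots> = emeasure ?N A"
      by (simp only: lborel_distr_plus em[OF A])
    finally show ?thesis .
  qed
  fix A assume "A \<in> sets ?N"
  hence A: "A \<in> sets borel" by simp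
  have "uminus -` ball (0::real^'n) 1 = ball 0 1" by auto
  hence "emeasure ?N A * emeasure lborel (ball (0::real^'n) 1) = emeasure lborel A * emeasure lborel (ball (0::real^'n) 1)"
    using translation_invariant_measure_unique[OF _ sf inv A, of "ball 0 1"] ball[of 1] by simp
  moreover define c where "c = unit_ball_vol (real CARD('n))"
  hence "c > 0" "emeasure lborel (ball (0::real^'n) 1) = ennreal c"
    by (simp_all add: emeasure_ball)
  ultimately have "emeasure ?N A * ennreal c = emeasure lborel A * ennreal c" "\<not> c \<le> 0"
    by (simp_all only: not_le)
  thus "emeasure ?N A = emeasure lborel A"
    by (simp only: mult_right_ennreal_cancel) blast
qed simp

lemma Basis_cart: "(Basis :: (real^'n) set) = range (\<lambda>i. axis i 1)"
  by (auto simp: Basis_vec_def)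

lemma inj_axis_1: "inj (\<lambda>i. axis i 1 :: real^'n)"
  by (auto simp: inj_def axis_eq_axis)

lemma lborel_distr_diag_matrix:
  fixes d :: "'n::finite \<Rightarrow> real"
  assumes d: "\<And>i. d i \<noteq> 0"
  shows "lborel = density (distr lborel borel (\<lambda>x. diag_matrix d *v x)) (\<lambda>_. ennreal \<bar>det (diag_matrix d)\<bar>)"
proof -
  \<comment> \<open>\<open>lborel_affine_euclidean\<close> scales along basis vectors instead of
    indices; \<open>c\<close> transports the factors \<open>d\<close> to the basis vectors.\<close>
  define c :: "real^'n \<Rightarrow> real" where "c j = d (THE i. j = axis i 1)" for j
  have c: "c (axis i 1) = d i" for i
    unfolding c_def by (simp add: axis_eq_axis)
  have "(0 :: real^'n) + (\<Sum>j\<in>Basis. (c j * (x \<bullet> j)) *\<^sub>R j) = diag_matrix d *v x" for x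
  proof -
    have "(\<Sum>j\<in>Basis. (c j * (x \<bullet> j)) *\<^sub>R j) = (\<Sum>i\<in>UNIV. (d i * x $ i) *\<^sub>R (axis i 1 :: real^'n))"
      unfolding Basis_cart
      by (subst sum.reindex) (auto simp: inj_axis_1 c inner_axis)
    thus ?thesis by (simp add: diag_matrix_mult_vec vec_eq_iff axis_def if_distrib cong: if_cong)
  qed
  moreover have "(\<Prod>j\<in>Basis. \<bar>c j\<bar>) = \<bar>det (diag_matrix d)\<bar>"
    unfolding Basis_cart det_diag_matrix
    by (subst prod.reindex) (auto simp: inj_axis_1 c abs_prod)
  moreover have cne: "c j \<noteq> 0" if "j \<in> Basis" for j
    using that c d by (auto simp: Basis_cart)
  ultimately show ?thesis
    using lborel_affine_euclidean[of c 0] cne by simp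
qed

text \<open>The singular values are the square roots of the eigenvalues of
  \<open>A ** transpose A\<close>; then \<open>V\<close> is forced and turns out orthogonal. This
  reduces the linear change of variables to orthogonal and diagonal maps.\<close>

lemma invertible_matrix_svd:
  fixes A :: "real^'n^'n"
  assumes A: "invertible A"
  obtains U V :: "real^'n^'n" and d where "orthogonal_matrix U" "orthogonal_matrix V" "\<And>i. d i > 0"
    "A = U ** diag_matrix d ** V"
proof -
  have "pos_def_matrix (mat 1 :: real^'n^'n)"
    by (simp add: pos_def_matrix_def transpose_mat)
  moreover have "invertible (transpose A)" using A by (simp add: invertible_det_nz)
  ultimately have "pos_def_matrix (A ** transpose A)"
    using pos_def_congruence[of "mat 1" "transpose A"] by simp
  then obtain U e where U: "orthogonal_matrix U" and e: "\<And>i. e i > 0"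
    and AA: "A ** transpose A = U ** diag_matrix e ** transpose U"
    using pos_def_matrix_diagonalization[of "A ** transpose A"] by blast
  define d where "d i = sqrt (e i)" for i
  have d: "d i > 0" for i using e by (simp add: d_def)
  let ?D = "diag_matrix d" and ?E = "diag_matrix (\<lambda>i. inverse (d i))"
  have DE: "?D ** ?E = mat 1" "?E ** ?D = mat 1" "diag_matrix e = ?D ** ?D"
    using d e less_imp_neq[OF d] by (simp_all add: diag_matrix_mult diag_matrix_1[symmetric] d_def less_imp_le less_imp_neq[symmetric])
  have UU: "transpose U ** U = mat 1" "U ** transpose U = mat 1"
    using U by (simp_all add: orthogonal_matrix_def)
  define V where "V = ?E ** transpose U ** A"
  have "V ** transpose V = ?E ** (transpose U ** (A ** transpose A) ** U) ** ?E"
    by (simp add: V_def matrix_transpose_mul matrix_mul_assoc)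
  also have "\<dots> = ?E ** ((transpose U ** U) ** (?D ** ?D) ** (transpose U ** U)) ** ?E"
    unfolding AA DE(3) by (simp only: matrix_mul_assoc)
  also have "\<dots> = (?E ** ?D) ** (?D ** ?E)"
    by (simp only: UU matrix_mul_lid matrix_mul_rid matrix_mul_assoc)
  also have "\<dots> = mat 1" by (simp add: DE)
  finally have "orthogonal_matrix (transpose V)" by (simp add: orthogonal_matrix)
  moreover have "U ** ?D ** V = (U ** (?D ** ?E) ** transpose U) ** A"
    by (simp add: V_def matrix_mul_assoc)
  hence "A = U ** ?D ** V" by (simp add: DE UU)
  ultimately show thesis using that[OF U _ d, of V] by simp
qed

lemma lborel_distr_linear:
  fixes A :: "real^'n^'n"
  assumes A: "invertible A"
  shows "lborel = density (distr lborel borel (\<lambda>x. A *v x)) (\<lambda>_. ennreal \<bar>det A\<bar>)"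
proof -
  obtain U V :: "real^'n^'n" and d where U: "orthogonal_matrix U" and V: "orthogonal_matrix V"
    and d: "\<And>i. d i > 0" and A: "A = U ** diag_matrix d ** V"
    using invertible_matrix_svd[OF A] by blast
  have [measurable]: "(\<lambda>x. A *v x) \<in> borel_measurable borel" for A :: "real^'n^'n"
    by (intro borel_measurable_continuous_onI continuous_intros)
  have dA: "\<bar>det A\<bar> = \<bar>det (diag_matrix d)\<bar>"
    using det_orthogonal_matrix[OF U] det_orthogonal_matrix[OF V] by (auto simp: A det_mul abs_mult)
  have "distr lborel borel (\<lambda>x. A *v x) =
      distr (distr (distr lborel borel (\<lambda>x. V *v x)) borel (\<lambda>x. diag_matrix d *v x)) borel (\<lambda>x. U *v x)"
    by (simp add: distr_distr o_def A matrix_vector_mul_assoc matrix_mul_assoc)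
  also have "\<dots> = distr (distr lborel borel (\<lambda>x. diag_matrix d *v x)) borel (\<lambda>x. U *v x)"
    by (simp add: lborel_distr_orthogonal[OF V])
  finally have "density (distr lborel borel (\<lambda>x. A *v x)) (\<lambda>_. ennreal \<bar>det A\<bar>) =
     distr (density (distr lborel borel (\<lambda>x. diag_matrix d *v x)) (\<lambda>_. ennreal \<bar>det A\<bar>)) borel (\<lambda>x. U *v x)"
    by (simp add: density_distr)
  also have "density (distr lborel borel (\<lambda>x. diag_matrix d *v x)) (\<lambda>_. ennreal \<bar>det A\<bar>) = lborel"
    unfolding dA by (rule lborel_distr_diag_matrix[symmetric]) (metis d less_irrefl)
  also have "distr lborel borel (\<lambda>x. U *v x) = lborel"
    by (rule lborel_distr_orthogonal[OF U])
  finally show ?thesis ..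
qed

lemma nn_integral_lborel_affine:
  fixes A :: "real^'n^'n" and c :: "real^'n"
  assumes A: "invertible A" and [measurable]: "f \<in> borel_measurable borel"
  shows "(\<integral>\<^sup>+x. f x \<partial>lborel) = ennreal \<bar>det A\<bar> * (\<integral>\<^sup>+x. f (c + A *v x) \<partial>lborel)"
proof -
  have [measurable]: "(\<lambda>x. A *v x) \<in> borel_measurable borel"
    by (intro borel_measurable_continuous_onI continuous_intros)
  have "(\<integral>\<^sup>+x. f x \<partial>lborel) = (\<integral>\<^sup>+x. f x \<partial>distr lborel borel ((+) c))"
    by (simp only: lborel_distr_plus)
  also have "\<dots> = (\<integral>\<^sup>+x. f (c + x) \<partial>lborel)" by (simp add: nn_integral_distr)
  also have "\<dots> = ennreal \<bar>det A\<bar> * (\<integral>\<^sup>+x. f (c + A *v x) \<partial>lborel)"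
    by (subst lborel_distr_linear[OF A])
       (simp add: nn_integral_density nn_integral_distr nn_integral_cmult)
  finally show ?thesis .
qed

section \<open>Averages of independent observations\<close>

definition avg :: "nat \<Rightarrow> (nat \<Rightarrow> 'a) \<Rightarrow> ('a \<Rightarrow> real) \<Rightarrow> real" where
  "avg n x g = (\<Sum>j<n. g (x j)) / real n"

lemma avg_add: "avg n x (\<lambda>a. f a + g a) = avg n x f + avg n x g"
  by (simp add: avg_def sum.distrib add_divide_distrib)

lemma avg_diff: "avg n x (\<lambda>a. f a - g a) = avg n x f - avg n x g"
  by (simp add: avg_def sum_subtractf diff_divide_distrib)

lemma avg_cmult: "avg n x (\<lambda>a. c * f a) = c * avg n x f"
  by (simp add: avg_def sum_distrib_left[symmetric])

lemma avg_sum: "avg n x (\<lambda>a. \<Sum>i\<in>I. f i a) = (\<Sum>i\<in>I. avg n x (f i))"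
  by (induction I rule: infinite_finite_induct) (simp_all add: avg_add, simp_all add: avg_def)

lemma avg_const: "n > 0 \<Longrightarrow> avg n x (\<lambda>a. c) = c"
  by (simp add: avg_def)

lemma avg_mono: "(\<And>j. j < n \<Longrightarrow> f (x j) \<le> g (x j)) \<Longrightarrow> avg n x f \<le> avg n x g"
  unfolding avg_def by (intro divide_right_mono sum_mono) auto

lemma avg_abs: "\<bar>avg n x f\<bar> \<le> avg n x (\<lambda>a. \<bar>f a\<bar>)"
  by (simp add: avg_def divide_right_mono sum_abs)

text \<open>A deterministic substitute for convergence in probability. A property of a nonempty
  sample holds eventually if it holds as soon as finitely many averages of functions in
  \<open>G\<close> are close enough to their expectations. Limits and Landau symbols become
  available without a probability space for the sample.\<close>

definition emp_filter :: "('a \<Rightarrow> real) set \<Rightarrow> 'a measure \<Rightarrow> (nat \<times> (nat \<Rightarrow> 'a)) filter" where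
  "emp_filter G L = inf (principal {c. fst c > 0})
     (INF g\<in>G. filtercomap (\<lambda>c. avg (fst c) (snd c) g) (nhds (\<integral>a. g a \<partial>L)))"

lemma emp_filter_pos: "eventually (\<lambda>c. fst c > 0) (emp_filter G L)"
  unfolding emp_filter_def by (rule filter_leD[OF inf_le1]) (simp add: eventually_principal)

lemma emp_filter_tendsto:
  assumes "g \<in> G"
  shows "((\<lambda>c. avg (fst c) (snd c) g) \<longlongrightarrow> (\<integral>a. g a \<partial>L)) (emp_filter G L)"
proof -
  have "emp_filter G L \<le> filtercomap (\<lambda>c. avg (fst c) (snd c) g) (nhds (\<integral>a. g a \<partial>L))"
    unfolding emp_filter_def using assms by (intro le_infI2 INF_lower)
  thus ?thesis by (simp add: filterlim_iff_le_filtercomap)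
qed

text \<open>Makes an eventual property explicit: where it fails for a nonempty sample, one of
  finitely many averages is off by at least \<open>\<epsilon>\<close>. In this form moment bounds
  control the failure.\<close>

lemma eventually_emp_filterD:
  assumes "eventually Pr (emp_filter G L)"
  obtains H \<epsilon> where "finite H" "H \<subseteq> G" "\<epsilon> > 0"
    "\<And>n x. n > 0 \<Longrightarrow> (\<And>g. g \<in> H \<Longrightarrow> \<bar>avg n x g - (\<integral>a. g a \<partial>L)\<bar> < \<epsilon>) \<Longrightarrow> Pr (n, x)"
proof -
  let ?F = "\<lambda>g. filtercomap (\<lambda>c. avg (fst c) (snd c) g) (nhds (\<integral>a. g a \<partial>L))"
  obtain Q R where Q: "eventually Q (principal {c :: nat \<times> (nat \<Rightarrow> 'a). fst c > 0})"
    and R: "eventually R (INF g\<in>G. ?F g)" and QR: "\<And>c. Q c \<Longrightarrow> R c \<Longrightarrow> Pr c"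
    using assms unfolding emp_filter_def eventually_inf by blast
  obtain H where H: "H \<subseteq> G" "finite H" and RH: "eventually R (INF g\<in>H. ?F g)"
    using R unfolding eventually_INF[of R ?F G] by blast
  from H(2) RH have "\<exists>\<epsilon>>0. \<forall>n x. (\<forall>g\<in>H. \<bar>avg n x g - (\<integral>a. g a \<partial>L)\<bar> < \<epsilon>) \<longrightarrow> R (n, x)"
  proof (induction H arbitrary: R rule: finite_induct)
    case empty
    then show ?case by (auto intro!: exI[of _ 1])
  next
    case (insert g H)
    from insert.prems have "eventually R (inf (?F g) (INF g\<in>H. ?F g))" by simp
    then obtain S T where S: "eventually S (?F g)" and T: "eventually T (INF g\<in>H. ?F g)"
      and ST: "\<And>c. S c \<Longrightarrow> T c \<Longrightarrow> R c"
      unfolding eventually_inf by blast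
    obtain S' where S': "eventually S' (nhds (\<integral>a. g a \<partial>L))" "\<And>c. S' (avg (fst c) (snd c) g) \<Longrightarrow> S c"
      using S unfolding eventually_filtercomap by blast
    obtain e where e: "e > 0" "\<And>y. dist y (\<integral>a. g a \<partial>L) < e \<Longrightarrow> S' y"
      using S'(1) unfolding eventually_nhds_metric by blast
    obtain e' where e': "e' > 0" "\<And>n x. (\<forall>g\<in>H. \<bar>avg n x g - (\<integral>a. g a \<partial>L)\<bar> < e') \<Longrightarrow> T (n, x)"
      using insert.IH[OF T] by blast
    show ?case
    proof (intro exI[of _ "min e e'"] conjI allI impI)
      fix n x assume a: "\<forall>g\<in>insert g H. \<bar>avg n x g - (\<integral>a. g a \<partial>L)\<bar> < min e e'"
      have "S (n, x)" by (rule S'(2), rule e(2)) (use a in \<open>auto simp: dist_real_def\<close>)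
      moreover have "T (n, x)" by (rule e'(2)) (use a in auto)
      ultimately show "R (n, x)" by (rule ST)
    qed (use e e' in auto)
  qed
  then obtain \<epsilon> where "\<epsilon> > 0" "\<And>n x. (\<And>g. g \<in> H \<Longrightarrow> \<bar>avg n x g - (\<integral>a. g a \<partial>L)\<bar> < \<epsilon>) \<Longrightarrow> R (n, x)"
    by blast
  with H show thesis using Q QR by (intro that[of H \<epsilon>]) (auto simp: eventually_principal)
qed

section \<open>Moments of averages of independent variables\<close>

context prob_space
begin

lemma integrable_power_le_4:
  fixes f :: "'a \<Rightarrow> real"
  assumes [measurable]: "f \<in> borel_measurable M" and i: "integrable M (\<lambda>x. f x ^ 4)" and "k \<le> 4"
  shows "integrable M (\<lambda>x. f x ^ k)"
proof (rule Bochner_Integration.integrable_bound)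
  show "integrable M (\<lambda>x. 1 + f x ^ 4)" using i by simp
  have "\<bar>t\<bar> ^ k \<le> 1 + t ^ 4" for t :: real
  proof (cases "\<bar>t\<bar> \<le> 1")
    case True
    have "\<bar>t\<bar> ^ k \<le> 1" using True by (simp add: power_le_one)
    also have "\<dots> \<le> 1 + t ^ 4" by simp
    finally show ?thesis .
  next
    case False
    hence "\<bar>t\<bar> ^ k \<le> \<bar>t\<bar> ^ 4" using \<open>k \<le> 4\<close> by (intro power_increasing) auto
    thus ?thesis by (simp add: power_abs)
  qed
  thus "AE x in M. norm (f x ^ k) \<le> norm (1 + f x ^ 4)"
    by (auto simp: power_abs)
qed measurable

lemma expectation_square_le_4:
  fixes f :: "'a \<Rightarrow> real"
  assumes "f \<in> borel_measurable M" and "integrable M (\<lambda>x. f x ^ 4)"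
  shows "(expectation (\<lambda>x. f x ^ 2))\<^sup>2 \<le> expectation (\<lambda>x. f x ^ 4)"
proof -
  have i: "integrable M (\<lambda>x. f x ^ 2)" by (rule integrable_power_le_4) (use assms in auto)
  let ?m = "expectation (\<lambda>x. f x ^ 2)"
  have "0 \<le> expectation (\<lambda>x. (f x ^ 2 - ?m)\<^sup>2)" by (intro integral_nonneg_AE) auto
  also have "expectation (\<lambda>x. (f x ^ 2 - ?m)\<^sup>2) = expectation (\<lambda>x. f x ^ 4 - 2 * ?m * f x ^ 2 + ?m\<^sup>2)"
    by (intro Bochner_Integration.integral_cong) (auto simp: power2_eq_square power4_eq_xxxx algebra_simps)
  also have "\<dots> = expectation (\<lambda>x. f x ^ 4) - ?m\<^sup>2"
    using i assms by (simp add: prob_space power2_eq_square)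
  finally show ?thesis by simp
qed

text \<open>Second and fourth moments go through one induction because the mixed term 6 E(Y^2)
  E(S^2) of the fourth moment uses the exact second moment. The mixed terms with a first power
  vanish since both means are 0.\<close>

lemma iid_sum_moments:
  fixes Y :: "nat \<Rightarrow> 'a \<Rightarrow> real"
  assumes ind: "indep_vars (\<lambda>_. borel) Y UNIV"
    and i4: "\<And>j. integrable M (\<lambda>\<omega>. Y j \<omega> ^ 4)" and z: "\<And>j. expectation (Y j) = 0"
    and v: "\<And>j. expectation (\<lambda>\<omega>. Y j \<omega> ^ 2) = v" and K: "\<And>j. expectation (\<lambda>\<omega>. Y j \<omega> ^ 4) \<le> K"
  shows "integrable M (\<lambda>\<omega>. (\<Sum>j<n. Y j \<omega>) ^ 4) \<and> expectation (\<lambda>\<omega>. (\<Sum>j<n. Y j \<omega>) ^ 2) = real n * v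
    \<and> expectation (\<lambda>\<omega>. (\<Sum>j<n. Y j \<omega>) ^ 4) \<le> 3 * K * (real n)\<^sup>2"
proof (induction n)
  case (Suc n)
  have [measurable]: "Y j \<in> borel_measurable M" for j using ind by (simp add: indep_vars_def)
  let ?S = "\<lambda>\<omega>. \<Sum>j<n. Y j \<omega>"
  have "indep_var borel (Y n) borel ?S"
    by (rule indep_vars_sum) (auto intro: indep_vars_subset[OF ind])
  have ind': "indep_var borel (\<lambda>\<omega>. Y n \<omega> ^ a) borel (\<lambda>\<omega>. ?S \<omega> ^ b)" for a b
    using indep_var_compose[OF \<open>indep_var borel (Y n) borel ?S\<close>, of "\<lambda>x. x ^ a" borel "\<lambda>x. x ^ b" borel]
    by (simp add: o_def)
  have Sm: "?S \<in> borel_measurable M" by simp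
  have iY: "integrable M (\<lambda>\<omega>. Y n \<omega> ^ a)" if "a \<le> 4" for a
    by (rule integrable_power_le_4) (use i4 that in auto)
  have iS: "integrable M (\<lambda>\<omega>. ?S \<omega> ^ b)" if "b \<le> 4" for b
    by (rule integrable_power_le_4) (use Suc that in auto)
  have iYS: "integrable M (\<lambda>\<omega>. Y n \<omega> ^ a * ?S \<omega> ^ b)" if "a \<le> 4" "b \<le> 4" for a b
    by (rule indep_var_integrable[OF ind' iY iS]) (use that in auto)
  have EYS: "expectation (\<lambda>\<omega>. Y n \<omega> ^ a * ?S \<omega> ^ b) = expectation (\<lambda>\<omega>. Y n \<omega> ^ a) * expectation (\<lambda>\<omega>. ?S \<omega> ^ b)"
    if "a \<le> 4" "b \<le> 4" for a b
    by (rule indep_var_lebesgue_integral[OF ind' iY iS]) (use that in auto)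
  have ES1: "expectation ?S = 0"
  proof -
    have "integrable M (Y j)" for j using integrable_power_le_4[OF _ i4, where k = 1] by simp
    thus ?thesis using z by (simp add: Bochner_Integration.integral_sum)
  qed
  have e4: "(\<Sum>j<Suc n. Y j \<omega>) ^ 4 = ?S \<omega> ^ 4 + 4 * (Y n \<omega> ^ 1 * ?S \<omega> ^ 3) + 6 * (Y n \<omega> ^ 2 * ?S \<omega> ^ 2)
     + 4 * (Y n \<omega> ^ 3 * ?S \<omega> ^ 1) + Y n \<omega> ^ 4" for \<omega>
    by (simp add: power4_eq_xxxx power3_eq_cube power2_eq_square algebra_simps)
  have e2: "(\<Sum>j<Suc n. Y j \<omega>) ^ 2 = ?S \<omega> ^ 2 + 2 * (Y n \<omega> ^ 1 * ?S \<omega> ^ 1) + Y n \<omega> ^ 2" for \<omega>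
    by (simp add: power2_eq_square algebra_simps)
  have i: "integrable M (\<lambda>\<omega>. (\<Sum>j<Suc n. Y j \<omega>) ^ 4)"
    unfolding e4 by (intro Bochner_Integration.integrable_add integrable_mult_right iYS iS iY) auto
  have E2: "expectation (\<lambda>\<omega>. (\<Sum>j<Suc n. Y j \<omega>) ^ 2) = real (Suc n) * v"
    unfolding e2 using iYS[of 1 1] iS[of 2] iY[of 2] EYS[of 1 1] Suc v[of n] ES1
    by (simp add: algebra_simps)
  have vK: "v\<^sup>2 \<le> K"
    using expectation_square_le_4[of "Y n"] i4[of n] v[of n] K[of n] by simp
  have v0: "v \<ge> 0" using v[of 0] by (metis integral_nonneg_AE AE_I2 zero_le_power2)
  have "expectation (\<lambda>\<omega>. (\<Sum>j<Suc n. Y j \<omega>) ^ 4) = expectation (\<lambda>\<omega>. ?S \<omega> ^ 4)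
      + 6 * (v * (real n * v)) + expectation (\<lambda>\<omega>. Y n \<omega> ^ 4)"
    unfolding e4 using iYS[of 1 3] iYS[of 2 2] iYS[of 3 1] iS[of 4] iY[of 4] EYS[of 1 3] EYS[of 2 2] EYS[of 3 1] Suc v[of n] ES1 z[of n]
    by simp
  also have "\<dots> \<le> 3 * K * (real n)\<^sup>2 + 6 * (real n * v\<^sup>2) + K"
    using Suc K[of n] by (simp add: power2_eq_square algebra_simps)
  also have "\<dots> \<le> 3 * K * (real n)\<^sup>2 + 6 * (real n * K) + 3 * K"
    using mult_left_mono[OF vK, of "real n"] vK zero_le_power2[of v] by linarith
  also have "\<dots> = 3 * K * (real (Suc n))\<^sup>2" by (simp add: power2_eq_square algebra_simps)
  finally show ?case using i E2 by blast
qed simp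

end

lemma sum_power4_le:
  fixes a :: "'b \<Rightarrow> real"
  assumes "finite G" "\<And>g. g \<in> G \<Longrightarrow> a g \<ge> 0"
  shows "(\<Sum>g\<in>G. a g) ^ 4 \<le> real (card G) ^ 4 * (\<Sum>g\<in>G. a g ^ 4)"
proof (cases "G = {}")
  case False
  define m where "m = Max (a ` G)"
  have "m \<in> a ` G" unfolding m_def by (rule Max_in) (use assms(1) False in auto)
  then obtain h where h: "h \<in> G" "a h = m" by blast
  have "(\<Sum>g\<in>G. a g) \<le> (\<Sum>g\<in>G. m)" unfolding m_def using assms(1) by (intro sum_mono Max_ge) auto
  hence "(\<Sum>g\<in>G. a g) ^ 4 \<le> (real (card G) * m) ^ 4"
    using assms by (intro power_mono sum_nonneg) auto
  also have "\<dots> = real (card G) ^ 4 * a h ^ 4" by (simp add: h power_mult_distrib)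
  also have "a h ^ 4 \<le> (\<Sum>g\<in>G. a g ^ 4)" by (rule member_le_sum) (use h assms in auto)
  finally show ?thesis by (simp add: mult_left_mono)
qed simp

text \<open>\<open>L\<close> serves at once as the sigma-algebra of the observations and as their
  common law.\<close>

locale iid_sample = prob_space P for P :: "'w measure" +
  fixes X :: "nat \<Rightarrow> 'w \<Rightarrow> 'a" and L :: "'a measure"
  assumes indep_X: "indep_vars (\<lambda>_. L) X UNIV" and distr_X: "\<And>j. distr P L (X j) = L"
begin

lemma X_measurable [measurable]: "X j \<in> measurable P L"
  using indep_X by (simp add: indep_vars_def)

lemma expectation_X:
  fixes g :: "'a \<Rightarrow> real"
  assumes "g \<in> borel_measurable L"
  shows "expectation (\<lambda>\<omega>. g (X j \<omega>)) = (\<integral>a. g a \<partial>L)" "integrable P (\<lambda>\<omega>. g (X j \<omega>)) \<longleftrightarrow> integrable L g"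
proof -
  have "(\<integral>a. g a \<partial>L) = (\<integral>a. g a \<partial>distr P L (X j))" by (simp only: distr_X)
  also have "\<dots> = expectation (\<lambda>\<omega>. g (X j \<omega>))" by (rule integral_distr[OF X_measurable assms])
  finally show "expectation (\<lambda>\<omega>. g (X j \<omega>)) = (\<integral>a. g a \<partial>L)" ..
  have "integrable L g \<longleftrightarrow> integrable (distr P L (X j)) g" by (simp only: distr_X)
  also have "\<dots> \<longleftrightarrow> integrable P (\<lambda>\<omega>. g (X j \<omega>))" by (rule integrable_distr_eq[OF X_measurable assms])
  finally show "integrable P (\<lambda>\<omega>. g (X j \<omega>)) \<longleftrightarrow> integrable L g" ..
qed

lemma prob_space_L: "prob_space L"
  using prob_space_distr[OF X_measurable] distr_X[of 0] by metis

lemma avg_moments: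
  assumes [measurable]: "g \<in> borel_measurable L" and i4: "integrable L (\<lambda>a. g a ^ 4)"
  defines "m \<equiv> (\<integral>a. g a \<partial>L)"
  shows "integrable P (\<lambda>\<omega>. (avg n (\<lambda>j. X j \<omega>) g - m) ^ 4)" (is ?A)
    and "\<exists>C. \<forall>n>0. expectation (\<lambda>\<omega>. (avg n (\<lambda>j. X j \<omega>) g - m) ^ 4) \<le> C / (real n)\<^sup>2" (is ?B)
    and "n > 0 \<Longrightarrow> expectation (\<lambda>\<omega>. (avg n (\<lambda>j. X j \<omega>) g - m)\<^sup>2) = (\<integral>a. (g a - m)\<^sup>2 \<partial>L) / real n" (is "_ \<Longrightarrow> ?C n")
proof -
  interpret L: prob_space L by (rule prob_space_L)
  define h where "h a = g a - m" for a
  have [measurable]: "h \<in> borel_measurable L" by (simp add: h_def[abs_def])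
  have ig: "integrable L g" using L.integrable_power_le_4[OF _ i4, of 1] by simp
  have "integrable L (\<lambda>a. 8 * (g a ^ 4 + m ^ 4))" using i4 by simp
  hence ih: "integrable L (\<lambda>a. h a ^ 4)"
  proof (rule Bochner_Integration.integrable_bound)
    have "(s - t) ^ 4 \<le> 8 * (s ^ 4 + t ^ 4)" for s t :: real
    proof -
      have "(s - t)\<^sup>2 \<le> 2 * (s\<^sup>2 + t\<^sup>2)" using zero_le_power2[of "s + t"] by (simp add: power2_eq_square algebra_simps)
      hence "((s - t)\<^sup>2)\<^sup>2 \<le> (2 * (s\<^sup>2 + t\<^sup>2))\<^sup>2" by (rule power_mono) simp
      also have "\<dots> \<le> 8 * (s ^ 4 + t ^ 4)"
        using zero_le_power2[of "s\<^sup>2 - t\<^sup>2"] by (simp add: power2_eq_square power4_eq_xxxx algebra_simps)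
      finally show ?thesis by simp
    qed
    thus "AE a in L. norm (h a ^ 4) \<le> norm (8 * (g a ^ 4 + m ^ 4))" by (auto simp: h_def)
  qed measurable
  define Y where "Y j \<omega> = h (X j \<omega>)" for j \<omega>
  have ind: "indep_vars (\<lambda>_. borel) Y UNIV"
    unfolding Y_def by (rule indep_vars_compose2[OF indep_X]) simp
  have z: "expectation (Y j) = 0" for j
    unfolding Y_def using expectation_X(1)[of h j] ig
    by (simp add: h_def[abs_def] m_def L.prob_space)
  have i4Y: "integrable P (\<lambda>\<omega>. Y j \<omega> ^ 4)" for j
    unfolding Y_def using expectation_X(2)[of "\<lambda>a. h a ^ 4" j] ih by simp
  have v: "expectation (\<lambda>\<omega>. Y j \<omega> ^ 2) = (\<integral>a. (h a)\<^sup>2 \<partial>L)" for j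
    unfolding Y_def by (rule expectation_X) simp
  have K: "expectation (\<lambda>\<omega>. Y j \<omega> ^ 4) \<le> (\<integral>a. h a ^ 4 \<partial>L)" for j
    unfolding Y_def by (rule eq_refl, rule expectation_X) simp
  note S = iid_sum_moments[OF ind i4Y z v K]
  have av: "avg n (\<lambda>j. X j \<omega>) g - m = (\<Sum>j<n. Y j \<omega>) / real n" if "n > 0" for n \<omega>
    using that by (simp add: avg_def Y_def h_def sum_subtractf field_simps)
  show ?A
  proof (cases "n = 0")
    case True thus ?thesis by (simp add: avg_def)
  next
    case False thus ?thesis using S[of n] by (simp add: av power_divide)
  qed
  show ?B
  proof (intro exI allI impI)
    fix n :: nat assume n: "n > 0"
    have "expectation (\<lambda>\<omega>. (avg n (\<lambda>j. X j \<omega>) g - m) ^ 4) = expectation (\<lambda>\<omega>. (\<Sum>j<n. Y j \<omega>) ^ 4) / real n ^ 4"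
      using n by (simp add: av power_divide)
    also have "\<dots> \<le> 3 * (\<integral>a. h a ^ 4 \<partial>L) * (real n)\<^sup>2 / real n ^ 4"
      using S[of n] by (intro divide_right_mono) auto
    also have "\<dots> = 3 * (\<integral>a. h a ^ 4 \<partial>L) / (real n)\<^sup>2"
      using n by (simp add: field_simps power2_eq_square power4_eq_xxxx)
    finally show "expectation (\<lambda>\<omega>. (avg n (\<lambda>j. X j \<omega>) g - m) ^ 4) \<le> 3 * (\<integral>a. h a ^ 4 \<partial>L) / (real n)\<^sup>2" .
  qed
  show "?C n" if n: "n > 0"
    using S[of n] n by (simp add: av power_divide h_def) (simp add: power2_eq_square)
qed

definition dev :: "('a \<Rightarrow> real) set \<Rightarrow> nat \<Rightarrow> 'w \<Rightarrow> real" where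
  "dev G n \<omega> = (\<Sum>g\<in>G. \<bar>avg n (\<lambda>j. X j \<omega>) g - (\<integral>a. g a \<partial>L)\<bar>)"

lemma dev_measurable [measurable]:
  assumes "G \<subseteq> borel_measurable L"
  shows "dev G n \<in> borel_measurable P"
  unfolding dev_def[abs_def] avg_def using assms
  by (intro borel_measurable_sum borel_measurable_abs borel_measurable_diff borel_measurable_divide
       measurable_compose[OF X_measurable]) auto

text \<open>Third absolute moments of sums are interpolated from fourth moments, which expand
  exactly for independent terms and are of order n^-2. The resulting order n^(-3/2) makes the cubed
  deviation negligible against 1/n.\<close>

lemma dev_cube:
  assumes G: "finite G" "G \<subseteq> {g \<in> borel_measurable L. integrable L (\<lambda>a. g a ^ 4)}"
  shows "integrable P (\<lambda>\<omega>. dev G n \<omega> ^ 3)"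
    and "(\<lambda>n. real n * expectation (\<lambda>\<omega>. dev G n \<omega> ^ 3)) \<longlonglongrightarrow> 0"
proof -
  have [measurable]: "dev G n \<in> borel_measurable P" for n using G by (intro dev_measurable) auto
  let ?e = "\<lambda>g n \<omega>. avg n (\<lambda>j. X j \<omega>) g - (\<integral>a. g a \<partial>L)"
  have le: "dev G n \<omega> ^ 4 \<le> real (card G) ^ 4 * (\<Sum>g\<in>G. ?e g n \<omega> ^ 4)" for n \<omega>
    unfolding dev_def using sum_power4_le[OF G(1), of "\<lambda>g. \<bar>?e g n \<omega>\<bar>"] by simp
  have iR: "integrable P (\<lambda>\<omega>. real (card G) ^ 4 * (\<Sum>g\<in>G. ?e g n \<omega> ^ 4))" for n
    using G by (intro integrable_mult_right Bochner_Integration.integrable_sum avg_moments) auto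
  have d0: "dev G n \<omega> \<ge> 0" for n \<omega> by (simp add: dev_def sum_nonneg)
  have i4: "integrable P (\<lambda>\<omega>. dev G n \<omega> ^ 4)" for n
    by (rule Bochner_Integration.integrable_bound[OF iR[of n]])
      (use le in \<open>auto intro!: AE_I2 order_trans[OF le] simp: sum_nonneg\<close>)
  show i3: "integrable P (\<lambda>\<omega>. dev G n \<omega> ^ 3)" for n
    by (rule integrable_power_le_4[OF _ i4]) auto
  have "\<forall>g\<in>G. \<exists>C. \<forall>n>0. expectation (\<lambda>\<omega>. (?e g n \<omega>) ^ 4) \<le> C / (real n)\<^sup>2"
    using G by (intro ballI avg_moments) auto
  then obtain C where C: "\<And>g n. g \<in> G \<Longrightarrow> n > 0 \<Longrightarrow> expectation (\<lambda>\<omega>. (?e g n \<omega>) ^ 4) \<le> C g / (real n)\<^sup>2"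
    by metis
  define K where "K = real (card G) ^ 4 * (\<Sum>g\<in>G. C g)"
  have E4: "expectation (\<lambda>\<omega>. dev G n \<omega> ^ 4) \<le> K / (real n)\<^sup>2" if "n > 0" for n
  proof -
    have "expectation (\<lambda>\<omega>. dev G n \<omega> ^ 4) \<le> expectation (\<lambda>\<omega>. real (card G) ^ 4 * (\<Sum>g\<in>G. ?e g n \<omega> ^ 4))"
      by (rule integral_mono[OF i4 iR]) (rule le)
    also have "\<dots> = real (card G) ^ 4 * (\<Sum>g\<in>G. expectation (\<lambda>\<omega>. ?e g n \<omega> ^ 4))"
      using G avg_moments(1) by (subst integral_mult_right_zero, subst Bochner_Integration.integral_sum) auto
    also have "\<dots> \<le> real (card G) ^ 4 * (\<Sum>g\<in>G. C g / (real n)\<^sup>2)"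
      using C that by (intro mult_left_mono sum_mono) auto
    also have "\<dots> = K / (real n)\<^sup>2" by (simp add: K_def sum_divide_distrib[symmetric])
    finally show ?thesis .
  qed
  have E3: "real n * expectation (\<lambda>\<omega>. dev G n \<omega> ^ 3) \<le> (1 + K) / sqrt (real n)" if n: "n > 0" for n
  proof -
    \<comment> \<open>The inequality d^3 <= t^3 + d^4 / t holds for every positive t; the choice t =
      n^(-1/2) makes both summands of order n^(-3/2) in expectation.\<close>
    let ?t = "1 / sqrt (real n)"
    have t: "?t > 0" using n by simp
    have "d ^ 3 \<le> ?t ^ 3 + d ^ 4 / ?t" if "d \<ge> 0" for d :: real
    proof (cases "d \<le> ?t")
      case True
      hence "d ^ 3 \<le> ?t ^ 3" using that by (rule power_mono)
      thus ?thesis using t that by (simp add: add_increasing2)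
    next
      case False
      hence "d ^ 3 * ?t \<le> d ^ 3 * d" using that by (intro mult_left_mono) auto
      hence "d ^ 3 \<le> d ^ 4 / ?t" using t by (subst pos_le_divide_eq) (auto simp: power4_eq_xxxx power3_eq_cube mult.assoc)
      thus ?thesis using t by (simp add: add_increasing)
    qed
    hence "expectation (\<lambda>\<omega>. dev G n \<omega> ^ 3) \<le> expectation (\<lambda>\<omega>. ?t ^ 3 + dev G n \<omega> ^ 4 / ?t)"
      using i4 i3 d0 by (intro integral_mono) auto
    also have "\<dots> = ?t ^ 3 + expectation (\<lambda>\<omega>. dev G n \<omega> ^ 4) / ?t"
      using i4 by (simp add: prob_space)
    also have "\<dots> \<le> ?t ^ 3 + (K / (real n)\<^sup>2) / ?t"
      using E4[OF n] t by (intro add_left_mono divide_right_mono) auto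
    finally have "real n * expectation (\<lambda>\<omega>. dev G n \<omega> ^ 3) \<le> real n * (?t ^ 3 + (K / (real n)\<^sup>2) / ?t)"
      using n by (intro mult_left_mono) auto
    also have "\<dots> = (1 + K) / sqrt (real n)"
    proof -
      define s where "s = sqrt (real n)"
      have "real n = s\<^sup>2" "s > 0" using n by (auto simp: s_def)
      thus ?thesis unfolding s_def[symmetric] by (simp add: field_simps power3_eq_cube power2_eq_square)
    qed
    finally show ?thesis .
  qed
  show "(\<lambda>n. real n * expectation (\<lambda>\<omega>. dev G n \<omega> ^ 3)) \<longlonglongrightarrow> 0"
  proof (rule tendsto_sandwich)
    show "\<forall>\<^sub>F n in sequentially. 0 \<le> real n * expectation (\<lambda>\<omega>. dev G n \<omega> ^ 3)"
      using d0 by (intro always_eventually allI mult_nonneg_nonneg integral_nonneg_AE) auto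
    show "\<forall>\<^sub>F n in sequentially. real n * expectation (\<lambda>\<omega>. dev G n \<omega> ^ 3) \<le> (1 + K) / sqrt (real n)"
      using eventually_gt_at_top[of 0] by eventually_elim (rule E3)
    show "(\<lambda>n. (1 + K) / sqrt (real n)) \<longlonglongrightarrow> 0"
      by (rule real_tendsto_divide_at_top[OF tendsto_const filterlim_compose[OF sqrt_at_top filterlim_real_sequentially]])
  qed simp
qed

end

section \<open>Likelihood and EM step\<close>

text \<open>Parameters with the precision matrix instead of the covariance matrix; equal means are allowed.\<close>
type_synonym 'p cparam = "real \<times> (real^'p) \<times> (real^'p) \<times> (real^'p^'p)"

fun cprior :: "'p::finite cparam \<Rightarrow> label \<Rightarrow> real" where
  "cprior t Class1 = fst t"
| "cprior t Class2 = 1 - fst t"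

fun cmean :: "'p::finite cparam \<Rightarrow> label \<Rightarrow> real^'p" where
  "cmean t Class1 = fst (snd t)"
| "cmean t Class2 = fst (snd (snd t))"

definition cprec :: "'p::finite cparam \<Rightarrow> real^'p^'p" where
  "cprec t = snd (snd (snd t))"

lemma cparam_eqI:
  assumes "\<And>i. cprior s i = cprior t i" "\<And>i. cmean s i = cmean t i" "cprec s = cprec t"
  shows "s = t"
  using assms(1)[of Class1] assms(2)[of Class1] assms(2)[of Class2] assms(3)
  by (simp add: prod_eq_iff cprec_def)

definition cspace :: "'p::finite cparam set" where
  "cspace = {t. 0 < fst t \<and> fst t < 1 \<and> pos_def_matrix (cprec t)}"

lemma cprior_pos: "t \<in> cspace \<Longrightarrow> cprior t i > 0"
  by (cases i) (auto simp: cspace_def)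

text \<open>The logarithm of prior times class density. In terms of the precision matrix it is a
  quadratic polynomial in \<open>y\<close> whose quadratic part is common to both classes and
  cancels in their difference.\<close>

definition lcomp :: "'p::finite cparam \<Rightarrow> label \<Rightarrow> real^'p \<Rightarrow> real" where
  "lcomp t i y = ln (cprior t i) + ln (det (cprec t)) / 2
     - (y - cmean t i) \<bullet> (cprec t *v (y - cmean t i)) / 2 - real CARD('p) * ln (2 * pi) / 2"

definition lobs :: "'p::finite cparam \<Rightarrow> 'p obs \<Rightarrow> real" where
  "lobs t = (\<lambda>(y, z, m). if m then ln (exp (lcomp t Class1 y) + exp (lcomp t Class2 y)) else lcomp t z y)"

definition cbeta :: "'p::finite cparam \<Rightarrow> real \<times> (real^'p)" where
  "cbeta t = (let b1 = cprec t *v (cmean t Class1 - cmean t Class2)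
     in (ln (cprior t Class1 / cprior t Class2) - (1/2) * ((cmean t Class1 + cmean t Class2) \<bullet> b1), b1))"

definition cparam_of :: "'p::finite params \<Rightarrow> 'p cparam" where
  "cparam_of \<theta> = (prior1 \<theta>, mean1 \<theta>, mean2 \<theta>, matrix_inv (cov \<theta>))"

definition param_of :: "'p::finite cparam \<Rightarrow> 'p params" where
  "param_of t = Params (fst t) (fst (snd t)) (fst (snd (snd t))) (matrix_inv (cprec t))"

lemma cprior_cparam_of [simp]: "cprior (cparam_of \<theta>) i = prior \<theta> i"
  by (cases i) (simp_all add: cparam_of_def)

lemma cmean_cparam_of [simp]: "cmean (cparam_of \<theta>) i = mean \<theta> i"
  by (cases i) (simp_all add: cparam_of_def)

lemma cprec_cparam_of [simp]: "cprec (cparam_of \<theta>) = matrix_inv (cov \<theta>)"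
  by (simp add: cparam_of_def cprec_def)

lemma cparam_of_param_of:
  assumes "t \<in> cspace"
  shows "cparam_of (param_of t) = t"
  using assms matrix_inv_matrix_inv[OF pos_def_matrix_invertible[of "cprec t"]]
  by (auto simp: cparam_of_def param_of_def cspace_def prod_eq_iff cprec_def)

lemma cparam_of_in_cspace: "\<theta> \<in> param_space \<Longrightarrow> cparam_of \<theta> \<in> cspace"
  using pos_def_matrix_inv[of "cov \<theta>"]
  unfolding param_space_def cspace_def
  by (auto simp: cparam_of_def cprec_def dest: spec[of _ Class1] spec[of _ Class2])

lemma param_of_in_param_space:
  assumes "t \<in> cspace" "cmean t Class1 \<noteq> cmean t Class2"
  shows "param_of t \<in> param_space"
proof -
  have "prior (param_of t) i > 0" for i
    using assms by (cases i) (auto simp: cspace_def param_of_def)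
  thus ?thesis
    using assms pos_def_matrix_inv[of "cprec t"]
    by (auto simp: param_space_def cspace_def param_of_def)
qed

lemma cbeta_cparam_of: "cbeta (cparam_of \<theta>) = beta \<theta>"
  by (simp add: cbeta_def beta_def del: cprior.simps cmean.simps prior.simps mean.simps)

lemma ln_prior_class_density:
  fixes \<theta> :: "'p::finite params"
  assumes "prior \<theta> i > 0" "pos_def_matrix (cov \<theta>)"
  shows "prior \<theta> i * class_density \<theta> i y = exp (lcomp (cparam_of \<theta>) i y)"
proof -
  have d: "det (cov \<theta>) > 0" by (rule det_pos_def_matrix[OF assms(2)])
  have "det (cov \<theta>) * det (matrix_inv (cov \<theta>)) = 1"
    using matrix_inv_right[OF pos_def_matrix_invertible[OF assms(2)]] by (metis det_I det_mul)
  hence "det (matrix_inv (cov \<theta>)) = 1 / det (cov \<theta>)" using d by (simp add: field_simps)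
  hence "ln (det (matrix_inv (cov \<theta>))) = - ln (det (cov \<theta>))" using d by (simp add: ln_div)
  moreover have "sqrt ((2 * pi) ^ CARD('p) * det (cov \<theta>)) =
      exp (real CARD('p) * ln (2 * pi) / 2 + ln (det (cov \<theta>)) / 2)"
  proof (rule real_sqrt_unique)
    have "(exp (real CARD('p) * ln (2 * pi) / 2 + ln (det (cov \<theta>)) / 2))\<^sup>2 =
        exp (real CARD('p) * ln (2 * pi)) * exp (ln (det (cov \<theta>)))"
      by (simp add: power2_eq_square exp_add[symmetric])
    thus "(exp (real CARD('p) * ln (2 * pi) / 2 + ln (det (cov \<theta>)) / 2))\<^sup>2 = (2 * pi) ^ CARD('p) * det (cov \<theta>)"
      using d by (simp add: exp_of_nat_mult)
  qed simp
  moreover define q where "q = (y - mean \<theta> i) \<bullet> (matrix_inv (cov \<theta>) *v (y - mean \<theta> i))"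
  ultimately have d: "class_density \<theta> i y = exp (- (1/2) * q) / exp (real CARD('p) * ln (2 * pi) / 2 + ln (det (cov \<theta>)) / 2)"
    and l: "lcomp (cparam_of \<theta>) i y = ln (prior \<theta> i) + (- (1/2) * q) - (real CARD('p) * ln (2 * pi) / 2 + ln (det (cov \<theta>)) / 2)"
    by (simp_all add: lcomp_def mvn_density_def)
  show ?thesis
    unfolding d l using assms(1) by (simp only: exp_add exp_diff exp_ln times_divide_eq_right)
qed

lemma log_lik_eq_lobs:
  fixes \<theta> :: "'p::finite params"
  assumes "\<theta> \<in> param_space"
  shows "log_lik_PC_ig n x \<theta> = (\<Sum>j<n. lobs (cparam_of \<theta>) (x j))"
proof -
  have e: "prior \<theta> i * class_density \<theta> i y = exp (lcomp (cparam_of \<theta>) i y)" for i y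
    using assms by (intro ln_prior_class_density) (auto simp: param_space_def)
  show ?thesis
    unfolding log_lik_PC_ig_def sum.distrib[symmetric]
  proof (rule sum.cong)
    fix j
    obtain y z m where x: "x j = (y, z, m)" by (cases "x j") auto
    show "(case x j of (y, z, m) \<Rightarrow> (1 - of_bool m) *
            (\<Sum>i\<in>UNIV. of_bool (z = i) * ln (prior \<theta> i * class_density \<theta> i y))) +
         (case x j of (y, z, m) \<Rightarrow> of_bool m * ln (\<Sum>i\<in>UNIV. prior \<theta> i * class_density \<theta> i y))
         = lobs (cparam_of \<theta>) (x j)"
      by (cases z) (auto simp: x e lobs_def UNIV_label)
  qed simp
qed

definition sigmoid :: "real \<Rightarrow> real" where
  "sigmoid s = exp s / (1 + exp s)"

lemma sigmoid_pos: "sigmoid s > 0" and sigmoid_less_1: "sigmoid s < 1"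
  by (simp_all add: sigmoid_def add_pos_pos divide_less_eq)

text \<open>The E step: the posterior probability of \<open>Class1\<close>, replaced by the label
  itself where that is observed. It depends on the parameter only through the discriminant
  coefficients, which is why the fixed point equation can be closed in them.\<close>

definition resp :: "real \<times> (real^'p::finite) \<Rightarrow> 'p obs \<Rightarrow> real" where
  "resp b = (\<lambda>(y, z, m). if m then sigmoid (discr b y) else of_bool (z = Class1))"

fun cwt :: "('p::finite obs \<Rightarrow> real) \<Rightarrow> label \<Rightarrow> 'p obs \<Rightarrow> real" where
  "cwt u Class1 a = u a"
| "cwt u Class2 a = 1 - u a"

lemma sum_label: "(\<Sum>i\<in>UNIV. f i) = f Class1 + f Class2"
  by (simp add: UNIV_label)

lemma lcomp_diff:
  assumes "t \<in> cspace"
  shows "lcomp t Class1 y - lcomp t Class2 y = discr (cbeta t) y"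
proof -
  let ?L = "cprec t" and ?m = "cmean t Class1" and ?n = "cmean t Class2"
  have sym: "transpose ?L = ?L" using assms by (simp add: cspace_def pos_def_matrix_def)
  have c: "a \<bullet> (?L *v b) = b \<bullet> (?L *v a)" for a b
    using symmetric_inner[OF sym, of a b] by (simp add: inner_commute)
  have l: "ln (cprior t Class1 / cprior t Class2) = ln (cprior t Class1) - ln (cprior t Class2)"
    using assms by (simp add: cspace_def ln_div)
  show ?thesis
    unfolding lcomp_def discr_def cbeta_def Let_def l fst_conv snd_conv
    using c[of y ?m] c[of y ?n] c[of ?m ?n]
    by (simp add: matrix_vector_mult_diff_distrib inner_diff_left inner_diff_right inner_add_left
        inner_commute[of _ y] field_simps)
qed

text \<open>The inequality behind EM: concavity of the logarithm, with the posterior class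
  probabilities under \<open>t\<close> as weights. For a labelled observation both sides
  agree.\<close>

lemma lobs_minorant:
  assumes t: "t \<in> cspace"
  shows "(\<Sum>i\<in>UNIV. cwt (resp (cbeta t)) i a * (lcomp t' i (fst a) - lcomp t i (fst a))) \<le> lobs t' a - lobs t a"
proof -
  obtain y z m where a: "a = (y, z, m)" by (cases a) auto
  show ?thesis
  proof (cases m)
    case False
    thus ?thesis by (cases z) (auto simp: a sum_label lobs_def resp_def)
  next
    case True
    define p where "p = sigmoid (discr (cbeta t) y)"
    define A where "A = exp (lcomp t Class1 y)"
    define B where "B = exp (lcomp t Class2 y)"
    have pos: "A > 0" "B > 0" "A + B > 0" by (simp_all add: A_def B_def add_pos_pos)
    have AB: "exp (discr (cbeta t) y) = A / B"
      by (simp add: lcomp_diff[OF t, symmetric] exp_diff A_def B_def)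
    have p: "p = A / (A + B)" "1 - p = B / (A + B)"
      unfolding p_def sigmoid_def AB using pos by (simp_all add: field_simps)
    define d where "d i = lcomp t' i y - lcomp t i y" for i
    define s where "s = p * d Class1 + (1 - p) * d Class2"
    have p01: "0 < p" "p < 1" by (simp_all add: p_def sigmoid_pos sigmoid_less_1)
    \<comment> \<open>The tangent line of exp at the weighted mean \<open>s\<close>, used for both
      classes, yields Jensen's inequality.\<close>
    have ex: "exp s * (1 + (v - s)) \<le> exp v" for v
      using mult_left_mono[OF exp_ge_add_one_self[of "v - s"], of "exp s"]
      by (simp add: exp_add[symmetric])
    have "exp s = p * (exp s * (1 + (d Class1 - s))) + (1 - p) * (exp s * (1 + (d Class2 - s)))"
      by (simp add: s_def algebra_simps)
    also have "\<dots> \<le> p * exp (d Class1) + (1 - p) * exp (d Class2)"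
      using p01 by (intro add_mono mult_left_mono ex) auto
    also have "\<dots> = (exp (lcomp t' Class1 y) + exp (lcomp t' Class2 y)) / (A + B)"
      unfolding d_def exp_diff A_def[symmetric] B_def[symmetric] p(2) unfolding p(1) using pos
      by (simp add: add_divide_distrib)
    finally have "s \<le> ln ((exp (lcomp t' Class1 y) + exp (lcomp t' Class2 y)) / (A + B))"
      using pos by (simp add: ln_ge_iff add_pos_pos)
    moreover have "exp a + exp b \<noteq> (0::real)" for a b
      by (metis add_pos_pos exp_gt_zero less_irrefl)
    ultimately show ?thesis using True
      by (simp add: a sum_label lobs_def resp_def s_def p_def d_def ln_div add_pos_pos A_def B_def)
  qed
qed

section \<open>The M step for fixed class weights\<close>

locale weighted_sample =
  fixes n :: nat and x :: "nat \<Rightarrow> 'p::finite obs" and u :: "'p obs \<Rightarrow> real"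
begin

definition wprior :: "label \<Rightarrow> real" where
  "wprior i = avg n x (cwt u i)"

definition wmean :: "label \<Rightarrow> real^'p" where
  "wmean i = (\<chi> k. avg n x (\<lambda>a. cwt u i a * fst a $ k) / wprior i)"

definition wcov :: "real^'p^'p" where
  "wcov = (\<chi> k l. \<Sum>i\<in>UNIV. avg n x (\<lambda>a. cwt u i a * ((fst a - wmean i) $ k * (fst a - wmean i) $ l)))"

definition wparam :: "'p cparam" where
  "wparam = (wprior Class1, wmean Class1, wmean Class2, matrix_inv wcov)"

definition wlik :: "'p cparam \<Rightarrow> real" where
  "wlik t = avg n x (\<lambda>a. \<Sum>i\<in>UNIV. cwt u i a * lcomp t i (fst a))"

lemma wprior_sum: "n > 0 \<Longrightarrow> wprior Class1 + wprior Class2 = 1"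
  unfolding wprior_def using avg_add[of n x "cwt u Class1" "cwt u Class2"]
  by (simp add: avg_const)

lemma inner_matrix_sum: "v \<bullet> (A *v w) = (\<Sum>k\<in>UNIV. \<Sum>l\<in>UNIV. A $ k $ l * (v $ k * w $ l))"
  for A :: "real^'p^'p"
  by (simp add: inner_vec_def matrix_vector_mult_def sum_distrib_left mult_ac)

text \<open>Collects the quadratic terms of both classes in one trace, the form in which
  \<open>trace_minus_ln_det\<close> maximizes over precision matrices.\<close>

lemma trace_wcov:
  "trace (A ** wcov) = (\<Sum>i\<in>UNIV. avg n x (\<lambda>a. cwt u i a * ((fst a - wmean i) \<bullet> (A *v (fst a - wmean i)))))"
proof -
  have sy: "wcov $ l $ k = wcov $ k $ l" for k l by (simp add: wcov_def mult.commute)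
  have "trace (A ** wcov) = (\<Sum>k\<in>UNIV. \<Sum>l\<in>UNIV. A $ k $ l * wcov $ k $ l)"
    by (simp add: trace_def matrix_matrix_mult_def sy)
  also have "\<dots> = (\<Sum>k\<in>UNIV. \<Sum>l\<in>UNIV. \<Sum>i\<in>UNIV.
      avg n x (\<lambda>a. cwt u i a * (A $ k $ l * ((fst a - wmean i) $ k * (fst a - wmean i) $ l))))"
    by (simp add: wcov_def sum_distrib_left avg_cmult[symmetric] mult_ac)
  also have "\<dots> = (\<Sum>i\<in>UNIV. \<Sum>k\<in>UNIV. \<Sum>l\<in>UNIV.
      avg n x (\<lambda>a. cwt u i a * (A $ k $ l * ((fst a - wmean i) $ k * (fst a - wmean i) $ l))))"
    by (simp only: sum_label sum.distrib)
  also have "\<dots> = (\<Sum>i\<in>UNIV. avg n x (\<lambda>a. cwt u i a * ((fst a - wmean i) \<bullet> (A *v (fst a - wmean i)))))"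
    by (simp add: inner_matrix_sum avg_sum sum_distrib_left)
  finally show ?thesis .
qed

lemma wmean_orthogonal:
  assumes "wprior i \<noteq> 0"
  shows "avg n x (\<lambda>a. cwt u i a * (v \<bullet> (fst a - wmean i))) = 0"
proof -
  have "avg n x (\<lambda>a. cwt u i a * (v \<bullet> (fst a - wmean i))) =
      (\<Sum>k\<in>UNIV. v $ k * (avg n x (\<lambda>a. cwt u i a * fst a $ k) - wmean i $ k * avg n x (cwt u i)))"
    unfolding avg_cmult[symmetric] avg_diff[symmetric] avg_sum[symmetric]
    by (simp add: inner_vec_def sum_distrib_left algebra_simps)
  also have "\<dots> = 0"
    using assms by (simp add: wmean_def wprior_def)
  finally show ?thesis .
qed

text \<open>The parallel axis theorem; the cross term vanishes by
  \<open>wmean_orthogonal\<close>.\<close>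

lemma avg_quadratic_shift:
  assumes "wprior i \<noteq> 0" and sym: "transpose A = A"
  shows "avg n x (\<lambda>a. cwt u i a * ((fst a - c) \<bullet> (A *v (fst a - c)))) =
     avg n x (\<lambda>a. cwt u i a * ((fst a - wmean i) \<bullet> (A *v (fst a - wmean i))))
     + wprior i * ((wmean i - c) \<bullet> (A *v (wmean i - c)))"
proof -
  let ?d = "wmean i - c"
  have ring: "w * (q + 2 * l + k) = w * q + 2 * (w * l) + k * w" for w q l k :: real by algebra
  have "(fst a - c) \<bullet> (A *v (fst a - c)) = (fst a - wmean i) \<bullet> (A *v (fst a - wmean i))
      + 2 * ((A *v ?d) \<bullet> (fst a - wmean i)) + ?d \<bullet> (A *v ?d)" for a :: "'p obs"
  proof -
    have "fst a - c = (fst a - wmean i) + ?d" by simp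
    thus ?thesis
      using symmetric_inner[OF sym, of "?d" "fst a - wmean i"]
      by (simp only: matrix_vector_right_distrib inner_add_left inner_add_right) (simp add: inner_commute)
  qed
  hence "avg n x (\<lambda>a. cwt u i a * ((fst a - c) \<bullet> (A *v (fst a - c)))) =
     avg n x (\<lambda>a. cwt u i a * ((fst a - wmean i) \<bullet> (A *v (fst a - wmean i)))
       + 2 * (cwt u i a * ((A *v ?d) \<bullet> (fst a - wmean i))) + (?d \<bullet> (A *v ?d)) * cwt u i a)"
    by (simp only: ring)
  thus ?thesis
    by (simp only: avg_add avg_cmult wmean_orthogonal[OF assms(1)] wprior_def) simp
qed

text \<open>After centring at the weighted means, the priors stand alone, the precision matrix meets
  the data only in one trace, and the means enter only through quadratic forms that vanish at the
  weighted means. The maximization thus separates.\<close>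

lemma wlik_eq:
  assumes n: "n > 0" and "\<And>i. wprior i \<noteq> 0" and t: "t \<in> cspace"
  shows "wlik t = (\<Sum>i\<in>UNIV. wprior i * ln (cprior t i)) + (ln (det (cprec t)) - trace (cprec t ** wcov)) / 2
     - (\<Sum>i\<in>UNIV. wprior i * ((wmean i - cmean t i) \<bullet> (cprec t *v (wmean i - cmean t i)))) / 2
     - real CARD('p) * ln (2 * pi) / 2"
proof -
  have sym: "transpose (cprec t) = cprec t" using t by (simp add: cspace_def pos_def_matrix_def)
  define k where "k = ln (det (cprec t)) / 2 - real CARD('p) * ln (2 * pi) / 2"
  have ring: "w * (a + d / 2 - q / 2 - c) = (a + (d / 2 - c)) * w - (1/2) * (w * q)" for w a d q c :: real
    by (simp add: algebra_simps)
  have "avg n x (\<lambda>a. cwt u i a * lcomp t i (fst a)) = wprior i * (ln (cprior t i) + k)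
      - avg n x (\<lambda>a. cwt u i a * ((fst a - cmean t i) \<bullet> (cprec t *v (fst a - cmean t i)))) / 2" for i
  proof -
    have "avg n x (\<lambda>a. cwt u i a * lcomp t i (fst a)) = avg n x (\<lambda>a. (ln (cprior t i) + k) * cwt u i a
      - (1/2) * (cwt u i a * ((fst a - cmean t i) \<bullet> (cprec t *v (fst a - cmean t i)))))"
      by (simp only: lcomp_def k_def ring)
    thus ?thesis by (simp only: avg_diff avg_cmult wprior_def) simp
  qed
  hence "wlik t = (\<Sum>i\<in>UNIV. wprior i * (ln (cprior t i) + k)
      - (avg n x (\<lambda>a. cwt u i a * ((fst a - wmean i) \<bullet> (cprec t *v (fst a - wmean i))))
     + wprior i * ((wmean i - cmean t i) \<bullet> (cprec t *v (wmean i - cmean t i)))) / 2)"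
    unfolding wlik_def avg_sum by (simp only: avg_quadratic_shift[OF assms(2) sym, of _ "cmean t _"])
  moreover have "wprior Class1 * k + wprior Class2 * k = k"
    using wprior_sum[OF n] by (metis distrib_right mult_1)
  ultimately show ?thesis
    using k_def unfolding trace_wcov sum_label distrib_left
    by (simp only: diff_divide_distrib add_divide_distrib)
qed

lemma wcov_quadratic:
  "v \<bullet> (wcov *v v) = (\<Sum>i\<in>UNIV. avg n x (\<lambda>a. cwt u i a * (v \<bullet> (fst a - wmean i))\<^sup>2))"
proof -
  \<comment> \<open>The rank one matrix v v^T, whose quadratic form is the squared inner product
    with \<open>v\<close>.\<close>
  define A :: "real^'p^'p" where "A = (\<chi> k l. v $ k * v $ l)"
  have q: "w \<bullet> (A *v w) = (v \<bullet> w)\<^sup>2" for w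
    unfolding inner_matrix_sum A_def by (simp add: power2_eq_square inner_vec_def sum_product mult_ac)
  have "trace (A ** wcov) = v \<bullet> (wcov *v v)"
    unfolding inner_matrix_sum A_def
    by (simp add: trace_def matrix_matrix_mult_def) (subst sum.swap, simp add: mult_ac)
  thus ?thesis using trace_wcov[of A] by (simp add: q)
qed

lemma transpose_wcov: "transpose wcov = wcov"
  by (simp add: wcov_def transpose_def vec_eq_iff mult.commute)

text \<open>The gap to the maximum is a Kullback-Leibler divergence of the priors, plus half a
  log-determinant divergence of the precision matrices, plus half a weighted sum of squared
  Mahalanobis distances of the means. Each is nonnegative and vanishes only at the weighted
  estimate, which gives uniqueness.\<close>

lemma wparam_maximizes:
  assumes n: "n > 0" and W: "\<And>i. wprior i > 0" and S: "pos_def_matrix wcov"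
  shows "wparam \<in> cspace"
    and "\<And>t. t \<in> cspace \<Longrightarrow> wlik t \<le> wlik wparam"
    and "\<And>t. t \<in> cspace \<Longrightarrow> wlik t = wlik wparam \<Longrightarrow> t = wparam"
proof -
  have Wne: "wprior i \<noteq> 0" for i using W[of i] by simp
  have pS: "pos_def_matrix (matrix_inv wcov)" by (rule pos_def_matrix_inv[OF S])
  have W1: "wprior Class1 < 1" using wprior_sum[OF n] W[of Class2] by linarith
  show wp: "wparam \<in> cspace"
    using W[of Class1] W1 pS by (simp add: wparam_def cspace_def cprec_def)
  have cp: "cprior wparam i = wprior i" "cmean wparam i = wmean i" "cprec wparam = matrix_inv wcov" for i
    using wprior_sum[OF n] by (cases i; simp add: wparam_def cprec_def)+
  have inv: "matrix_inv wcov ** wcov = mat 1"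
    by (rule matrix_inv_left[OF pos_def_matrix_invertible[OF S]])
  have dS: "det wcov > 0" "det (matrix_inv wcov) > 0"
    by (rule det_pos_def_matrix[OF S], rule det_pos_def_matrix[OF pS])
  have "det (matrix_inv wcov) * det wcov = 1" by (metis inv det_I det_mul)
  hence ld: "ln (det (matrix_inv wcov)) = - ln (det wcov)"
    using dS ln_mult[of "det (matrix_inv wcov)" "det wcov"] by simp
  have star: "wlik wparam = (\<Sum>i\<in>UNIV. wprior i * ln (wprior i)) + (- ln (det wcov) - real CARD('p)) / 2
     - real CARD('p) * ln (2 * pi) / 2"
    using wlik_eq[OF n Wne wp] by (simp add: cp ld inv trace_I)
  have gap: "wlik wparam - wlik t = g1 + g2 / 2 + g3 / 2 \<and> g1 \<ge> 0 \<and> g2 \<ge> 0 \<and> g3 \<ge> 0 \<and>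
      (g1 = 0 \<longrightarrow> (\<forall>i. cprior t i = wprior i)) \<and> (g2 = 0 \<longrightarrow> cprec t = matrix_inv wcov) \<and>
      (g3 = 0 \<longrightarrow> (\<forall>i. cmean t i = wmean i))"
    if t: "t \<in> cspace" and g: "g1 = (\<Sum>i\<in>UNIV. wprior i * (ln (wprior i) - ln (cprior t i)))"
      "g2 = trace (cprec t ** wcov) - ln (det (cprec t) * det wcov) - real CARD('p)"
      "g3 = (\<Sum>i\<in>UNIV. wprior i * ((wmean i - cmean t i) \<bullet> (cprec t *v (wmean i - cmean t i))))"
    for t g1 g2 g3
  proof (intro conjI)
    have L: "pos_def_matrix (cprec t)" using t by (simp add: cspace_def)
    have dL: "det (cprec t) > 0" by (rule det_pos_def_matrix[OF L])
    show "wlik wparam - wlik t = g1 + g2 / 2 + g3 / 2"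
      unfolding star wlik_eq[OF n Wne t] g using dS dL
      by (simp add: sum_label ln_mult field_simps)
    show "g2 \<ge> 0" using trace_minus_ln_det(1)[OF L S] by (simp add: g)
    show "g2 = 0 \<longrightarrow> cprec t = matrix_inv wcov"
    proof
      assume "g2 = 0"
      hence "cprec t ** wcov = mat 1" using trace_minus_ln_det(2)[OF L S] by (simp add: g)
      hence "wcov ** cprec t = mat 1" by (simp add: matrix_left_right_inverse)
      thus "cprec t = matrix_inv wcov" by (rule matrix_inv_unique[symmetric])
    qed
    have q: "v \<bullet> (cprec t *v v) \<ge> 0" "v \<bullet> (cprec t *v v) = 0 \<Longrightarrow> v = 0" for v
      using L by (auto simp: pos_def_matrix_def) (metis inner_zero_left less_imp_le order_refl)
    have nn3: "wprior i * ((wmean i - cmean t i) \<bullet> (cprec t *v (wmean i - cmean t i))) \<ge> 0" for i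
      using q(1) W[of i] by simp
    show "g3 \<ge> 0" unfolding g by (intro sum_nonneg nn3)
    show "g3 = 0 \<longrightarrow> (\<forall>i. cmean t i = wmean i)"
    proof (intro impI allI)
      fix i assume "g3 = 0"
      hence "wprior i * ((wmean i - cmean t i) \<bullet> (cprec t *v (wmean i - cmean t i))) = 0"
        unfolding g by (subst (asm) sum_nonneg_eq_0_iff) (use nn3 in auto)
      thus "cmean t i = wmean i" using q(2)[of "wmean i - cmean t i"] Wne[of i] by simp
    qed
    \<comment> \<open>Both prior vectors sum to 1, so adding their difference does not change
      \<open>g1\<close>, but it makes each summand nonnegative by x - 1 - ln x >= 0.\<close>
    define r where "r i = wprior i * (cprior t i / wprior i - 1 - ln (cprior t i / wprior i))" for i
    have rat: "cprior t i / wprior i > 0" for i using W cprior_pos[OF t] by simp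
    have r0: "r i \<ge> 0" for i
      unfolding r_def using ln_le_minus_one[OF rat[of i]] W[of i] by (intro mult_nonneg_nonneg) auto
    have "cprior t Class1 + cprior t Class2 = 1" by simp
    moreover have "r i = cprior t i - wprior i + wprior i * (ln (wprior i) - ln (cprior t i))" for i
      using W[of i] cprior_pos[OF t, of i] by (simp add: r_def ln_div algebra_simps)
    ultimately have g1: "g1 = (\<Sum>i\<in>UNIV. r i)"
      unfolding g sum_label using wprior_sum[OF n] by simp
    show "g1 \<ge> 0" unfolding g1 by (intro sum_nonneg r0)
    show "g1 = 0 \<longrightarrow> (\<forall>i. cprior t i = wprior i)"
    proof (intro impI allI)
      fix i assume "g1 = 0"
      hence "r i = 0" unfolding g1 by (subst (asm) sum_nonneg_eq_0_iff) (use r0 in auto)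
      hence "ln (cprior t i / wprior i) = cprior t i / wprior i - 1" using Wne[of i] by (simp add: r_def)
      hence "cprior t i / wprior i = 1" using ln_eq_minus_one[OF rat] by blast
      thus "cprior t i = wprior i" using Wne[of i] by simp
    qed
  qed
  fix t :: "'p cparam" assume t: "t \<in> cspace"
  obtain g1 g2 g3 where g: "wlik wparam - wlik t = g1 + g2 / 2 + g3 / 2" "g1 \<ge> 0" "g2 \<ge> 0" "g3 \<ge> 0"
      "g1 = 0 \<Longrightarrow> cprior t i = wprior i" "g2 = 0 \<Longrightarrow> cprec t = matrix_inv wcov"
      "g3 = 0 \<Longrightarrow> cmean t i = wmean i" for i
    using gap[OF t refl refl refl] by blast
  show "wlik t \<le> wlik wparam" using g(1-4) by linarith
  assume "wlik t = wlik wparam"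
  hence "g1 = 0" "g2 = 0" "g3 = 0" using g(1-4) by linarith+
  thus "t = wparam" using g(5-7) by (intro cparam_eqI) (simp_all add: cp)
qed

end

section \<open>Existence of a maximizer\<close>

definition lab :: "label \<Rightarrow> 'p::finite obs \<Rightarrow> real" where
  "lab i = (\<lambda>(y, z, m). of_bool (\<not> m \<and> z = i))"

lemma cwt_resp_nonneg: "cwt (resp b) i a \<ge> 0"
  using sigmoid_pos sigmoid_less_1
  by (cases i; cases a) (auto simp: resp_def less_imp_le)

lemma lab_le_cwt_resp: "lab i a \<le> cwt (resp b) i a"
proof -
  obtain y z m where a: "a = (y, z, m)" by (cases a) auto
  show ?thesis using sigmoid_pos sigmoid_less_1
    by (cases i; cases z; cases m) (auto simp: a resp_def lab_def less_imp_le)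
qed

lemma lab_nonneg: "lab i a \<ge> 0"
  by (cases a) (simp add: lab_def)

text \<open>A quantitative nondegeneracy condition on the labelled part of the data. It bounds one EM step
  uniformly in the weights given to the unlabelled observations.\<close>
definition nondegenerate :: "nat \<Rightarrow> (nat \<Rightarrow> 'p::finite obs) \<Rightarrow> real \<Rightarrow> real \<Rightarrow> bool" where
  "nondegenerate n x c C \<longleftrightarrow> n > 0 \<and>
     (\<forall>i v s. c * ((norm v)\<^sup>2 + s\<^sup>2) \<le> avg n x (\<lambda>a. lab i a * (v \<bullet> fst a - s)\<^sup>2)) \<and>
     avg n x (\<lambda>a. (norm (fst a))\<^sup>2) \<le> C"

text \<open>A compact set into which every EM step on nondegenerate data leads. Each class
  contributes \<open>c\<close> to the lower bound on the pooled covariance, and the second moment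
  bounds it by \<open>C\<close>; hence the precision lies between \<open>1 / C\<close> and
  \<open>1 / (2 * c)\<close>.\<close>

definition cparam_box :: "real \<Rightarrow> real \<Rightarrow> 'p::finite cparam set" where
  "cparam_box c C = {t. (\<forall>i. c \<le> cprior t i) \<and> (\<forall>i. norm (cmean t i) \<le> real CARD('p) * (1 + C) / c) \<and>
     transpose (cprec t) = cprec t \<and>
     (\<forall>v. (norm v)\<^sup>2 / C \<le> v \<bullet> (cprec t *v v) \<and> v \<bullet> (cprec t *v v) \<le> (norm v)\<^sup>2 / (2 * c))}"

lemma cparam_box_subset:
  assumes "c > 0" "C > 0"
  shows "cparam_box c C \<subseteq> cspace"
proof
  fix t :: "'p::finite cparam" assume t: "t \<in> cparam_box c C"
  have "c \<le> cprior t Class1" "c \<le> cprior t Class2" using t by (simp_all add: cparam_box_def del: cprior.simps)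
  moreover have "0 < v \<bullet> (cprec t *v v)" if "v \<noteq> 0" for v
  proof -
    have "0 < (norm v)\<^sup>2 / C" using that assms by simp
    also have "\<dots> \<le> v \<bullet> (cprec t *v v)" using t by (simp add: cparam_box_def)
    finally show ?thesis .
  qed
  ultimately show "t \<in> cspace"
    using t assms by (simp add: cspace_def pos_def_matrix_def cparam_box_def)
qed

lemma continuous_on_matrix_vector_mult [continuous_intros]:
  fixes A :: "'a::topological_space \<Rightarrow> real^'n^'m"
  assumes "continuous_on S A" "continuous_on S v"
  shows "continuous_on S (\<lambda>t. A t *v v t)"
  unfolding matrix_vector_mult_def
  by (intro continuous_on_vec_lambda continuous_intros assms)

lemma continuous_on_det [continuous_intros]:
  fixes A :: "'a::topological_space \<Rightarrow> real^'n^'n"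
  assumes "continuous_on S A"
  shows "continuous_on S (\<lambda>t. det (A t))"
  unfolding det_def by (intro continuous_intros assms)

lemma continuous_on_cprior [continuous_intros]: "continuous_on S (\<lambda>t. cprior t i)"
  by (cases i) (auto intro!: continuous_intros)

lemma continuous_on_cmean [continuous_intros]: "continuous_on S (\<lambda>t. cmean t i)"
  by (cases i) (auto intro!: continuous_intros)

lemma continuous_on_cprec [continuous_intros]: "continuous_on S cprec"
  unfolding cprec_def[abs_def] by (auto intro!: continuous_intros)

lemma continuous_on_transpose [continuous_intros]:
  fixes A :: "'a::topological_space \<Rightarrow> real^'n^'m"
  assumes "continuous_on S A"
  shows "continuous_on S (\<lambda>t. transpose (A t))"
  unfolding transpose_def by (intro continuous_on_vec_lambda continuous_intros assms)

text \<open>Polarization: an entry is read off from the form at two axis vectors and at their sum,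
  whose squared norm is at most 4.\<close>

lemma norm_matrix_le_quadratic:
  fixes A :: "real^'n^'n"
  assumes sym: "transpose A = A" and q: "\<And>v. 0 \<le> v \<bullet> (A *v v)" "\<And>v. v \<bullet> (A *v v) \<le> B * (norm v)\<^sup>2"
  shows "norm A \<le> real CARD('n) * (real CARD('n) * (2 * B))"
proof -
  have "\<bar>A $ k $ l\<bar> \<le> 2 * B" for k l
  proof -
    let ?e = "axis k 1 :: real^'n" and ?f = "axis l 1 :: real^'n"
    have ef: "?e \<bullet> (A *v ?f) = A $ k $ l"
      by (simp add: inner_axis' matrix_vector_mul_component inner_axis)
    have "?f \<bullet> (A *v ?e) = ?e \<bullet> (A *v ?f)"
      using symmetric_inner[OF sym, of ?e ?f] by (simp add: inner_commute)
    hence "(?e + ?f) \<bullet> (A *v (?e + ?f)) = ?e \<bullet> (A *v ?e) + 2 * (A $ k $ l) + ?f \<bullet> (A *v ?f)"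
      using ef by (simp add: matrix_vector_right_distrib inner_add_left inner_add_right)
    moreover have "?e \<bullet> (A *v ?e) \<le> B" "?f \<bullet> (A *v ?f) \<le> B"
      using q(2)[of ?e] q(2)[of ?f] by (simp_all add: norm_axis_1)
    moreover have "(norm (?e + ?f))\<^sup>2 \<le> 4"
    proof -
      have "norm (?e + ?f) \<le> 2" using norm_triangle_ineq[of ?e ?f] by (simp add: norm_axis_1)
      hence "(norm (?e + ?f))\<^sup>2 \<le> 2\<^sup>2" by (rule power_mono) simp
      thus ?thesis by simp
    qed
    moreover have "B \<ge> 0" using q[of ?e] by (simp add: norm_axis_1)
    ultimately show ?thesis
      using q[of "?e + ?f"] q(1)[of ?e] q(1)[of ?f] mult_left_mono[of "(norm (?e + ?f))\<^sup>2" 4 B]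
      by (simp add: abs_le_iff)
  qed
  hence "norm (A $ k) \<le> real CARD('n) * (2 * B)" for k
    by (intro order_trans[OF norm_le_l1_cart] sum_bounded_above) auto
  thus ?thesis
    unfolding norm_vec_def[of A] by (intro order_trans[OF L2_set_le_sum] sum_bounded_above) auto
qed

lemma compact_cparam_box:
  assumes c: "c > 0" and C: "C > 0"
  shows "compact (cparam_box c C :: 'p::finite cparam set)"
proof -
  have "closed (cparam_box c C :: 'p cparam set)"
    unfolding cparam_box_def
    by (intro closed_Collect_conj closed_Collect_all closed_Collect_le closed_Collect_eq continuous_intros)
  moreover have "bounded (cparam_box c C :: 'p cparam set)"
  proof -
    define R where "R = real CARD('p) * (1 + C) / c"
    define B where "B = real CARD('p) * (real CARD('p) * (2 * (1 / (2 * c))))"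
    have "cparam_box c C \<subseteq> cball 0 1 \<times> cball 0 R \<times> cball 0 R \<times> cball (0 :: real^'p^'p) B"
    proof
      fix t :: "'p cparam" assume t: "t \<in> cparam_box c C"
      have "c \<le> cprior t Class1" "c \<le> cprior t Class2" "norm (cmean t Class1) \<le> R" "norm (cmean t Class2) \<le> R"
        using t by (simp_all add: cparam_box_def R_def del: cprior.simps cmean.simps)
      moreover have "norm (cprec t) \<le> B"
        unfolding B_def
      proof (rule norm_matrix_le_quadratic)
        show "transpose (cprec t) = cprec t" using t by (simp add: cparam_box_def)
        show "0 \<le> v \<bullet> (cprec t *v v)" for v
          using t C by (auto simp: cparam_box_def intro: order_trans[of 0 "(norm v)\<^sup>2 / C"])
        show "v \<bullet> (cprec t *v v) \<le> 1 / (2 * c) * (norm v)\<^sup>2" for v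
          using t by (simp add: cparam_box_def)
      qed
      ultimately show "t \<in> cball 0 1 \<times> cball 0 R \<times> cball 0 R \<times> cball 0 B"
        using c by (cases t) (auto simp: cprec_def dist_real_def)
    qed
    thus ?thesis by (rule bounded_subset[rotated]) (intro bounded_Times bounded_cball)
  qed
  ultimately show ?thesis by (simp add: compact_eq_bounded_closed)
qed

lemma continuous_on_lcomp: "continuous_on cspace (\<lambda>t. lcomp t i (y :: real^'p::finite))"
proof -
  have d: "\<forall>t\<in>cspace. det (cprec t :: real^'p^'p) \<noteq> 0"
  proof
    fix t :: "'p cparam" assume "t \<in> cspace"
    hence "pos_def_matrix (cprec t)" unfolding cspace_def by blast
    from det_pos_def_matrix[OF this] show "det (cprec t) \<noteq> 0" by simp
  qed
  have c: "\<forall>t\<in>cspace. cprior (t :: 'p cparam) i \<noteq> 0"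
  proof
    fix t :: "'p cparam" assume "t \<in> cspace"
    from cprior_pos[OF this, of i] show "cprior t i \<noteq> 0" by simp
  qed
  have "continuous_on cspace (\<lambda>t :: 'p cparam. ln (cprior t i))"
    by (rule continuous_on_ln[OF continuous_on_cprior c])
  moreover have "continuous_on cspace (\<lambda>t. ln (det (cprec t :: real^'p^'p)))"
    by (rule continuous_on_ln[OF continuous_on_det[OF continuous_on_cprec] d])
  moreover have "continuous_on cspace (\<lambda>t. (y - cmean t i) \<bullet> (cprec t *v (y - cmean t i)))"
    by (intro continuous_on_inner continuous_on_matrix_vector_mult continuous_on_diff
        continuous_on_const continuous_on_cmean continuous_on_cprec)
  ultimately show ?thesis unfolding lcomp_def
    by (intro continuous_on_diff continuous_on_add continuous_on_const) (simp_all add: continuous_on_divide)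
qed

lemma continuous_on_lobs: "continuous_on cspace (\<lambda>t. lobs t a)"
proof -
  obtain y z m where a: "a = (y, z, m)" by (cases a) auto
  have nz: "exp u + exp v \<noteq> (0::real)" for u v by (metis add_pos_pos exp_gt_zero less_irrefl)
  show ?thesis
    by (cases m) (auto simp: a lobs_def nz intro!: continuous_intros continuous_on_lcomp)
qed

lemma continuous_on_avg_lobs: "continuous_on cspace (\<lambda>t. avg n x (lobs t))"
  unfolding avg_def by (cases "n = 0") (auto intro!: continuous_intros continuous_on_lobs)

section \<open>One EM step on nondegenerate data\<close>

context
  fixes n :: nat and x :: "nat \<Rightarrow> 'p::finite obs" and c C :: real
  assumes nd: "nondegenerate n x c C" and c: "c > 0" and C: "C > 0"
begin

lemma n_pos: "n > 0"
  using nd by (simp add: nondegenerate_def)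

context
  fixes b :: "real \<times> (real^'p)"
begin

interpretation weighted_sample n x "resp b" .

lemma wprior_ge: "c \<le> wprior i"
proof -
  \<comment> \<open>With \<open>v = 0\<close> and \<open>s = 1\<close>, nondegeneracy bounds the
    proportion of labelled observations of class \<open>i\<close> from below.\<close>
  have "c * ((norm (0::real^'p))\<^sup>2 + 1\<^sup>2) \<le> avg n x (\<lambda>a. lab i a * (0 \<bullet> fst a - 1)\<^sup>2)"
    using nd unfolding nondegenerate_def by blast
  also have "\<dots> \<le> wprior i"
    unfolding wprior_def by (rule avg_mono) (simp add: lab_le_cwt_resp)
  finally show ?thesis by simp
qed

text \<open>Nondegeneracy is applied with \<open>s = v \<bullet> wmean i\<close>. The class mean
  depends on the weights given to unlabelled observations; the free shift \<open>s\<close> in the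
  condition makes the bound uniform in them.\<close>

lemma wcov_ge: "2 * c * (norm v)\<^sup>2 \<le> v \<bullet> (wcov *v v)"
proof -
  have "c * (norm v)\<^sup>2 \<le> avg n x (\<lambda>a. cwt (resp b) i a * (v \<bullet> (fst a - wmean i))\<^sup>2)" for i
  proof -
    have "c * (norm v)\<^sup>2 \<le> c * ((norm v)\<^sup>2 + (v \<bullet> wmean i)\<^sup>2)" using c by simp
    also have "\<dots> \<le> avg n x (\<lambda>a. lab i a * (v \<bullet> fst a - v \<bullet> wmean i)\<^sup>2)"
      using nd unfolding nondegenerate_def by blast
    also have "\<dots> \<le> avg n x (\<lambda>a. cwt (resp b) i a * (v \<bullet> (fst a - wmean i))\<^sup>2)"
      by (rule avg_mono) (auto simp: inner_diff_right intro!: mult_right_mono lab_le_cwt_resp)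
    finally show ?thesis .
  qed
  from this[of Class1] this[of Class2] show ?thesis
    unfolding wcov_quadratic sum_label by linarith
qed

text \<open>Replacing the class means by 0 can only increase the quadratic form, and then the class
  weights add up to 1.\<close>

lemma wcov_le: "v \<bullet> (wcov *v v) \<le> C * (norm v)\<^sup>2"
proof -
  have W: "wprior i > 0" for i using wprior_ge[of i] c by linarith
  define A :: "real^'p^'p" where "A = (\<chi> k l. v $ k * v $ l)"
  have q: "w \<bullet> (A *v w) = (v \<bullet> w)\<^sup>2" for w
    unfolding inner_matrix_sum A_def by (simp add: power2_eq_square inner_vec_def sum_product mult_ac)
  have sy: "transpose A = A" by (simp add: A_def transpose_def vec_eq_iff mult.commute)
  have "avg n x (\<lambda>a. cwt (resp b) i a * (v \<bullet> (fst a - wmean i))\<^sup>2) \<le> avg n x (\<lambda>a. cwt (resp b) i a * (v \<bullet> fst a)\<^sup>2)" for i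
    using avg_quadratic_shift[OF _ sy, of i 0] W[of i] by (simp add: q)
  hence "v \<bullet> (wcov *v v) \<le> (\<Sum>i\<in>UNIV. avg n x (\<lambda>a. cwt (resp b) i a * (v \<bullet> fst a)\<^sup>2))"
    unfolding wcov_quadratic by (intro sum_mono)
  also have "\<dots> = avg n x (\<lambda>a. (v \<bullet> fst a)\<^sup>2)"
    by (simp add: sum_label avg_add[symmetric] algebra_simps)
  also have "\<dots> \<le> avg n x (\<lambda>a. (norm v)\<^sup>2 * (norm (fst a))\<^sup>2)"
    by (rule avg_mono) (metis Cauchy_Schwarz_ineq power2_norm_eq_inner)
  also have "\<dots> \<le> (norm v)\<^sup>2 * C"
    unfolding avg_cmult using nd by (intro mult_left_mono) (auto simp: nondegenerate_def)
  finally show ?thesis by (simp add: mult.commute)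
qed

lemma pos_def_wcov: "pos_def_matrix wcov"
  unfolding pos_def_matrix_def
proof (intro conjI allI impI)
  fix v :: "real^'p" assume "v \<noteq> 0"
  hence "0 < 2 * c * (norm v)\<^sup>2" using c by simp
  also have "\<dots> \<le> v \<bullet> (wcov *v v)" by (rule wcov_ge)
  finally show "0 < v \<bullet> (wcov *v v)" .
qed (rule transpose_wcov)

lemma norm_wmean_le: "norm (wmean i) \<le> real CARD('p) * (1 + C) / c"
proof -
  have "\<bar>wmean i $ k\<bar> \<le> (1 + C) / c" for k
  proof -
    have "\<bar>avg n x (\<lambda>a. cwt (resp b) i a * fst a $ k)\<bar> \<le> avg n x (\<lambda>a. \<bar>cwt (resp b) i a * fst a $ k\<bar>)"
      by (rule avg_abs)
    also have "\<dots> \<le> avg n x (\<lambda>a. 1 + (norm (fst a))\<^sup>2)"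
    proof (rule avg_mono)
      fix j
      let ?a = "x j"
      have "cwt (resp b) i ?a \<le> 1"
        using cwt_resp_nonneg[of b Class1 ?a] cwt_resp_nonneg[of b Class2 ?a] by (cases i) auto
      hence "\<bar>cwt (resp b) i ?a * fst ?a $ k\<bar> \<le> 1 * norm (fst ?a)"
        unfolding abs_mult using cwt_resp_nonneg[of b i ?a]
        by (intro mult_mono component_le_norm_cart) auto
      also have "\<dots> \<le> 1 + (norm (fst ?a))\<^sup>2"
      proof -
        have "2 * norm (fst ?a) \<le> 1 + (norm (fst ?a))\<^sup>2"
          using zero_le_power2[of "norm (fst ?a) - 1"] by (simp add: power2_eq_square algebra_simps)
        thus ?thesis using norm_ge_zero[of "fst ?a"] by linarith
      qed
      finally show "\<bar>cwt (resp b) i ?a * fst ?a $ k\<bar> \<le> 1 + (norm (fst ?a))\<^sup>2" .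
    qed
    also have "\<dots> \<le> 1 + C"
      using nd by (simp add: avg_add avg_const nondegenerate_def)
    finally show ?thesis
      using wprior_ge[of i] c C by (auto simp: wmean_def intro!: frac_le)
  qed
  hence "norm (wmean i) \<le> real CARD('p) * ((1 + C) / c)"
    by (intro order_trans[OF norm_le_l1_cart] sum_bounded_above) auto
  thus ?thesis by simp
qed

lemma wparam_in_box: "wparam \<in> cparam_box c C"
proof -
  have cp: "cprior wparam i = wprior i" "cmean wparam i = wmean i" "cprec wparam = matrix_inv wcov" for i
    using wprior_sum[OF n_pos] by (cases i; simp add: wparam_def cprec_def)+
  let ?L = "matrix_inv wcov"
  have pL: "pos_def_matrix ?L" by (rule pos_def_matrix_inv[OF pos_def_wcov])
  have SL: "wcov *v (?L *v v) = v" for v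
    by (simp add: matrix_vector_mul_assoc matrix_inv_right[OF pos_def_matrix_invertible[OF pos_def_wcov]])
  have q: "(norm v)\<^sup>2 / C \<le> v \<bullet> (?L *v v) \<and> v \<bullet> (?L *v v) \<le> (norm v)\<^sup>2 / (2 * c)" for v
  proof
    let ?u = "?L *v v"
    have vu: "v \<bullet> ?u = ?u \<bullet> (wcov *v ?u)" by (simp add: SL inner_commute)
    have "2 * c * (norm ?u)\<^sup>2 \<le> v \<bullet> ?u" unfolding vu by (rule wcov_ge)
    also have "\<dots> \<le> norm v * norm ?u" by (rule norm_cauchy_schwarz)
    finally have "norm ?u * (2 * c * norm ?u) \<le> norm ?u * norm v"
      by (simp add: power2_eq_square mult_ac)
    hence "2 * c * norm ?u \<le> norm v"
      by (cases "?u = 0") auto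
    hence "norm v * norm ?u \<le> norm v * (norm v / (2 * c))"
      using c by (intro mult_left_mono) (auto simp: field_simps)
    with \<open>v \<bullet> ?u \<le> norm v * norm ?u\<close> show "v \<bullet> ?u \<le> (norm v)\<^sup>2 / (2 * c)"
      by (simp add: power2_eq_square)
    show "(norm v)\<^sup>2 / C \<le> v \<bullet> ?u"
    proof (rule ccontr)
      assume "\<not> (norm v)\<^sup>2 / C \<le> v \<bullet> ?u"
      hence less: "C * (v \<bullet> ?u) < (norm v)\<^sup>2" using C by (simp add: field_simps)
      \<comment> \<open>The covariance form would be negative at this vector: the upper bound on the
        form at \<open>v\<close> and the assumed smallness of \<open>v \<bullet> ?u\<close> outweigh
        the remaining terms.\<close>
      define w where "w = v - C *\<^sub>R ?u"
      have "0 \<le> w \<bullet> (wcov *v w)" using wcov_ge[of w] c by (meson order_trans mult_nonneg_nonneg less_imp_le zero_le_numeral zero_le_power2)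
      also have "w \<bullet> (wcov *v w) = v \<bullet> (wcov *v v) - 2 * C * (v \<bullet> v) + C\<^sup>2 * (v \<bullet> ?u)"
      proof -
        have "?u \<bullet> (wcov *v v) = v \<bullet> v"
          using symmetric_inner[OF transpose_wcov, of ?u v] by (simp add: SL)
        thus ?thesis
          by (simp add: w_def matrix_vector_mult_diff_distrib matrix_vector_mult_scaleR SL inner_diff_left
             inner_diff_right inner_commute[of ?u v] power2_eq_square algebra_simps)
      qed
      also have "\<dots> \<le> C * (norm v)\<^sup>2 - 2 * C * (norm v)\<^sup>2 + C * (C * (v \<bullet> ?u))"
        using wcov_le[of v] by (simp add: dot_square_norm) (simp add: power2_eq_square)
      also have "\<dots> < C * (norm v)\<^sup>2 - 2 * C * (norm v)\<^sup>2 + C * (norm v)\<^sup>2"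
        using less C by simp
      finally show False by simp
    qed
  qed
  show ?thesis
    using wprior_ge norm_wmean_le pL q by (simp add: cparam_box_def cp pos_def_matrix_def)
qed

end

text \<open>The gain in log-likelihood dominates the gain in weighted likelihood, which is
  nonnegative because the M step maximizes it. If nothing is gained, \<open>t\<close> already
  maximizes the weighted likelihood, and that maximizer is unique.\<close>

lemma EM_step_increases:
  assumes t: "t \<in> cspace"
  defines "t' \<equiv> weighted_sample.wparam n x (resp (cbeta t))"
  shows "avg n x (lobs t) \<le> avg n x (lobs t')"
    and "avg n x (lobs t) = avg n x (lobs t') \<Longrightarrow> t = t'"
proof -
  interpret weighted_sample n x "resp (cbeta t)" .
  have W: "wprior i > 0" for i using wprior_ge[of "cbeta t" i] c by linarith
  note mx = wparam_maximizes[OF n_pos W pos_def_wcov[of "cbeta t"]]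
  have "wlik t' - wlik t = avg n x (\<lambda>a. \<Sum>i\<in>UNIV. cwt (resp (cbeta t)) i a * (lcomp t' i (fst a) - lcomp t i (fst a)))"
    unfolding wlik_def avg_diff[symmetric] by (simp add: sum_subtractf algebra_simps)
  also have "\<dots> \<le> avg n x (\<lambda>a. lobs t' a - lobs t a)"
    by (rule avg_mono) (rule lobs_minorant[OF t])
  finally have le: "wlik t' - wlik t \<le> avg n x (lobs t') - avg n x (lobs t)" by (simp add: avg_diff)
  with mx(2)[OF t] show "avg n x (lobs t) \<le> avg n x (lobs t')" by (simp add: t'_def)
  assume "avg n x (lobs t) = avg n x (lobs t')"
  with le mx(2)[OF t] have "wlik t = wlik t'" by (simp add: t'_def)
  thus "t = t'" using mx(3)[OF t] by (simp add: t'_def)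
qed

text \<open>Maximizing over the compact box suffices, since one EM step leads from any parameter
  into the box without lowering the likelihood.\<close>

lemma maximizer_exists:
  "\<exists>t\<in>cparam_box c C. \<forall>t'\<in>cspace. avg n x (lobs t') \<le> avg n x (lobs t)"
proof -
  have "continuous_on (cparam_box c C) (\<lambda>t. avg n x (lobs t))"
    by (rule continuous_on_subset[OF continuous_on_avg_lobs cparam_box_subset[OF c C]])
  moreover have "cparam_box c C \<noteq> ({} :: 'p cparam set)" using wparam_in_box by blast
  ultimately obtain t where t: "t \<in> cparam_box c C" and
    mx: "\<And>s. s \<in> cparam_box c C \<Longrightarrow> avg n x (lobs s) \<le> avg n x (lobs t)"
    using continuous_attains_sup[OF compact_cparam_box[OF c C]] by blast
  have "avg n x (lobs t') \<le> avg n x (lobs t)" if "t' \<in> cspace" for t'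
    using EM_step_increases(1)[OF that] mx[OF wparam_in_box] by (rule order_trans)
  with t show ?thesis by blast
qed

lemma maximizer_EM_fixed_point:
  assumes t: "t \<in> cspace" and mx: "\<And>s. s \<in> cspace \<Longrightarrow> avg n x (lobs s) \<le> avg n x (lobs t)"
  shows "t = weighted_sample.wparam n x (resp (cbeta t))" "t \<in> cparam_box c C"
proof -
  have "weighted_sample.wparam n x (resp (cbeta t)) \<in> cspace"
    using wparam_in_box cparam_box_subset[OF c C] by blast
  from antisym[OF EM_step_increases(1)[OF t] mx[OF this]]
  show eq: "t = weighted_sample.wparam n x (resp (cbeta t))"
    by (rule EM_step_increases(2)[OF t])
  show "t \<in> cparam_box c C"
    using wparam_in_box[of "cbeta t"] unfolding eq[symmetric] .
qed

end

text \<open>The parameter space excludes equal means, whereas EM and compactness arguments take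
  place in \<open>cspace\<close>, which admits them. Separating equal means by a vanishing multiple
  of \<open>e\<close> and using continuity carries the bound over.\<close>

lemma avg_lobs_le_of_param_space:
  fixes t s :: "'p::finite cparam"
  assumes mx: "\<And>s. s \<in> cspace \<Longrightarrow> cmean s Class1 \<noteq> cmean s Class2 \<Longrightarrow> avg n x (lobs s) \<le> A"
    and s: "s \<in> cspace"
  shows "avg n x (lobs s) \<le> A"
proof (cases "cmean s Class1 = cmean s Class2")
  case True
  define e :: "real^'p" where "e = axis undefined 1"
  have e: "e \<noteq> 0" by (simp add: e_def axis_eq_0_iff)
  define f where "f k = (fst s, fst (snd s) + (1 / real (Suc k)) *\<^sub>R e, snd (snd s))" for k
  have f: "f k \<in> cspace" for k using s by (simp add: f_def cspace_def cprec_def)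
  have "(\<lambda>k. fst (snd s) + (1 / real (Suc k)) *\<^sub>R e) \<longlonglongrightarrow> fst (snd s) + 0 *\<^sub>R e"
    by (intro tendsto_intros LIMSEQ_Suc[OF lim_1_over_n])
  hence "f \<longlonglongrightarrow> (fst s, fst (snd s), snd (snd s))"
    unfolding f_def by (intro tendsto_Pair tendsto_const) simp
  hence "(\<lambda>k. avg n x (lobs (f k))) \<longlonglongrightarrow> avg n x (lobs s)"
    using continuous_on_tendsto_compose[OF continuous_on_avg_lobs _ s, of f] f by simp
  moreover have "avg n x (lobs (f k)) \<le> A" for k
    by (rule mx[OF f]) (use True e in \<open>simp add: f_def\<close>)
  ultimately show ?thesis using LIMSEQ_le_const2 by blast
qed (use mx s in auto)

section \<open>Gaussian integrals and moments of the class densities\<close>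

lemma pos_def_matrix_lower_bound:
  fixes A :: "real^'n^'n"
  assumes A: "pos_def_matrix A"
  obtains c where "c > 0" "\<And>v. c * (norm v)\<^sup>2 \<le> v \<bullet> (A *v v)"
proof -
  have "continuous_on (sphere 0 1) (\<lambda>v. v \<bullet> (A *v v))" by (intro continuous_intros)
  moreover have "axis undefined 1 \<in> sphere (0 :: real^'n) 1" by (simp add: norm_axis_1)
  hence "sphere (0 :: real^'n) 1 \<noteq> {}" by blast
  ultimately obtain u where u: "u \<in> sphere 0 1" and mn: "\<And>v. v \<in> sphere 0 1 \<Longrightarrow> u \<bullet> (A *v u) \<le> v \<bullet> (A *v v)"
    using continuous_attains_inf[OF compact_sphere] by blast
  have "(u \<bullet> (A *v u)) * (norm v)\<^sup>2 \<le> v \<bullet> (A *v v)" for v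
  proof (cases "v = 0")
    case False
    have "u \<bullet> (A *v u) \<le> (v /\<^sub>R norm v) \<bullet> (A *v (v /\<^sub>R norm v))"
      using False by (intro mn) simp
    also have "\<dots> = (v \<bullet> (A *v v)) / (norm v)\<^sup>2"
      by (simp add: matrix_vector_mult_scaleR power2_eq_square divide_inverse mult_ac)
    finally show ?thesis using False by (simp add: field_simps)
  qed simp
  moreover have "u \<bullet> (A *v u) > 0" using A u
  proof -
    have "u \<noteq> 0" using u by auto
    thus ?thesis using A by (simp add: pos_def_matrix_def)
  qed
  ultimately show thesis by (intro that)
qed

lemma nn_integral_gauss_prod:
  "(\<integral>\<^sup>+y. ennreal (exp (- c * (norm (y :: 'a::euclidean_space))\<^sup>2)) \<partial>lborel)
     = (\<integral>\<^sup>+x. ennreal (exp (- c * x\<^sup>2)) \<partial>lborel) ^ DIM('a)"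
proof -
  have "exp (- c * (norm y)\<^sup>2) = (\<Prod>b\<in>Basis. exp (- c * (y \<bullet> b)\<^sup>2))" for y :: 'a
  proof -
    have "(norm y)\<^sup>2 = (\<Sum>b\<in>Basis. (y \<bullet> b)\<^sup>2)"
      by (subst power2_norm_eq_inner, subst euclidean_inner) (simp add: power2_eq_square)
    thus ?thesis by (simp add: exp_sum[symmetric] sum_distrib_left sum_negf)
  qed
  hence "(\<integral>\<^sup>+y. ennreal (exp (- c * (norm (y :: 'a))\<^sup>2)) \<partial>lborel)
      = (\<integral>\<^sup>+y. (\<Prod>b\<in>Basis. ennreal (exp (- c * (y \<bullet> b)\<^sup>2))) \<partial>(lborel :: 'a measure))"
    by (simp add: prod_ennreal)
  also have "\<dots> = (\<Prod>b\<in>(Basis :: 'a set). (\<integral>\<^sup>+x. ennreal (exp (- c * x\<^sup>2)) \<partial>lborel))"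
    by (rule nn_integral_lborel_prod) auto
  finally show ?thesis by simp
qed

lemma nn_integral_gauss_half: "(\<integral>\<^sup>+x. ennreal (exp (- (1/2) * x\<^sup>2)) \<partial>lborel) = ennreal (sqrt (2 * pi))"
proof -
  have "(\<integral>\<^sup>+x. ennreal (exp (- (1/2) * x\<^sup>2)) \<partial>lborel) =
      (\<integral>\<^sup>+x. ennreal (sqrt (2 * pi)) * ennreal (normal_density 0 1 x) \<partial>lborel)"
    by (intro nn_integral_cong) (simp add: normal_density_def ennreal_mult'[symmetric])
  also have "\<dots> = ennreal (sqrt (2 * pi)) * (\<integral>\<^sup>+x. ennreal (normal_density 0 1 x) \<partial>lborel)"
    by (rule nn_integral_cmult) simp
  also have "(\<integral>\<^sup>+x. ennreal (normal_density 0 1 x) \<partial>lborel) = 1"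
    by (subst nn_integral_eq_integral) auto
  finally show ?thesis by simp
qed

lemma nn_integral_gauss_finite:
  assumes "c > 0"
  shows "(\<integral>\<^sup>+x. ennreal (exp (- c * x\<^sup>2)) \<partial>lborel) < \<infinity>"
proof -
  define s where "s = 1 / sqrt (2 * c)"
  have s: "s > 0" "s\<^sup>2 = 1 / (2 * c)" using assms by (auto simp: s_def power_divide)
  have "(\<integral>\<^sup>+x. ennreal (exp (- c * x\<^sup>2)) \<partial>lborel) =
      (\<integral>\<^sup>+x. ennreal (sqrt (2 * pi * s\<^sup>2)) * ennreal (normal_density 0 s x) \<partial>lborel)"
    using assms by (intro nn_integral_cong) (simp add: normal_density_def ennreal_mult'[symmetric] s)
  also have "\<dots> = ennreal (sqrt (2 * pi * s\<^sup>2)) * (\<integral>\<^sup>+x. ennreal (normal_density 0 s x) \<partial>lborel)"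
    by (rule nn_integral_cmult) simp
  also have "(\<integral>\<^sup>+x. ennreal (normal_density 0 s x) \<partial>lborel) = 1"
    using s by (subst nn_integral_eq_integral) auto
  finally show ?thesis by simp
qed

lemma lcomp_measurable [measurable]: "lcomp t i \<in> borel_measurable borel"
  unfolding lcomp_def[abs_def] by (intro borel_measurable_continuous_onI continuous_intros) auto

lemma nn_integral_exp_lcomp:
  fixes t :: "'p::finite cparam"
  assumes t: "t \<in> cspace"
  shows "(\<integral>\<^sup>+y. ennreal (exp (lcomp t i y)) \<partial>lborel) = ennreal (cprior t i)"
proof -
  have L: "pos_def_matrix (cprec t)" using t by (simp add: cspace_def)
  obtain R :: "real^'p^'p" where R: "cprec t = R ** transpose R" "invertible R"
    by (rule pos_def_matrix_sqrt[OF L])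
  \<comment> \<open>The substitution \<open>y = cmean t i + A *v w\<close> turns the quadratic form
    of the precision matrix into the squared norm of \<open>w\<close>.\<close>
  define A where "A = matrix_inv (transpose R)"
  have iT: "invertible (transpose R)" using R(2) by (simp add: invertible_det_nz)
  have TA: "transpose R ** A = mat 1" unfolding A_def by (rule matrix_inv_right[OF iT])
  have iA: "invertible A"
    unfolding invertible_def A_def
    by (rule exI[of _ "transpose R"]) (intro conjI matrix_inv_left matrix_inv_right iT)
  have "det R * det A = 1" using TA by (metis det_I det_mul det_transpose)
  moreover have dL: "det (cprec t) = (det R)\<^sup>2" by (simp add: R(1) det_mul power2_eq_square)
  ultimately have dA: "\<bar>det A\<bar> = 1 / sqrt (det (cprec t))"
  proof -
    have "\<bar>det R\<bar> * \<bar>det A\<bar> = 1" using \<open>det R * det A = 1\<close> by (simp add: abs_mult[symmetric])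
    moreover from this have "\<bar>det R\<bar> \<noteq> 0" by force
    ultimately show ?thesis unfolding dL real_sqrt_abs by (simp add: field_simps)
  qed
  have dpos: "det (cprec t) > 0" by (rule det_pos_def_matrix[OF L])
  have q: "(A *v w) \<bullet> (cprec t *v (A *v w)) = (norm w)\<^sup>2" for w
  proof -
    have "(A *v w) \<bullet> (cprec t *v (A *v w)) = (transpose R *v (A *v w)) \<bullet> (transpose R *v (A *v w))"
      unfolding R(1) by (simp only: inner_matrix_vector_transpose transpose_transpose matrix_vector_mul_assoc[symmetric])
    also have "transpose R *v (A *v w) = w" by (simp only: matrix_vector_mul_assoc TA matrix_vector_mul_lid)
    finally show ?thesis by (simp add: power2_norm_eq_inner)
  qed
  define K where "K = cprior t i * sqrt (det (cprec t)) * exp (- (real CARD('p) * ln (2 * pi) / 2))"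
  have K0: "K \<ge> 0" using cprior_pos[OF t, of i] dpos by (simp add: K_def)
  have "exp (lcomp t i (cmean t i + A *v w)) = K * exp (- (1/2) * (norm w)\<^sup>2)" for w
  proof -
    have "exp (ln (det (cprec t)) / 2) = sqrt (det (cprec t))"
      using dpos by (subst ln_sqrt[symmetric]) simp_all
    moreover have "exp (ln (cprior t i)) = cprior t i"
      using cprior_pos[OF t, of i] by simp
    moreover have "lcomp t i (cmean t i + A *v w) = ln (cprior t i) + ln (det (cprec t)) / 2
        + (- (real CARD('p) * ln (2 * pi) / 2)) + (- (1/2) * (norm w)\<^sup>2)"
      unfolding lcomp_def add_diff_cancel_left' q by linarith
    ultimately show ?thesis by (simp only: K_def exp_add)
  qed
  hence "(\<integral>\<^sup>+y. ennreal (exp (lcomp t i y)) \<partial>lborel) =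
      ennreal \<bar>det A\<bar> * (\<integral>\<^sup>+w. ennreal K * ennreal (exp (- (1/2) * (norm (w :: real^'p))\<^sup>2)) \<partial>lborel)"
    using K0 by (subst nn_integral_lborel_affine[OF iA, of _ "cmean t i"]) (simp_all only: ennreal_mult', measurable)
  also have "\<dots> = ennreal \<bar>det A\<bar> * (ennreal K * ennreal (sqrt (2 * pi) ^ CARD('p)))"
    by (subst nn_integral_cmult)
      (simp_all only: nn_integral_gauss_prod nn_integral_gauss_half ennreal_power DIM_cart DIM_real mult_1_right real_sqrt_ge_zero pi_ge_zero mult_nonneg_nonneg zero_le_numeral, measurable)
  also have "\<dots> = ennreal (\<bar>det A\<bar> * (K * sqrt (2 * pi) ^ CARD('p)))"
    using K0 by (simp add: ennreal_mult'[symmetric])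
  finally have fin: "(\<integral>\<^sup>+y. ennreal (exp (lcomp t i y)) \<partial>lborel) =
      ennreal (\<bar>det A\<bar> * (K * sqrt (2 * pi) ^ CARD('p)))" .
  have "\<bar>det A\<bar> * (K * sqrt (2 * pi) ^ CARD('p)) = cprior t i"
  proof -
    have "exp (real CARD('p) * ln (2 * pi) / 2) = sqrt (2 * pi) ^ CARD('p)"
    proof -
      have "exp (real CARD('p) * ln (2 * pi) / 2) = exp (real CARD('p) * (ln (2 * pi) / 2))" by simp
      also have "\<dots> = exp (ln (2 * pi) / 2) ^ CARD('p)" by (rule exp_of_nat_mult)
      also have "exp (ln (2 * pi) / 2) = sqrt (2 * pi)"
        by (subst ln_sqrt[symmetric]) simp_all
      finally show ?thesis .
    qed
    thus ?thesis using dpos by (simp add: K_def dA exp_minus field_simps)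
  qed
  thus ?thesis unfolding fin by (rule arg_cong)
qed

lemma exp_lcomp_gaussian_bound:
  fixes t :: "'p::finite cparam"
  assumes t: "t \<in> cspace"
  obtains c K where "c > 0" "K > 0" "\<And>y. exp (lcomp t i y) \<le> K * exp (- c * (norm y)\<^sup>2)"
proof -
  have L: "pos_def_matrix (cprec t)" using t by (simp add: cspace_def)
  then obtain c where c: "c > 0" "\<And>v. c * (norm v)\<^sup>2 \<le> v \<bullet> (cprec t *v v)"
    using pos_def_matrix_lower_bound by blast
  define k where "k = ln (cprior t i) + ln (det (cprec t)) / 2 - real CARD('p) * ln (2 * pi) / 2 + c / 2 * (norm (cmean t i))\<^sup>2"
  \<comment> \<open>In c / 4 one factor 1/2 comes from the density and the other from |y|^2 <= 2 |y
    - m|^2 + 2 |m|^2; the last term of \<open>k\<close> pays for the shift by the mean.\<close>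
  have "exp (lcomp t i y) \<le> exp k * exp (- (c / 4) * (norm y)\<^sup>2)" for y
  proof -
    let ?m = "cmean t i"
    have "norm y \<le> norm (y - ?m) + norm ?m" using norm_triangle_sub[of y ?m] by simp
    hence "(norm y)\<^sup>2 \<le> (norm (y - ?m) + norm ?m)\<^sup>2" by (intro power_mono) auto
    also have "\<dots> \<le> 2 * (norm (y - ?m))\<^sup>2 + 2 * (norm ?m)\<^sup>2"
      using zero_le_power2[of "norm (y - ?m) - norm ?m"] by (simp add: power2_eq_square algebra_simps)
    finally have "c / 4 * (norm y)\<^sup>2 \<le> c / 4 * (2 * (norm (y - ?m))\<^sup>2 + 2 * (norm ?m)\<^sup>2)"
      using c(1) by (intro mult_left_mono) auto
    also have "\<dots> = c * (norm (y - ?m))\<^sup>2 / 2 + c / 2 * (norm ?m)\<^sup>2" by (simp add: algebra_simps)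
    also have "c * (norm (y - ?m))\<^sup>2 / 2 \<le> (y - ?m) \<bullet> (cprec t *v (y - ?m)) / 2" using c(2)[of "y - ?m"] by simp
    finally have "lcomp t i y \<le> k + - (c / 4) * (norm y)\<^sup>2"
      unfolding lcomp_def k_def by linarith
    thus ?thesis by (simp only: exp_add[symmetric] exp_le_cancel_iff)
  qed
  thus thesis using c(1) by (intro that[of "c / 4" "exp k"]) auto
qed

lemma power_over_fact_le_exp:
  fixes x :: real
  assumes "x \<ge> 0"
  shows "x ^ m / fact m \<le> exp x"
proof -
  have "(\<Sum>n\<in>{m}. x ^ n /\<^sub>R fact n) \<le> (\<Sum>n. x ^ n /\<^sub>R fact n)"
    using assms by (intro sum_le_suminf summable_exp_generic) auto
  thus ?thesis by (simp add: exp_def divide_inverse mult.commute)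
qed

lemma integrable_exp_lcomp_moment:
  fixes t :: "'p::finite cparam"
  assumes t: "t \<in> cspace"
  shows "integrable lborel (\<lambda>y. exp (lcomp t i y) * (1 + norm y) ^ m)"
proof -
  obtain c K where c: "c > 0" "K > 0" "\<And>y. exp (lcomp t i y) \<le> K * exp (- c * (norm y)\<^sup>2)"
    using exp_lcomp_gaussian_bound[OF t, of i] by blast
  \<comment> \<open>With r the norm of y, the power is at most \<open>fact m * exp (1 + r)\<close>,
    and r is at most c r^2 / 2 + 1 / (2 c). Half of the Gaussian decay thus absorbs the polynomial
    factor, at the cost of this constant.\<close>
  define B where "B = K * (fact m * exp (1 + 1 / (2 * c)))"
  have bd: "exp (lcomp t i y) * (1 + norm y) ^ m \<le> B * exp (- (c / 2) * (norm y)\<^sup>2)" for y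
  proof -
    let ?r = "norm y"
    have "(1 + ?r) ^ m / fact m \<le> exp (1 + ?r)"
      by (rule power_over_fact_le_exp) simp
    hence "(1 + ?r) ^ m \<le> fact m * exp (1 + ?r)" by (simp add: field_simps)
    also have "?r \<le> c / 2 * ?r\<^sup>2 + 1 / (2 * c)"
    proof -
      have "0 \<le> (c * ?r - 1)\<^sup>2 / (2 * c)" using c by simp
      also have "\<dots> = c / 2 * ?r\<^sup>2 + 1 / (2 * c) - ?r" using c(1) by (simp add: power2_eq_square field_simps)
      finally show ?thesis by simp
    qed
    hence "fact m * exp (1 + ?r) \<le> fact m * exp (1 + (c / 2 * ?r\<^sup>2 + 1 / (2 * c)))" by simp
    finally have "exp (lcomp t i y) * (1 + ?r) ^ m \<le> (K * exp (- c * ?r\<^sup>2)) * (fact m * exp (1 + (c / 2 * ?r\<^sup>2 + 1 / (2 * c))))"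
      using c by (intro mult_mono) auto
    also have "\<dots> = B * exp (- (c / 2) * ?r\<^sup>2)"
    proof -
      have "exp (- c * ?r\<^sup>2) * exp (1 + (c / 2 * ?r\<^sup>2 + 1 / (2 * c))) = exp (1 + 1 / (2 * c)) * exp (- (c / 2) * ?r\<^sup>2)"
        by (simp add: exp_add[symmetric])
      thus ?thesis by (simp add: B_def mult_ac)
    qed
    finally show ?thesis .
  qed
  have B0: "B \<ge> 0" using c by (simp add: B_def)
  show ?thesis
  proof (rule integrableI_nonneg)
    have "(\<integral>\<^sup>+y. ennreal (exp (lcomp t i y) * (1 + norm y) ^ m) \<partial>lborel)
       \<le> (\<integral>\<^sup>+y. ennreal B * ennreal (exp (- (c / 2) * (norm (y :: real^'p))\<^sup>2)) \<partial>lborel)"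
      using bd B0 by (intro nn_integral_mono) (simp add: ennreal_mult'[symmetric] ennreal_leI)
    also have "\<dots> = ennreal B * (\<integral>\<^sup>+x. ennreal (exp (- (c / 2) * x\<^sup>2)) \<partial>lborel) ^ CARD('p)"
      by (subst nn_integral_cmult) (simp_all only: nn_integral_gauss_prod DIM_cart DIM_real mult_1_right, measurable)
    also have "\<dots> < \<infinity>"
      using nn_integral_gauss_finite[of "c / 2"] c(1)
      by (simp add: ennreal_mult_less_top power_less_top_ennreal)
    finally show "(\<integral>\<^sup>+y. ennreal (exp (lcomp t i y) * (1 + norm y) ^ m) \<partial>lborel) < \<infinity>" .
  qed (auto intro!: AE_I2)
qed

section \<open>Measurability and integration on the observation space\<close>

lemma obs_measurableI:
  assumes "\<And>z m. (\<lambda>y. f (y, z, m)) \<in> measurable borel N"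
  shows "f \<in> measurable (obs_space :: 'p::finite obs measure) N"
proof -
  have [measurable]: "(\<lambda>y. f (y, z, m)) \<in> measurable borel N" for z m by (rule assms)
  have "(\<lambda>p. f (snd p, fst (fst p), snd (fst p))) \<in> measurable (count_space (UNIV :: (label \<times> bool) set) \<Otimes>\<^sub>M lborel) N"
    by (rule measurable_pair_measure_countable1) auto
  hence "(\<lambda>p. f (snd p, fst (fst p), snd (fst p))) \<circ> (\<lambda>a. (snd a, fst a)) \<in> measurable (lborel \<Otimes>\<^sub>M count_space (UNIV :: (label \<times> bool) set)) N"
    by (intro measurable_comp[where N = "count_space (UNIV :: (label \<times> bool) set) \<Otimes>\<^sub>M lborel"]) measurable
  thus ?thesis by (simp add: o_def pair_measure_count_space)
qed

lemma obs_measurableD: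
  assumes [measurable]: "f \<in> measurable (obs_space :: 'p::finite obs measure) N"
  shows "(\<lambda>y. f (y, z, m)) \<in> measurable borel N"
  by measurable

lemma nn_integral_obs_space:
  fixes f :: "'p::finite obs \<Rightarrow> ennreal"
  assumes [measurable]: "f \<in> borel_measurable obs_space"
  shows "(\<integral>\<^sup>+a. f a \<partial>obs_space) = (\<Sum>z\<in>UNIV. \<Sum>m\<in>UNIV. \<integral>\<^sup>+y. f (y, z, m) \<partial>lborel)"
proof -
  let ?C = "count_space (UNIV :: label set) \<Otimes>\<^sub>M count_space (UNIV :: bool set)"
  have C: "?C = count_space UNIV" by (simp add: pair_measure_count_space)
  interpret C: sigma_finite_measure ?C unfolding C by (rule sigma_finite_measure_count_space_finite) simp
  note [measurable] = obs_measurableD[OF assms]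
  have "(\<integral>\<^sup>+a. f a \<partial>obs_space) = (\<integral>\<^sup>+y. \<integral>\<^sup>+c. f (y, c) \<partial>?C \<partial>lborel)"
    by (rule C.nn_integral_fst[symmetric]) measurable
  also have "\<dots> = (\<integral>\<^sup>+y. (\<Sum>z\<in>UNIV. \<Sum>m\<in>UNIV. f (y, z, m)) \<partial>lborel)"
    unfolding C by (simp add: nn_integral_count_space_finite sum.cartesian_product)
  also have "\<dots> = (\<Sum>z\<in>UNIV. \<Sum>m\<in>UNIV. \<integral>\<^sup>+y. f (y, z, m) \<partial>lborel)"
    by (subst nn_integral_sum, simp)+ simp
  finally show ?thesis .
qed

lemma integral_obs_space:
  fixes f :: "'p::finite obs \<Rightarrow> real"
  assumes [measurable]: "f \<in> borel_measurable obs_space" and i: "\<And>z m. integrable lborel (\<lambda>y. f (y, z, m))"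
  shows "integrable obs_space f" and "(\<integral>a. f a \<partial>obs_space) = (\<Sum>z\<in>UNIV. \<Sum>m\<in>UNIV. \<integral>y. f (y, z, m) \<partial>lborel)"
proof -
  let ?C = "count_space (UNIV :: label set) \<Otimes>\<^sub>M count_space (UNIV :: bool set)"
  have C: "?C = count_space UNIV" by (simp add: pair_measure_count_space)
  interpret C: sigma_finite_measure ?C unfolding C by (rule sigma_finite_measure_count_space_finite) simp
  interpret pair_sigma_finite lborel ?C ..
  show int: "integrable obs_space f"
  proof (rule integrableI_bounded)
    have "(\<integral>\<^sup>+a. ennreal (norm (f a)) \<partial>obs_space) = (\<Sum>z\<in>UNIV. \<Sum>m\<in>UNIV. \<integral>\<^sup>+y. ennreal (norm (f (y, z, m))) \<partial>lborel)"
      by (rule nn_integral_obs_space) measurable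
    also have "\<dots> < \<infinity>"
      using i unfolding integrable_iff_bounded by (simp add: sum_label UNIV_bool)
    finally show "(\<integral>\<^sup>+a. ennreal (norm (f a)) \<partial>obs_space) < \<infinity>" .
  qed measurable
  have "(\<integral>a. f a \<partial>obs_space) = (\<integral>y. \<integral>c. f (y, c) \<partial>?C \<partial>lborel)"
    by (rule integral_fst'[OF int, symmetric])
  also have "\<dots> = (\<integral>y. (\<Sum>z\<in>UNIV. \<Sum>m\<in>UNIV. f (y, z, m)) \<partial>lborel)"
    unfolding C by (simp add: lebesgue_integral_count_space_finite sum.cartesian_product)
  also have "\<dots> = (\<Sum>z\<in>UNIV. \<Sum>m\<in>UNIV. \<integral>y. f (y, z, m) \<partial>lborel)"
    using i by (simp add: Bochner_Integration.integral_sum)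
  finally show "(\<integral>a. f a \<partial>obs_space) = (\<Sum>z\<in>UNIV. \<Sum>m\<in>UNIV. \<integral>y. f (y, z, m) \<partial>lborel)" .
qed

text \<open>The index set of the empirical filter. It is closed under sums and products, and its
  members have moments of all orders under the law, so fourth moment bounds hold for each of their
  averages.\<close>

definition poly_growth :: "('p::finite obs \<Rightarrow> real) set" where
  "poly_growth = {g \<in> borel_measurable obs_space. \<exists>C m. \<forall>a. \<bar>g a\<bar> \<le> C * (1 + norm (fst a)) ^ m}"

lemma poly_growthI:
  assumes "g \<in> borel_measurable obs_space" "\<And>a. \<bar>g a\<bar> \<le> C * (1 + norm (fst a)) ^ m"
  shows "g \<in> poly_growth"
  using assms unfolding poly_growth_def by blast

lemma poly_growth_measurable: "g \<in> poly_growth \<Longrightarrow> g \<in> borel_measurable obs_space"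
  by (simp add: poly_growth_def)

lemma poly_growthE:
  assumes "g \<in> poly_growth"
  obtains C m where "C \<ge> 0" "\<And>a. \<bar>g a\<bar> \<le> C * (1 + norm (fst a)) ^ m"
proof -
  obtain C m where C: "\<And>a. \<bar>g a\<bar> \<le> C * (1 + norm (fst a)) ^ m" using assms unfolding poly_growth_def by blast
  have "\<bar>g a\<bar> \<le> \<bar>C\<bar> * (1 + norm (fst a)) ^ m" for a
    by (rule order_trans[OF C]) (intro mult_right_mono, auto)
  thus thesis by (intro that[of "\<bar>C\<bar>"]) auto
qed

lemma poly_growth_bounded:
  assumes "g \<in> borel_measurable obs_space" "\<And>a. \<bar>g a\<bar> \<le> C"
  shows "g \<in> poly_growth"
  using assms by (intro poly_growthI[where m = 0]) auto

lemma poly_growth_const: "(\<lambda>_. c) \<in> poly_growth"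
  by (rule poly_growth_bounded[of _ "\<bar>c\<bar>"]) auto

lemma poly_growth_mult:
  assumes "f \<in> poly_growth" "g \<in> poly_growth"
  shows "(\<lambda>a. f a * g a) \<in> poly_growth"
proof -
  obtain C m where C: "C \<ge> 0" "\<And>a. \<bar>f a\<bar> \<le> C * (1 + norm (fst a)) ^ m" using poly_growthE[OF assms(1)] by blast
  obtain D k where D: "D \<ge> 0" "\<And>a. \<bar>g a\<bar> \<le> D * (1 + norm (fst a)) ^ k" using poly_growthE[OF assms(2)] by blast
  show ?thesis
  proof (rule poly_growthI)
    fix a
    have "\<bar>f a\<bar> * \<bar>g a\<bar> \<le> (C * (1 + norm (fst a)) ^ m) * (D * (1 + norm (fst a)) ^ k)"
      by (intro mult_mono C D) (use C(1) in auto)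
    thus "\<bar>f a * g a\<bar> \<le> (C * D) * (1 + norm (fst a)) ^ (m + k)"
      by (simp add: abs_mult power_add mult_ac)
  qed (intro borel_measurable_times poly_growth_measurable assms)
qed

lemma poly_growth_add:
  assumes "f \<in> poly_growth" "g \<in> poly_growth"
  shows "(\<lambda>a. f a + g a) \<in> poly_growth"
proof -
  obtain C m where C: "C \<ge> 0" "\<And>a. \<bar>f a\<bar> \<le> C * (1 + norm (fst a)) ^ m" using poly_growthE[OF assms(1)] by blast
  obtain D k where D: "D \<ge> 0" "\<And>a. \<bar>g a\<bar> \<le> D * (1 + norm (fst a)) ^ k" using poly_growthE[OF assms(2)] by blast
  show ?thesis
  proof (rule poly_growthI)
    fix a
    have "\<bar>f a + g a\<bar> \<le> C * (1 + norm (fst a)) ^ m + D * (1 + norm (fst a)) ^ k"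
      using C(2)[of a] D(2)[of a] by linarith
    also have "\<dots> \<le> C * (1 + norm (fst a)) ^ (m + k) + D * (1 + norm (fst a)) ^ (m + k)"
      by (intro add_mono mult_left_mono power_increasing C D) auto
    finally show "\<bar>f a + g a\<bar> \<le> (C + D) * (1 + norm (fst a)) ^ (m + k)" by (simp add: distrib_right)
  qed (intro borel_measurable_add poly_growth_measurable assms)
qed

lemma poly_growth_cmult: "f \<in> poly_growth \<Longrightarrow> (\<lambda>a. c * f a) \<in> poly_growth"
  by (rule poly_growth_mult[OF poly_growth_const])

lemma poly_growth_diff: "f \<in> poly_growth \<Longrightarrow> g \<in> poly_growth \<Longrightarrow> (\<lambda>a. f a - g a) \<in> poly_growth"
  using poly_growth_add[of f "\<lambda>a. (-1) * g a"] poly_growth_cmult[of g "-1"] by simp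

lemma poly_growth_sum: "(\<And>i. i \<in> I \<Longrightarrow> f i \<in> poly_growth) \<Longrightarrow> (\<lambda>a. \<Sum>i\<in>I. f i a) \<in> poly_growth"
  by (induction I rule: infinite_finite_induct) (auto intro: poly_growth_const poly_growth_add)

lemma poly_growth_power: "f \<in> poly_growth \<Longrightarrow> (\<lambda>a. f a ^ k) \<in> poly_growth"
  by (induction k) (auto intro: poly_growth_const poly_growth_mult)

lemma poly_growth_norm: "(\<lambda>a. norm (fst a)) \<in> poly_growth"
proof (rule poly_growthI[where C = 1 and m = 1])
  show "(\<lambda>a::'a obs. norm (fst a)) \<in> borel_measurable obs_space" by (rule obs_measurableI) simp
qed simp

lemma poly_growth_component: "(\<lambda>a. fst a $ k) \<in> poly_growth"
proof (rule poly_growthI[where C = 1 and m = 1])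
  show "(\<lambda>a::'a obs. fst a $ k) \<in> borel_measurable obs_space"
    by (rule obs_measurableI) simp
  show "\<bar>fst a $ k\<bar> \<le> 1 * (1 + norm (fst a)) ^ 1" for a :: "'a obs"
    using component_le_norm_cart[of "fst a" k] by simp
qed

lemma poly_growth_inner: "(\<lambda>a. v \<bullet> fst a) \<in> poly_growth"
  unfolding inner_vec_def by (auto intro!: poly_growth_sum poly_growth_cmult poly_growth_component)

lemma poly_growth_cases:
  assumes "f \<in> borel_measurable obs_space" "g \<in> poly_growth" "\<And>a. \<bar>f a\<bar> \<le> \<bar>g a\<bar>"
  shows "f \<in> poly_growth"
  using assms(2) assms(1,3) by (elim poly_growthE) (blast intro: poly_growthI order_trans)

lemma lab_poly_growth: "lab i \<in> poly_growth"
  by (rule poly_growth_bounded[of _ 1], rule obs_measurableI) (auto simp: lab_def split: prod.splits)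

lemma resp_measurable: "resp b \<in> borel_measurable obs_space"
proof (rule obs_measurableI)
  show "(\<lambda>y. resp b (y, z, m)) \<in> borel_measurable borel" for z m
    by (cases m) (auto simp: resp_def sigmoid_def discr_def)
qed

lemma resp_poly_growth: "resp b \<in> poly_growth"
proof (rule poly_growth_bounded[of _ 1, OF resp_measurable])
  show "\<bar>resp b a\<bar> \<le> 1" for a
    using cwt_resp_nonneg[of b Class1 a] cwt_resp_nonneg[of b Class2 a] by simp
qed

section \<open>Dependence of the log-likelihood on the parameter\<close>

definition lcoef0 :: "'p::finite cparam \<Rightarrow> label \<Rightarrow> real" where
  "lcoef0 t i = ln (cprior t i) + ln (det (cprec t)) / 2 - cmean t i \<bullet> (cprec t *v cmean t i) / 2"

lemma lcomp_polynomial: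
  fixes y :: "real^'p::finite"
  assumes "t \<in> cspace"
  shows "lcomp t i y = lcoef0 t i + (cprec t *v cmean t i) \<bullet> y - y \<bullet> (cprec t *v y) / 2 - real CARD('p) * ln (2 * pi) / 2"
proof -
  have sym: "transpose (cprec t) = cprec t" using assms by (simp add: cspace_def pos_def_matrix_def)
  have "cmean t i \<bullet> (cprec t *v y) = (cprec t *v cmean t i) \<bullet> y"
    by (rule symmetric_inner[OF sym, symmetric])
  thus ?thesis
    by (simp add: lcomp_def lcoef0_def matrix_vector_mult_diff_distrib inner_diff_left inner_diff_right
        inner_commute[of y "cprec t *v cmean t i"] field_simps)
qed

text \<open>Compares the coefficients of the class log densities as polynomials in \<open>y\<close>.
  It vanishes for equal parameters and controls differences of log-likelihoods up to the integrable
  envelope (1 + |y|)^2.\<close>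

definition cparam_diff :: "'p::finite cparam \<Rightarrow> 'p cparam \<Rightarrow> real" where
  "cparam_diff t s = (\<Sum>i\<in>UNIV. \<bar>lcoef0 t i - lcoef0 s i\<bar> + norm (cprec t *v cmean t i - cprec s *v cmean s i))
     + (\<Sum>k\<in>UNIV. \<Sum>l\<in>UNIV. \<bar>cprec t $ k $ l - cprec s $ k $ l\<bar>)"

lemma abs_quadratic_le:
  fixes A :: "real^'n^'n"
  shows "\<bar>y \<bullet> (A *v y)\<bar> \<le> (\<Sum>k\<in>UNIV. \<Sum>l\<in>UNIV. \<bar>A $ k $ l\<bar>) * (norm y)\<^sup>2"
proof -
  have "\<bar>y \<bullet> (A *v y)\<bar> = \<bar>\<Sum>k\<in>UNIV. \<Sum>l\<in>UNIV. A $ k $ l * (y $ k * y $ l)\<bar>"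
    by (simp add: inner_vec_def matrix_vector_mult_def sum_distrib_left mult_ac)
  also have "\<dots> \<le> (\<Sum>k\<in>UNIV. \<Sum>l\<in>UNIV. \<bar>A $ k $ l * (y $ k * y $ l)\<bar>)"
    by (rule order_trans[OF sum_abs]) (intro sum_mono sum_abs)
  also have "\<dots> \<le> (\<Sum>k\<in>UNIV. \<Sum>l\<in>UNIV. \<bar>A $ k $ l\<bar> * (norm y)\<^sup>2)"
    unfolding abs_mult power2_eq_square
    by (intro sum_mono mult_left_mono mult_mono component_le_norm_cart) auto
  finally show ?thesis by (simp add: sum_distrib_right)
qed

lemma lcomp_lipschitz:
  fixes y :: "real^'p::finite"
  assumes "t \<in> cspace" "s \<in> cspace"
  shows "\<bar>lcomp t i y - lcomp s i y\<bar> \<le> cparam_diff t s * (1 + norm y)\<^sup>2"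
proof -
  let ?r = "(1 + norm y)\<^sup>2"
  have r: "1 \<le> ?r" "norm y \<le> ?r" "(norm y)\<^sup>2 \<le> ?r"
    using norm_ge_zero[of y] zero_le_power2[of "norm y"] unfolding power2_sum by simp_all
  define a b where "a = \<bar>lcoef0 t i - lcoef0 s i\<bar>" and "b = norm (cprec t *v cmean t i - cprec s *v cmean s i)"
  define d where "d = (\<Sum>k\<in>UNIV. \<Sum>l\<in>UNIV. \<bar>cprec t $ k $ l - cprec s $ k $ l\<bar>)"
  have ab: "a + b \<le> (\<Sum>i\<in>UNIV. \<bar>lcoef0 t i - lcoef0 s i\<bar> + norm (cprec t *v cmean t i - cprec s *v cmean s i))"
    unfolding a_def b_def by (rule member_le_sum) auto
  have nn: "a \<ge> 0" "b \<ge> 0" "d \<ge> 0" by (auto simp: a_def b_def d_def sum_nonneg)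
  have "lcomp t i y - lcomp s i y = (lcoef0 t i - lcoef0 s i) + (cprec t *v cmean t i - cprec s *v cmean s i) \<bullet> y
     - y \<bullet> ((cprec t - cprec s) *v y) / 2"
    by (simp add: lcomp_polynomial assms matrix_vector_mult_diff_rdistrib inner_diff_left inner_diff_right diff_divide_distrib)
  hence "\<bar>lcomp t i y - lcomp s i y\<bar> = \<bar>(lcoef0 t i - lcoef0 s i) + (cprec t *v cmean t i - cprec s *v cmean s i) \<bullet> y
     - y \<bullet> ((cprec t - cprec s) *v y) / 2\<bar>"
    by (rule arg_cong)
  also have "\<dots> \<le> a + b * norm y + \<bar>y \<bullet> ((cprec t - cprec s) *v y)\<bar> / 2"
    using Cauchy_Schwarz_ineq2[of "cprec t *v cmean t i - cprec s *v cmean s i" y] unfolding a_def b_def by linarith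
  also have "\<bar>y \<bullet> ((cprec t - cprec s) *v y)\<bar> / 2 \<le> d * (norm y)\<^sup>2"
    using abs_quadratic_le[of y "cprec t - cprec s"] nn(3) unfolding d_def by simp
  also have "a + b * norm y + d * (norm y)\<^sup>2 \<le> a * ?r + b * ?r + d * ?r"
    using mult_left_mono[OF r(1) nn(1)] mult_left_mono[OF r(2) nn(2)] mult_left_mono[OF r(3) nn(3)] by simp
  also have "\<dots> = (a + b + d) * ?r" by (simp add: algebra_simps)
  also have "\<dots> \<le> cparam_diff t s * ?r"
    using ab unfolding cparam_diff_def d_def by (intro mult_right_mono) auto
  finally show ?thesis by simp
qed

text \<open>The function ln (exp a + exp b) is monotone in both arguments and commutes with adding a
  constant to both.\<close>

lemma ln_sum_exp_lipschitz:
  fixes a b c d :: real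
  assumes "\<bar>a - c\<bar> \<le> e" "\<bar>b - d\<bar> \<le> e"
  shows "\<bar>ln (exp a + exp b) - ln (exp c + exp d)\<bar> \<le> e"
proof -
  have *: "ln (exp a + exp b) \<le> ln (exp c + exp d) + e" if "a \<le> c + e" "b \<le> d + e" for a b c d :: real
  proof -
    have "exp a + exp b \<le> exp (c + e) + exp (d + e)" using that by (intro add_mono) auto
    also have "\<dots> = (exp c + exp d) * exp e" by (simp add: exp_add distrib_right)
    finally have "ln (exp a + exp b) \<le> ln ((exp c + exp d) * exp e)"
      by (subst ln_le_cancel_iff) (simp_all add: add_pos_pos)
    also have "\<dots> = ln (exp c + exp d) + e"
      by (subst ln_mult_pos) (auto intro: add_pos_pos)
    finally show ?thesis .
  qed
  show ?thesis using *[of a c b d] *[of c a d b] assms by linarith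
qed

lemma lobs_lipschitz:
  fixes t s :: "'p::finite cparam"
  assumes "t \<in> cspace" "s \<in> cspace"
  shows "\<bar>lobs t a - lobs s a\<bar> \<le> cparam_diff t s * (1 + norm (fst a))\<^sup>2"
proof -
  obtain y z m where a: "a = (y, z, m)" by (cases a) auto
  note L = lcomp_lipschitz[OF assms, of _ y]
  show ?thesis
    using ln_sum_exp_lipschitz[OF L[of Class1] L[of Class2]] L[of z] by (cases m) (simp_all add: a lobs_def)
qed

lemma lobs_measurable: "lobs t \<in> borel_measurable obs_space"
proof (rule obs_measurableI)
  show "(\<lambda>y. lobs t (y, z, m)) \<in> borel_measurable borel" for z m
    by (cases m) (auto simp: lobs_def)
qed

lemma lobs_poly_growth:
  fixes t :: "'p::finite cparam"
  assumes t: "t \<in> cspace"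
  shows "lobs t \<in> poly_growth"
proof -
  define B where "B y = (\<Sum>i\<in>UNIV. \<bar>lcoef0 t i\<bar> + norm (cprec t *v cmean t i) * norm y)
     + (\<Sum>k\<in>UNIV. \<Sum>l\<in>UNIV. \<bar>cprec t $ k $ l\<bar>) * (norm y)\<^sup>2 + real CARD('p) * ln (2 * pi)" for y :: "real^'p"
  have bl: "\<bar>lcomp t i y\<bar> \<le> B y" for i y
  proof -
    have "\<bar>lcoef0 t i\<bar> + norm (cprec t *v cmean t i) * norm y \<le> (\<Sum>i\<in>UNIV. \<bar>lcoef0 t i\<bar> + norm (cprec t *v cmean t i) * norm y)"
      by (rule member_le_sum[of i UNIV "\<lambda>i. \<bar>lcoef0 t i\<bar> + norm (cprec t *v cmean t i) * norm y"]) auto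
    moreover have "0 \<le> real CARD('p) * ln (2 * pi)" using pi_gt3 by (simp add: ln_ge_zero)
    moreover have "\<bar>y \<bullet> (cprec t *v y)\<bar> \<ge> 0" by simp
    ultimately show ?thesis
      using Cauchy_Schwarz_ineq2[of "cprec t *v cmean t i" y] abs_quadratic_le[of y "cprec t"]
      unfolding lcomp_polynomial[OF t] B_def by linarith
  qed
  have "(\<lambda>a. ln 2 + B (fst a)) \<in> poly_growth"
    unfolding B_def
    by (intro poly_growth_add poly_growth_const poly_growth_sum poly_growth_cmult poly_growth_norm poly_growth_power)
  thus ?thesis
  proof (rule poly_growth_cases[OF lobs_measurable])
    fix a :: "'p obs"
    obtain y z m where a: "a = (y, z, m)" by (cases a) auto
    have "\<bar>ln (exp (lcomp t Class1 y) + exp (lcomp t Class2 y)) - ln (exp 0 + exp 0)\<bar> \<le> B y"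
      by (rule ln_sum_exp_lipschitz) (use bl in auto)
    moreover have "\<bar>u\<bar> \<le> ln 2 + B y" if "\<bar>u - ln 2\<bar> \<le> B y \<or> \<bar>u\<bar> \<le> B y" for u
      using that ln_gt_zero[of "2::real"] by linarith
    ultimately have "\<bar>lobs t a\<bar> \<le> ln 2 + B y"
      using bl[of z y] by (cases m) (simp_all add: a lobs_def)
    thus "\<bar>lobs t a\<bar> \<le> \<bar>ln 2 + B (fst a)\<bar>" by (simp add: a)
  qed
qed

lemma continuous_on_cparam_diff:
  fixes t :: "'p::finite cparam"
  shows "continuous_on cspace (cparam_diff t)"
proof -
  have d: "\<forall>t\<in>cspace. det (cprec t :: real^'p^'p) \<noteq> 0"
  proof
    fix t :: "'p cparam" assume "t \<in> cspace"
    hence "pos_def_matrix (cprec t)" unfolding cspace_def by blast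
    from det_pos_def_matrix[OF this] show "det (cprec t) \<noteq> 0" by simp
  qed
  have c: "\<forall>t\<in>cspace. cprior (t :: 'p cparam) i \<noteq> 0" for i
  proof
    fix t :: "'p cparam" assume "t \<in> cspace"
    from cprior_pos[OF this, of i] show "cprior t i \<noteq> 0" by simp
  qed
  have m: "continuous_on cspace (\<lambda>t :: 'p cparam. cprec t *v cmean t i)" for i
    by (intro continuous_on_matrix_vector_mult continuous_on_cprec continuous_on_cmean)
  have "continuous_on cspace (\<lambda>t :: 'p cparam. lcoef0 t i)" for i
    unfolding lcoef0_def
    by (intro continuous_on_diff continuous_on_add continuous_on_divide continuous_on_const continuous_on_inner
       m continuous_on_cmean continuous_on_ln[OF continuous_on_cprior c]
       continuous_on_ln[OF continuous_on_det[OF continuous_on_cprec] d]) simp_all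
  moreover have "continuous_on cspace (\<lambda>t :: 'p cparam. cprec t $ k $ l)" for k l
    by (intro continuous_on_component continuous_on_cprec)
  ultimately show ?thesis
    unfolding cparam_diff_def[abs_def]
    by (intro continuous_on_add continuous_on_sum continuous_on_rabs continuous_on_norm continuous_on_diff
        continuous_on_const m) simp_all
qed

lemma cparam_diff_self: "cparam_diff t t = 0"
  by (simp add: cparam_diff_def)

lemma continuous_on_cbeta: "continuous_on cspace (cbeta :: 'p::finite cparam \<Rightarrow> _)"
proof -
  have c: "\<forall>t\<in>cspace. cprior (t :: 'p cparam) Class1 / cprior t Class2 \<noteq> 0"
  proof
    fix t :: "'p cparam" assume t: "t \<in> cspace"
    show "cprior t Class1 / cprior t Class2 \<noteq> 0"
      using cprior_pos[OF t, of Class1] cprior_pos[OF t, of Class2] by simp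
  qed
  have c2: "\<forall>t\<in>cspace. cprior (t :: 'p cparam) Class2 \<noteq> 0"
  proof
    fix t :: "'p cparam" assume t: "t \<in> cspace"
    show "cprior t Class2 \<noteq> 0" using cprior_pos[OF t, of Class2] by simp
  qed
  have m: "continuous_on cspace (\<lambda>t :: 'p cparam. cprec t *v (cmean t Class1 - cmean t Class2))"
    by (intro continuous_on_matrix_vector_mult continuous_on_cprec continuous_on_diff continuous_on_cmean)
  show ?thesis
    unfolding cbeta_def[abs_def] Let_def
    by (intro continuous_on_Pair continuous_on_diff continuous_on_mult continuous_on_const continuous_on_inner
      continuous_on_add continuous_on_cmean m
      continuous_on_ln[OF continuous_on_divide[OF continuous_on_cprior continuous_on_cprior c2] c])
qed

section \<open>Consistency\<close>

lemma AE_lborel_continuous_zero: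
  fixes f :: "'a::euclidean_space \<Rightarrow> real"
  assumes "continuous_on UNIV f" and ae: "AE y in lborel. f y = 0"
  shows "f y = 0"
proof -
  have "closed {y. f y = 0}" using assms(1) by (intro closed_Collect_eq continuous_intros)
  moreover have "AE y in lebesgue. y \<in> {y. f y = 0}"
    using AE_completion[OF ae] by simp
  ultimately show ?thesis using mem_closed_if_AE_lebesgue by blast
qed

text \<open>An arbitrary missing probability \<open>q\<close> covers the logistic model and, with
  \<open>q = 0\<close>, the completely classified sample. The strict bound \<open>q y < 1\<close>
  keeps labelled observations possible at every feature value.\<close>

locale missing_model =
  fixes t0 :: "'p::finite cparam" and q :: "real^'p \<Rightarrow> real"
  assumes t0: "t0 \<in> cspace" and q_measurable [measurable]: "q \<in> borel_measurable borel"
    and q_nonneg: "0 \<le> q y" and q_less_1: "q y < 1"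
begin

definition dens :: "'p obs \<Rightarrow> real" where
  "dens = (\<lambda>(y, z, m). exp (lcomp t0 z y) * (if m then q y else 1 - q y))"

definition law :: "'p obs measure" where
  "law = density obs_space (\<lambda>a. ennreal (dens a))"

lemma dens_nonneg: "dens a \<ge> 0"
  using q_nonneg q_less_1[THEN less_imp_le] by (cases a) (simp add: dens_def)

lemma dens_measurable [measurable]: "dens \<in> borel_measurable obs_space"
proof (rule obs_measurableI)
  show "(\<lambda>y. dens (y, z, m)) \<in> borel_measurable borel" for z m
    by (cases m) (auto simp: dens_def)
qed

lemma sets_law [measurable_cong]: "sets law = sets obs_space"
  by (simp add: law_def)

lemma borel_measurable_law: "borel_measurable law = borel_measurable obs_space"
  by (rule measurable_cong_sets[OF sets_law refl])

lemma prob_space_law: "prob_space law"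
proof
  have "emeasure law (space law) = (\<integral>\<^sup>+a. ennreal (dens a) \<partial>obs_space)"
    unfolding law_def space_density by (subst emeasure_density[OF _ sets.top]) (auto intro!: nn_integral_cong)
  also have "\<dots> = (\<Sum>z\<in>UNIV. \<Sum>m\<in>UNIV. \<integral>\<^sup>+y. ennreal (dens (y, z, m)) \<partial>lborel)"
    by (rule nn_integral_obs_space) simp
  also have "\<dots> = (\<Sum>z\<in>UNIV. \<integral>\<^sup>+y. (\<Sum>m\<in>UNIV. ennreal (dens (y, z, m))) \<partial>lborel)"
    using obs_measurableD[OF dens_measurable] by (subst nn_integral_sum) auto
  also have "\<dots> = (\<Sum>z\<in>UNIV. \<integral>\<^sup>+y. ennreal (exp (lcomp t0 z y)) \<partial>lborel)"
  proof (intro sum.cong refl nn_integral_cong)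
    fix z y
    have "(\<Sum>m\<in>UNIV. ennreal (dens (y, z, m))) = ennreal (dens (y, z, False) + dens (y, z, True))"
      by (simp add: UNIV_bool dens_nonneg)
    thus "(\<Sum>m\<in>UNIV. ennreal (dens (y, z, m))) = ennreal (exp (lcomp t0 z y))"
      by (simp add: dens_def algebra_simps)
  qed
  also have "\<dots> = (\<Sum>z\<in>UNIV. ennreal (cprior t0 z))" by (simp only: nn_integral_exp_lcomp[OF t0])
  also have "\<dots> = 1"
    using cprior_pos[OF t0, of Class1] cprior_pos[OF t0, of Class2]
    by (simp add: sum_label ennreal_plus[symmetric] del: ennreal_plus)
  finally show "emeasure law (space law) = 1" .
qed

lemma integral_law:
  fixes g :: "'p obs \<Rightarrow> real"
  assumes g: "g \<in> poly_growth"
  shows "integrable law g"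
    and "(\<integral>a. g a \<partial>law) = (\<Sum>z\<in>UNIV. \<Sum>m\<in>UNIV. \<integral>y. dens (y, z, m) * g (y, z, m) \<partial>lborel)"
    and "integrable lborel (\<lambda>y. dens (y, z, m) * g (y, z, m))"
proof -
  have gm [measurable]: "g \<in> borel_measurable obs_space" by (rule poly_growth_measurable[OF g])
  obtain C k where C: "C \<ge> 0" "\<And>a. \<bar>g a\<bar> \<le> C * (1 + norm (fst a)) ^ k" using poly_growthE[OF g] by blast
  have dg: "(\<lambda>a. dens a * g a) \<in> borel_measurable obs_space" by measurable
  show i: "integrable lborel (\<lambda>y. dens (y, z, m) * g (y, z, m))" for z m
  proof (rule Bochner_Integration.integrable_bound)
    show "integrable lborel (\<lambda>y. C * (exp (lcomp t0 z y) * (1 + norm y) ^ k))"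
      by (intro integrable_mult_right integrable_exp_lcomp_moment[OF t0])
    show "(\<lambda>y. dens (y, z, m) * g (y, z, m)) \<in> borel_measurable lborel"
      using obs_measurableD[OF dg, of z m] by simp
    show "AE y in lborel. norm (dens (y, z, m) * g (y, z, m)) \<le> norm (C * (exp (lcomp t0 z y) * (1 + norm y) ^ k))"
    proof (rule AE_I2)
      fix y
      have "dens (y, z, m) \<le> exp (lcomp t0 z y)"
        using q_nonneg[of y] q_less_1[of y] by (simp add: dens_def)
      hence "dens (y, z, m) * \<bar>g (y, z, m)\<bar> \<le> exp (lcomp t0 z y) * (C * (1 + norm y) ^ k)"
        using C(2)[of "(y, z, m)"] dens_nonneg by (intro mult_mono) auto
      thus "norm (dens (y, z, m) * g (y, z, m)) \<le> norm (C * (exp (lcomp t0 z y) * (1 + norm y) ^ k))"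
        using C(1) dens_nonneg[of "(y, z, m)"] by (simp add: abs_mult mult_ac)
    qed
  qed
  note I = integral_obs_space[OF dg i]
  show "integrable law g"
    unfolding law_def using I(1) dens_nonneg by (subst integrable_density) auto
  have "(\<integral>a. g a \<partial>law) = (\<integral>a. dens a * g a \<partial>obs_space)"
    unfolding law_def using dens_nonneg by (subst integral_density) auto
  with I(2) show "(\<integral>a. g a \<partial>law) = (\<Sum>z\<in>UNIV. \<Sum>m\<in>UNIV. \<integral>y. dens (y, z, m) * g (y, z, m) \<partial>lborel)"
    by simp
qed

abbreviation Ex :: "('p obs \<Rightarrow> real) \<Rightarrow> real" where
  "Ex g \<equiv> \<integral>a. g a \<partial>law"

text \<open>Labelled observations of class \<open>z\<close> have positive density at every feature
  value, so what holds almost surely on them holds Lebesgue almost everywhere and, by continuity,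
  everywhere. This provides identifiability.\<close>

lemma law_null_labelled:
  fixes f :: "real^'p \<Rightarrow> real"
  assumes "AE a in law. \<not> snd (snd a) \<longrightarrow> fst (snd a) = z \<longrightarrow> f (fst a) = 0" and cont: "continuous_on UNIV f"
  shows "f y = 0"
proof (rule AE_lborel_continuous_zero[OF cont])
  have fm [measurable]: "f \<in> borel_measurable borel" by (rule borel_measurable_continuous_onI[OF cont])
  define N where "N = {a :: 'p obs. \<not> snd (snd a) \<and> fst (snd a) = z \<and> f (fst a) \<noteq> 0}"
  have Nm: "(\<lambda>a. indicator N a :: ennreal) \<in> borel_measurable obs_space"
    by (rule obs_measurableI) (auto simp: N_def indicator_def)
  have "AE a in obs_space. dens a > 0 \<longrightarrow> a \<notin> N"
    using assms(1) unfolding law_def N_def by (subst (asm) AE_density) auto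
  hence "AE a in obs_space. ennreal (dens a) * indicator N a = 0"
    by eventually_elim (auto simp: ennreal_eq_0_iff not_less indicator_def)
  hence "(\<integral>\<^sup>+a. ennreal (dens a) * indicator N a \<partial>obs_space) = 0"
    using Nm by (subst nn_integral_0_iff_AE) auto
  hence "(\<Sum>w\<in>UNIV. \<Sum>m\<in>UNIV. \<integral>\<^sup>+y. ennreal (dens (y, w, m)) * indicator N (y, w, m) \<partial>lborel) = 0"
    using Nm by (subst (asm) nn_integral_obs_space) auto
  hence "(\<integral>\<^sup>+y. ennreal (dens (y, z, False)) * indicator N (y, z, False) \<partial>lborel) = 0"
    by (cases z) (auto simp: sum_label UNIV_bool)
  hence "AE y in lborel. ennreal (dens (y, z, False)) * indicator N (y, z, False) = 0"
    using obs_measurableD[OF Nm] obs_measurableD[OF dens_measurable]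
    by (subst (asm) nn_integral_0_iff_AE) auto
  thus "AE y in lborel. f y = 0"
  proof eventually_elim
    case (elim y)
    have "dens (y, z, False) > 0" using q_less_1[of y] by (simp add: dens_def)
    with elim show "f y = 0" by (auto simp: N_def indicator_def ennreal_eq_0_iff split: if_splits)
  qed
qed

lemma nn_integral_law:
  assumes [measurable]: "h \<in> borel_measurable obs_space" and h: "\<And>a. h a \<ge> 0"
  shows "(\<integral>\<^sup>+a. ennreal (h a) \<partial>law) = (\<Sum>z\<in>UNIV. \<integral>\<^sup>+y. ennreal (exp (lcomp t0 z y) * (q y * h (y, z, True) + (1 - q y) * h (y, z, False))) \<partial>lborel)"
proof -
  have [measurable]: "(\<lambda>y. h (y, z, m)) \<in> borel_measurable borel" "(\<lambda>y. dens (y, z, m)) \<in> borel_measurable borel" for z m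
    by (rule obs_measurableD[OF assms(1)], rule obs_measurableD[OF dens_measurable])
  have "(\<integral>\<^sup>+a. ennreal (h a) \<partial>law) = (\<integral>\<^sup>+a. ennreal (dens a * h a) \<partial>obs_space)"
    unfolding law_def using h dens_nonneg by (subst nn_integral_density) (auto simp: ennreal_mult)
  also have "\<dots> = (\<Sum>z\<in>UNIV. \<Sum>m\<in>UNIV. \<integral>\<^sup>+y. ennreal (dens (y, z, m) * h (y, z, m)) \<partial>lborel)"
    by (rule nn_integral_obs_space) measurable
  also have "\<dots> = (\<Sum>z\<in>UNIV. \<integral>\<^sup>+y. (\<Sum>m\<in>UNIV. ennreal (dens (y, z, m) * h (y, z, m))) \<partial>lborel)"
    by (subst nn_integral_sum) auto
  also have "\<dots> = (\<Sum>z\<in>UNIV. \<integral>\<^sup>+y. ennreal (exp (lcomp t0 z y) * (q y * h (y, z, True) + (1 - q y) * h (y, z, False))) \<partial>lborel)"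
  proof (intro sum.cong refl nn_integral_cong)
    fix z y
    have "(\<Sum>m\<in>UNIV. ennreal (dens (y, z, m) * h (y, z, m))) = ennreal (dens (y, z, False) * h (y, z, False) + dens (y, z, True) * h (y, z, True))"
      using h dens_nonneg by (simp add: UNIV_bool)
    thus "(\<Sum>m\<in>UNIV. ennreal (dens (y, z, m) * h (y, z, m))) = ennreal (exp (lcomp t0 z y) * (q y * h (y, z, True) + (1 - q y) * h (y, z, False)))"
      by (simp add: dens_def algebra_simps)
  qed
  finally show ?thesis .
qed

text \<open>The missingness factor is common to both parameters and cancels, so the ratio of the
  ignoring likelihoods is a ratio of probability densities. At a feature value unlabelled
  observations contribute \<open>q\<close> times, labelled ones \<open>1 - q\<close> times the
  mixture density of \<open>t\<close>.\<close>

lemma lik_ratio_integral: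
  assumes t: "t \<in> cspace"
  shows "(\<integral>\<^sup>+a. ennreal (exp (lobs t a - lobs t0 a)) \<partial>law) = 1"
proof -
  have lm [measurable]: "(\<lambda>a. exp (lobs t a - lobs t0 a)) \<in> borel_measurable obs_space"
    using lobs_measurable[of t] lobs_measurable[of t0] by measurable
  define Ar Br where "Ar y = exp (lcomp t Class1 y) + exp (lcomp t Class2 y)"
    and "Br y = exp (lcomp t0 Class1 y) + exp (lcomp t0 Class2 y)" for y
  have pos: "Ar y > 0" "Br y > 0" for y by (auto simp: Ar_def Br_def intro: add_pos_pos)
  have [measurable]: "Ar \<in> borel_measurable borel" "Br \<in> borel_measurable borel"
    unfolding Ar_def[abs_def] Br_def[abs_def] by measurable
  have T: "exp (lobs t (y, z, True) - lobs t0 (y, z, True)) = Ar y / Br y" for y z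
    using pos[of y] by (simp add: lobs_def Ar_def Br_def exp_diff)
  have F: "exp (lobs t (y, z, False) - lobs t0 (y, z, False)) = exp (lcomp t z y) / exp (lcomp t0 z y)" for y z
    by (simp add: lobs_def exp_diff)
  have q01: "0 \<le> q y" "0 \<le> 1 - q y" for y using q_nonneg[of y] q_less_1[of y] by auto
  have "(\<integral>\<^sup>+a. ennreal (exp (lobs t a - lobs t0 a)) \<partial>law) = (\<Sum>z\<in>UNIV. \<integral>\<^sup>+y. ennreal (exp (lcomp t0 z y) *
      (q y * exp (lobs t (y, z, True) - lobs t0 (y, z, True)) + (1 - q y) * exp (lobs t (y, z, False) - lobs t0 (y, z, False)))) \<partial>lborel)"
    by (rule nn_integral_law[OF lm]) simp
  also have "\<dots> = (\<Sum>z\<in>UNIV. \<integral>\<^sup>+y. ennreal (exp (lcomp t0 z y) *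
      (q y * (Ar y / Br y) + (1 - q y) * (exp (lcomp t z y) / exp (lcomp t0 z y)))) \<partial>lborel)"
    unfolding T F ..
  also have "\<dots> = (\<integral>\<^sup>+y. (\<Sum>z\<in>UNIV. ennreal (exp (lcomp t0 z y) *
      (q y * (Ar y / Br y) + (1 - q y) * (exp (lcomp t z y) / exp (lcomp t0 z y))))) \<partial>lborel)"
    by (rule nn_integral_sum[symmetric]) measurable
  also have "\<dots> = (\<integral>\<^sup>+y. (\<Sum>z\<in>UNIV. ennreal (exp (lcomp t z y))) \<partial>lborel)"
  proof (rule nn_integral_cong)
    fix y
    have nn: "0 \<le> exp (lcomp t0 z y) * (q y * (Ar y / Br y) + (1 - q y) * (exp (lcomp t z y) / exp (lcomp t0 z y)))" for z
      using q01[of y] pos[of y] by (intro mult_nonneg_nonneg add_nonneg_nonneg divide_nonneg_nonneg) auto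
    have e: "exp (lcomp t0 z y) * (q y * (Ar y / Br y) + (1 - q y) * (exp (lcomp t z y) / exp (lcomp t0 z y)))
       = q y * (Ar y / Br y) * exp (lcomp t0 z y) + (1 - q y) * exp (lcomp t z y)" for z
    proof -
      have "E * (a + r * (F / E)) = a * E + r * F" if "E \<noteq> 0" for a r E F :: real
        using that by (simp add: field_simps)
      thus ?thesis by simp
    qed
    have "(\<Sum>z\<in>UNIV. exp (lcomp t0 z y) * (q y * (Ar y / Br y) + (1 - q y) * (exp (lcomp t z y) / exp (lcomp t0 z y))))
       = q y * (Ar y / Br y) * Br y + (1 - q y) * Ar y"
    proof -
      define k where "k = q y * (Ar y / Br y)"
      show ?thesis unfolding e unfolding sum_label k_def[symmetric] by (simp add: Ar_def Br_def algebra_simps)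
    qed
    also have "\<dots> = Ar y" using pos(2)[of y] by (simp add: algebra_simps)
    finally have "ennreal (\<Sum>z\<in>UNIV. exp (lcomp t0 z y) *
      (q y * (Ar y / Br y) + (1 - q y) * (exp (lcomp t z y) / exp (lcomp t0 z y)))) = ennreal (Ar y)"
      by (rule arg_cong)
    also have "\<dots> = (\<Sum>z\<in>UNIV. ennreal (exp (lcomp t z y)))" by (simp add: Ar_def sum_label)
    finally show "(\<Sum>z\<in>UNIV. ennreal (exp (lcomp t0 z y) *
      (q y * (Ar y / Br y) + (1 - q y) * (exp (lcomp t z y) / exp (lcomp t0 z y))))) = (\<Sum>z\<in>UNIV. ennreal (exp (lcomp t z y)))"
      unfolding sum_ennreal[OF nn] .
  qed
  also have "\<dots> = (\<Sum>z\<in>UNIV. \<integral>\<^sup>+y. ennreal (exp (lcomp t z y)) \<partial>lborel)"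
    by (rule nn_integral_sum) measurable
  also have "\<dots> = (\<Sum>z\<in>UNIV. ennreal (cprior t z))" by (simp only: nn_integral_exp_lcomp[OF t])
  also have "\<dots> = 1"
    using cprior_pos[OF t, of Class1] cprior_pos[OF t, of Class2]
    by (simp add: sum_label ennreal_plus[symmetric] del: ennreal_plus)
  finally show ?thesis .
qed

lemma discr_inj:
  assumes "\<And>y. discr b y = discr b' y"
  shows "b = (b' :: real \<times> (real^'p))"
proof -
  have "fst b = fst b'" using assms[of 0] by (simp add: discr_def)
  moreover have "snd b \<bullet> y = snd b' \<bullet> y" for y using assms[of y] \<open>fst b = fst b'\<close> by (simp add: discr_def)
  hence "snd b = snd b'" by (intro vector_eq_rdot[THEN iffD1]) auto
  ultimately show ?thesis by (simp add: prod_eq_iff)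
qed

text \<open>Gibbs' inequality, from exp u - 1 - u >= 0 and the unit expectation of the likelihood
  ratio. In the equality case the class log densities agree on labelled observations, hence so do
  the discriminants.\<close>

theorem expected_lobs_less:
  assumes t: "t \<in> cspace" and ne: "cbeta t \<noteq> cbeta t0"
  shows "Ex (lobs t) < Ex (lobs t0)"
proof -
  interpret L: prob_space law by (rule prob_space_law)
  let ?u = "\<lambda>a. lobs t a - lobs t0 a"
  have pg: "lobs t \<in> poly_growth" "lobs t0 \<in> poly_growth" by (rule lobs_poly_growth[OF t], rule lobs_poly_growth[OF t0])
  note int = integral_law(1)[OF pg(1)] integral_law(1)[OF pg(2)]
  have em [measurable]: "(\<lambda>a. exp (?u a)) \<in> borel_measurable law"
    using lobs_measurable[of t] lobs_measurable[of t0] unfolding borel_measurable_law by measurable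
  have ie: "integrable law (\<lambda>a. exp (?u a))"
    by (rule integrableI_nonneg) (simp_all add: lik_ratio_integral[OF t] em)
  have E1: "Ex (\<lambda>a. exp (?u a)) = 1"
    by (subst integral_eq_nn_integral) (simp_all add: lik_ratio_integral[OF t] em)
  have nn: "0 \<le> exp (?u a) - 1 - ?u a" for a using exp_ge_add_one_self[of "?u a"] by linarith
  have "Ex (\<lambda>a. exp (?u a) - 1 - ?u a) = 1 - 1 - (Ex (lobs t) - Ex (lobs t0))"
    using ie int E1 by (simp add: L.prob_space)
  moreover have "Ex (\<lambda>a. exp (?u a) - 1 - ?u a) \<ge> 0" by (intro integral_nonneg_AE AE_I2 nn)
  moreover have "Ex (\<lambda>a. exp (?u a) - 1 - ?u a) \<noteq> 0"
  proof
    assume "Ex (\<lambda>a. exp (?u a) - 1 - ?u a) = 0"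
    hence "AE a in law. exp (?u a) - 1 - ?u a = 0"
      using ie int nn by (subst (asm) integral_nonneg_eq_0_iff_AE) auto
    hence ae: "AE a in law. ?u a = 0"
    proof eventually_elim
      case (elim a)
      have "ln (exp (?u a)) = exp (?u a) - 1" using elim by simp
      hence "exp (?u a) = 1" using ln_eq_minus_one[of "exp (?u a)"] by simp
      thus ?case by simp
    qed
    have "lcomp t z y - lcomp t0 z y = 0" for z y
    proof (rule law_null_labelled[where z = z])
      show "AE a in law. \<not> snd (snd a) \<longrightarrow> fst (snd a) = z \<longrightarrow> lcomp t z (fst a) - lcomp t0 z (fst a) = 0"
        using ae by eventually_elim (auto simp: lobs_def)
      show "continuous_on UNIV (\<lambda>y. lcomp t z y - lcomp t0 z y)"
        unfolding lcomp_def by (intro continuous_intros) auto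
    qed
    hence "discr (cbeta t) y = discr (cbeta t0) y" for y
      using lcomp_diff[OF t, of y] lcomp_diff[OF t0, of y] by (metis eq_iff_diff_eq_0)
    from discr_inj[OF this] ne show False by blast
  qed
  ultimately show ?thesis by linarith
qed

abbreviation Emp :: "(nat \<times> (nat \<Rightarrow> 'p obs)) filter" where
  "Emp \<equiv> emp_filter poly_growth law"

abbreviation avg' :: "(nat \<times> (nat \<Rightarrow> 'p obs)) \<Rightarrow> ('p obs \<Rightarrow> real) \<Rightarrow> real" where
  "avg' c g \<equiv> avg (fst c) (snd c) g"

text \<open>A uniform law of large numbers in deterministic form. Finitely many neighbourhoods cover
  \<open>K\<close>, and within each of them the averages grow by at most the modulus
  \<open>w\<close> times the average of the envelope \<open>h\<close>.\<close>

lemma uniform_negative: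
  fixes K :: "'s::metric_space set" and f :: "'s \<Rightarrow> 'p obs \<Rightarrow> real"
  assumes K: "compact K" and f: "\<And>s. s \<in> K \<Longrightarrow> f s \<in> poly_growth" and h: "h \<in> poly_growth" "\<And>a. h a \<ge> 0"
    and lip: "\<And>s t a. s \<in> K \<Longrightarrow> t \<in> K \<Longrightarrow> f s a \<le> f t a + w t s * h a"
    and w: "\<And>t. t \<in> K \<Longrightarrow> continuous_on K (w t)" "\<And>t. t \<in> K \<Longrightarrow> w t t = 0"
    and neg: "\<And>s. s \<in> K \<Longrightarrow> Ex (f s) < 0"
  shows "\<forall>\<^sub>F c in Emp. \<forall>s\<in>K. avg' c (f s) < 0"
proof -
  define B where "B = Ex h + 1"
  have B: "B > 0"
    using integral_nonneg_AE[of h law] h(2) by (simp add: B_def add_nonneg_pos)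
  \<comment> \<open>Half of the margin \<open>- Ex (f t)\<close> is reserved for the deviation of
    the average at \<open>t\<close>, the other half for the variation \<open>\<delta> t * B\<close>
    inside the neighbourhood.\<close>
  define \<delta> where "\<delta> t = - Ex (f t) / (2 * B)" for t
  have \<delta>: "\<delta> t > 0" if "t \<in> K" for t unfolding \<delta>_def using neg[OF that] B by (intro divide_pos_pos) auto
  have "\<exists>U. open U \<and> t \<in> U \<and> (\<forall>s\<in>K \<inter> U. w t s < \<delta> t)" if t: "t \<in> K" for t
  proof -
    have "openin (top_of_set K) (K \<inter> w t -` {..<\<delta> t})"
      by (rule continuous_openin_preimage_gen[OF w(1)[OF t]]) simp
    then obtain U where U: "open U" "K \<inter> w t -` {..<\<delta> t} = K \<inter> U" by (auto simp: openin_open)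
    moreover have "t \<in> U" using U(2) t w(2)[OF t] \<delta>[OF t] by auto
    ultimately show ?thesis by (intro exI[of _ U]) auto
  qed
  then obtain U where U: "\<And>t. t \<in> K \<Longrightarrow> open (U t)" "\<And>t. t \<in> K \<Longrightarrow> t \<in> U t"
    "\<And>t s. t \<in> K \<Longrightarrow> s \<in> K \<Longrightarrow> s \<in> U t \<Longrightarrow> w t s < \<delta> t"
    by (metis IntI)
  obtain T where T: "T \<subseteq> K" "finite T" "K \<subseteq> (\<Union>t\<in>T. U t)"
    using compactE_image[OF K, of K U] U(1,2) by blast
  have "\<forall>\<^sub>F c in Emp. \<forall>t\<in>T. avg' c (f t) < Ex (f t) / 2"
  proof (rule eventually_ball_finite[OF T(2)], rule ballI)
    fix t assume "t \<in> T"
    hence t: "t \<in> K" using T by blast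
    show "\<forall>\<^sub>F c in Emp. avg' c (f t) < Ex (f t) / 2"
      by (rule order_tendstoD(2)[OF emp_filter_tendsto[OF f[OF t]]]) (use neg[OF t] in linarith)
  qed
  moreover have "\<forall>\<^sub>F c in Emp. avg' c h < B"
    by (rule order_tendstoD(2)[OF emp_filter_tendsto[OF h(1)]]) (simp add: B_def)
  ultimately show ?thesis
  proof eventually_elim
    case (elim c)
    show ?case
    proof
      fix s assume s: "s \<in> K"
      then obtain t where t: "t \<in> T" "s \<in> U t" using T by blast
      hence tK: "t \<in> K" using T by blast
      have ws: "w t s \<le> \<delta> t" using U(3)[OF tK s t(2)] by simp
      have "avg' c (f s) \<le> avg' c (\<lambda>a. f t a + w t s * h a)"
        by (rule avg_mono) (rule lip[OF s tK])
      also have "\<dots> = avg' c (f t) + w t s * avg' c h" by (simp add: avg_add avg_cmult)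
      also have "w t s * avg' c h \<le> \<delta> t * B"
      proof -
        have h0: "0 \<le> avg' c h" by (simp add: avg_def h(2) sum_nonneg)
        have "w t s * avg' c h \<le> \<delta> t * avg' c h" by (rule mult_right_mono[OF ws h0])
        also have "\<dots> \<le> \<delta> t * B" using elim(2) \<delta>[OF tK] by (intro mult_left_mono) auto
        finally show ?thesis .
      qed
      also have "\<delta> t * B = - Ex (f t) / 2" using B by (simp add: \<delta>_def field_simps)
      finally show "avg' c (f s) < 0" using elim(1) t(1) by fastforce
    qed
  qed
qed

lemma poly_growth_envelope: "(\<lambda>a. (1 + norm (fst a))\<^sup>2) \<in> poly_growth"
  by (intro poly_growth_power poly_growth_add poly_growth_const poly_growth_norm)

text \<open>Wald's consistency argument on the compact box. Separation is measured at the
  discriminant coefficients, the part of the parameter on which the rule depends.\<close>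

theorem eventually_likelihood_separated:
  assumes c: "c > 0" and C: "C > 0" and \<epsilon>: "\<epsilon> > 0"
  shows "\<forall>\<^sub>F d in Emp. \<forall>t\<in>cparam_box c C. \<epsilon> \<le> dist (cbeta t) (cbeta t0) \<longrightarrow> avg' d (lobs t) < avg' d (lobs t0)"
proof -
  define K where "K = {t \<in> cparam_box c C. \<epsilon> \<le> dist (cbeta t) (cbeta t0)}"
  have sub: "cparam_box c C \<subseteq> (cspace :: 'p cparam set)" by (rule cparam_box_subset[OF c C])
  hence KS: "K \<subseteq> cspace" by (auto simp: K_def)
  have "continuous_on (cparam_box c C) (\<lambda>t. dist (cbeta t) (cbeta t0))"
    by (intro continuous_on_dist continuous_on_const continuous_on_subset[OF continuous_on_cbeta sub])
  hence "closedin (top_of_set (cparam_box c C)) (cparam_box c C \<inter> (\<lambda>t. dist (cbeta t) (cbeta t0)) -` {\<epsilon>..})"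
    by (rule continuous_closedin_preimage) simp
  moreover have "cparam_box c C \<inter> (\<lambda>t. dist (cbeta t) (cbeta t0)) -` {\<epsilon>..} = K" by (auto simp: K_def)
  ultimately have "compact K" using closedin_compact[OF compact_cparam_box[OF c C]] by metis
  hence "\<forall>\<^sub>F d in Emp. \<forall>t\<in>K. avg' d (\<lambda>a. lobs t a - lobs t0 a) < 0"
  proof (rule uniform_negative[where h = "\<lambda>a. (1 + norm (fst a))\<^sup>2" and w = cparam_diff])
    show "(\<lambda>a. lobs s a - lobs t0 a) \<in> poly_growth" if "s \<in> K" for s
      using that KS t0 by (intro poly_growth_diff lobs_poly_growth) auto
    show "lobs s a - lobs t0 a \<le> lobs t a - lobs t0 a + cparam_diff t s * (1 + norm (fst a))\<^sup>2"
      if "s \<in> K" "t \<in> K" for s t a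
    proof -
      have "t \<in> cspace" "s \<in> cspace" using that KS by auto
      from lobs_lipschitz[OF this, of a] show ?thesis by linarith
    qed
    show "continuous_on K (cparam_diff t)" for t
      by (rule continuous_on_subset[OF continuous_on_cparam_diff KS])
    show "Ex (\<lambda>a. lobs s a - lobs t0 a) < 0" if "s \<in> K" for s
    proof -
      have s: "s \<in> cspace" "cbeta s \<noteq> cbeta t0" using that KS \<epsilon> by (auto simp: K_def)
      show ?thesis
        using expected_lobs_less[OF s] integral_law(1)[OF lobs_poly_growth[OF s(1)]] integral_law(1)[OF lobs_poly_growth[OF t0]]
        by simp
    qed
  qed (auto simp: cparam_diff_self poly_growth_envelope)
  thus ?thesis
    by eventually_elim (auto simp: K_def avg_diff)
qed

lemma labelled_quadratic_pos:
  assumes "v \<noteq> 0 \<or> s \<noteq> 0"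
  shows "Ex (\<lambda>a. lab i a * (v \<bullet> fst a - s)\<^sup>2) > 0"
proof -
  let ?g = "\<lambda>a. lab i a * (v \<bullet> fst a - s)\<^sup>2"
  have pg: "?g \<in> poly_growth"
    by (intro poly_growth_mult lab_poly_growth poly_growth_power poly_growth_diff poly_growth_inner poly_growth_const)
  have nn: "?g a \<ge> 0" for a by (simp add: lab_nonneg)
  have "Ex ?g \<noteq> 0"
  proof
    assume "Ex ?g = 0"
    hence ae: "AE a in law. ?g a = 0"
      using integral_law(1)[OF pg] nn by (subst (asm) integral_nonneg_eq_0_iff_AE) auto
    have z: "v \<bullet> y - s = 0" for y
    proof (rule law_null_labelled[where z = i])
      show "AE a in law. \<not> snd (snd a) \<longrightarrow> fst (snd a) = i \<longrightarrow> v \<bullet> fst a - s = 0"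
        using ae by eventually_elim (auto simp: lab_def)
      show "continuous_on UNIV (\<lambda>y. v \<bullet> y - s)" by (intro continuous_intros)
    qed
    from z[of 0] z[of v] assms show False by auto
  qed
  moreover have "Ex ?g \<ge> 0" using nn by (intro integral_nonneg_AE) auto
  ultimately show ?thesis by linarith
qed

text \<open>The condition is homogeneous in \<open>(v, s)\<close>, so the unit sphere suffices.
  There the expected quadratic form is continuous and positive, and the uniform law transfers a
  smaller positive constant to the sample.\<close>

theorem eventually_nondegenerate:
  obtains c C where "c > 0" "C > 0" "\<forall>\<^sub>F d in Emp. nondegenerate (fst d) (snd d) c C"
proof -
  define S where "S = sphere (0 :: (real^'p) \<times> real) 1"
  define g where "g i p a = lab i a * (fst p \<bullet> fst a - snd p)\<^sup>2" for i :: label and p :: "(real^'p) \<times> real" and a :: "'p obs"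
  let ?h = "\<lambda>a :: 'p obs. (1 + norm (fst a))\<^sup>2"
  have pg: "g i p \<in> poly_growth" for i p
    unfolding g_def
    by (intro poly_growth_mult lab_poly_growth poly_growth_power poly_growth_diff poly_growth_inner poly_growth_const)
  have lip: "g i p a \<le> g i r a + (2 * norm (p - r)) * ?h a" if "p \<in> S" "r \<in> S" for i p r a
  proof -
    have bd: "\<bar>fst x \<bullet> fst a - snd x\<bar> \<le> norm x * (1 + norm (fst a))" for x :: "(real^'p) \<times> real"
    proof -
      have "\<bar>fst x \<bullet> fst a - snd x\<bar> \<le> norm (fst x) * norm (fst a) + norm (snd x)"
        using Cauchy_Schwarz_ineq2[of "fst x" "fst a"] by simp
      also have "\<dots> \<le> norm x * norm (fst a) + norm x"
        using norm_fst_le[of "fst x" "snd x"] norm_snd_le[of "snd x" "fst x"] by (intro add_mono mult_right_mono) auto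
      finally show ?thesis by (simp add: algebra_simps)
    qed
    have "(fst p \<bullet> fst a - snd p)\<^sup>2 - (fst r \<bullet> fst a - snd r)\<^sup>2
        = (fst (p - r) \<bullet> fst a - snd (p - r)) * (fst (p + r) \<bullet> fst a - snd (p + r))"
      by (simp add: inner_diff_left inner_add_left power2_eq_square algebra_simps)
    also have "\<dots> \<le> \<bar>fst (p - r) \<bullet> fst a - snd (p - r)\<bar> * \<bar>fst (p + r) \<bullet> fst a - snd (p + r)\<bar>"
      by (metis abs_ge_self abs_mult)
    also have "\<dots> \<le> (norm (p - r) * (1 + norm (fst a))) * (norm (p + r) * (1 + norm (fst a)))"
      by (intro mult_mono bd) auto
    also have "\<dots> \<le> (norm (p - r) * (1 + norm (fst a))) * (2 * (1 + norm (fst a)))"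
      using norm_triangle_ineq[of p r] that by (intro mult_left_mono mult_right_mono) (auto simp: S_def)
    also have "\<dots> = (2 * norm (p - r)) * ?h a" unfolding power2_eq_square by algebra
    finally have le: "(fst p \<bullet> fst a - snd p)\<^sup>2 - (fst r \<bullet> fst a - snd r)\<^sup>2 \<le> (2 * norm (p - r)) * ?h a" .
    have "lab i a = 0 \<or> lab i a = 1" by (cases a) (simp add: lab_def)
    thus ?thesis using le by (auto simp: g_def)
  qed
  have cS: "compact S" by (simp add: S_def)
  have Sne: "S \<noteq> {}"
  proof -
    have "(0, 1) \<in> S" by (simp add: S_def norm_Pair)
    thus ?thesis by blast
  qed
  have "\<exists>c>0. \<forall>p\<in>S. c < Ex (g i p)" for i
  proof -
    let ?B = "Ex ?h"
    have "continuous_on S (\<lambda>p. Ex (g i p))"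
    proof (rule lipschitz_on_continuous_on)
      show "(2 * ?B)-lipschitz_on S (\<lambda>p. Ex (g i p))"
      proof (rule lipschitz_onI)
        have B0: "?B \<ge> 0" by (intro integral_nonneg_AE) auto
        thus "0 \<le> 2 * ?B" by simp
        have le: "Ex (g i p) \<le> Ex (g i r) + 2 * norm (p - r) * ?B" if "p \<in> S" "r \<in> S" for p r
        proof -
          have "Ex (g i p) \<le> Ex (\<lambda>a. g i r a + (2 * norm (p - r)) * ?h a)"
            using lip[OF that] integral_law(1)[OF pg] integral_law(1)[OF poly_growth_envelope] by (intro integral_mono) auto
          also have "\<dots> = Ex (g i r) + 2 * norm (p - r) * ?B"
            using integral_law(1)[OF pg] integral_law(1)[OF poly_growth_envelope] by simp
          finally show ?thesis .
        qed
        show "dist (Ex (g i p)) (Ex (g i r)) \<le> 2 * ?B * dist p r" if "p \<in> S" "r \<in> S" for p r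
          using le[OF that] le[OF that(2,1)] by (simp add: dist_norm norm_minus_commute abs_le_iff mult_ac)
      qed
    qed
    then obtain r where r: "r \<in> S" and mn: "\<And>p. p \<in> S \<Longrightarrow> Ex (g i r) \<le> Ex (g i p)"
      using continuous_attains_inf[OF cS Sne] by blast
    have "r \<noteq> 0" using r by (auto simp: S_def)
    hence "fst r \<noteq> 0 \<or> snd r \<noteq> 0" by (auto simp: prod_eq_iff)
    hence "Ex (g i r) > 0" using labelled_quadratic_pos unfolding g_def by blast
    hence "Ex (g i r) / 2 > 0" "\<forall>p\<in>S. Ex (g i r) / 2 < Ex (g i p)"
    proof -
      assume *: "Ex (g i r) > 0"
      thus "Ex (g i r) / 2 > 0" by simp
      show "\<forall>p\<in>S. Ex (g i r) / 2 < Ex (g i p)"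
      proof
        fix p assume "p \<in> S"
        from mn[OF this] * show "Ex (g i r) / 2 < Ex (g i p)" by linarith
      qed
    qed
    thus ?thesis by blast
  qed
  then obtain c' where c': "\<And>i. c' i > 0" "\<And>i p. p \<in> S \<Longrightarrow> c' i < Ex (g i p)" by metis
  define c where "c = min (c' Class1) (c' Class2)"
  have c: "c > 0" "c \<le> c' i" for i using c' by (cases i; simp add: c_def)+
  define C where "C = Ex (\<lambda>a. (norm (fst a))\<^sup>2) + 1"
  have "C > 0" unfolding C_def by (intro add_nonneg_pos integral_nonneg_AE) auto
  have ev: "\<forall>\<^sub>F d in Emp. \<forall>p\<in>S. avg' d (\<lambda>a. c - g i p a) < 0" for i
  proof (rule uniform_negative[where h = ?h and w = "\<lambda>t s. 2 * norm (t - s)"])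
    show "(\<lambda>a. c - g i p a) \<in> poly_growth" for p by (intro poly_growth_diff poly_growth_const pg)
    show "c - g i p a \<le> c - g i r a + 2 * norm (r - p) * ?h a" if "p \<in> S" "r \<in> S" for p r a
      using lip[OF that(2,1)] by (simp add: algebra_simps)
    interpret L: prob_space law by (rule prob_space_law)
    show "Ex (\<lambda>a. c - g i p a) < 0" if "p \<in> S" for p
      using c'(2)[OF that, of i] c(2)[of i] integral_law(1)[OF pg] by (simp add: L.prob_space)
  qed (auto intro!: cS poly_growth_envelope continuous_intros)
  have "\<forall>\<^sub>F d in Emp. avg' d (\<lambda>a. (norm (fst a))\<^sup>2) < C"
    by (rule order_tendstoD(2)[OF emp_filter_tendsto[OF poly_growth_power[OF poly_growth_norm]]]) (simp add: C_def)
  hence "\<forall>\<^sub>F d in Emp. nondegenerate (fst d) (snd d) c C"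
    using ev[of Class1] ev[of Class2] emp_filter_pos
  proof eventually_elim
    case (elim d)
    have gS: "c \<le> avg' d (g i p)" if "p \<in> S" for i p
      using elim that by (cases i) (auto simp: avg_diff avg_const)
    have "c * ((norm v)\<^sup>2 + s\<^sup>2) \<le> avg' d (\<lambda>a. lab i a * (v \<bullet> fst a - s)\<^sup>2)" for i v s
    proof (cases "v = 0 \<and> s = 0")
      case False
      define r where "r = norm (v, s)"
      have r: "r > 0" "r\<^sup>2 = (norm v)\<^sup>2 + s\<^sup>2"
      proof -
        show "r > 0" using False by (auto simp: r_def zero_prod_def)
        show "r\<^sup>2 = (norm v)\<^sup>2 + s\<^sup>2" by (simp add: r_def norm_Pair)
      qed
      have "((1 / r) *\<^sub>R (v, s)) \<in> S" using r(1) by (simp add: S_def r_def del: scaleR_Pair)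
      from gS[OF this, of i] have "r\<^sup>2 * c \<le> r\<^sup>2 * avg' d (g i ((1 / r) *\<^sub>R (v, s)))" by (simp add: mult_left_mono)
      also have "\<dots> = avg' d (\<lambda>a. lab i a * (v \<bullet> fst a - s)\<^sup>2)"
      proof -
        have "r\<^sup>2 * g i ((1 / r) *\<^sub>R (v, s)) a = lab i a * (v \<bullet> fst a - s)\<^sup>2" for a
        proof -
          have "fst ((1 / r) *\<^sub>R (v, s)) \<bullet> fst a - snd ((1 / r) *\<^sub>R (v, s)) = (v \<bullet> fst a - s) / r"
            by (simp add: diff_divide_distrib)
          thus ?thesis using r(1) by (simp add: g_def power_divide)
        qed
        thus ?thesis unfolding avg_cmult[symmetric] by simp
      qed
      finally show ?thesis by (simp add: r(2) mult.commute)
    qed (simp add: avg_def sum_nonneg lab_nonneg)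
    thus ?case using elim by (auto simp: nondegenerate_def)
  qed
  with c(1) \<open>C > 0\<close> show thesis by (rule that)
qed

end

section \<open>Canonical form\<close>

lemma integral_lborel_prod_cart:
  fixes g :: "'n::finite \<Rightarrow> real \<Rightarrow> real"
  assumes g: "\<And>i. integrable lborel (g i)"
  shows "(\<integral>y. (\<Prod>i\<in>UNIV. g i (y $ i)) \<partial>(lborel :: (real^'n) measure)) = (\<Prod>i\<in>UNIV. \<integral>x. g i x \<partial>lborel)"
proof -
  interpret product_sigma_finite "\<lambda>_ :: real^'n. lborel :: real measure" ..
  define c :: "real^'n \<Rightarrow> 'n" where "c b = (THE i. b = axis i 1)" for b
  have c: "c (axis i 1) = i" for i unfolding c_def by (simp add: axis_eq_axis)
  have [measurable]: "g i \<in> borel_measurable borel" for i using borel_measurable_integrable[OF g] by simp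
  have "(\<integral>y. (\<Prod>i\<in>UNIV. g i (y $ i)) \<partial>(lborel :: (real^'n) measure)) =
      (\<integral>f. (\<Prod>i\<in>UNIV. g i ((\<Sum>b\<in>Basis. f b *\<^sub>R b) $ i)) \<partial>(\<Pi>\<^sub>M b\<in>(Basis :: (real^'n) set). lborel))"
    by (subst lborel_eq, subst integral_distr) auto
  also have "\<dots> = (\<integral>f. (\<Prod>b\<in>Basis. g (c b) (f b)) \<partial>(\<Pi>\<^sub>M b\<in>(Basis :: (real^'n) set). lborel))"
  proof (rule Bochner_Integration.integral_cong[OF refl])
    fix f :: "real^'n \<Rightarrow> real"
    have "(\<Sum>b\<in>Basis. f b *\<^sub>R b) $ i = f (axis i 1)" for i
    proof -
      have "(\<Sum>b\<in>Basis. f b *\<^sub>R b) $ i = (\<Sum>j\<in>UNIV. f (axis j 1) * (axis j 1 :: real^'n) $ i)"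
        unfolding Basis_cart by (subst sum.reindex) (auto simp: inj_axis_1)
      also have "\<dots> = f (axis i 1)"
        by (simp add: axis_def if_distrib cong: if_cong)
      finally show ?thesis .
    qed
    thus "(\<Prod>i\<in>UNIV. g i ((\<Sum>b\<in>Basis. f b *\<^sub>R b) $ i)) = (\<Prod>b\<in>Basis. g (c b) (f b))"
      unfolding Basis_cart by (subst prod.reindex) (auto simp: inj_axis_1 c)
  qed
  also have "\<dots> = (\<Prod>b\<in>(Basis :: (real^'n) set). \<integral>x. g (c b) x \<partial>lborel)"
    by (rule product_integral_prod) (auto intro: g)
  also have "\<dots> = (\<Prod>i\<in>UNIV. \<integral>x. g i x \<partial>lborel)"
    unfolding Basis_cart by (subst prod.reindex) (auto simp: inj_axis_1 c)
  finally show ?thesis .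
qed

section \<open>Moments of one-dimensional normal densities\<close>

lemma integrable_normal_abs_power: "integrable lborel (\<lambda>x. normal_density m 1 x * (1 + \<bar>x\<bar>) ^ j)"
proof -
  have "integrable lborel (\<lambda>x. \<Sum>i\<le>j. real (j choose i) * (1 + \<bar>m\<bar>) ^ (j - i) * (normal_density m 1 x * \<bar>x - m\<bar> ^ i))"
    by (intro Bochner_Integration.integrable_sum integrable_mult_right integrable_normal_moment_abs) simp
  thus ?thesis
  proof (rule Bochner_Integration.integrable_bound)
    show "AE x in lborel. norm (normal_density m 1 x * (1 + \<bar>x\<bar>) ^ j)
        \<le> norm (\<Sum>i\<le>j. real (j choose i) * (1 + \<bar>m\<bar>) ^ (j - i) * (normal_density m 1 x * \<bar>x - m\<bar> ^ i))"
    proof (rule AE_I2)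
      fix x
      have "(1 + \<bar>x\<bar>) ^ j \<le> (\<bar>x - m\<bar> + (1 + \<bar>m\<bar>)) ^ j" by (rule power_mono) auto
      also have "\<dots> = (\<Sum>i\<le>j. real (j choose i) * \<bar>x - m\<bar> ^ i * (1 + \<bar>m\<bar>) ^ (j - i))" by (rule binomial_ring)
      finally have "normal_density m 1 x * (1 + \<bar>x\<bar>) ^ j \<le> normal_density m 1 x * (\<Sum>i\<le>j. real (j choose i) * \<bar>x - m\<bar> ^ i * (1 + \<bar>m\<bar>) ^ (j - i))"
        by (rule mult_left_mono) simp
      also have "\<dots> = (\<Sum>i\<le>j. real (j choose i) * (1 + \<bar>m\<bar>) ^ (j - i) * (normal_density m 1 x * \<bar>x - m\<bar> ^ i))"
        by (simp add: sum_distrib_left mult_ac)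
      finally show "norm (normal_density m 1 x * (1 + \<bar>x\<bar>) ^ j)
        \<le> norm (\<Sum>i\<le>j. real (j choose i) * (1 + \<bar>m\<bar>) ^ (j - i) * (normal_density m 1 x * \<bar>x - m\<bar> ^ i))"
        by (simp add: abs_mult)
    qed
  qed measurable
qed

lemma integrable_normal_mult:
  assumes "h \<in> borel_measurable borel" "\<And>x. \<bar>h x\<bar> \<le> C * (1 + \<bar>x\<bar>) ^ j"
  shows "integrable lborel (\<lambda>x. normal_density m 1 x * h x)"
proof (rule Bochner_Integration.integrable_bound)
  show "integrable lborel (\<lambda>x. C * (normal_density m 1 x * (1 + \<bar>x\<bar>) ^ j))"
    by (intro integrable_mult_right integrable_normal_abs_power)
  show "AE x in lborel. norm (normal_density m 1 x * h x) \<le> norm (C * (normal_density m 1 x * (1 + \<bar>x\<bar>) ^ j))"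
  proof (rule AE_I2)
    fix x
    have "normal_density m 1 x * \<bar>h x\<bar> \<le> normal_density m 1 x * (C * (1 + \<bar>x\<bar>) ^ j)"
      by (intro mult_left_mono assms) simp
    moreover have "C \<ge> 0" using assms(2)[of 0] by simp
    ultimately show "norm (normal_density m 1 x * h x) \<le> norm (C * (normal_density m 1 x * (1 + \<bar>x\<bar>) ^ j))"
      by (simp add: abs_mult mult_ac)
  qed
qed (use assms in measurable)

lemma integrable_normal_power: "integrable lborel (\<lambda>x. normal_density m 1 x * x ^ j)"
proof (rule integrable_normal_mult[where C = 1 and j = j])
  show "\<bar>x ^ j\<bar> \<le> 1 * (1 + \<bar>x\<bar>) ^ j" for x :: real
    by (simp add: power_abs power_mono)
qed simp

lemma normal_shift:
  "(\<integral>x. normal_density m 1 x * h x \<partial>lborel) = (\<integral>x. std_normal_density x * h (m + x) \<partial>lborel)"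
  by (subst lborel_integral_real_affine[of 1 _ m]) (simp_all add: normal_density_def)

lemma std_normal_moments:
  "(\<integral>x. std_normal_density x * x ^ 0 \<partial>lborel) = 1"
  "(\<integral>x. std_normal_density x * x ^ 1 \<partial>lborel) = 0"
  "(\<integral>x. std_normal_density x * x ^ 2 \<partial>lborel) = 1"
  "(\<integral>x. std_normal_density x * x ^ 3 \<partial>lborel) = 0"
  "(\<integral>x. std_normal_density x * x ^ 4 \<partial>lborel) = 3"
  using integral_std_normal_moment_odd[of 0] integral_std_normal_moment_odd[of 1]
    integral_std_normal_moment_even[of 1] integral_std_normal_moment_even[of 2]
  by (simp_all add: eval_nat_numeral fact_numeral)

lemma normal_moments:
  "(\<integral>x. normal_density m 1 x * x ^ 0 \<partial>lborel) = 1"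
  "(\<integral>x. normal_density m 1 x * x ^ 1 \<partial>lborel) = m"
  "(\<integral>x. normal_density m 1 x * x ^ 2 \<partial>lborel) = m\<^sup>2 + 1"
  "(\<integral>x. normal_density m 1 x * x ^ 3 \<partial>lborel) = m ^ 3 + 3 * m"
  "(\<integral>x. normal_density m 1 x * x ^ 4 \<partial>lborel) = m ^ 4 + 6 * m\<^sup>2 + 3"
proof -
  note i = integrable_std_normal_moment
  have e: "std_normal_density x * (m + x) ^ 1 = m * (std_normal_density x * x ^ 0) + std_normal_density x * x ^ 1"
    "std_normal_density x * (m + x) ^ 2 = m\<^sup>2 * (std_normal_density x * x ^ 0) + 2 * m * (std_normal_density x * x ^ 1) + std_normal_density x * x ^ 2"
    "std_normal_density x * (m + x) ^ 3 = m ^ 3 * (std_normal_density x * x ^ 0) + 3 * m\<^sup>2 * (std_normal_density x * x ^ 1) + 3 * m * (std_normal_density x * x ^ 2) + std_normal_density x * x ^ 3"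
    "std_normal_density x * (m + x) ^ 4 = m ^ 4 * (std_normal_density x * x ^ 0) + 4 * m ^ 3 * (std_normal_density x * x ^ 1) + 6 * m\<^sup>2 * (std_normal_density x * x ^ 2) + 4 * m * (std_normal_density x * x ^ 3) + std_normal_density x * x ^ 4"
    for x by (simp_all add: power2_eq_square power3_eq_cube power4_eq_xxxx algebra_simps)
  have I: "(\<integral>x. std_normal_density x * (m + x) ^ 1 \<partial>lborel) = m * 1 + 0"
    "(\<integral>x. std_normal_density x * (m + x) ^ 2 \<partial>lborel) = m\<^sup>2 * 1 + 2 * m * 0 + 1"
    "(\<integral>x. std_normal_density x * (m + x) ^ 3 \<partial>lborel) = m ^ 3 * 1 + 3 * m\<^sup>2 * 0 + 3 * m * 1 + 0"
    "(\<integral>x. std_normal_density x * (m + x) ^ 4 \<partial>lborel) = m ^ 4 * 1 + 4 * m ^ 3 * 0 + 6 * m\<^sup>2 * 1 + 4 * m * 0 + 3"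
    unfolding e
    by (simp_all only: Bochner_Integration.integral_add integral_mult_right_zero std_normal_moments
        Bochner_Integration.integrable_add integrable_mult_right i)
  show "(\<integral>x. normal_density m 1 x * x ^ 0 \<partial>lborel) = 1" by simp
  show "(\<integral>x. normal_density m 1 x * x ^ 1 \<partial>lborel) = m"
    "(\<integral>x. normal_density m 1 x * x ^ 2 \<partial>lborel) = m\<^sup>2 + 1"
    "(\<integral>x. normal_density m 1 x * x ^ 3 \<partial>lborel) = m ^ 3 + 3 * m"
    "(\<integral>x. normal_density m 1 x * x ^ 4 \<partial>lborel) = m ^ 4 + 6 * m\<^sup>2 + 3"
    unfolding normal_shift[of m "\<lambda>x. x ^ _"] I by simp_all
qed

definition canon_param :: "'p::finite \<Rightarrow> real \<Rightarrow> 'p cparam" where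
  "canon_param k D = (1/2, (D/2) *\<^sub>R axis k 1, - (D/2) *\<^sub>R axis k 1, mat 1)"

fun cmu :: "real \<Rightarrow> label \<Rightarrow> real" where
  "cmu D Class1 = D / 2"
| "cmu D Class2 = - (D / 2)"

lemma pos_def_mat_1: "pos_def_matrix (mat 1 :: real^'n^'n)"
  by (simp add: pos_def_matrix_def transpose_mat)

lemma canon_param_in_cspace: "canon_param k D \<in> cspace"
  by (simp add: canon_param_def cspace_def cprec_def pos_def_mat_1)

lemma canon_lcomp:
  fixes y :: "real^'p::finite"
  shows "exp (lcomp (canon_param k D) z y) = 1/2 * (normal_density (cmu D z) 1 (y $ k) * (\<Prod>i\<in>UNIV - {k}. std_normal_density (y $ i)))"
proof -
  have m: "cmean (canon_param k D) z = cmu D z *\<^sub>R axis k 1" by (cases z) (simp_all add: canon_param_def)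
  have p: "cprior (canon_param k D) z = 1/2" by (cases z) (simp_all add: canon_param_def)
  have c: "cprec (canon_param k D) = mat 1" by (simp add: canon_param_def cprec_def)
  define e where "e i = (if i = k then y $ k - cmu D z else y $ i)" for i
  have "(y - cmu D z *\<^sub>R axis k 1) \<bullet> (y - cmu D z *\<^sub>R axis k 1) = (\<Sum>i\<in>UNIV. (e i)\<^sup>2)"
    unfolding inner_vec_def by (rule sum.cong) (auto simp: e_def axis_def power2_eq_square)
  hence "lcomp (canon_param k D) z y = ln (1/2) + (\<Sum>i\<in>UNIV. - (e i)\<^sup>2 / 2 - ln (2 * pi) / 2)"
    by (simp add: lcomp_def m p c sum_subtractf sum_negf sum_divide_distrib)
  moreover have "exp (- (e i)\<^sup>2 / 2 - ln (2 * pi) / 2) = std_normal_density (e i)" for i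
  proof -
    have "exp (ln (2 * pi) / 2) = sqrt (2 * pi)" by (subst ln_sqrt[symmetric]) simp_all
    thus ?thesis by (simp only: normal_density_def exp_diff) simp
  qed
  moreover have "exp (ln (1/2)) = (1/2 :: real)" by simp
  ultimately have "exp (lcomp (canon_param k D) z y) = 1/2 * (\<Prod>i\<in>UNIV. std_normal_density (e i))"
    by (simp only: exp_add exp_sum finite)
  also have "(\<Prod>i\<in>UNIV. std_normal_density (e i)) = std_normal_density (e k) * (\<Prod>i\<in>UNIV - {k}. std_normal_density (e i))"
    by (rule prod.remove) auto
  also have "(\<Prod>i\<in>UNIV - {k}. std_normal_density (e i)) = (\<Prod>i\<in>UNIV - {k}. std_normal_density (y $ i))"
    by (rule prod.cong) (auto simp: e_def)
  also have "std_normal_density (e k) = normal_density (cmu D z) 1 (y $ k)"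
    by (simp add: e_def normal_density_def)
  finally show ?thesis .
qed

lemma sigmoid_even_product: "sigmoid (- x) * (1 - sigmoid (- x)) = sigmoid x * (1 - sigmoid x)"
proof -
  have "sigmoid (- x) = 1 - sigmoid x"
  proof -
    define E where "E = exp x"
    have "E > 0" "1 + E > 0" by (simp_all add: E_def add_pos_pos)
    thus ?thesis unfolding sigmoid_def exp_minus E_def[symmetric] by (simp add: field_simps)
  qed
  thus ?thesis by simp
qed

text \<open>Bayes' formula for the coordinate \<open>k\<close>: with equal priors the posterior
  log-odds are \<open>D * x\<close>.\<close>

lemma half_normal_eq_sigmoid:
  "1/2 * normal_density (D/2) 1 x = sigmoid (D * x) * fy1 D x"
  "1/2 * normal_density (- (D/2)) 1 x = (1 - sigmoid (D * x)) * fy1 D x"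
proof -
  have r: "normal_density (D/2) 1 x = exp (D * x) * normal_density (- (D/2)) 1 x"
  proof -
    have "- (x - D/2)\<^sup>2 / (2 * 1\<^sup>2) = D * x + - (x - (- (D/2)))\<^sup>2 / (2 * 1\<^sup>2)"
      by (simp add: power2_eq_square field_simps)
    thus ?thesis unfolding normal_density_def by (simp add: exp_add[symmetric])
  qed
  define E where "E = exp (D * x)"
  have "E > 0" by (simp add: E_def)
  hence E: "E > 0" "1 + E \<noteq> 0" "1 + E > 0" by linarith+
  have f: "fy1 D x = (1/2) * (1 + E) * normal_density (- (D/2)) 1 x"
    unfolding fy1_def r E_def by (simp add: algebra_simps)
  show "1/2 * normal_density (D/2) 1 x = sigmoid (D * x) * fy1 D x"
    unfolding f r sigmoid_def E_def[symmetric] using E by simp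
  show "1/2 * normal_density (- (D/2)) 1 x = (1 - sigmoid (D * x)) * fy1 D x"
    unfolding f sigmoid_def E_def[symmetric] using E by (simp add: field_simps)
qed

lemma tau_eq_sigmoid: "tau D Class1 x = sigmoid (D * x)" "tau D Class2 x = 1 - sigmoid (D * x)"
  by (simp_all add: sigmoid_def)

text \<open>Evenness of \<open>Q\<close> reflects that the missing probability depends on the square
  of a discriminant which has no intercept at equal priors. It makes the equations for the intercept
  and for coordinate \<open>k\<close> decouple.\<close>

locale canon =
  fixes k :: "'p::finite" and D :: real and Q :: "real \<Rightarrow> real"
  assumes D_pos: "D > 0" and Q_measurable [measurable]: "Q \<in> borel_measurable borel"
    and Q_nonneg: "0 \<le> Q x" and Q_less_1: "Q x < 1" and Q_even: "Q (- x) = Q x"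

sublocale canon \<subseteq> missing_model "canon_param k D" "\<lambda>y. Q (y $ k)"
  by unfold_locales (auto simp: canon_param_in_cspace Q_nonneg Q_less_1)

context canon
begin

text \<open>The expectation of a function of coordinate \<open>k\<close>, label and missing
  indicator, reduced to one-dimensional integrals.\<close>

definition E1 :: "(real \<Rightarrow> label \<Rightarrow> bool \<Rightarrow> real) \<Rightarrow> real" where
  "E1 h = (\<Sum>z\<in>UNIV. \<Sum>m\<in>UNIV. \<integral>x. 1/2 * (normal_density (cmu D z) 1 x * ((if m then Q x else 1 - Q x) * h x z m)) \<partial>lborel)"

lemma Ex_product:
  assumes hm: "\<And>z m. (\<lambda>x. h x z m) \<in> borel_measurable borel" and hb: "\<And>x z m. \<bar>h x z m\<bar> \<le> C * (1 + \<bar>x\<bar>) ^ j"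
    and g: "g \<in> poly_growth" and geq: "\<And>y z m. g (y, z, m) = h (y $ k) z m * (\<Prod>i\<in>UNIV - {k}. (y $ i) ^ e i)"
  shows "Ex g = E1 h * (\<Prod>i\<in>UNIV - {k}. \<integral>x. std_normal_density x * x ^ e i \<partial>lborel)"
proof -
  have "(\<integral>y. dens (y, z, m) * g (y, z, m) \<partial>lborel) =
     (\<integral>x. 1/2 * (normal_density (cmu D z) 1 x * ((if m then Q x else 1 - Q x) * h x z m)) \<partial>lborel)
       * (\<Prod>i\<in>UNIV - {k}. \<integral>x. std_normal_density x * x ^ e i \<partial>lborel)" for z m
  proof -
    define f where "f i = (if i = k then (\<lambda>x. 1/2 * (normal_density (cmu D z) 1 x * ((if m then Q x else 1 - Q x) * h x z m)))
       else (\<lambda>x. std_normal_density x * x ^ e i))" for i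
    have fi: "integrable lborel (f i)" for i
    proof (cases "i = k")
      case True
      have q: "0 \<le> (if m then Q x else 1 - Q x)" "(if m then Q x else 1 - Q x) \<le> 1" for x
        using Q_nonneg[of x] Q_less_1[of x] by auto
      have [measurable]: "(\<lambda>x. if m then Q x else 1 - Q x) \<in> borel_measurable borel" by (cases m) auto
      have "integrable lborel (\<lambda>x. normal_density (cmu D z) 1 x * ((if m then Q x else 1 - Q x) * h x z m))"
      proof (rule integrable_normal_mult)
        show "(\<lambda>x. (if m then Q x else 1 - Q x) * h x z m) \<in> borel_measurable borel"
          using hm[of z m] by measurable
        show "\<bar>(if m then Q x else 1 - Q x) * h x z m\<bar> \<le> C * (1 + \<bar>x\<bar>) ^ j" for x
        proof -
          have "(if m then Q x else 1 - Q x) * \<bar>h x z m\<bar> \<le> 1 * \<bar>h x z m\<bar>" by (rule mult_right_mono[OF q(2)]) simp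
          thus ?thesis using hb[of x z m] q(1)[of x] unfolding abs_mult by linarith
        qed
      qed
      thus ?thesis using True by (simp add: f_def)
    next
      case False
      thus ?thesis using integrable_normal_power[of 0 "e i"] by (simp add: f_def)
    qed
    have "dens (y, z, m) * g (y, z, m) = (\<Prod>i\<in>UNIV. f i (y $ i))" for y
    proof -
      have "(\<Prod>i\<in>UNIV. f i (y $ i)) = f k (y $ k) * (\<Prod>i\<in>UNIV - {k}. f i (y $ i))"
        by (rule prod.remove) auto
      also have "(\<Prod>i\<in>UNIV - {k}. f i (y $ i)) = (\<Prod>i\<in>UNIV - {k}. std_normal_density (y $ i) * (y $ i) ^ e i)"
        by (rule prod.cong) (auto simp: f_def)
      also have "\<dots> = (\<Prod>i\<in>UNIV - {k}. std_normal_density (y $ i)) * (\<Prod>i\<in>UNIV - {k}. (y $ i) ^ e i)"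
        by (rule prod.distrib)
      also have "f k (y $ k) = 1/2 * (normal_density (cmu D z) 1 (y $ k) * ((if m then Q (y $ k) else 1 - Q (y $ k)) * h (y $ k) z m))"
        by (simp add: f_def)
      finally show ?thesis unfolding dens_def geq by (simp only: prod.case canon_lcomp mult_ac)
    qed
    hence "(\<integral>y. dens (y, z, m) * g (y, z, m) \<partial>lborel) = (\<Prod>i\<in>UNIV. \<integral>x. f i x \<partial>lborel)"
      using integral_lborel_prod_cart[OF fi] by simp
    also have "\<dots> = (\<integral>x. f k x \<partial>lborel) * (\<Prod>i\<in>UNIV - {k}. \<integral>x. f i x \<partial>lborel)"
      by (rule prod.remove) auto
    also have "(\<Prod>i\<in>UNIV - {k}. \<integral>x. f i x \<partial>lborel) = (\<Prod>i\<in>UNIV - {k}. \<integral>x. std_normal_density x * x ^ e i \<partial>lborel)"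
      by (rule prod.cong) (auto simp: f_def)
    finally show ?thesis by (simp add: f_def)
  qed
  thus ?thesis
    unfolding integral_law(2)[OF g] E1_def by (simp only: sum_distrib_right)
qed

text \<open>The coordinates other than \<open>k\<close> are standard normal, independent of each
  other and of coordinate \<open>k\<close>, label and missing indicator. Factors in them enter an
  expectation only through their own moments.\<close>

lemma Ex_component:
  assumes hm: "\<And>z m. (\<lambda>x. h x z m) \<in> borel_measurable borel" and hb: "\<And>x z m. \<bar>h x z m\<bar> \<le> C * (1 + \<bar>x\<bar>) ^ j"
  defines "H \<equiv> \<lambda>a :: 'p obs. h (fst a $ k) (fst (snd a)) (snd (snd a))"
  shows "H \<in> poly_growth"
    and "Ex H = E1 h"
    and "i \<noteq> k \<Longrightarrow> Ex (\<lambda>a. H a * fst a $ i) = 0"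
    and "i \<noteq> k \<Longrightarrow> Ex (\<lambda>a. H a * (fst a $ i * fst a $ i)) = E1 h"
    and "i \<noteq> k \<Longrightarrow> l \<noteq> k \<Longrightarrow> i \<noteq> l \<Longrightarrow> Ex (\<lambda>a. H a * (fst a $ i * fst a $ l)) = 0"
proof -
  have C0: "C \<ge> 0" using hb[of 0 Class1 True] by simp
  show H: "H \<in> poly_growth"
  proof (rule poly_growthI[where C = C and m = j])
    have [measurable]: "(\<lambda>y. h (y $ k) z m) \<in> borel_measurable borel" for z m
      by (rule measurable_compose[OF _ hm]) simp
    show "H \<in> borel_measurable obs_space"
      unfolding H_def by (rule obs_measurableI) simp
    fix a :: "'p obs"
    have "\<bar>H a\<bar> \<le> C * (1 + \<bar>fst a $ k\<bar>) ^ j" unfolding H_def by (rule hb)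
    also have "\<dots> \<le> C * (1 + norm (fst a)) ^ j"
      using component_le_norm_cart[of "fst a" k] C0 by (intro mult_left_mono power_mono) auto
    finally show "\<bar>H a\<bar> \<le> C * (1 + norm (fst a)) ^ j" .
  qed
  note pg = H poly_growth_mult[OF H] poly_growth_mult poly_growth_component
  have rest: "(\<Prod>i'\<in>UNIV - {k} - {i}. \<integral>x. std_normal_density x * x ^ e i' \<partial>lborel) = 1"
    if "\<And>i'. i' \<noteq> i \<Longrightarrow> e i' = 0" for i and e :: "'p \<Rightarrow> nat"
    using that by (intro prod.neutral) (auto simp: std_normal_moments)
  have p1: "(\<Prod>i'\<in>UNIV - {k}. (y $ i') ^ e i') = (y $ i) ^ e i" if "i \<noteq> k" "\<And>i'. i' \<noteq> i \<Longrightarrow> e i' = 0"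
    for i and e :: "'p \<Rightarrow> nat" and y :: "real^'p"
    using that by (subst prod.remove[of _ i]) (auto intro!: prod.neutral)
  show "Ex H = E1 h"
    by (subst Ex_product[OF hm hb H, where e = "\<lambda>_. 0"]) (simp_all add: H_def)
  show "Ex (\<lambda>a. H a * fst a $ i) = 0" if i: "i \<noteq> k"
  proof -
    define e where "e i' = (if i' = i then 1 else 0 :: nat)" for i'
    have "Ex (\<lambda>a. H a * fst a $ i) = E1 h * (\<Prod>i\<in>UNIV - {k}. \<integral>x. std_normal_density x * x ^ e i \<partial>lborel)"
    proof (rule Ex_product[OF hm hb])
      show "(\<lambda>a. H a * fst a $ i) \<in> poly_growth" by (intro pg)
      show "H (y, z, m) * fst (y, z, m) $ i = h (y $ k) z m * (\<Prod>i\<in>UNIV - {k}. (y $ i) ^ e i)" for y z m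
        by (subst p1[OF i]) (simp_all add: e_def H_def)
    qed
    also have "(\<Prod>i\<in>UNIV - {k}. \<integral>x. std_normal_density x * x ^ e i \<partial>lborel) = 0"
    proof (rule prod_zero)
      have "(\<integral>x. std_normal_density x * x ^ e i \<partial>lborel) = 0"
        using std_normal_moments(2) by (simp add: e_def)
      thus "\<exists>i\<in>UNIV - {k}. (\<integral>x. std_normal_density x * x ^ e i \<partial>lborel) = 0" using i by blast
    qed simp
    finally show ?thesis by simp
  qed
  show "Ex (\<lambda>a. H a * (fst a $ i * fst a $ i)) = E1 h" if i: "i \<noteq> k"
  proof -
    define e where "e i' = (if i' = i then 2 else 0 :: nat)" for i'
    have "Ex (\<lambda>a. H a * (fst a $ i * fst a $ i)) = E1 h * (\<Prod>i\<in>UNIV - {k}. \<integral>x. std_normal_density x * x ^ e i \<partial>lborel)"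
    proof (rule Ex_product[OF hm hb])
      show "(\<lambda>a. H a * (fst a $ i * fst a $ i)) \<in> poly_growth" by (intro pg)
      show "H (y, z, m) * (fst (y, z, m) $ i * fst (y, z, m) $ i) = h (y $ k) z m * (\<Prod>i\<in>UNIV - {k}. (y $ i) ^ e i)" for y z m
        by (subst p1[OF i]) (simp_all add: e_def H_def power2_eq_square)
    qed
    also have "(\<Prod>i\<in>UNIV - {k}. \<integral>x. std_normal_density x * x ^ e i \<partial>lborel) = 1"
      using std_normal_moments(1,3) by (intro prod.neutral) (auto simp: e_def)
    finally show ?thesis by simp
  qed
  show "Ex (\<lambda>a. H a * (fst a $ i * fst a $ l)) = 0" if i: "i \<noteq> k" "l \<noteq> k" "i \<noteq> l"
  proof -
    define e where "e i' = (if i' = i \<or> i' = l then 1 else 0 :: nat)" for i'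
    have p2: "(\<Prod>i'\<in>UNIV - {k}. (y $ i') ^ e i') = y $ i * y $ l" for y :: "real^'p"
    proof -
      have "(\<Prod>i'\<in>UNIV - {k}. (y $ i') ^ e i') = (\<Prod>i'\<in>{i, l}. (y $ i') ^ e i')"
        by (rule prod.mono_neutral_right) (use i in \<open>auto simp: e_def\<close>)
      thus ?thesis using i by (simp add: e_def)
    qed
    have "Ex (\<lambda>a. H a * (fst a $ i * fst a $ l)) = E1 h * (\<Prod>i\<in>UNIV - {k}. \<integral>x. std_normal_density x * x ^ e i \<partial>lborel)"
    proof (rule Ex_product[OF hm hb])
      show "(\<lambda>a. H a * (fst a $ i * fst a $ l)) \<in> poly_growth" by (intro pg)
      show "H (y, z, m) * (fst (y, z, m) $ i * fst (y, z, m) $ l) = h (y $ k) z m * (\<Prod>i\<in>UNIV - {k}. (y $ i) ^ e i)" for y z m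
        by (simp add: p2 H_def)
    qed
    also have "(\<Prod>i\<in>UNIV - {k}. \<integral>x. std_normal_density x * x ^ e i \<partial>lborel) = 0"
    proof (rule prod_zero)
      have "(\<integral>x. std_normal_density x * x ^ e i \<partial>lborel) = 0"
        using std_normal_moments(2) by (simp add: e_def)
      thus "\<exists>i\<in>UNIV - {k}. (\<integral>x. std_normal_density x * x ^ e i \<partial>lborel) = 0" using i by blast
    qed simp
    finally show ?thesis by simp
  qed
qed

end

section \<open>Moments of the marginal density and bounds on the conditional label variance\<close>

lemma fy1_pos: "fy1 D x > 0"
  unfolding fy1_def by (intro add_pos_pos mult_pos_pos normal_density_pos) auto

lemma fy1_measurable [measurable]: "fy1 D \<in> borel_measurable borel"
  unfolding fy1_def[abs_def] by measurable

lemma fy1_even: "fy1 D (- x) = fy1 D x"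
  by (simp add: fy1_def normal_density_def power2_eq_square algebra_simps)

lemma sigmoid_measurable [measurable]: "sigmoid \<in> borel_measurable borel"
  unfolding sigmoid_def[abs_def] by measurable

lemma integrable_fy1_mult:
  assumes "h \<in> borel_measurable borel" "\<And>x. \<bar>h x\<bar> \<le> C * (1 + \<bar>x\<bar>) ^ j"
  shows "integrable lborel (\<lambda>x. fy1 D x * h x)"
proof -
  have "integrable lborel (\<lambda>x. 1/2 * (normal_density (D/2) 1 x * h x) + 1/2 * (normal_density (- (D/2)) 1 x * h x))"
    by (intro Bochner_Integration.integrable_add integrable_mult_right integrable_normal_mult[OF assms])
  thus ?thesis by (simp add: fy1_def algebra_simps)
qed

lemma fy1_moments:
  "(\<integral>x. fy1 D x * x ^ 0 \<partial>lborel) = 1"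
  "(\<integral>x. fy1 D x * x ^ 1 \<partial>lborel) = 0"
  "(\<integral>x. fy1 D x * x ^ 2 \<partial>lborel) = (D/2)\<^sup>2 + 1"
  "(\<integral>x. fy1 D x * x ^ 4 \<partial>lborel) = (D/2) ^ 4 + 6 * (D/2)\<^sup>2 + 3"
proof -
  have "(\<integral>x. fy1 D x * x ^ j \<partial>lborel) = 1/2 * (\<integral>x. normal_density (D/2) 1 x * x ^ j \<partial>lborel) + 1/2 * (\<integral>x. normal_density (- (D/2)) 1 x * x ^ j \<partial>lborel)" for j
  proof -
    have "(\<integral>x. fy1 D x * x ^ j \<partial>lborel) = (\<integral>x. 1/2 * (normal_density (D/2) 1 x * x ^ j) + 1/2 * (normal_density (- (D/2)) 1 x * x ^ j) \<partial>lborel)"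
      by (intro Bochner_Integration.integral_cong) (auto simp: fy1_def algebra_simps)
    thus ?thesis
      by (simp only: Bochner_Integration.integral_add integrable_mult_right integrable_normal_power integral_mult_right_zero)
  qed
  note e = this
  show "(\<integral>x. fy1 D x * x ^ 0 \<partial>lborel) = 1"
    "(\<integral>x. fy1 D x * x ^ 1 \<partial>lborel) = 0"
    "(\<integral>x. fy1 D x * x ^ 2 \<partial>lborel) = (D/2)\<^sup>2 + 1"
    "(\<integral>x. fy1 D x * x ^ 4 \<partial>lborel) = (D/2) ^ 4 + 6 * (D/2)\<^sup>2 + 3"
    unfolding e normal_moments by simp_all
qed

lemma fy1_sigmoid_moments:
  "(\<integral>x. fy1 D x * ((sigmoid (D * x) - 1/2) * x ^ 0) \<partial>lborel) = 0"
  "(\<integral>x. fy1 D x * ((sigmoid (D * x) - 1/2) * x ^ 1) \<partial>lborel) = D / 4"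
  "(\<integral>x. fy1 D x * ((sigmoid (D * x) - 1/2) * x ^ 3) \<partial>lborel) = 1/2 * ((D/2) ^ 3 + 3 * (D/2))"
proof -
  have p: "fy1 D x * ((sigmoid (D * x) - 1/2) * x ^ j) = 1/4 * (normal_density (D/2) 1 x * x ^ j) - 1/4 * (normal_density (- (D/2)) 1 x * x ^ j)" for x j
  proof -
    have "1/4 * normal_density (D/2) 1 x - 1/4 * normal_density (- (D/2)) 1 x = fy1 D x * (sigmoid (D * x) - 1/2)"
      using half_normal_eq_sigmoid[of D x] by (simp add: algebra_simps)
    thus ?thesis by (simp only: mult.assoc[symmetric] left_diff_distrib[symmetric])
  qed
  have e: "(\<integral>x. fy1 D x * ((sigmoid (D * x) - 1/2) * x ^ j) \<partial>lborel) = 1/4 * (\<integral>x. normal_density (D/2) 1 x * x ^ j \<partial>lborel) - 1/4 * (\<integral>x. normal_density (- (D/2)) 1 x * x ^ j \<partial>lborel)" for j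
    unfolding p
    by (simp only: Bochner_Integration.integral_diff integrable_mult_right integrable_normal_power integral_mult_right_zero)
  show "(\<integral>x. fy1 D x * ((sigmoid (D * x) - 1/2) * x ^ 0) \<partial>lborel) = 0"
    "(\<integral>x. fy1 D x * ((sigmoid (D * x) - 1/2) * x ^ 1) \<partial>lborel) = D / 4"
    "(\<integral>x. fy1 D x * ((sigmoid (D * x) - 1/2) * x ^ 3) \<partial>lborel) = 1/2 * ((D/2) ^ 3 + 3 * (D/2))"
    unfolding e normal_moments by (simp_all add: power3_eq_cube field_simps)
qed

lemma sigmoid_bounds: "0 \<le> sigmoid x * (1 - sigmoid x)" "sigmoid x * (1 - sigmoid x) \<le> 1" "\<bar>sigmoid x - 1/2\<bar> \<le> 1"
proof -
  have s: "0 < sigmoid x" "sigmoid x < 1" by (rule sigmoid_pos, rule sigmoid_less_1)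
  show "0 \<le> sigmoid x * (1 - sigmoid x)" using s by simp
  show "sigmoid x * (1 - sigmoid x) \<le> 1" using s mult_mono[of "sigmoid x" 1 "1 - sigmoid x" 1] by simp
  show "\<bar>sigmoid x - 1/2\<bar> \<le> 1" using s by (simp add: abs_le_iff)
qed

lemma fy1_integrable_power: "integrable lborel (\<lambda>x. fy1 D x * x ^ j)"
proof (rule integrable_fy1_mult[where C = 1 and j = j])
  show "\<bar>x ^ j\<bar> \<le> 1 * (1 + \<bar>x\<bar>) ^ j" for x :: real by (simp add: power_abs power_mono)
qed simp

lemma fy1_integrable_bounded_power:
  assumes [measurable]: "g \<in> borel_measurable borel" and g: "\<And>x. \<bar>g x\<bar> \<le> 1"
  shows "integrable lborel (\<lambda>x. fy1 D x * (g x * x ^ j))"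
proof (rule integrable_fy1_mult[where C = 1 and j = j])
  show "\<bar>g x * x ^ j\<bar> \<le> 1 * (1 + \<bar>x\<bar>) ^ j" for x :: real
    unfolding abs_mult power_abs by (intro mult_mono g power_mono) auto
qed measurable

text \<open>These bounds concern a sample without any labels. The conditional label variance is 1/4
  minus the square of sigmoid - 1/2, and residual variances are nonnegative: that of sigmoid - 1/2
  regressed on x gives the first bound, that of (sigmoid - 1/2) x regressed on 1 and x^2 the
  second.\<close>

lemma fy1_information_bounds:
  "(\<integral>x. fy1 D x * (sigmoid (D * x) * (1 - sigmoid (D * x)) * x ^ 0) \<partial>lborel) \<le> 1 / (4 + D\<^sup>2)"
  "(\<integral>x. fy1 D x * (sigmoid (D * x) * (1 - sigmoid (D * x)) * x ^ 2) \<partial>lborel) \<le> 1 / (4 + 2 * D\<^sup>2)"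
proof -
  let ?s = "\<lambda>x. sigmoid (D * x)"
  let ?v = "\<lambda>x. ?s x * (1 - ?s x)"
  have iv: "integrable lborel (\<lambda>x. fy1 D x * (?v x * x ^ j))" for j
    using sigmoid_bounds(1,2) by (intro fy1_integrable_bounded_power) auto
  have isg: "integrable lborel (\<lambda>x. fy1 D x * ((?s x - 1/2) * x ^ j))" for j
    using sigmoid_bounds(3) by (intro fy1_integrable_bounded_power) auto
  note ip = fy1_integrable_power
  define a where "a = D / 2"
  define I0 where "I0 = (\<integral>x. fy1 D x * (?v x * x ^ 0) \<partial>lborel)"
  define I1 where "I1 = (\<integral>x. fy1 D x * (?v x * x ^ 2) \<partial>lborel)"
  have m: "(\<integral>x. fy1 D x * x ^ 0 \<partial>lborel) = 1" "(\<integral>x. fy1 D x * x ^ 2 \<partial>lborel) = a\<^sup>2 + 1"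
    "(\<integral>x. fy1 D x * x ^ 4 \<partial>lborel) = a ^ 4 + 6 * a\<^sup>2 + 3"
    "(\<integral>x. fy1 D x * ((?s x - 1/2) * x ^ 1) \<partial>lborel) = a / 2"
    "(\<integral>x. fy1 D x * ((?s x - 1/2) * x ^ 3) \<partial>lborel) = 1/2 * (a ^ 3 + 3 * a)"
    unfolding fy1_moments fy1_sigmoid_moments by (simp_all add: a_def)
  have D2: "D\<^sup>2 = 4 * a\<^sup>2" by (simp add: a_def power2_eq_square)
  have s2: "(?s x - 1/2)\<^sup>2 = 1/4 - ?v x" for x by (simp add: power2_eq_square algebra_simps)
  {
    \<comment> \<open>The regression coefficient: covariance a / 2 over variance a^2 + 1.\<close>
    define c where "c = a / (2 * (1 + a\<^sup>2))"
    have "0 \<le> (\<integral>x. fy1 D x * ((?s x - 1/2) - c * x)\<^sup>2 \<partial>lborel)"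
      using fy1_pos[of D] by (intro integral_nonneg_AE AE_I2 mult_nonneg_nonneg) (auto intro: less_imp_le)
    also have "(\<lambda>x. fy1 D x * ((?s x - 1/2) - c * x)\<^sup>2) = (\<lambda>x. 1/4 * (fy1 D x * x ^ 0) - fy1 D x * (?v x * x ^ 0)
        - 2 * c * (fy1 D x * ((?s x - 1/2) * x ^ 1)) + c\<^sup>2 * (fy1 D x * x ^ 2))"
    proof
      fix x
      have sq: "((?s x - 1/2) - c * x)\<^sup>2 = (?s x - 1/2)\<^sup>2 - 2 * c * ((?s x - 1/2) * x) + c\<^sup>2 * x\<^sup>2"
        by (simp add: power2_eq_square algebra_simps)
      show "fy1 D x * ((?s x - 1/2) - c * x)\<^sup>2 = 1/4 * (fy1 D x * x ^ 0) - fy1 D x * (?v x * x ^ 0)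
        - 2 * c * (fy1 D x * ((?s x - 1/2) * x ^ 1)) + c\<^sup>2 * (fy1 D x * x ^ 2)"
        unfolding sq s2 by (simp add: algebra_simps)
    qed
    also have "(\<integral>x. 1/4 * (fy1 D x * x ^ 0) - fy1 D x * (?v x * x ^ 0)
        - 2 * c * (fy1 D x * ((?s x - 1/2) * x ^ 1)) + c\<^sup>2 * (fy1 D x * x ^ 2) \<partial>lborel)
        = 1/4 * 1 - I0 - 2 * c * (a / 2) + c\<^sup>2 * (a\<^sup>2 + 1)"
      by (simp only: Bochner_Integration.integral_add Bochner_Integration.integral_diff integral_mult_right_zero
          Bochner_Integration.integrable_add Bochner_Integration.integrable_diff integrable_mult_right ip iv isg m I0_def)
    finally have "I0 \<le> 1/4 - c * a + c\<^sup>2 * (a\<^sup>2 + 1)" by simp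
    also have "1/4 - c * a + c\<^sup>2 * (a\<^sup>2 + 1) = 1 / (4 + D\<^sup>2)"
    proof -
      define r where "r = 1 + a\<^sup>2"
      have r: "r > 0" "a\<^sup>2 = r - 1" by (auto simp: r_def add_pos_nonneg)
      have "c * a = (r - 1) / (2 * r)" "c\<^sup>2 = (r - 1) / (4 * r\<^sup>2)"
        unfolding c_def r_def[symmetric] power_divide using r by (simp_all add: power2_eq_square)
      thus ?thesis unfolding D2 r(2) using r(1) by (simp add: field_simps power2_eq_square)
    qed
    finally show "(\<integral>x. fy1 D x * (?v x * x ^ 0) \<partial>lborel) \<le> 1 / (4 + D\<^sup>2)" by (simp only: I0_def)
  }
  {
    \<comment> \<open>The regression coefficient on x^2, with intercept \<open>b\<close> below: the
      covariance is a and the variance of x^2 is 4 a^2 + 2.\<close>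
    define c where "c = a / (4 * a\<^sup>2 + 2)"
    define b where "b = a / 2 - c * (1 + a\<^sup>2)"
    have "0 \<le> (\<integral>x. fy1 D x * ((?s x - 1/2) * x - b - c * x\<^sup>2)\<^sup>2 \<partial>lborel)"
      using fy1_pos[of D] by (intro integral_nonneg_AE AE_I2 mult_nonneg_nonneg) (auto intro: less_imp_le)
    also have "(\<lambda>x. fy1 D x * ((?s x - 1/2) * x - b - c * x\<^sup>2)\<^sup>2) = (\<lambda>x. 1/4 * (fy1 D x * x ^ 2) - fy1 D x * (?v x * x ^ 2)
        + b\<^sup>2 * (fy1 D x * x ^ 0) + c\<^sup>2 * (fy1 D x * x ^ 4) - 2 * b * (fy1 D x * ((?s x - 1/2) * x ^ 1))
        - 2 * c * (fy1 D x * ((?s x - 1/2) * x ^ 3)) + 2 * b * c * (fy1 D x * x ^ 2))"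
    proof
      fix x
      have sq: "((?s x - 1/2) * x - b - c * x\<^sup>2)\<^sup>2 = (?s x - 1/2)\<^sup>2 * x\<^sup>2 + b\<^sup>2 + c\<^sup>2 * x ^ 4 - 2 * b * ((?s x - 1/2) * x)
         - 2 * c * ((?s x - 1/2) * x ^ 3) + 2 * b * c * x\<^sup>2"
        by (simp add: power2_eq_square power3_eq_cube power4_eq_xxxx algebra_simps)
      show "fy1 D x * ((?s x - 1/2) * x - b - c * x\<^sup>2)\<^sup>2 = 1/4 * (fy1 D x * x ^ 2) - fy1 D x * (?v x * x ^ 2)
        + b\<^sup>2 * (fy1 D x * x ^ 0) + c\<^sup>2 * (fy1 D x * x ^ 4) - 2 * b * (fy1 D x * ((?s x - 1/2) * x ^ 1))
        - 2 * c * (fy1 D x * ((?s x - 1/2) * x ^ 3)) + 2 * b * c * (fy1 D x * x ^ 2)"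
        unfolding sq s2 by (simp add: algebra_simps)
    qed
    also have "(\<integral>x. 1/4 * (fy1 D x * x ^ 2) - fy1 D x * (?v x * x ^ 2)
        + b\<^sup>2 * (fy1 D x * x ^ 0) + c\<^sup>2 * (fy1 D x * x ^ 4) - 2 * b * (fy1 D x * ((?s x - 1/2) * x ^ 1))
        - 2 * c * (fy1 D x * ((?s x - 1/2) * x ^ 3)) + 2 * b * c * (fy1 D x * x ^ 2) \<partial>lborel)
        = 1/4 * (a\<^sup>2 + 1) - I1 + b\<^sup>2 * 1 + c\<^sup>2 * (a ^ 4 + 6 * a\<^sup>2 + 3) - 2 * b * (a / 2)
          - 2 * c * (1/2 * (a ^ 3 + 3 * a)) + 2 * b * c * (a\<^sup>2 + 1)"
      by (simp only: Bochner_Integration.integral_add Bochner_Integration.integral_diff integral_mult_right_zero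
          Bochner_Integration.integrable_add Bochner_Integration.integrable_diff integrable_mult_right ip iv isg m I1_def)
    finally have "I1 \<le> 1/4 * (a\<^sup>2 + 1) + b\<^sup>2 + c\<^sup>2 * (a ^ 4 + 6 * a\<^sup>2 + 3) - b * a - c * (a ^ 3 + 3 * a) + 2 * b * c * (a\<^sup>2 + 1)"
      by simp
    also have "\<dots> = 1/4 - 2 * c * a + c\<^sup>2 * (4 * a\<^sup>2 + 2)"
      unfolding b_def by (simp add: power2_eq_square power3_eq_cube power4_eq_xxxx field_simps)
    also have "\<dots> = 1 / (4 + 2 * D\<^sup>2)"
    proof -
      define r where "r = 4 * a\<^sup>2 + 2"
      have r: "r > 0" "a\<^sup>2 = (r - 2) / 4" by (auto simp: r_def add_nonneg_pos)
      have "c * a = a\<^sup>2 / r" "c\<^sup>2 = a\<^sup>2 / r\<^sup>2"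
        unfolding c_def r_def[symmetric] by (simp_all add: power_divide power2_eq_square)
      hence "c * a = (r - 2) / (4 * r)" "c\<^sup>2 = (r - 2) / (4 * r\<^sup>2)"
        unfolding r(2) by simp_all
      hence "1/4 - 2 * (c * a) + c\<^sup>2 * r = 1 / (2 * r)" using r(1) by (simp add: field_simps power2_eq_square)
      thus ?thesis unfolding D2 by (simp add: r_def algebra_simps)
    qed
    finally show "(\<integral>x. fy1 D x * (?v x * x ^ 2) \<partial>lborel) \<le> 1 / (4 + 2 * D\<^sup>2)" by (simp only: I1_def)
  }
qed

section \<open>Information lost through missing labels\<close>

context canon
begin

lemma E1_eq:
  assumes hm: "\<And>z m. (\<lambda>x. h x z m) \<in> borel_measurable borel" and hb: "\<And>x z m. \<bar>h x z m\<bar> \<le> C * (1 + \<bar>x\<bar>) ^ j"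
  shows "E1 h = (\<integral>x. fy1 D x * (Q x * (sigmoid (D * x) * h x Class1 True + (1 - sigmoid (D * x)) * h x Class2 True)
      + (1 - Q x) * (sigmoid (D * x) * h x Class1 False + (1 - sigmoid (D * x)) * h x Class2 False)) \<partial>lborel)"
proof -
  have i: "integrable lborel (\<lambda>x. 1/2 * (normal_density (cmu D z) 1 x * ((if m then Q x else 1 - Q x) * h x z m)))" for z m
  proof (intro integrable_mult_right integrable_normal_mult)
    have [measurable]: "(\<lambda>x. if m then Q x else 1 - Q x) \<in> borel_measurable borel" by (cases m) auto
    show "(\<lambda>x. (if m then Q x else 1 - Q x) * h x z m) \<in> borel_measurable borel" using hm[of z m] by measurable
    show "\<bar>(if m then Q x else 1 - Q x) * h x z m\<bar> \<le> C * (1 + \<bar>x\<bar>) ^ j" for x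
    proof -
      have q: "0 \<le> (if m then Q x else 1 - Q x)" "(if m then Q x else 1 - Q x) \<le> 1"
        using Q_nonneg[of x] Q_less_1[of x] by auto
      have "(if m then Q x else 1 - Q x) * \<bar>h x z m\<bar> \<le> 1 * \<bar>h x z m\<bar>" by (rule mult_right_mono[OF q(2)]) simp
      thus ?thesis using hb[of x z m] q(1) unfolding abs_mult by linarith
    qed
  qed
  have "E1 h = (\<integral>x. (\<Sum>z\<in>UNIV. \<Sum>m\<in>UNIV. 1/2 * (normal_density (cmu D z) 1 x * ((if m then Q x else 1 - Q x) * h x z m))) \<partial>lborel)"
    unfolding E1_def using i by (simp only: Bochner_Integration.integral_sum Bochner_Integration.integrable_sum)
  also have "\<dots> = (\<integral>x. fy1 D x * (Q x * (sigmoid (D * x) * h x Class1 True + (1 - sigmoid (D * x)) * h x Class2 True)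
      + (1 - Q x) * (sigmoid (D * x) * h x Class1 False + (1 - sigmoid (D * x)) * h x Class2 False)) \<partial>lborel)"
  proof (rule Bochner_Integration.integral_cong[OF refl])
    fix x
    have e: "1/2 * (normal_density (cmu D z) 1 x * u) = (if z = Class1 then sigmoid (D * x) else 1 - sigmoid (D * x)) * fy1 D x * u" for z u
      using half_normal_eq_sigmoid[of D x] by (cases z) (simp_all only: mult.assoc[symmetric] cmu.simps if_True label.distinct if_False simp_thms)
    show "(\<Sum>z\<in>UNIV. \<Sum>m\<in>UNIV. 1/2 * (normal_density (cmu D z) 1 x * ((if m then Q x else 1 - Q x) * h x z m)))
      = fy1 D x * (Q x * (sigmoid (D * x) * h x Class1 True + (1 - sigmoid (D * x)) * h x Class2 True)
      + (1 - Q x) * (sigmoid (D * x) * h x Class1 False + (1 - sigmoid (D * x)) * h x Class2 False))"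
      unfolding e by (simp add: sum_label UNIV_bool algebra_simps)
  qed
  finally show ?thesis .
qed

definition I0 :: real where
  "I0 = (\<integral>x. fy1 D x * (Q x * (sigmoid (D * x) * (1 - sigmoid (D * x))) * x ^ 0) \<partial>lborel)"

text \<open>The counterpart of \<open>I0\<close> for coordinate \<open>k\<close>. It serves to show
  that the coefficient of this coordinate, too, is of the order of the sample deviation.\<close>

definition I1 :: real where
  "I1 = (\<integral>x. fy1 D x * (Q x * (sigmoid (D * x) * (1 - sigmoid (D * x))) * x ^ 2) \<partial>lborel)"

lemma Qv_bounds: "\<bar>Q x * (sigmoid (D * x) * (1 - sigmoid (D * x)))\<bar> \<le> 1"
proof -
  have "\<bar>Q x * (sigmoid (D * x) * (1 - sigmoid (D * x)))\<bar> = Q x * (sigmoid (D * x) * (1 - sigmoid (D * x)))"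
    using Q_nonneg[of x] sigmoid_bounds(1)[of "D * x"] by (simp only: abs_of_nonneg mult_nonneg_nonneg)
  also have "\<dots> \<le> 1 * 1"
    using Q_nonneg[of x] Q_less_1[of x] sigmoid_bounds(1,2)[of "D * x"] by (intro mult_mono) auto
  finally show ?thesis by simp
qed

lemma fy1_Qv_integrable: "integrable lborel (\<lambda>x. fy1 D x * (Q x * (sigmoid (D * x) * (1 - sigmoid (D * x))) * x ^ j))"
  using Qv_bounds by (intro fy1_integrable_bounded_power) auto

text \<open>Since \<open>Q x < 1\<close>, the difference of the integrands is positive except
  possibly at 0. The bounds for unlabelled data thus become strict, which keeps the linearized
  equations solvable.\<close>

lemma information_loss_less:
  assumes "j = 0 \<or> j = 2"
  shows "(\<integral>x. fy1 D x * (Q x * (sigmoid (D * x) * (1 - sigmoid (D * x))) * x ^ j) \<partial>lborel)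
     < (\<integral>x. fy1 D x * (sigmoid (D * x) * (1 - sigmoid (D * x)) * x ^ j) \<partial>lborel)"
proof -
  let ?v = "\<lambda>x. sigmoid (D * x) * (1 - sigmoid (D * x))"
  have iv: "integrable lborel (\<lambda>x. fy1 D x * (?v x * x ^ j))"
    using sigmoid_bounds(1,2) by (intro fy1_integrable_bounded_power) auto
  define g where "g x = fy1 D x * (?v x * x ^ j) - fy1 D x * (Q x * ?v x * x ^ j)" for x
  have geq: "g x = fy1 D x * ((1 - Q x) * (?v x * x ^ j))" for x by (simp add: g_def algebra_simps)
  have vpos: "?v x > 0" for x using sigmoid_pos sigmoid_less_1 by (intro mult_pos_pos) auto
  have xj: "x ^ j \<ge> 0" for x :: real using assms by auto
  have gnn: "g x \<ge> 0" for x
    unfolding geq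
    by (rule mult_nonneg_nonneg[OF less_imp_le[OF fy1_pos] mult_nonneg_nonneg[OF _ mult_nonneg_nonneg[OF less_imp_le[OF vpos] xj]]])
       (use Q_less_1[of x] in simp)
  have ig: "integrable lborel g" unfolding g_def by (intro Bochner_Integration.integrable_diff iv fy1_Qv_integrable)
  have "(\<integral>x. g x \<partial>lborel) \<noteq> 0"
  proof
    assume "(\<integral>x. g x \<partial>lborel) = 0"
    hence "AE x in lborel. g x = 0" using ig gnn by (subst (asm) integral_nonneg_eq_0_iff_AE) auto
    hence "AE x in lborel. x = (0::real)"
    proof eventually_elim
      case (elim x)
      have "x ^ j = 0" using elim fy1_pos[of D x] Q_less_1[of x] vpos[of x] unfolding geq mult_eq_0_iff by auto
      thus ?case by simp
    qed
    hence "AE x in lborel. \<not> (x = (0::real)) \<longrightarrow> False" by eventually_elim simp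
    moreover have "AE x in lborel. x \<noteq> (0::real)" by (rule AE_lborel_singleton)
    ultimately have "AE x in (lborel :: real measure). False" by eventually_elim blast
    thus False by (simp add: eventually_False ae_filter_eq_bot_iff)
  qed
  moreover have "(\<integral>x. g x \<partial>lborel) \<ge> 0" using gnn by (intro integral_nonneg_AE) auto
  ultimately have "(\<integral>x. g x \<partial>lborel) > 0" by linarith
  thus ?thesis unfolding g_def using iv fy1_Qv_integrable[of j] by simp
qed

lemma I0_bound: "(4 + D\<^sup>2) * I0 < 1" and I1_bound: "(4 + 2 * D\<^sup>2) * I1 < 1"
proof -
  have p: "4 + D\<^sup>2 > 0" "4 + 2 * D\<^sup>2 > 0" by (simp_all add: add_pos_nonneg)
  have "I0 < 1 / (4 + D\<^sup>2)"
    using information_loss_less[of 0] fy1_information_bounds(1)[of D] unfolding I0_def by linarith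
  thus "(4 + D\<^sup>2) * I0 < 1" using p(1) by (simp add: field_simps)
  have "I1 < 1 / (4 + 2 * D\<^sup>2)"
    using information_loss_less[of 2] fy1_information_bounds(2)[of D] unfolding I1_def by linarith
  thus "(4 + 2 * D\<^sup>2) * I1 < 1" using p(2) by (simp add: field_simps)
qed

definition w0 :: "real \<Rightarrow> label \<Rightarrow> bool \<Rightarrow> real" where
  "w0 x z m = (if m then sigmoid (D * x) else of_bool (z = Class1))"

lemma w0_measurable [measurable]: "(\<lambda>x. w0 x z m) \<in> borel_measurable borel"
  unfolding w0_def by (cases m) auto

lemma w0_bound: "\<bar>w0 x z m - 1/2\<bar> \<le> 1"
  using sigmoid_bounds(3)[of "D * x"] by (cases z) (auto simp: w0_def)

lemma E1_power:
  "E1 (\<lambda>x z m. x ^ j) = (\<integral>x. fy1 D x * x ^ j \<partial>lborel)"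
proof -
  have "\<bar>x ^ j\<bar> \<le> 1 * (1 + \<bar>x\<bar>) ^ j" for x :: real by (simp add: power_abs power_mono)
  thus ?thesis
    by (subst E1_eq[of _ 1 j]) (auto simp: algebra_simps intro!: Bochner_Integration.integral_cong)
qed

lemma E1_w0_power:
  "E1 (\<lambda>x z m. (w0 x z m - 1/2) * x ^ j) = (\<integral>x. fy1 D x * ((sigmoid (D * x) - 1/2) * x ^ j) \<partial>lborel)"
proof -
  have "\<bar>(w0 x z m - 1/2) * x ^ j\<bar> \<le> 1 * (1 + \<bar>x\<bar>) ^ j" for x z m
    unfolding abs_mult power_abs by (intro mult_mono w0_bound power_mono) auto
  thus ?thesis
    by (subst E1_eq[of _ 1 j])
       (measurable, rule Bochner_Integration.integral_cong[OF refl], simp add: w0_def field_simps)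
qed

lemma E1_missing_power:
  "E1 (\<lambda>x z m. (of_bool m * (sigmoid (D * x) * (1 - sigmoid (D * x)))) * x ^ j)
    = (\<integral>x. fy1 D x * (Q x * (sigmoid (D * x) * (1 - sigmoid (D * x))) * x ^ j) \<partial>lborel)"
proof -
  have "\<bar>(of_bool m * (sigmoid (D * x) * (1 - sigmoid (D * x)))) * x ^ j\<bar> \<le> 1 * (1 + \<bar>x\<bar>) ^ j" for x m
    unfolding abs_mult[of _ "x ^ j"] power_abs
    using sigmoid_bounds(1,2)[of "D * x"] by (intro mult_mono power_mono) auto
  moreover have "(\<lambda>x. (of_bool m * (sigmoid (D * x) * (1 - sigmoid (D * x)))) * x ^ j) \<in> borel_measurable borel" for m :: bool
    by measurable
  ultimately show ?thesis
    by (subst E1_eq[of _ 1 j]) (auto simp: algebra_simps intro!: Bochner_Integration.integral_cong)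
qed

text \<open>Up to the factor 4 + D^2, the residual of the class weight minus 1/2 after linear
  regression on coordinate \<open>k\<close>, whose regression coefficient is D / (4 + D^2).
  Multiplied by 1 or by another coordinate it becomes the summand of the corresponding
  score.\<close>

definition psi :: "real \<Rightarrow> label \<Rightarrow> bool \<Rightarrow> real" where
  "psi x z m = (4 + D\<^sup>2) * (w0 x z m - 1/2) - D * x"

lemma psi_measurable: "(\<lambda>x. psi x z m) \<in> borel_measurable borel"
  unfolding psi_def by measurable

lemma psi_bound: "\<bar>psi x z m\<bar> \<le> (4 + D\<^sup>2 + D) * (1 + \<bar>x\<bar>) ^ 1"
proof -
  have psi1: "\<bar>(4 + D\<^sup>2) * (w0 x z m - 1/2)\<bar> \<le> (4 + D\<^sup>2) * 1"
    unfolding abs_mult using w0_bound[of x z m] by (intro mult_mono) auto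
  have psi2: "\<bar>D * x\<bar> = D * \<bar>x\<bar>" using D_pos by (simp add: abs_mult)
  have "\<bar>psi x z m\<bar> \<le> (4 + D\<^sup>2) + D * \<bar>x\<bar>"
  proof -
    have "\<bar>A - B\<bar> \<le> c + d" if "\<bar>A\<bar> \<le> c * 1" "\<bar>B\<bar> = d" for A B c d :: real
      using that by linarith
    from this[OF psi1 psi2] show ?thesis by (simp only: psi_def)
  qed
  also have "\<dots> \<le> (4 + D\<^sup>2) + D * \<bar>x\<bar> + ((4 + D\<^sup>2) * \<bar>x\<bar> + D)" using D_pos by simp
  finally show ?thesis by (simp add: algebra_simps)
qed

text \<open>The second moment of the class weight around 1/2 is 1/4 - I0: an observed label
  contributes 1/4, and replacing a missing one by its posterior probability removes exactly its
  conditional variance.\<close>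

lemma E1_psi_squared: "E1 (\<lambda>x z m. (psi x z m)\<^sup>2) = (4 + D\<^sup>2) * (1 - (4 + D\<^sup>2) * I0)"
proof -
  let ?s = "\<lambda>x. sigmoid (D * x)"
  let ?v = "\<lambda>x. ?s x * (1 - ?s x)"
  define c where "c = 4 + D\<^sup>2"
  have isg: "integrable lborel (\<lambda>x. fy1 D x * ((?s x - 1/2) * x ^ j))" for j
    using sigmoid_bounds(3) by (intro fy1_integrable_bounded_power) auto
  have "E1 (\<lambda>x z m. (psi x z m)\<^sup>2) = (\<integral>x. fy1 D x * (Q x * (?s x * (psi x Class1 True)\<^sup>2 + (1 - ?s x) * (psi x Class2 True)\<^sup>2)
      + (1 - Q x) * (?s x * (psi x Class1 False)\<^sup>2 + (1 - ?s x) * (psi x Class2 False)\<^sup>2)) \<partial>lborel)"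
  proof (rule E1_eq)
    show "(\<lambda>x. (psi x z m)\<^sup>2) \<in> borel_measurable borel" for z m using psi_measurable[of z m] by measurable
    show "\<bar>(psi x z m)\<^sup>2\<bar> \<le> (4 + D\<^sup>2 + D)\<^sup>2 * (1 + \<bar>x\<bar>) ^ 2" for x z m
      using power_mono[OF psi_bound[of x z m], of 2] by (simp add: power_mult_distrib)
  qed
  also have "\<dots> = (\<integral>x. c\<^sup>2 / 4 * (fy1 D x * x ^ 0) - c\<^sup>2 * (fy1 D x * (Q x * ?v x * x ^ 0))
      - 2 * c * D * (fy1 D x * ((?s x - 1/2) * x ^ 1)) + D\<^sup>2 * (fy1 D x * x ^ 2) \<partial>lborel)"
  proof (rule Bochner_Integration.integral_cong[OF refl])
    fix x
    define s where "s = ?s x"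
    show "fy1 D x * (Q x * (?s x * (psi x Class1 True)\<^sup>2 + (1 - ?s x) * (psi x Class2 True)\<^sup>2)
      + (1 - Q x) * (?s x * (psi x Class1 False)\<^sup>2 + (1 - ?s x) * (psi x Class2 False)\<^sup>2))
      = c\<^sup>2 / 4 * (fy1 D x * x ^ 0) - c\<^sup>2 * (fy1 D x * (Q x * ?v x * x ^ 0))
      - 2 * c * D * (fy1 D x * ((?s x - 1/2) * x ^ 1)) + D\<^sup>2 * (fy1 D x * x ^ 2)"
      unfolding psi_def w0_def c_def[symmetric] s_def[symmetric]
      by (simp add: power2_eq_square algebra_simps) (simp add: field_simps)
  qed
  also have "\<dots> = c\<^sup>2 / 4 * 1 - c\<^sup>2 * I0 - 2 * c * D * (D / 4) + D\<^sup>2 * ((D/2)\<^sup>2 + 1)"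
    by (simp only: Bochner_Integration.integral_add Bochner_Integration.integral_diff integral_mult_right_zero
          Bochner_Integration.integrable_add Bochner_Integration.integrable_diff integrable_mult_right
          fy1_integrable_power isg fy1_Qv_integrable fy1_moments fy1_sigmoid_moments I0_def)
  also have "\<dots> = c * (1 - c * I0)"
  proof -
    have D2: "D\<^sup>2 = c - 4" by (simp add: c_def)
    have "2 * c * D * (D / 4) = c * D\<^sup>2 / 2" "D\<^sup>2 * ((D/2)\<^sup>2 + 1) = D\<^sup>2 * D\<^sup>2 / 4 + D\<^sup>2"
      by (simp_all add: power2_eq_square field_simps)
    thus ?thesis unfolding D2 by (simp add: power2_eq_square field_simps)
  qed
  finally show ?thesis by (simp add: c_def)
qed

end

section \<open>Linearization of the EM equations\<close>

context weighted_sample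
begin

lemma avg_cwt_component:
  assumes "wprior i \<noteq> 0"
  shows "avg n x (\<lambda>a. cwt u i a * fst a $ j) = wprior i * wmean i $ j"
  using assms by (simp add: wmean_def)

lemma wcov_component:
  assumes "\<And>i. wprior i \<noteq> 0"
  shows "wcov $ k $ l = avg n x (\<lambda>a. fst a $ k * fst a $ l) - (\<Sum>i\<in>UNIV. wprior i * (wmean i $ k * wmean i $ l))"
proof -
  have "avg n x (\<lambda>a. cwt u i a * ((fst a - wmean i) $ k * (fst a - wmean i) $ l))
     = avg n x (\<lambda>a. cwt u i a * (fst a $ k * fst a $ l)) - wprior i * (wmean i $ k * wmean i $ l)" for i
  proof -
    have "avg n x (\<lambda>a. cwt u i a * ((fst a - wmean i) $ k * (fst a - wmean i) $ l)) =
      avg n x (\<lambda>a. cwt u i a * (fst a $ k * fst a $ l) - wmean i $ l * (cwt u i a * fst a $ k)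
        - wmean i $ k * (cwt u i a * fst a $ l) + (wmean i $ k * wmean i $ l) * cwt u i a)"
      by (simp add: algebra_simps)
    also have "\<dots> = avg n x (\<lambda>a. cwt u i a * (fst a $ k * fst a $ l)) - wmean i $ l * (wprior i * wmean i $ k)
        - wmean i $ k * (wprior i * wmean i $ l) + (wmean i $ k * wmean i $ l) * wprior i"
      by (simp only: avg_add avg_diff avg_cmult avg_cwt_component[OF assms] wprior_def[symmetric])
    finally show ?thesis by (simp add: algebra_simps)
  qed
  hence "wcov $ k $ l = (\<Sum>i\<in>UNIV. avg n x (\<lambda>a. cwt u i a * (fst a $ k * fst a $ l)) - wprior i * (wmean i $ k * wmean i $ l))"
    unfolding wcov_def by simp
  also have "\<dots> = (\<Sum>i\<in>UNIV. avg n x (\<lambda>a. cwt u i a * (fst a $ k * fst a $ l))) - (\<Sum>i\<in>UNIV. wprior i * (wmean i $ k * wmean i $ l))"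
    by (rule sum_subtractf)
  also have "(\<Sum>i\<in>UNIV. avg n x (\<lambda>a. cwt u i a * (fst a $ k * fst a $ l))) = avg n x (\<lambda>a. fst a $ k * fst a $ l)"
    by (simp add: sum_label avg_add[symmetric] algebra_simps)
  finally show ?thesis .
qed

end

text \<open>The stationarity equations of the likelihood, solved for the discriminant coefficients and freed of
  denominators so that they are polynomial apart from the logit of the estimated prior.\<close>
definition EM_equations :: "nat \<Rightarrow> (nat \<Rightarrow> 'p::finite obs) \<Rightarrow> real \<times> (real^'p) \<Rightarrow> bool" where
  "EM_equations n x b \<longleftrightarrow> (let W = avg n x (resp b); Y = (\<lambda>i. avg n x (\<lambda>a. fst a $ i));
       C = (\<lambda>i. avg n x (\<lambda>a. resp b a * fst a $ i) - W * Y i); T = (\<lambda>i j. avg n x (\<lambda>a. fst a $ i * fst a $ j)) in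
     (\<forall>i. W * (1 - W) * (\<Sum>j\<in>UNIV. (T i j - Y i * Y j) * snd b $ j) = C i * (1 + (\<Sum>j\<in>UNIV. C j * snd b $ j))) \<and>
     W * (1 - W) * fst b = W * (1 - W) * ln (W / (1 - W)) - W * (1 - W) * (\<Sum>j\<in>UNIV. Y j * snd b $ j)
        + (W - 1/2) * (\<Sum>j\<in>UNIV. C j * snd b $ j))"

text \<open>The total covariance is the within-class covariance plus w (1 - w) times the outer
  square of the mean difference p - q, and \<open>C\<close> is w (1 - w) (p - q). The within-class
  covariance maps the slope to p - q, so after multiplication by w (1 - w) only \<open>C\<close> and
  plain averages remain.\<close>

lemma EM_equations_of_fixed_point:
  fixes b :: "real \<times> (real^'p::finite)"
  assumes n: "n > 0" and W: "\<And>i. weighted_sample.wprior n x (resp b) i > 0"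
    and S: "pos_def_matrix (weighted_sample.wcov n x (resp b))"
    and b: "b = cbeta (weighted_sample.wparam n x (resp b))"
  shows "EM_equations n x b"
proof -
  interpret weighted_sample n x "resp b" .
  define w where "w = wprior Class1"
  have w2: "wprior Class2 = 1 - w" using wprior_sum[OF n] by (simp add: w_def)
  have Wne: "wprior i \<noteq> 0" for i using W[of i] by simp
  have cp: "cprior wparam i = wprior i" "cmean wparam i = wmean i" "cprec wparam = matrix_inv wcov" for i
    using wprior_sum[OF n] by (cases i; simp add: wparam_def cprec_def)+
  define p q where "p = wmean Class1" and "q = wmean Class2"
  define b1 where "b1 = snd b"
  have "b1 = matrix_inv wcov *v (p - q)"
    unfolding b1_def by (subst b) (simp add: cbeta_def Let_def cp p_def q_def del: cprior.simps cmean.simps)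
  hence Sb: "wcov *v b1 = p - q"
    by (simp add: matrix_vector_mul_assoc matrix_inv_right[OF pos_def_matrix_invertible[OF S]])
  have b0: "fst b = ln (w / (1 - w)) - 1/2 * (\<Sum>j\<in>UNIV. (p $ j + q $ j) * b1 $ j)"
  proof -
    have "fst b = ln (w / (1 - w)) - 1/2 * ((p + q) \<bullet> (matrix_inv wcov *v (p - q)))"
      by (subst b) (simp add: cbeta_def Let_def cp p_def q_def w_def w2[unfolded w_def] del: cprior.simps cmean.simps)
    thus ?thesis using \<open>b1 = matrix_inv wcov *v (p - q)\<close> by (simp add: inner_vec_def)
  qed
  have Wavg: "avg n x (resp b) = w" by (simp add: w_def wprior_def cwt.simps[abs_def])
  have U: "avg n x (\<lambda>a. resp b a * fst a $ i) = w * p $ i" for i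
    using avg_cwt_component[OF Wne, of Class1 i] by (simp add: w_def p_def)
  have Y: "avg n x (\<lambda>a. fst a $ i) = w * p $ i + (1 - w) * q $ i" for i
  proof -
    have "avg n x (\<lambda>a. fst a $ i) = avg n x (\<lambda>a. cwt (resp b) Class1 a * fst a $ i) + avg n x (\<lambda>a. cwt (resp b) Class2 a * fst a $ i)"
      by (simp add: avg_add[symmetric] algebra_simps)
    thus ?thesis unfolding avg_cwt_component[OF Wne] by (simp add: w2 w_def[symmetric] p_def q_def)
  qed
  have C: "avg n x (\<lambda>a. resp b a * fst a $ i) - w * avg n x (\<lambda>a. fst a $ i) = w * (1 - w) * (p $ i - q $ i)" for i
    unfolding U Y by algebra
  have TY: "avg n x (\<lambda>a. fst a $ i * fst a $ j) - avg n x (\<lambda>a. fst a $ i) * avg n x (\<lambda>a. fst a $ j)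
      = wcov $ i $ j + w * (1 - w) * ((p $ i - q $ i) * (p $ j - q $ j))" for i j
  proof -
    have "avg n x (\<lambda>a. fst a $ i * fst a $ j) = wcov $ i $ j + (w * (p $ i * p $ j) + (1 - w) * (q $ i * q $ j))"
      using wcov_component[OF Wne, of i j] by (simp add: sum_label w2 w_def[symmetric] p_def q_def)
    thus ?thesis unfolding Y by algebra
  qed
  define s where "s = (\<Sum>j\<in>UNIV. (p $ j - q $ j) * b1 $ j)"
  have Cs: "(\<Sum>j\<in>UNIV. w * (1 - w) * (p $ j - q $ j) * b1 $ j) = w * (1 - w) * s"
    by (simp add: s_def sum_distrib_left mult.assoc)
  have TYs: "(\<Sum>j\<in>UNIV. (wcov $ i $ j + w * (1 - w) * ((p $ i - q $ i) * (p $ j - q $ j))) * b1 $ j)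
      = (p $ i - q $ i) + w * (1 - w) * (p $ i - q $ i) * s" for i
  proof -
    have "(\<Sum>j\<in>UNIV. wcov $ i $ j * b1 $ j) = p $ i - q $ i"
      using Sb by (simp add: vec_eq_iff matrix_vector_mult_def)
    moreover have "(wcov $ i $ j + w * (1 - w) * ((p $ i - q $ i) * (p $ j - q $ j))) * b1 $ j
       = wcov $ i $ j * b1 $ j + w * (1 - w) * (p $ i - q $ i) * ((p $ j - q $ j) * b1 $ j)" for j
      by algebra
    ultimately show ?thesis
      by (simp only: s_def sum.distrib sum_distrib_left[symmetric])
  qed
  \<comment> \<open>The overall mean differs from the midpoint of the class means by w - 1/2 times p
    - q; this replaces the midpoint in the intercept by a plain average.\<close>
  have "(\<Sum>j\<in>UNIV. (w * p $ j + (1 - w) * q $ j) * b1 $ j) = 1/2 * (\<Sum>j\<in>UNIV. (p $ j + q $ j) * b1 $ j) + (w - 1/2) * s"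
    unfolding s_def sum_distrib_left sum.distrib[symmetric] by (rule sum.cong) (simp_all add: field_simps)
  note Ysum = this
  have B: "w * (1 - w) * fst b = w * (1 - w) * ln (w / (1 - w)) - w * (1 - w) * (\<Sum>j\<in>UNIV. (w * p $ j + (1 - w) * q $ j) * b1 $ j)
        + (w - 1/2) * (w * (1 - w) * s)"
  proof -
    have "v * (l - 1/2 * P) = v * l - v * (1/2 * P + (w - 1/2) * s) + (w - 1/2) * (v * s)" for v l P :: real
      by algebra
    thus ?thesis unfolding b0 Ysum .
  qed
  show ?thesis
    unfolding EM_equations_def Let_def Wavg C TY b1_def[symmetric] Cs TYs
    using B unfolding Y by (simp add: algebra_simps)
qed

text \<open>The derivative of the logistic function is itself 1-Lipschitz, so subtracting the
  tangent slope at \<open>t\<close> leaves a function whose derivative is at most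
  \<open>\<bar>d\<bar>\<close> on the segment.\<close>

lemma sigmoid_taylor: "\<bar>sigmoid (t + d) - sigmoid t - sigmoid t * (1 - sigmoid t) * d\<bar> \<le> d\<^sup>2"
proof -
  have p: "1 + exp x \<noteq> (0::real)" for x using exp_gt_zero[of x] by linarith
  have d1: "(sigmoid has_real_derivative sigmoid x * (1 - sigmoid x)) (at x)" for x
  proof -
    have "(sigmoid has_real_derivative (exp x * (1 + exp x) - exp x * exp x) / ((1 + exp x) * (1 + exp x))) (at x)"
      unfolding sigmoid_def[abs_def] using p by (auto intro!: derivative_eq_intros)
    moreover have "(exp x * (1 + exp x) - exp x * exp x) / ((1 + exp x) * (1 + exp x)) = sigmoid x * (1 - sigmoid x)"
      using p[of x] by (simp add: sigmoid_def field_simps)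
    ultimately show ?thesis by simp
  qed
  define v where "v x = sigmoid x * (1 - sigmoid x)" for x
  have d2: "(v has_real_derivative v x * (1 - 2 * sigmoid x)) (at x)" for x
    unfolding v_def[abs_def] by (rule derivative_eq_intros refl d1)+ (simp add: v_def algebra_simps)
  have vb: "\<bar>v x * (1 - 2 * sigmoid x)\<bar> \<le> 1" for x
  proof -
    have "\<bar>v x\<bar> \<le> 1" using sigmoid_bounds(1,2)[of x] by (simp add: v_def)
    moreover have "\<bar>1 - 2 * sigmoid x\<bar> \<le> 1" using sigmoid_pos[of x] sigmoid_less_1[of x] by (simp add: abs_le_iff)
    ultimately show ?thesis unfolding abs_mult using mult_mono[of "\<bar>v x\<bar>" 1 "\<bar>1 - 2 * sigmoid x\<bar>" 1] by simp
  qed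
  have vL: "\<bar>v x - v y\<bar> \<le> \<bar>x - y\<bar>" for x y
    using field_differentiable_bound[of UNIV v "\<lambda>x. v x * (1 - 2 * sigmoid x)" 1 x y] d2 vb by simp
  define g where "g x = sigmoid x - v t * x" for x
  have dg: "(g has_real_derivative v x - v t) (at x)" for x
    unfolding g_def[abs_def] by (rule derivative_eq_intros refl d1)+ (simp add: v_def)
  have "\<bar>g (t + d) - g t\<bar> \<le> \<bar>d\<bar> * \<bar>(t + d) - t\<bar>"
  proof -
    let ?I = "closed_segment t (t + d)"
    have "norm (g (t + d) - g t) \<le> \<bar>d\<bar> * norm ((t + d) - t)"
    proof (rule field_differentiable_bound[of ?I g "\<lambda>x. v x - v t"])
      show "(g has_field_derivative v z - v t) (at z within ?I)" for z by (rule DERIV_subset[OF dg]) simp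
      show "norm (v z - v t) \<le> \<bar>d\<bar>" if "z \<in> ?I" for z
      proof -
        have "\<bar>z - t\<bar> \<le> \<bar>d\<bar>" using that by (auto simp: closed_segment_eq_real_ivl split: if_splits)
        thus ?thesis using vL[of z t] by simp
      qed
    qed auto
    thus ?thesis by simp
  qed
  thus ?thesis by (simp add: g_def v_def power2_eq_square algebra_simps)
qed

section \<open>First-order expansion of the E step at the truth\<close>

context canon
begin

abbreviation \<beta>0 :: "real \<times> (real^'p)" where
  "\<beta>0 \<equiv> (0, D *\<^sub>R axis k 1)"

lemma cbeta_canon: "cbeta (canon_param k D) = \<beta>0"
proof -
  have "(D/2) *\<^sub>R axis k 1 - (- (D/2)) *\<^sub>R axis k 1 = D *\<^sub>R (axis k 1 :: real^'p)"
    by (simp only: scaleR_left_diff_distrib[symmetric]) simp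
  moreover have "(D/2) *\<^sub>R axis k 1 + (- (D/2)) *\<^sub>R axis k 1 = (0 :: real^'p)"
    by (simp only: scaleR_left_distrib[symmetric]) simp
  ultimately show ?thesis
    by (simp add: cbeta_def Let_def canon_param_def cprec_def)
qed

lemma resp_\<beta>0: "resp \<beta>0 a = w0 (fst a $ k) (fst (snd a)) (snd (snd a))"
  by (cases a) (auto simp: resp_def w0_def discr_def inner_axis' mult.commute)

text \<open>Index \<open>None\<close> stands for the intercept.\<close>
definition ext_coord :: "'p option \<Rightarrow> 'p obs \<Rightarrow> real" where
  "ext_coord l a = (case l of None \<Rightarrow> 1 | Some i \<Rightarrow> fst a $ i)"

definition coef_dev :: "real \<times> (real^'p) \<Rightarrow> 'p option \<Rightarrow> real" where
  "coef_dev b l = (case l of None \<Rightarrow> fst b | Some i \<Rightarrow> snd b $ i - (if i = k then D else 0))"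

lemma sum_option: "(\<Sum>l\<in>UNIV. f l) = f None + (\<Sum>i\<in>UNIV. f (Some i))" for f :: "'p option \<Rightarrow> real"
  unfolding UNIV_option_conv by (subst sum.insert) (auto simp: sum.reindex)

lemma discr_coef_dev: "discr b (fst a) = D * fst a $ k + (\<Sum>l\<in>UNIV. coef_dev b l * ext_coord l a)"
proof -
  have "(\<Sum>i\<in>UNIV. (snd b $ i - (if i = k then D else 0)) * fst a $ i)
      = (\<Sum>i\<in>UNIV. snd b $ i * fst a $ i) - (\<Sum>i\<in>UNIV. (if i = k then D else 0) * fst a $ i)"
    by (simp add: left_diff_distrib sum_subtractf)
  also have "(\<Sum>i\<in>UNIV. (if i = k then D else 0) * fst a $ i) = D * fst a $ k"
    by (simp add: if_distribR if_distrib cong: if_cong)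
  finally show ?thesis by (simp add: discr_def sum_option coef_dev_def ext_coord_def inner_vec_def)
qed

lemma abs_ext_coord_le: "\<bar>ext_coord l a\<bar> \<le> 1 + norm (fst a)"
proof (cases l)
  case (Some i)
  thus ?thesis using component_le_norm_cart[of "fst a" i] by (simp add: ext_coord_def)
qed (simp add: ext_coord_def)

lemma ext_coord_poly_growth: "ext_coord l \<in> poly_growth"
  by (cases l) (auto simp: ext_coord_def[abs_def] poly_growth_const poly_growth_component)

text \<open>The conditional variance of a label that is not observed, which is also the derivative
  of the E step weight with respect to the discriminant.\<close>

definition missing_var :: "'p obs \<Rightarrow> real" where
  "missing_var a = of_bool (snd (snd a)) * (sigmoid (D * fst a $ k) * (1 - sigmoid (D * fst a $ k)))"

lemma missing_var_bounds: "0 \<le> missing_var a" "missing_var a \<le> 1"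
  using sigmoid_bounds(1,2)[of "D * fst a $ k"] by (auto simp: missing_var_def)

lemma missing_var_poly_growth: "missing_var \<in> poly_growth"
proof (rule poly_growth_bounded[of _ 1])
  show "missing_var \<in> borel_measurable obs_space" unfolding missing_var_def[abs_def] by (rule obs_measurableI) simp
qed (use missing_var_bounds in simp)

lemma resp_expansion:
  "\<bar>resp b a - resp \<beta>0 a - missing_var a * (\<Sum>m\<in>UNIV. coef_dev b m * ext_coord m a)\<bar> \<le> (\<Sum>m\<in>UNIV. \<bar>coef_dev b m\<bar>)\<^sup>2 * (1 + norm (fst a))\<^sup>2"
proof -
  obtain y z m where a: "a = (y, z, m)" by (cases a) auto
  let ?d = "\<Sum>m\<in>UNIV. coef_dev b m * ext_coord m a"
  have "\<bar>?d\<bar> \<le> (\<Sum>m\<in>UNIV. \<bar>coef_dev b m\<bar> * (1 + norm (fst a)))"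
    by (rule order_trans[OF sum_abs]) (auto simp: abs_mult intro!: sum_mono mult_left_mono abs_ext_coord_le)
  also have "\<dots> = (\<Sum>m\<in>UNIV. \<bar>coef_dev b m\<bar>) * (1 + norm (fst a))" by (simp add: sum_distrib_right)
  finally have "\<bar>?d\<bar>\<^sup>2 \<le> ((\<Sum>m\<in>UNIV. \<bar>coef_dev b m\<bar>) * (1 + norm (fst a)))\<^sup>2" by (rule power_mono) simp
  hence d2: "?d\<^sup>2 \<le> (\<Sum>m\<in>UNIV. \<bar>coef_dev b m\<bar>)\<^sup>2 * (1 + norm (fst a))\<^sup>2" by (simp add: power_mult_distrib)
  show ?thesis
  proof (cases m)
    case True
    have "\<bar>sigmoid (D * y $ k + ?d) - sigmoid (D * y $ k) - sigmoid (D * y $ k) * (1 - sigmoid (D * y $ k)) * ?d\<bar> \<le> ?d\<^sup>2"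
      by (rule sigmoid_taylor)
    moreover have "resp b a = sigmoid (D * y $ k + ?d)" using discr_coef_dev[of b a] True by (simp add: a resp_def)
    moreover have "resp \<beta>0 a = sigmoid (D * y $ k)" "missing_var a = sigmoid (D * y $ k) * (1 - sigmoid (D * y $ k))"
      using True by (simp_all add: resp_\<beta>0 w0_def missing_var_def a)
    ultimately show ?thesis using d2 by simp
  next
    case False
    hence "resp b a = resp \<beta>0 a" "missing_var a = 0" by (simp_all add: a resp_def missing_var_def)
    thus ?thesis by simp
  qed
qed

text \<open>The averages that occur in the linearized equations: second moments of the extended
  coordinates, centred class weights, and the Jacobian of the E step. They are finitely many, so one
  sum of deviations measures the quality of a sample.\<close>

definition test_functions :: "('p obs \<Rightarrow> real) set" where
  "test_functions = (\<lambda>(l, m). (\<lambda>a. ext_coord l a * ext_coord m a)) ` UNIV \<union> (\<lambda>l. (\<lambda>a. (resp \<beta>0 a - 1/2) * ext_coord l a)) ` UNIV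
     \<union> (\<lambda>(l, m). (\<lambda>a. missing_var a * (ext_coord l a * ext_coord m a))) ` UNIV"

lemma finite_test_functions: "finite test_functions"
  unfolding test_functions_def by (intro finite_UnI finite_imageI finite)

lemma test_functions_mem: "(\<lambda>a. ext_coord l a * ext_coord m a) \<in> test_functions" "(\<lambda>a. (resp \<beta>0 a - 1/2) * ext_coord l a) \<in> test_functions" "(\<lambda>a. missing_var a * (ext_coord l a * ext_coord m a)) \<in> test_functions"
  unfolding test_functions_def by (force simp: image_iff)+

lemma test_functions_poly_growth: "test_functions \<subseteq> poly_growth"
  unfolding test_functions_def
  by (auto intro!: poly_growth_mult ext_coord_poly_growth missing_var_poly_growth poly_growth_diff resp_poly_growth poly_growth_const)

lemma Ex_ext_coord_ext_coord:
  "Ex (\<lambda>a. ext_coord l a * ext_coord m a) = (if l \<noteq> m then 0 else if l = Some k then (D/2)\<^sup>2 + 1 else 1)"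
proof -
  have b: "\<bar>x ^ j\<bar> \<le> 1 * (1 + \<bar>x\<bar>) ^ j" for x :: real and j by (simp add: power_abs power_mono)
  note C = Ex_component[of "\<lambda>x z m. x ^ j" 1 j for j, OF _ b]
  have m: "Ex (\<lambda>a. fst a $ k ^ j) = (\<integral>x. fy1 D x * x ^ j \<partial>lborel)" for j
    using C(2)[of j] by (simp add: E1_power)
  have m1: "Ex (\<lambda>a. fst a $ i) = 0" if "i \<noteq> k" for i using C(3)[of 0 i] that by simp
  have mk: "Ex (\<lambda>a. fst a $ k * fst a $ i) = 0" if "i \<noteq> k" for i using C(3)[of 1 i] that by simp
  have mii: "Ex (\<lambda>a. fst a $ i * fst a $ i) = 1" if "i \<noteq> k" for i using C(4)[of 0 i] that E1_power[of 0] fy1_moments(1) by simp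
  have mij: "Ex (\<lambda>a. fst a $ i * fst a $ j) = 0" if "i \<noteq> k" "j \<noteq> k" "i \<noteq> j" for i j using C(5)[of 0 i j] that by simp
  have mkk: "Ex (\<lambda>a. fst a $ k * fst a $ k) = (D/2)\<^sup>2 + 1" using m[of 2] fy1_moments(3) by (simp add: power2_eq_square)
  have mk1: "Ex (\<lambda>a. fst a $ k) = 0" using m[of 1] fy1_moments(2) by simp
  have m0: "Ex (\<lambda>a. 1) = 1" using m[of 0] fy1_moments(1) by simp
  have mk': "Ex (\<lambda>a. fst a $ i * fst a $ k) = 0" if "i \<noteq> k" for i using mk[OF that] by (simp add: mult.commute)
  have "Ex (\<lambda>a. fst a $ i * fst a $ j) = 0" if "i \<noteq> j" for i j
    using that mk[of j] mk'[of i] mij[of i j] by (cases "i = k"; cases "j = k") auto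
  moreover have "Ex (\<lambda>a. fst a $ i) = 0" for i
    using mk1 m1[of i] by (cases "i = k") auto
  ultimately show ?thesis
    using m0 mii mkk by (cases l; cases m) (auto simp: ext_coord_def)
qed

lemma Ex_w0_ext_coord: "Ex (\<lambda>a. (resp \<beta>0 a - 1/2) * ext_coord l a) = (if l = Some k then D / 4 else 0)"
proof -
  have b: "\<bar>(w0 x z m - 1/2) * x ^ j\<bar> \<le> 1 * (1 + \<bar>x\<bar>) ^ j" for x z m j
    unfolding abs_mult power_abs by (intro mult_mono w0_bound power_mono) auto
  note C = Ex_component[of "\<lambda>x z m. (w0 x z m - 1/2) * x ^ j" 1 j for j, OF _ b]
  have "Ex (\<lambda>a. resp \<beta>0 a - 1/2) = 0"
    using C(2)[of 0] E1_w0_power[of 0] fy1_sigmoid_moments(1)[of D] by (simp add: resp_\<beta>0)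
  moreover have "Ex (\<lambda>a. (resp \<beta>0 a - 1/2) * fst a $ k) = D / 4"
    using C(2)[of 1] E1_w0_power[of 1] fy1_sigmoid_moments(2)[of D] by (simp add: resp_\<beta>0)
  moreover have "Ex (\<lambda>a. (resp \<beta>0 a - 1/2) * fst a $ i) = 0" if "i \<noteq> k" for i
    using C(3)[of 0 i] that by (simp add: resp_\<beta>0)
  ultimately show ?thesis by (cases l) (auto simp: ext_coord_def)
qed

text \<open>The expected Jacobian of the E step is diagonal, which decouples the linearized
  equations. Independence of the other coordinates removes all mixed terms except that of intercept
  and coordinate \<open>k\<close>, which vanishes because \<open>Q\<close>, the label variance and
  the marginal density are even.\<close>

lemma Ex_missing_var_ext_coord_ext_coord:
  "Ex (\<lambda>a. missing_var a * (ext_coord l a * ext_coord m a)) = (if l \<noteq> m then 0 else if l = Some k then I1 else I0)"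
proof -
  have b: "\<bar>(of_bool m * (sigmoid (D * x) * (1 - sigmoid (D * x)))) * x ^ j\<bar> \<le> 1 * (1 + \<bar>x\<bar>) ^ j" for x m j
    unfolding abs_mult[of _ "x ^ j"] power_abs
    using sigmoid_bounds(1,2)[of "D * x"] by (intro mult_mono power_mono) auto
  have mm: "(\<lambda>x. (of_bool m * (sigmoid (D * x) * (1 - sigmoid (D * x)))) * x ^ j) \<in> borel_measurable borel" for m :: bool and j
    by measurable
  note C = Ex_component[of "\<lambda>x z m. (of_bool m * (sigmoid (D * x) * (1 - sigmoid (D * x)))) * x ^ j" 1 j for j, OF mm b]
  have mE: "missing_var a * fst a $ k ^ j = (of_bool (snd (snd a)) * (sigmoid (D * fst a $ k) * (1 - sigmoid (D * fst a $ k)))) * fst a $ k ^ j" for a j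
    by (simp add: missing_var_def)
  have m: "Ex (\<lambda>a. missing_var a * fst a $ k ^ j) = (\<integral>x. fy1 D x * (Q x * (sigmoid (D * x) * (1 - sigmoid (D * x))) * x ^ j) \<partial>lborel)" for j
    unfolding mE using C(2)[of j] E1_missing_power[of j] by simp
  have odd: "(\<integral>x. fy1 D x * (Q x * (sigmoid (D * x) * (1 - sigmoid (D * x))) * x ^ 1) \<partial>lborel) = 0"
  proof -
    let ?f = "\<lambda>x. fy1 D x * (Q x * (sigmoid (D * x) * (1 - sigmoid (D * x))) * x ^ 1)"
    have "(\<integral>x. ?f x \<partial>lborel) = (\<integral>x. ?f (0 + (-1) * x) \<partial>lborel)"
      using lborel_integral_real_affine[of "-1" ?f 0] by simp
    also have "\<dots> = (\<integral>x. - ?f x \<partial>lborel)"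
    proof (rule Bochner_Integration.integral_cong[OF refl])
      fix x
      show "?f (0 + (-1) * x) = - ?f x"
        using sigmoid_even_product[of "D * x"] by (simp add: fy1_even Q_even)
    qed
    also have "\<dots> = - (\<integral>x. ?f x \<partial>lborel)" by simp
    finally show ?thesis by linarith
  qed
  have m0: "Ex missing_var = I0" using m[of 0] by (simp add: I0_def)
  have mk1: "Ex (\<lambda>a. missing_var a * fst a $ k) = 0" using m[of 1] odd by simp
  have mkk: "Ex (\<lambda>a. missing_var a * (fst a $ k * fst a $ k)) = I1" using m[of 2] by (simp add: I1_def power2_eq_square)
  have m1: "Ex (\<lambda>a. missing_var a * fst a $ i) = 0" if "i \<noteq> k" for i using C(3)[of i 0] that by (simp add: missing_var_def)
  have mk: "Ex (\<lambda>a. missing_var a * (fst a $ k * fst a $ i)) = 0" if "i \<noteq> k" for i using C(3)[of i 1] that by (simp add: missing_var_def mult.assoc)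
  have mk': "Ex (\<lambda>a. missing_var a * (fst a $ i * fst a $ k)) = 0" if "i \<noteq> k" for i using mk[OF that] by (simp add: mult.commute)
  have mii: "Ex (\<lambda>a. missing_var a * (fst a $ i * fst a $ i)) = I0" if "i \<noteq> k" for i using C(4)[of i 0] E1_missing_power[of 0] that by (simp add: missing_var_def I0_def)
  have mij: "Ex (\<lambda>a. missing_var a * (fst a $ i * fst a $ j)) = 0" if "i \<noteq> k" "j \<noteq> k" "i \<noteq> j" for i j using C(5)[of i j 0] that by (simp add: missing_var_def)
  have "Ex (\<lambda>a. missing_var a * (fst a $ i * fst a $ j)) = 0" if "i \<noteq> j" for i j
    using that mk[of j] mk'[of i] mij[of i j] by (cases "i = k"; cases "j = k") auto
  moreover have "Ex (\<lambda>a. missing_var a * fst a $ i) = 0" for i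
    using mk1 m1[of i] by (cases "i = k") auto
  ultimately show ?thesis
    using m0 mii mkk by (cases l; cases m) (auto simp: ext_coord_def)
qed

end

section \<open>Landau calculus for solutions of the EM equations\<close>

context canon
begin

text \<open>Samples paired with solutions of their EM equations near the true coefficients. On this
  joint filter the Landau calculus applies without choosing a solution as a function of the
  sample.\<close>

definition EMF :: "((nat \<times> (nat \<Rightarrow> 'p obs)) \<times> (real \<times> (real^'p))) filter" where
  "EMF = inf (filtercomap fst Emp) (inf (filtercomap snd (nhds \<beta>0))
     (principal {c. EM_equations (fst (fst c)) (snd (fst c)) (snd c)}))"

lemma EMF_le: "EMF \<le> filtercomap fst Emp" "EMF \<le> filtercomap snd (nhds \<beta>0)"
  "EMF \<le> principal {c. EM_equations (fst (fst c)) (snd (fst c)) (snd c)}"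
  unfolding EMF_def
  by (rule inf_le1, rule inf.coboundedI2[OF inf_le1], rule inf.coboundedI2[OF inf_le2])

lemma eventually_EMF_EM: "\<forall>\<^sub>F c in EMF. EM_equations (fst (fst c)) (snd (fst c)) (snd c)"
  by (rule filter_leD[OF EMF_le(3)]) (simp add: eventually_principal)

lemma eventually_EMF_pos: "\<forall>\<^sub>F c in EMF. fst (fst c) > 0"
  by (rule filter_leD[OF EMF_le(1)]) (rule eventually_filtercomapI[OF emp_filter_pos])

lemma EMF_avg: "g \<in> poly_growth \<Longrightarrow> ((\<lambda>c. avg' (fst c) g) \<longlongrightarrow> Ex g) EMF"
proof -
  assume "g \<in> poly_growth"
  hence "filterlim (\<lambda>d. avg' d g) (nhds (Ex g)) Emp" by (rule emp_filter_tendsto)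
  moreover have "filterlim fst Emp EMF" using EMF_le(1) by (simp add: filterlim_iff_le_filtercomap)
  ultimately show ?thesis by (rule filterlim_compose)
qed

lemma EMF_b: "(snd \<longlongrightarrow> \<beta>0) EMF"
  using EMF_le(2) by (simp add: filterlim_iff_le_filtercomap)

lemma EMF_coef_dev: "((\<lambda>c. coef_dev (snd c) l) \<longlongrightarrow> 0) EMF"
proof (cases l)
  case None
  thus ?thesis using tendsto_fst[OF EMF_b] by (simp add: coef_dev_def)
next
  case (Some i)
  have "((\<lambda>c. snd (snd c) $ i - (if i = k then D else 0)) \<longlongrightarrow> (D *\<^sub>R axis k 1 :: real^'p) $ i - (if i = k then D else 0)) EMF"
    using tendsto_snd[OF EMF_b] by (intro tendsto_intros) simp
  thus ?thesis using Some by (cases "i = k") (simp_all add: coef_dev_def axis_def)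
qed

definition sample_dev :: "nat \<times> (nat \<Rightarrow> 'p obs) \<Rightarrow> real" where
  "sample_dev d = (\<Sum>g\<in>test_functions. \<bar>avg' d g - Ex g\<bar>)"

definition coef_size :: "real \<times> (real^'p) \<Rightarrow> real" where
  "coef_size b = (\<Sum>l\<in>UNIV. \<bar>coef_dev b l\<bar>)"

text \<open>The common scale of all error terms. It still contains the unknown deviation of the
  coefficients, which \<open>EMF_bounds\<close> eliminates.\<close>

definition Xc :: "(nat \<times> (nat \<Rightarrow> 'p obs)) \<times> (real \<times> (real^'p)) \<Rightarrow> real" where
  "Xc c = coef_size (snd c) + sample_dev (fst c)"

lemma sample_dev_nonneg: "sample_dev d \<ge> 0" and coef_size_nonneg: "coef_size b \<ge> 0" and Xc_nonneg: "Xc c \<ge> 0"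
  by (auto simp: sample_dev_def coef_size_def Xc_def sum_nonneg)

lemma Xc_tendsto: "(Xc \<longlongrightarrow> 0) EMF"
proof -
  have "((\<lambda>c. coef_size (snd c) + sample_dev (fst c)) \<longlongrightarrow> (\<Sum>l\<in>(UNIV :: 'p option set). \<bar>0\<bar>) + (\<Sum>g\<in>test_functions. \<bar>Ex g - Ex g\<bar>)) EMF"
    unfolding coef_size_def sample_dev_def using test_functions_poly_growth
    by (intro tendsto_add tendsto_sum tendsto_rabs EMF_coef_dev tendsto_diff EMF_avg tendsto_const) auto
  thus ?thesis by (simp add: Xc_def[abs_def])
qed

abbreviation O1 where "O1 \<equiv> O[EMF](\<lambda>_. 1 :: real)"
abbreviation OX where "OX \<equiv> O[EMF](Xc)"
abbreviation OXX where "OXX \<equiv> O[EMF](\<lambda>c. Xc c * Xc c)"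

lemma O1_tendsto: "(f \<longlongrightarrow> (c::real)) EMF \<Longrightarrow> f \<in> O1"
  by (rule bigoI_tendsto[where c = c]) auto

lemma O1_const: "(\<lambda>_. c) \<in> O1"
  by (rule O1_tendsto[OF tendsto_const])

lemma OX_imp_O1: "f \<in> OX \<Longrightarrow> f \<in> O1"
  using O1_tendsto[OF Xc_tendsto] landau_o.big_trans by blast

lemma OXX_imp_OX: "f \<in> OXX \<Longrightarrow> f \<in> OX"
proof -
  have "(\<lambda>c. Xc c * Xc c) \<in> O[EMF](\<lambda>c. Xc c * 1)"
    by (intro landau_o.big.mult landau_o.big_refl O1_tendsto[OF Xc_tendsto])
  thus "f \<in> OXX \<Longrightarrow> f \<in> OX" using landau_o.big_trans by fastforce
qed

lemma OX_OX: "f \<in> OX \<Longrightarrow> g \<in> OX \<Longrightarrow> (\<lambda>c. f c * g c) \<in> OXX"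
  by (rule landau_o.big.mult)

lemma O1_O1: "f \<in> O1 \<Longrightarrow> g \<in> O1 \<Longrightarrow> (\<lambda>c. f c * g c) \<in> O1"
  using landau_o.big.mult[of f EMF "\<lambda>_. 1" g "\<lambda>_. 1"] by simp

lemma OXX_O1: "f \<in> OXX \<Longrightarrow> g \<in> O1 \<Longrightarrow> (\<lambda>c. f c * g c) \<in> OXX"
  using landau_o.big.mult[of f EMF "\<lambda>c. Xc c * Xc c" g "\<lambda>_. 1"] by simp

lemma O1_OXX: "f \<in> O1 \<Longrightarrow> g \<in> OXX \<Longrightarrow> (\<lambda>c. f c * g c) \<in> OXX"
  using OXX_O1[of g f] by (simp add: mult.commute)

lemma O1_OX: "f \<in> O1 \<Longrightarrow> g \<in> OX \<Longrightarrow> (\<lambda>c. f c * g c) \<in> OX"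
  using landau_o.big.mult[of f EMF "\<lambda>c. 1" g Xc] by simp

lemma OX_dev: "g \<in> test_functions \<Longrightarrow> (\<lambda>c. avg' (fst c) g - Ex g) \<in> OX"
proof (rule landau_o.bigI[of 1])
  assume g: "g \<in> test_functions"
  have "\<bar>avg' (fst c) g - Ex g\<bar> \<le> Xc c" for c
    using member_le_sum[of g test_functions "\<lambda>g. \<bar>avg' (fst c) g - Ex g\<bar>"] g finite_test_functions coef_size_nonneg[of "snd c"]
    unfolding Xc_def sample_dev_def by simp
  thus "\<forall>\<^sub>F c in EMF. norm (avg' (fst c) g - Ex g) \<le> 1 * norm (Xc c)"
    using Xc_nonneg by simp
qed simp

lemma OX_coef_dev: "(\<lambda>c. coef_dev (snd c) l) \<in> OX"
proof (rule landau_o.bigI[of 1])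
  have "\<bar>coef_dev (snd c) l\<bar> \<le> Xc c" for c
    using member_le_sum[of l UNIV "\<lambda>l. \<bar>coef_dev (snd c) l\<bar>"] sample_dev_nonneg[of "fst c"]
    unfolding Xc_def coef_size_def by simp
  thus "\<forall>\<^sub>F c in EMF. norm (coef_dev (snd c) l) \<le> 1 * norm (Xc c)" using Xc_nonneg by simp
qed simp

definition A :: "'p option \<Rightarrow> (nat \<times> (nat \<Rightarrow> 'p obs)) \<times> (real \<times> (real^'p)) \<Rightarrow> real" where
  "A l c = avg' (fst c) (\<lambda>a. (resp (snd c) a - 1/2) * ext_coord l a)"

definition A0 :: "'p option \<Rightarrow> nat \<times> (nat \<Rightarrow> 'p obs) \<Rightarrow> real" where
  "A0 l d = avg' d (\<lambda>a. (resp \<beta>0 a - 1/2) * ext_coord l a)"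

definition A_limit :: "'p option \<Rightarrow> real" where
  "A_limit l = (if l = Some k then D / 4 else 0)"

definition info_loss :: "'p option \<Rightarrow> real" where
  "info_loss l = (if l = Some k then I1 else I0)"

lemma A0_OX: "(\<lambda>c. A0 l (fst c) - A_limit l) \<in> OX"
  using OX_dev[OF test_functions_mem(2)[of l]] unfolding A0_def Ex_w0_ext_coord A_limit_def by simp

text \<open>Two errors arise, both quadratic in the scale \<open>Xc\<close>: the Taylor remainder of
  the class weights, and the deviation of the averaged Jacobian from its expectation multiplied by
  the coefficient deviations.\<close>

lemma A_expansion: "(\<lambda>c. A l c - A0 l (fst c) - info_loss l * coef_dev (snd c) l) \<in> OXX"
proof -
  let ?h = "\<lambda>a :: 'p obs. (1 + norm (fst a)) ^ 3"
  have h: "?h \<in> poly_growth" by (intro poly_growth_power poly_growth_add poly_growth_const poly_growth_norm)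
  define rem where "rem c = avg' (fst c) (\<lambda>a. (resp (snd c) a - resp \<beta>0 a - missing_var a * (\<Sum>m\<in>UNIV. coef_dev (snd c) m * ext_coord m a)) * ext_coord l a)" for c
  have "rem \<in> OXX"
  proof -
    have le: "\<bar>rem c\<bar> \<le> coef_size (snd c) ^ 2 * avg' (fst c) ?h" for c
    proof -
      have "\<bar>rem c\<bar> \<le> avg' (fst c) (\<lambda>a. coef_size (snd c) ^ 2 * ?h a)"
        unfolding rem_def
      proof (rule order_trans[OF avg_abs avg_mono])
        fix j
        let ?a = "snd (fst c) j"
        have "\<bar>(resp (snd c) ?a - resp \<beta>0 ?a - missing_var ?a * (\<Sum>m\<in>UNIV. coef_dev (snd c) m * ext_coord m ?a)) * ext_coord l ?a\<bar>
          \<le> (coef_size (snd c) ^ 2 * (1 + norm (fst ?a))\<^sup>2) * (1 + norm (fst ?a))"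
          unfolding abs_mult coef_size_def by (intro mult_mono resp_expansion abs_ext_coord_le) auto
        thus "\<bar>(resp (snd c) ?a - resp \<beta>0 ?a - missing_var ?a * (\<Sum>m\<in>UNIV. coef_dev (snd c) m * ext_coord m ?a)) * ext_coord l ?a\<bar> \<le> coef_size (snd c) ^ 2 * ?h ?a"
          by (simp add: power2_eq_square power3_eq_cube mult_ac)
      qed
      thus ?thesis by (simp only: avg_cmult)
    qed
    have "(\<lambda>c. coef_size (snd c)) \<in> OX"
    proof (rule landau_o.bigI[of 1])
      have "norm (coef_size (snd c)) \<le> 1 * norm (Xc c)" for c
        using coef_size_nonneg[of "snd c"] sample_dev_nonneg[of "fst c"] by (simp add: Xc_def)
      thus "\<forall>\<^sub>F c in EMF. norm (coef_size (snd c)) \<le> 1 * norm (Xc c)"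
        by (intro always_eventually allI)
    qed simp
    hence "(\<lambda>c. coef_size (snd c) * coef_size (snd c) * avg' (fst c) ?h) \<in> OXX"
      by (intro OXX_O1 OX_OX O1_tendsto[OF EMF_avg[OF h]])
    moreover have "rem \<in> O[EMF](\<lambda>c. coef_size (snd c) * coef_size (snd c) * avg' (fst c) ?h)"
    proof (rule landau_o.bigI[of 1])
      have "norm (rem c) \<le> 1 * norm (coef_size (snd c) * coef_size (snd c) * avg' (fst c) ?h)" for c
        using le[of c] abs_ge_self[of "coef_size (snd c) * coef_size (snd c) * avg' (fst c) ?h"]
        unfolding power2_eq_square real_norm_def mult_1 by linarith
      thus "\<forall>\<^sub>F c in EMF. norm (rem c) \<le> 1 * norm (coef_size (snd c) * coef_size (snd c) * avg' (fst c) ?h)"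
        by (intro always_eventually allI)
    qed simp
    ultimately show ?thesis by (rule landau_o.big_trans[rotated])
  qed
  moreover have "(\<lambda>c. \<Sum>m\<in>UNIV. (avg' (fst c) (\<lambda>a. missing_var a * (ext_coord l a * ext_coord m a)) - Ex (\<lambda>a. missing_var a * (ext_coord l a * ext_coord m a))) * coef_dev (snd c) m) \<in> OXX"
    by (intro big_sum_in_bigo OX_OX OX_dev test_functions_mem OX_coef_dev)
  ultimately have "(\<lambda>c. rem c + (\<Sum>m\<in>UNIV. (avg' (fst c) (\<lambda>a. missing_var a * (ext_coord l a * ext_coord m a)) - Ex (\<lambda>a. missing_var a * (ext_coord l a * ext_coord m a))) * coef_dev (snd c) m)) \<in> OXX"
    by (rule sum_in_bigo)
  moreover have "A l c - A0 l (fst c) - info_loss l * coef_dev (snd c) l = rem c + (\<Sum>m\<in>UNIV. (avg' (fst c) (\<lambda>a. missing_var a * (ext_coord l a * ext_coord m a)) - Ex (\<lambda>a. missing_var a * (ext_coord l a * ext_coord m a))) * coef_dev (snd c) m)" for c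
  proof -
    have f: "(resp (snd c) a - 1/2) * ext_coord l a - (resp \<beta>0 a - 1/2) * ext_coord l a
      = (resp (snd c) a - resp \<beta>0 a - missing_var a * (\<Sum>m\<in>UNIV. coef_dev (snd c) m * ext_coord m a)) * ext_coord l a
        + (\<Sum>m\<in>UNIV. coef_dev (snd c) m * (missing_var a * (ext_coord l a * ext_coord m a)))" for a
    proof -
      have "(\<Sum>m\<in>UNIV. coef_dev (snd c) m * (missing_var a * (ext_coord l a * ext_coord m a))) = missing_var a * (\<Sum>m\<in>UNIV. coef_dev (snd c) m * ext_coord m a) * ext_coord l a"
        unfolding sum_distrib_left sum_distrib_right by (rule sum.cong) (simp_all only: mult_ac)
      moreover have "(u - 1/2) * y - (v - 1/2) * y = (u - v - w) * y + w * y" for u v w y :: real by algebra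
      ultimately show ?thesis by (simp only:)
    qed
    have "A l c - A0 l (fst c) = rem c + (\<Sum>m\<in>UNIV. coef_dev (snd c) m * avg' (fst c) (\<lambda>a. missing_var a * (ext_coord l a * ext_coord m a)))"
      unfolding A_def A0_def avg_diff[symmetric] f by (simp only: avg_add rem_def avg_sum avg_cmult)
    moreover have "info_loss l * coef_dev (snd c) l = (\<Sum>m\<in>UNIV. coef_dev (snd c) m * Ex (\<lambda>a. missing_var a * (ext_coord l a * ext_coord m a)))"
    proof -
      have "(\<Sum>m\<in>UNIV. coef_dev (snd c) m * Ex (\<lambda>a. missing_var a * (ext_coord l a * ext_coord m a))) = (\<Sum>m\<in>UNIV. if l = m then info_loss l * coef_dev (snd c) l else 0)"
        unfolding Ex_missing_var_ext_coord_ext_coord info_loss_def by (rule sum.cong) auto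
      thus ?thesis by simp
    qed
    moreover have "(\<Sum>m\<in>UNIV. (u m - v m) * w m) = (\<Sum>m\<in>UNIV. w m * u m) - (\<Sum>m\<in>UNIV. w m * v m)" for u v w :: "'p option \<Rightarrow> real"
      unfolding sum_subtractf[symmetric] by (rule sum.cong) (simp_all add: algebra_simps)
    ultimately show ?thesis by (simp only: add_diff_eq)
  qed
  ultimately show ?thesis by (simp only:)
qed

lemma A_OX: "(\<lambda>c. A l c - A_limit l) \<in> OX"
proof -
  have "(\<lambda>c. (A l c - A0 l (fst c) - info_loss l * coef_dev (snd c) l) + (A0 l (fst c) - A_limit l) + info_loss l * coef_dev (snd c) l) \<in> OX"
    by (rule A0_OX OXX_imp_OX[OF A_expansion] O1_OX O1_const OX_coef_dev sum_in_bigo)+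
  thus ?thesis by simp
qed

definition Y :: "'p \<Rightarrow> (nat \<times> (nat \<Rightarrow> 'p obs)) \<times> (real \<times> (real^'p)) \<Rightarrow> real" where
  "Y i c = avg' (fst c) (\<lambda>a. fst a $ i)"
definition T :: "'p \<Rightarrow> 'p \<Rightarrow> (nat \<times> (nat \<Rightarrow> 'p obs)) \<times> (real \<times> (real^'p)) \<Rightarrow> real" where
  "T i j c = avg' (fst c) (\<lambda>a. fst a $ i * fst a $ j)"
text \<open>Centring the estimated prior W at 1/2 pays off because W (1 - W) = 1/4 - om^2 then
  differs from 1/4 only to second order. Here equal priors simplify the equations.\<close>

definition om :: "(nat \<times> (nat \<Rightarrow> 'p obs)) \<times> (real \<times> (real^'p)) \<Rightarrow> real" where
  "om c = avg' (fst c) (resp (snd c)) - 1/2"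
definition C :: "'p \<Rightarrow> (nat \<times> (nat \<Rightarrow> 'p obs)) \<times> (real \<times> (real^'p)) \<Rightarrow> real" where
  "C i c = avg' (fst c) (\<lambda>a. resp (snd c) a * fst a $ i) - (om c + 1/2) * Y i c"
definition bb :: "'p \<Rightarrow> (nat \<times> (nat \<Rightarrow> 'p obs)) \<times> (real \<times> (real^'p)) \<Rightarrow> real" where
  "bb i c = snd (snd c) $ i"

definition T0 :: "'p \<Rightarrow> 'p \<Rightarrow> real" where
  "T0 i j = (if i \<noteq> j then 0 else if i = k then (D/2)\<^sup>2 + 1 else 1)"

lemma Y_OX: "Y i \<in> OX"
proof -
  have "(\<lambda>c. avg' (fst c) (\<lambda>a. ext_coord None a * ext_coord (Some i) a) - Ex (\<lambda>a. ext_coord None a * ext_coord (Some i) a)) \<in> OX"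
    by (rule OX_dev[OF test_functions_mem(1)])
  thus ?thesis unfolding Ex_ext_coord_ext_coord by (simp add: ext_coord_def Y_def[abs_def])
qed

lemma T_OX: "(\<lambda>c. T i j c - T0 i j) \<in> OX"
proof -
  have "(\<lambda>c. avg' (fst c) (\<lambda>a. ext_coord (Some i) a * ext_coord (Some j) a) - Ex (\<lambda>a. ext_coord (Some i) a * ext_coord (Some j) a)) \<in> OX"
    by (rule OX_dev[OF test_functions_mem(1)])
  moreover have "Ex (\<lambda>a. ext_coord (Some i) a * ext_coord (Some j) a) = T0 i j" by (simp add: Ex_ext_coord_ext_coord T0_def)
  ultimately show ?thesis by (simp add: ext_coord_def T_def[abs_def])
qed

lemma om_eq: "\<forall>\<^sub>F c in EMF. om c = A None c"
  using eventually_EMF_pos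
  by eventually_elim (simp add: A_def om_def ext_coord_def avg_diff avg_const)

lemma om_OX: "om \<in> OX"
  using A_OX[of None] landau_o.big.in_cong[OF om_eq] by (simp add: A_limit_def)

lemma C_eq: "C i c = A (Some i) c - om c * Y i c"
proof -
  have "A (Some i) c = avg' (fst c) (\<lambda>a. resp (snd c) a * fst a $ i) - 1/2 * Y i c"
    unfolding A_def Y_def avg_cmult[symmetric] avg_diff[symmetric] by (simp add: ext_coord_def algebra_simps)
  thus ?thesis by (simp add: C_def algebra_simps)
qed

lemma C_A: "(\<lambda>c. C i c - A (Some i) c) \<in> OXX"
proof -
  have "(\<lambda>c. - (om c * Y i c)) \<in> OXX" by (simp add: OX_OX om_OX Y_OX)
  thus ?thesis by (simp add: C_eq)
qed

lemma C_OX: "(\<lambda>c. C i c - A_limit (Some i)) \<in> OX"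
proof -
  have "(\<lambda>c. (C i c - A (Some i) c) + (A (Some i) c - A_limit (Some i))) \<in> OX"
    by (rule OXX_imp_OX[OF C_A] A_OX sum_in_bigo)+
  thus ?thesis by simp
qed

lemma bb_eq: "bb i c = coef_dev (snd c) (Some i) + (if i = k then D else 0)"
  by (simp add: bb_def coef_dev_def)

definition qq :: "(nat \<times> (nat \<Rightarrow> 'p obs)) \<times> (real \<times> (real^'p)) \<Rightarrow> real" where
  "qq c = (\<Sum>j\<in>UNIV. C j c * bb j c)"
definition PP :: "'p \<Rightarrow> (nat \<times> (nat \<Rightarrow> 'p obs)) \<times> (real \<times> (real^'p)) \<Rightarrow> real" where
  "PP i c = (\<Sum>j\<in>UNIV. (T i j c - Y i c * Y j c) * bb j c)"
definition YB :: "(nat \<times> (nat \<Rightarrow> 'p obs)) \<times> (real \<times> (real^'p)) \<Rightarrow> real" where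
  "YB c = (\<Sum>j\<in>UNIV. Y j c * bb j c)"

lemma eventually_EM_eqs:
  "\<forall>\<^sub>F c in EMF. (\<forall>i. (1/4 - (om c)\<^sup>2) * PP i c = C i c * (1 + qq c)) \<and>
     (1/4 - (om c)\<^sup>2) * coef_dev (snd c) None = (1/4 - (om c)\<^sup>2) * ln ((1/2 + om c) / (1/2 - om c)) - (1/4 - (om c)\<^sup>2) * YB c + om c * qq c"
  using eventually_EMF_EM
proof eventually_elim
  case (elim c)
  have w: "avg' (fst c) (resp (snd c)) = om c + 1/2" by (simp add: om_def)
  have V: "(om c + 1/2) * (1 - (om c + 1/2)) = 1/4 - (om c)\<^sup>2" by (simp add: power2_eq_square algebra_simps)
  have f: "(om c + 1/2) / (1 - (om c + 1/2)) = (1/2 + om c) / (1/2 - om c)" "om c + 1/2 - 1/2 = om c"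
    by (simp_all add: add.commute)
  show ?case
    using elim
    unfolding EM_equations_def Let_def w V f T_def[symmetric] Y_def[symmetric] C_def[symmetric] bb_def[symmetric]
      PP_def[symmetric] qq_def[symmetric] YB_def[symmetric]
    by (simp add: coef_dev_def)
qed

lemma sum_if_k: "(\<Sum>j\<in>UNIV. f j * (if j = k then r else 0)) = f k * r" for f :: "'p \<Rightarrow> real"
  by (simp add: if_distrib cong: if_cong)

lemma qq_expansion: "(\<lambda>c. qq c - ((D/2)\<^sup>2 + D * (C k c - D/4) + D/4 * coef_dev (snd c) (Some k))) \<in> OXX"
proof -
  have "(\<lambda>c. \<Sum>j\<in>UNIV. (C j c - A_limit (Some j)) * coef_dev (snd c) (Some j)) \<in> OXX"
    by (intro big_sum_in_bigo OX_OX C_OX OX_coef_dev)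
  moreover have "qq c - ((D/2)\<^sup>2 + D * (C k c - D/4) + D/4 * coef_dev (snd c) (Some k)) = (\<Sum>j\<in>UNIV. (C j c - A_limit (Some j)) * coef_dev (snd c) (Some j))" for c
  proof -
    have "C j c * bb j c = (C j c - A_limit (Some j)) * coef_dev (snd c) (Some j) + coef_dev (snd c) (Some j) * (if j = k then D/4 else 0) + C j c * (if j = k then D else 0)" for j
      by (simp add: bb_eq A_limit_def algebra_simps)
    hence "qq c = (\<Sum>j\<in>UNIV. (C j c - A_limit (Some j)) * coef_dev (snd c) (Some j)) + coef_dev (snd c) (Some k) * (D/4) + C k c * D"
      unfolding qq_def by (simp only: sum.distrib sum_if_k)
    thus ?thesis by (simp add: power2_eq_square algebra_simps)
  qed
  ultimately show ?thesis by simp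
qed

lemma qq_OX: "(\<lambda>c. qq c - (D/2)\<^sup>2) \<in> OX"
proof -
  have CX: "(\<lambda>c. C k c - D/4) \<in> OX" using C_OX[of k] by (simp add: A_limit_def)
  have "(\<lambda>c. (qq c - ((D/2)\<^sup>2 + D * (C k c - D/4) + D/4 * coef_dev (snd c) (Some k))) + (D * (C k c - D/4) + D/4 * coef_dev (snd c) (Some k))) \<in> OX"
    by (rule OXX_imp_OX[OF qq_expansion] CX O1_OX O1_const OX_coef_dev sum_in_bigo)+
  thus ?thesis by simp
qed

lemma YB_expansion: "(\<lambda>c. YB c - D * Y k c) \<in> OXX"
proof -
  have "(\<lambda>c. \<Sum>j\<in>UNIV. Y j c * coef_dev (snd c) (Some j)) \<in> OXX"
    by (intro big_sum_in_bigo OX_OX Y_OX OX_coef_dev)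
  moreover have "YB c - D * Y k c = (\<Sum>j\<in>UNIV. Y j c * coef_dev (snd c) (Some j))" for c
    unfolding YB_def bb_eq distrib_left sum.distrib sum_if_k by simp
  ultimately show ?thesis by simp
qed

lemma YB_OX: "YB \<in> OX"
proof -
  have "(\<lambda>c. (YB c - D * Y k c) + D * Y k c) \<in> OX"
    by (rule OXX_imp_OX[OF YB_expansion] O1_OX O1_const Y_OX sum_in_bigo)+
  thus ?thesis by simp
qed

lemma PP_expansion:
  "(\<lambda>c. PP i c - (coef_dev (snd c) (Some i) + D * (T i k c - T0 i k) + (if i = k then D * (1 + (D/2)\<^sup>2) + (D/2)\<^sup>2 * coef_dev (snd c) (Some k) else 0))) \<in> OXX"
proof -
  have "(\<lambda>c. (\<Sum>j\<in>UNIV. (T i j c - T0 i j) * coef_dev (snd c) (Some j)) - Y i c * YB c) \<in> OXX"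
    by (rule T_OX Y_OX YB_OX OX_coef_dev OX_OX big_sum_in_bigo sum_in_bigo)+
  moreover have "PP i c - (coef_dev (snd c) (Some i) + D * (T i k c - T0 i k) + (if i = k then D * (1 + (D/2)\<^sup>2) + (D/2)\<^sup>2 * coef_dev (snd c) (Some k) else 0))
     = (\<Sum>j\<in>UNIV. (T i j c - T0 i j) * coef_dev (snd c) (Some j)) - Y i c * YB c" for c
  proof -
    have "PP i c = (\<Sum>j\<in>UNIV. (T i j c - T0 i j) * coef_dev (snd c) (Some j) + (T i j c - T0 i j) * (if j = k then D else 0)
        + T0 i j * bb j c - Y i c * (Y j c * bb j c))"
      unfolding PP_def by (rule sum.cong[OF refl]) (simp add: bb_eq algebra_simps)
    also have "\<dots> = (\<Sum>j\<in>UNIV. (T i j c - T0 i j) * coef_dev (snd c) (Some j)) + (T i k c - T0 i k) * D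
        + (\<Sum>j\<in>UNIV. T0 i j * bb j c) - Y i c * YB c"
      by (simp only: sum.distrib sum_subtractf sum_if_k YB_def sum_distrib_left)
    also have "(\<Sum>j\<in>UNIV. T0 i j * bb j c) = (if i = k then (D/2)\<^sup>2 + 1 else 1) * bb i c"
    proof -
      have "(\<Sum>j\<in>UNIV. T0 i j * bb j c) = (\<Sum>j\<in>UNIV. if i = j then (if i = k then (D/2)\<^sup>2 + 1 else 1) * bb i c else 0)"
        by (rule sum.cong) (auto simp: T0_def)
      thus ?thesis by simp
    qed
    finally show ?thesis by (cases "i = k") (simp_all add: bb_eq algebra_simps)
  qed
  ultimately show ?thesis by simp
qed

lemma PP_O1: "PP i \<in> O1"
proof -
  have "(\<lambda>c. (PP i c - (coef_dev (snd c) (Some i) + D * (T i k c - T0 i k) + (if i = k then D * (1 + (D/2)\<^sup>2) + (D/2)\<^sup>2 * coef_dev (snd c) (Some k) else 0)))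
     + (coef_dev (snd c) (Some i) + D * (T i k c - T0 i k) + (if i = k then D * (1 + (D/2)\<^sup>2) + (D/2)\<^sup>2 * coef_dev (snd c) (Some k) else 0))) \<in> O1"
  proof (rule OX_imp_O1[OF OXX_imp_OX[OF PP_expansion]] sum_in_bigo)+
    show "(\<lambda>c. if i = k then D * (1 + (D/2)\<^sup>2) + (D/2)\<^sup>2 * coef_dev (snd c) (Some k) else 0) \<in> O1"
      by (cases "i = k") (auto intro!: sum_in_bigo O1_const O1_O1 OX_imp_O1[OF OX_coef_dev])
  qed (intro O1_O1 O1_const OX_imp_O1[OF T_OX] OX_imp_O1[OF OX_coef_dev])+
  thus ?thesis by simp
qed

lemma ln_odds_expansion: "(\<lambda>c. ln ((1/2 + om c) / (1/2 - om c)) - 4 * om c) \<in> OXX"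
proof -
  have lim: "(om \<longlongrightarrow> 0) EMF"
  proof -
    obtain K where K: "K > 0" "\<forall>\<^sub>F c in EMF. norm (om c) \<le> K * norm (Xc c)" using landau_o.bigE[OF om_OX] by blast
    show ?thesis
    proof (rule tendsto_0_le[OF Xc_tendsto])
      show "\<forall>\<^sub>F c in EMF. norm (om c) \<le> norm (Xc c) * K" using K(2) by (simp add: mult.commute)
    qed
  qed
  have "\<forall>\<^sub>F c in EMF. \<bar>om c\<bar> < 1/4"
    using order_tendstoD(2)[OF tendsto_rabs[OF lim], of "1/4"] by simp
  hence "\<forall>\<^sub>F c in EMF. norm (ln ((1/2 + om c) / (1/2 - om c)) - 4 * om c) \<le> 16 * norm (om c * om c)"
  proof eventually_elim
    case (elim c)
    let ?x = "2 * om c"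
    have "ln ((1/2 + om c) / (1/2 - om c)) = ln ((1 + ?x) / (1 + - ?x))"
      using elim by (simp add: field_simps)
    also have "\<dots> = ln (1 + ?x) - ln (1 + - ?x)" using elim by (subst ln_div) auto
    finally have e: "ln ((1/2 + om c) / (1/2 - om c)) - 4 * om c = (ln (1 + ?x) - ?x) - (ln (1 + - ?x) - - ?x)" by simp
    have "\<bar>ln (1 + ?x) - ?x\<bar> \<le> 2 * ?x\<^sup>2" by (rule abs_ln_one_plus_x_minus_x_bound) (use elim in simp)
    moreover have "\<bar>ln (1 + - ?x) - - ?x\<bar> \<le> 2 * (- ?x)\<^sup>2" by (rule abs_ln_one_plus_x_minus_x_bound) (use elim in simp)
    ultimately have "\<bar>ln ((1/2 + om c) / (1/2 - om c)) - 4 * om c\<bar> \<le> 2 * ?x\<^sup>2 + 2 * (- ?x)\<^sup>2"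
      unfolding e using abs_triangle_ineq4[of "ln (1 + ?x) - ?x" "ln (1 + - ?x) - - ?x"] by linarith
    thus ?case by (simp add: power2_eq_square abs_mult)
  qed
  hence "(\<lambda>c. ln ((1/2 + om c) / (1/2 - om c)) - 4 * om c) \<in> O[EMF](\<lambda>c. om c * om c)"
    by (rule landau_o.bigI[rotated]) simp
  thus ?thesis using OX_OX[OF om_OX om_OX] by (rule landau_o.big_trans)
qed

text \<open>For \<open>i \<noteq> k\<close> the covariance \<open>C i\<close> tends to 0, so the
  factor \<open>1 + qq\<close> may be replaced by its limit 1 + D^2/4; the factor 4 from 1/4 - om^2
  turns this into 4 + D^2.\<close>

lemma coef_dev_Some_linear:
  assumes i: "i \<noteq> k"
  shows "(\<lambda>c. coef_dev (snd c) (Some i) - ((4 + D\<^sup>2) * A (Some i) c - D * T i k c)) \<in> OXX"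
proof -
  define f where "f c = PP i c - (coef_dev (snd c) (Some i) + D * (T i k c - T0 i k) + (if i = k then D * (1 + (D/2)\<^sup>2) + (D/2)\<^sup>2 * coef_dev (snd c) (Some k) else 0))" for c
  have f: "f \<in> OXX" unfolding f_def by (rule PP_expansion)
  have CX: "C i \<in> OX" using C_OX[of i] i by (simp add: A_limit_def)
  have "(\<lambda>c. - f c + 4 * (om c * om c) * PP i c + 4 * (C i c * (qq c - (D/2)\<^sup>2)) + (4 + D\<^sup>2) * (C i c - A (Some i) c)) \<in> OXX"
    by (rule C_A qq_OX CX OX_OX om_OX PP_O1 O1_const OXX_O1 O1_OXX f[THEN landau_o.big.uminus_in_iff[THEN iffD2]] sum_in_bigo)+
  moreover have "\<forall>\<^sub>F c in EMF. coef_dev (snd c) (Some i) - ((4 + D\<^sup>2) * A (Some i) c - D * T i k c) =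
     - f c + 4 * (om c * om c) * PP i c + 4 * (C i c * (qq c - (D/2)\<^sup>2)) + (4 + D\<^sup>2) * (C i c - A (Some i) c)"
    using eventually_EM_eqs
  proof eventually_elim
    case (elim c)
    hence e: "(1/4 - (om c)\<^sup>2) * PP i c = C i c * (1 + qq c)" by blast
    have P: "PP i c = f c + coef_dev (snd c) (Some i) + D * T i k c" using i by (simp add: f_def T0_def)
    have "PP i c = 4 * ((1/4 - (om c)\<^sup>2) * PP i c) + 4 * (om c)\<^sup>2 * PP i c" by algebra
    also have "\<dots> = 4 * (C i c * (1 + qq c)) + 4 * (om c)\<^sup>2 * PP i c" unfolding e ..
    finally have "coef_dev (snd c) (Some i) = - f c - D * T i k c + 4 * (C i c * (1 + qq c)) + 4 * (om c)\<^sup>2 * PP i c" using P by linarith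
    thus ?case by (simp add: power2_eq_square algebra_simps)
  qed
  ultimately show ?thesis using landau_o.big.in_cong by fastforce
qed

text \<open>Here \<open>C k\<close> tends to D / 4, so the variation of \<open>qq\<close> counts to
  first order. It raises the weight to 4 + 2 D^2, and its term in the coefficient deviation cancels
  against the one that the excess variance of coordinate \<open>k\<close> produces in
  \<open>PP\<close>.\<close>

lemma coef_dev_k_linear:
  "(\<lambda>c. coef_dev (snd c) (Some k) - ((4 + 2 * D\<^sup>2) * (A (Some k) c - D/4) - D * (T k k c - T0 k k))) \<in> OXX"
proof -
  define f where "f c = PP k c - (coef_dev (snd c) (Some k) + D * (T k k c - T0 k k) + (if k = k then D * (1 + (D/2)\<^sup>2) + (D/2)\<^sup>2 * coef_dev (snd c) (Some k) else 0))" for c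
  have f: "f \<in> OXX" unfolding f_def by (rule PP_expansion)
  define g where "g c = qq c - ((D/2)\<^sup>2 + D * (C k c - D/4) + D/4 * coef_dev (snd c) (Some k))" for c
  have g: "g \<in> OXX" unfolding g_def by (rule qq_expansion)
  have CX: "(\<lambda>c. C k c - D/4) \<in> OX" using C_OX[of k] by (simp add: A_limit_def)
  have "(\<lambda>c. - f c + 4 * (om c * om c) * PP k c + 4 * ((C k c - D/4) * (qq c - (D/2)\<^sup>2)) + D * g c + (4 + 2 * D\<^sup>2) * (C k c - A (Some k) c)) \<in> OXX"
    by (rule C_A qq_OX CX OX_OX om_OX PP_O1 O1_const g OXX_O1 O1_OXX f[THEN landau_o.big.uminus_in_iff[THEN iffD2]] sum_in_bigo)+
  moreover have "\<forall>\<^sub>F c in EMF. coef_dev (snd c) (Some k) - ((4 + 2 * D\<^sup>2) * (A (Some k) c - D/4) - D * (T k k c - T0 k k)) =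
     - f c + 4 * (om c * om c) * PP k c + 4 * ((C k c - D/4) * (qq c - (D/2)\<^sup>2)) + D * g c + (4 + 2 * D\<^sup>2) * (C k c - A (Some k) c)"
    using eventually_EM_eqs
  proof eventually_elim
    case (elim c)
    hence e: "(1/4 - (om c)\<^sup>2) * PP k c = C k c * (1 + qq c)" by blast
    have P: "PP k c = f c + coef_dev (snd c) (Some k) + D * (T k k c - T0 k k) + D * (1 + (D/2)\<^sup>2) + (D/2)\<^sup>2 * coef_dev (snd c) (Some k)"
      by (simp add: f_def)
    have q: "qq c = g c + (D/2)\<^sup>2 + D * (C k c - D/4) + D/4 * coef_dev (snd c) (Some k)" by (simp add: g_def)
    have "PP k c = 4 * ((1/4 - (om c)\<^sup>2) * PP k c) + 4 * (om c)\<^sup>2 * PP k c" by algebra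
    also have "\<dots> = 4 * (C k c * (1 + qq c)) + 4 * (om c)\<^sup>2 * PP k c" unfolding e ..
    also have "4 * (C k c * (1 + qq c)) = 4 * ((C k c - D/4) * (qq c - (D/2)\<^sup>2)) + 4 * (C k c - D/4) * (1 + (D/2)\<^sup>2) + D * (1 + qq c)"
      by (simp add: algebra_simps)
    also have "D * (1 + qq c) = D * (1 + (D/2)\<^sup>2) + D * g c + D\<^sup>2 * (C k c - D/4) + (D/2)\<^sup>2 * coef_dev (snd c) (Some k)"
      unfolding q by (simp add: power2_eq_square algebra_simps)
    finally have "coef_dev (snd c) (Some k) = - f c - D * (T k k c - T0 k k) + 4 * ((C k c - D/4) * (qq c - (D/2)\<^sup>2)) + 4 * (C k c - D/4) * (1 + (D/2)\<^sup>2)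
       + D * g c + D\<^sup>2 * (C k c - D/4) + 4 * (om c)\<^sup>2 * PP k c"
      using P by linarith
    moreover have "4 * (C k c - D/4) * (1 + (D/2)\<^sup>2) + D\<^sup>2 * (C k c - D/4) = (4 + 2 * D\<^sup>2) * (C k c - D/4)"
      by (simp add: power2_eq_square algebra_simps)
    moreover have "(4 + 2 * D\<^sup>2) * (C k c - D/4) = (4 + 2 * D\<^sup>2) * (A (Some k) c - D/4) + (4 + 2 * D\<^sup>2) * (C k c - A (Some k) c)"
      by algebra
    moreover have "(om c)\<^sup>2 = om c * om c" by (rule power2_eq_square)
    ultimately show ?case
      by (simp only: right_diff_distrib left_diff_distrib distrib_left distrib_right mult.assoc)
  qed
  ultimately show ?thesis using landau_o.big.in_cong by fastforce
qed

text \<open>The estimated prior enters twice: through its logit, which has slope 4 at 1/2, and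
  through \<open>om * qq\<close>, which after division by 1/4 contributes D^2.\<close>

lemma coef_dev_None_linear:
  "(\<lambda>c. coef_dev (snd c) None - ((4 + D\<^sup>2) * A None c - D * Y k c)) \<in> OXX"
proof -
  define g where "g c = ln ((1/2 + om c) / (1/2 - om c)) - 4 * om c" for c
  have g: "g \<in> OXX" unfolding g_def by (rule ln_odds_expansion)
  have LO1: "(\<lambda>c. g c + 4 * om c) \<in> O1"
    by (intro sum_in_bigo OX_imp_O1[OF OXX_imp_OX[OF g]] O1_O1 O1_const OX_imp_O1[OF om_OX])
  have "(\<lambda>c. 4 * (om c * om c) * coef_dev (snd c) None + g c - 4 * (om c * om c) * (g c + 4 * om c) - (YB c - D * Y k c)
      + 4 * (om c * om c) * YB c + 4 * (om c * (qq c - (D/2)\<^sup>2))) \<in> OXX"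
    by (rule YB_expansion qq_OX LO1 OX_OX om_OX OX_imp_O1[OF OX_coef_dev] OX_imp_O1[OF YB_OX] O1_const g OXX_O1 O1_OXX sum_in_bigo)+
  moreover have "\<forall>\<^sub>F c in EMF. coef_dev (snd c) None - ((4 + D\<^sup>2) * A None c - D * Y k c) =
     4 * (om c * om c) * coef_dev (snd c) None + g c - 4 * (om c * om c) * (g c + 4 * om c) - (YB c - D * Y k c)
      + 4 * (om c * om c) * YB c + 4 * (om c * (qq c - (D/2)\<^sup>2))"
    using eventually_EM_eqs om_eq
  proof eventually_elim
    case (elim c)
    define b o' q y yk where "b = coef_dev (snd c) None" and "o' = om c" and "q = qq c" and "y = YB c" and "yk = Y k c"
    have L: "ln ((1/2 + om c) / (1/2 - om c)) = g c + 4 * o'" by (simp add: g_def o'_def)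
    have "(1/4 - o'\<^sup>2) * b = (1/4 - o'\<^sup>2) * (g c + 4 * o') - (1/4 - o'\<^sup>2) * y + o' * q"
      using conjunct2[OF elim(1)] unfolding L
      unfolding b_def[symmetric] o'_def[symmetric] q_def[symmetric] y_def[symmetric] .
    hence "b = 4 * (o' * o') * b + (g c + 4 * o') - 4 * (o' * o') * (g c + 4 * o') - y + 4 * (o' * o') * y + 4 * (o' * q)"
      by (simp add: power2_eq_square algebra_simps)
    moreover have "4 * (o' * q) = 4 * (o' * (q - (D/2)\<^sup>2)) + D\<^sup>2 * o'" by (simp add: power2_eq_square algebra_simps)
    ultimately have "b - ((4 + D\<^sup>2) * o' - D * yk) = 4 * (o' * o') * b + g c - 4 * (o' * o') * (g c + 4 * o') - (y - D * yk)
      + 4 * (o' * o') * y + 4 * (o' * (q - (D/2)\<^sup>2))"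
      by (simp add: distrib_right)
    thus ?case unfolding b_def o'_def q_def y_def yk_def elim(2) .
  qed
  ultimately show ?thesis using landau_o.big.in_cong by fastforce
qed

end

section \<open>Solution of the linearized equations and expansion of the estimator\<close>

context canon
begin

text \<open>The linearized equations are \<open>info_factor l * coef_dev b l = score l d\<close>. The covariance of label
  and observation enters the EM equations quadratically and vanishes at the truth except in direction \<open>k\<close>;
  hence the different weight there.\<close>
definition score_weight :: "'p option \<Rightarrow> real" where
  "score_weight l = (if l = Some k then 4 + 2 * D\<^sup>2 else 4 + D\<^sup>2)"

definition info_factor :: "'p option \<Rightarrow> real" where
  "info_factor l = 1 - score_weight l * info_loss l"

definition score :: "'p option \<Rightarrow> nat \<times> (nat \<Rightarrow> 'p obs) \<Rightarrow> real" where
  "score l d = score_weight l * (A0 l d - A_limit l) - D * (avg' d (\<lambda>a. ext_coord (Some k) a * ext_coord l a) - Ex (\<lambda>a. ext_coord (Some k) a * ext_coord l a))"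

lemma info_factor_pos: "info_factor l > 0"
  using I0_bound I1_bound by (auto simp: info_factor_def score_weight_def info_loss_def)

lemma score_weight_pos: "score_weight l > 0"
  by (simp add: score_weight_def add_pos_nonneg)

lemma score_bound: "\<bar>score l d\<bar> \<le> (score_weight l + D) * sample_dev d"
proof -
  have m: "\<bar>avg' d g - Ex g\<bar> \<le> sample_dev d" if "g \<in> test_functions" for g
    unfolding sample_dev_def using member_le_sum[of g test_functions "\<lambda>g. \<bar>avg' d g - Ex g\<bar>"] that finite_test_functions by simp
  have "\<bar>A0 l d - A_limit l\<bar> \<le> sample_dev d"
    using m[OF test_functions_mem(2)[of l]] unfolding A0_def Ex_w0_ext_coord A_limit_def by simp
  hence "score_weight l * \<bar>A0 l d - A_limit l\<bar> \<le> score_weight l * sample_dev d" using score_weight_pos[of l] by (intro mult_left_mono) auto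
  moreover have "D * \<bar>avg' d (\<lambda>a. ext_coord (Some k) a * ext_coord l a) - Ex (\<lambda>a. ext_coord (Some k) a * ext_coord l a)\<bar> \<le> D * sample_dev d"
    using D_pos by (intro mult_left_mono m test_functions_mem(1)) auto
  moreover have "\<bar>score l d\<bar> \<le> score_weight l * \<bar>A0 l d - A_limit l\<bar> + D * \<bar>avg' d (\<lambda>a. ext_coord (Some k) a * ext_coord l a) - Ex (\<lambda>a. ext_coord (Some k) a * ext_coord l a)\<bar>"
  proof -
    have "\<bar>score_weight l * u - D * v\<bar> \<le> score_weight l * \<bar>u\<bar> + D * \<bar>v\<bar>" for u v
      using abs_triangle_ineq4[of "score_weight l * u" "D * v"] score_weight_pos[of l] D_pos by (simp add: abs_mult)
    thus ?thesis unfolding score_def .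
  qed
  ultimately show ?thesis by (simp add: distrib_right)
qed

lemma coef_dev_linear: "(\<lambda>c. info_factor l * coef_dev (snd c) l - score l (fst c)) \<in> OXX"
proof -
  have "(\<lambda>c. coef_dev (snd c) l - (score_weight l * (A l c - A_limit l) - D * (avg' (fst c) (\<lambda>a. ext_coord (Some k) a * ext_coord l a) - Ex (\<lambda>a. ext_coord (Some k) a * ext_coord l a)))) \<in> OXX"
  proof (cases l)
    case None
    thus ?thesis using coef_dev_None_linear unfolding None Ex_ext_coord_ext_coord by (simp add: score_weight_def A_limit_def Y_def ext_coord_def)
  next
    case (Some i)
    show ?thesis
    proof (cases "i = k")
      case True
      have e: "Ex (\<lambda>a. ext_coord (Some k) a * ext_coord (Some k) a) = T0 k k" by (simp add: Ex_ext_coord_ext_coord T0_def)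
      show ?thesis using coef_dev_k_linear unfolding Some True e by (simp add: score_weight_def A_limit_def T_def ext_coord_def)
    next
      case False
      have e: "Ex (\<lambda>a. ext_coord (Some k) a * ext_coord (Some i) a) = 0" using False by (simp add: Ex_ext_coord_ext_coord)
      have t: "T i k c = avg' (fst c) (\<lambda>a. ext_coord (Some k) a * ext_coord (Some i) a)" for c
        unfolding T_def ext_coord_def by (simp add: mult.commute)
      show ?thesis using coef_dev_Some_linear[OF False] False unfolding Some e t by (simp add: score_weight_def A_limit_def)
    qed
  qed
  hence "(\<lambda>c. (coef_dev (snd c) l - (score_weight l * (A l c - A_limit l) - D * (avg' (fst c) (\<lambda>a. ext_coord (Some k) a * ext_coord l a) - Ex (\<lambda>a. ext_coord (Some k) a * ext_coord l a))))
      + score_weight l * (A l c - A0 l (fst c) - info_loss l * coef_dev (snd c) l)) \<in> OXX"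
    by (rule sum_in_bigo) (rule O1_OXX[OF O1_const A_expansion])
  moreover have "info_factor l * coef_dev (snd c) l - score l (fst c) = (coef_dev (snd c) l - (score_weight l * (A l c - A_limit l) - D * (avg' (fst c) (\<lambda>a. ext_coord (Some k) a * ext_coord l a) - Ex (\<lambda>a. ext_coord (Some k) a * ext_coord l a))))
      + score_weight l * (A l c - A0 l (fst c) - info_loss l * coef_dev (snd c) l)" for c
    unfolding info_factor_def score_def by (simp add: algebra_simps)
  ultimately show ?thesis by (simp only:)
qed

text \<open>A bootstrap: the linear equations bound the coefficient deviation by the sample
  deviation plus a term quadratic in \<open>Xc\<close>. Near the truth that term is at most half of
  \<open>Xc\<close> and can be absorbed; afterwards all remainders are quadratic in the sample
  deviation alone.\<close>

lemma EMF_bounds: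
  obtains K where "K > 0" "\<forall>\<^sub>F c in EMF. coef_size (snd c) \<le> K * sample_dev (fst c) \<and>
    (\<forall>l. \<bar>info_factor l * coef_dev (snd c) l - score l (fst c)\<bar> \<le> K * (sample_dev (fst c))\<^sup>2)"
proof -
  have "\<forall>l. \<exists>K>0. \<forall>\<^sub>F c in EMF. \<bar>info_factor l * coef_dev (snd c) l - score l (fst c)\<bar> \<le> K * (Xc c * Xc c)"
  proof
    fix l
    obtain K where "K > 0" "\<forall>\<^sub>F c in EMF. norm (info_factor l * coef_dev (snd c) l - score l (fst c)) \<le> K * norm (Xc c * Xc c)"
      using landau_o.bigE[OF coef_dev_linear[of l]] by blast
    thus "\<exists>K>0. \<forall>\<^sub>F c in EMF. \<bar>info_factor l * coef_dev (snd c) l - score l (fst c)\<bar> \<le> K * (Xc c * Xc c)"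
      by (intro exI[of _ K]) simp
  qed
  from choice[OF this] obtain Kl where Kl0: "\<forall>l. Kl l > 0 \<and> (\<forall>\<^sub>F c in EMF. \<bar>info_factor l * coef_dev (snd c) l - score l (fst c)\<bar> \<le> Kl l * (Xc c * Xc c))" ..
  note Kl = conjunct1[OF spec[OF Kl0]] conjunct2[OF spec[OF Kl0]]
  define K1 where "K1 = (\<Sum>l\<in>UNIV. (score_weight l + D) / info_factor l)"
  define K2 where "K2 = (\<Sum>l\<in>UNIV. Kl l / info_factor l)"
  have K1: "K1 \<ge> 0" unfolding K1_def using score_weight_pos info_factor_pos D_pos by (intro sum_nonneg divide_nonneg_nonneg add_nonneg_nonneg) (auto intro: less_imp_le)
  have K2: "K2 \<ge> 0" unfolding K2_def using Kl(1) info_factor_pos by (intro sum_nonneg divide_nonneg_nonneg) (auto intro: less_imp_le)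
  have all: "\<forall>\<^sub>F c in EMF. \<forall>l\<in>UNIV. \<bar>info_factor l * coef_dev (snd c) l - score l (fst c)\<bar> \<le> Kl l * (Xc c * Xc c)"
    by (intro eventually_ball_finite ballI Kl(2)) simp
  \<comment> \<open>Ensures \<open>K2 * Xc c \<le> 1/2\<close>; the constant \<open>K2\<close> is
    only known to be nonnegative at this point, hence the added 1.\<close>
  have small: "\<forall>\<^sub>F c in EMF. Xc c < 1 / (2 * (K2 + 1))"
    by (rule order_tendstoD(2)[OF Xc_tendsto]) (use K2 in simp)
  define K where "K = 2 * K1 + 2 + (\<Sum>l\<in>UNIV. Kl l * (2 * K1 + 2)\<^sup>2)"
  have Ks: "Kl l * (2 * K1 + 2)\<^sup>2 \<le> (\<Sum>l\<in>UNIV. Kl l * (2 * K1 + 2)\<^sup>2)" for l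
    by (intro member_le_sum mult_nonneg_nonneg less_imp_le[OF Kl(1)]) simp_all
  have Ks0: "0 \<le> (\<Sum>l\<in>UNIV. Kl l * (2 * K1 + 2)\<^sup>2)"
    by (intro sum_nonneg mult_nonneg_nonneg less_imp_le[OF Kl(1)]) simp_all
  show thesis
  proof
    show "K > 0" using K1 Ks0 by (simp add: K_def)
    show "\<forall>\<^sub>F c in EMF. coef_size (snd c) \<le> K * sample_dev (fst c) \<and> (\<forall>l. \<bar>info_factor l * coef_dev (snd c) l - score l (fst c)\<bar> \<le> K * (sample_dev (fst c))\<^sup>2)"
      using all small
    proof eventually_elim
      case (elim c)
      let ?S = "sample_dev (fst c)" and ?X = "Xc c"
      have S0: "?S \<ge> 0" and X0: "?X \<ge> 0" by (rule sample_dev_nonneg, rule Xc_nonneg)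
      have bl: "\<bar>coef_dev (snd c) l\<bar> \<le> (score_weight l + D) / info_factor l * ?S + Kl l / info_factor l * (?X * ?X)" for l
      proof -
        have "info_factor l * \<bar>coef_dev (snd c) l\<bar> = \<bar>info_factor l * coef_dev (snd c) l\<bar>" using info_factor_pos[of l] by (simp add: abs_mult)
        also have "\<dots> \<le> \<bar>score l (fst c)\<bar> + \<bar>info_factor l * coef_dev (snd c) l - score l (fst c)\<bar>" by linarith
        also have "\<dots> \<le> (score_weight l + D) * ?S + Kl l * (?X * ?X)" by (intro add_mono score_bound bspec[OF elim(1) UNIV_I])
        finally have "\<bar>coef_dev (snd c) l\<bar> \<le> ((score_weight l + D) * ?S + Kl l * (?X * ?X)) / info_factor l" using info_factor_pos[of l] by (simp add: pos_le_divide_eq mult.commute)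
        thus ?thesis unfolding add_divide_distrib[of "_ * sample_dev _"] by (simp only: times_divide_eq_left)
      qed
      have "coef_size (snd c) \<le> (\<Sum>l\<in>UNIV. (score_weight l + D) / info_factor l * ?S + Kl l / info_factor l * (?X * ?X))"
        unfolding coef_size_def by (intro sum_mono bl)
      also have "\<dots> = K1 * ?S + K2 * ?X * ?X"
        unfolding K1_def K2_def sum.distrib sum_distrib_right by (simp add: mult.assoc)
      also have "K2 * ?X * ?X \<le> 1/2 * ?X"
      proof (rule mult_right_mono[OF _ X0])
        have "K2 * ?X \<le> (K2 + 1) * (1 / (2 * (K2 + 1)))" using elim(2) K2 X0 by (intro mult_mono) auto
        also have "\<dots> = 1/2" using K2 by (simp add: field_simps)
        finally show "K2 * ?X \<le> 1/2" .
      qed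
      finally have R: "coef_size (snd c) \<le> (2 * K1 + 1) * ?S" unfolding Xc_def by (simp add: algebra_simps)
      hence X: "?X \<le> (2 * K1 + 2) * ?S" unfolding Xc_def by (simp add: algebra_simps)
      have "(2 * K1 + 1) * ?S \<le> K * ?S" using Ks0 by (intro mult_right_mono S0) (simp add: K_def)
      moreover have "\<bar>info_factor l * coef_dev (snd c) l - score l (fst c)\<bar> \<le> K * ?S\<^sup>2" for l
      proof -
        have "\<bar>info_factor l * coef_dev (snd c) l - score l (fst c)\<bar> \<le> Kl l * (?X * ?X)" by (rule bspec[OF elim(1) UNIV_I])
        also have "\<dots> \<le> Kl l * (((2 * K1 + 2) * ?S) * ((2 * K1 + 2) * ?S))"
          using Kl(1)[of l] X X0 by (intro mult_left_mono mult_mono) auto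
        also have "\<dots> = (Kl l * (2 * K1 + 2)\<^sup>2) * ?S\<^sup>2" by (simp add: power2_eq_square mult_ac)
        also have "\<dots> \<le> K * ?S\<^sup>2" using Ks[of l] K1 by (intro mult_right_mono) (auto simp: K_def)
        finally show ?thesis .
      qed
      ultimately show ?case using R by (intro conjI allI order_trans[OF R])
    qed
  qed
qed

lemma eventually_EMF_D:
  assumes "eventually Pr EMF"
  obtains \<delta> where "\<delta> > 0" "\<forall>\<^sub>F d in Emp. \<forall>b. dist b \<beta>0 < \<delta> \<longrightarrow> EM_equations (fst d) (snd d) b \<longrightarrow> Pr (d, b)"
proof -
  obtain P1 P2 P3 where P: "eventually P1 (filtercomap fst Emp)" "eventually P2 (filtercomap snd (nhds \<beta>0))"
    "eventually P3 (principal {c. EM_equations (fst (fst c)) (snd (fst c)) (snd c)})" "\<And>c. P1 c \<Longrightarrow> P2 c \<Longrightarrow> P3 c \<Longrightarrow> Pr c"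
    using assms unfolding EMF_def eventually_inf by blast
  obtain R1 where R1: "eventually R1 Emp" "\<And>c. R1 (fst c) \<Longrightarrow> P1 c" using P(1) unfolding eventually_filtercomap by blast
  obtain R2 where R2: "eventually R2 (nhds \<beta>0)" "\<And>c. R2 (snd c) \<Longrightarrow> P2 c" using P(2) unfolding eventually_filtercomap by blast
  obtain \<delta> where \<delta>: "\<delta> > 0" "\<And>b. dist b \<beta>0 < \<delta> \<Longrightarrow> R2 b" using R2(1) unfolding eventually_nhds_metric by blast
  have "\<forall>\<^sub>F d in Emp. \<forall>b. dist b \<beta>0 < \<delta> \<longrightarrow> EM_equations (fst d) (snd d) b \<longrightarrow> Pr (d, b)"
    using R1(1)
  proof eventually_elim
    case (elim d)
    show ?case
    proof (intro allI impI)
      fix b assume b: "dist b \<beta>0 < \<delta>" "EM_equations (fst d) (snd d) b"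
      show "Pr (d, b)"
      proof (rule P(4))
        show "P1 (d, b)" using R1(2)[of "(d, b)"] elim by simp
        show "P2 (d, b)" using R2(2)[of "(d, b)"] \<delta>(2)[OF b(1)] by simp
        show "P3 (d, b)" using bspec[OF P(3)[unfolded eventually_principal], of "(d, b)"] b(2) by simp
      qed
    qed
  qed
  with \<delta>(1) show thesis by (rule that)
qed

abbreviation is_ML :: "nat \<Rightarrow> (nat \<Rightarrow> 'p obs) \<Rightarrow> 'p params \<Rightarrow> bool" where
  "is_ML n x \<theta> \<equiv> is_arg_max (log_lik_PC_ig n x) (\<lambda>\<theta>. \<theta> \<in> param_space) \<theta>"

lemma log_lik_avg: "\<theta> \<in> param_space \<Longrightarrow> n > 0 \<Longrightarrow> log_lik_PC_ig n x \<theta> = real n * avg n x (lobs (cparam_of \<theta>))"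
  by (simp add: log_lik_eq_lobs avg_def)

text \<open>Consistency brings every maximizer near the truth, and being an EM fixed point it solves
  the equations of the joint filter. For existence, the maximizer found in \<open>cspace\<close>
  must moreover have distinct means in order to lie in the parameter space.\<close>

theorem estimator_expansion:
  assumes \<eta>: "\<eta> > 0"
  obtains K where "K > 0" "\<forall>\<^sub>F d in Emp. (\<exists>\<theta>. is_ML (fst d) (snd d) \<theta>) \<and>
    (\<forall>\<theta>. is_ML (fst d) (snd d) \<theta> \<longrightarrow> dist (beta \<theta>) \<beta>0 < \<eta> \<and> coef_size (beta \<theta>) \<le> K * sample_dev d \<and>
       (\<forall>l. \<bar>info_factor l * coef_dev (beta \<theta>) l - score l d\<bar> \<le> K * (sample_dev d)\<^sup>2))"
proof -
  obtain K where K: "K > 0" and ev: "\<forall>\<^sub>F c in EMF. coef_size (snd c) \<le> K * sample_dev (fst c) \<and>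
    (\<forall>l. \<bar>info_factor l * coef_dev (snd c) l - score l (fst c)\<bar> \<le> K * (sample_dev (fst c))\<^sup>2)"
    using EMF_bounds by blast
  obtain \<delta>' where \<delta>': "\<delta>' > 0" "\<forall>\<^sub>F d in Emp. \<forall>b. dist b \<beta>0 < \<delta>' \<longrightarrow> EM_equations (fst d) (snd d) b \<longrightarrow>
     coef_size (snd (d, b)) \<le> K * sample_dev (fst (d, b)) \<and> (\<forall>l. \<bar>info_factor l * coef_dev (snd (d, b)) l - score l (fst (d, b))\<bar> \<le> K * (sample_dev (fst (d, b)))\<^sup>2)"
    using eventually_EMF_D[OF ev] by blast
  \<comment> \<open>Equal means give slope 0, which has distance at least \<open>D\<close> from
    \<open>\<beta>0\<close>; a radius of at most \<open>D\<close> therefore rules them out.\<close>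
  define \<delta> where "\<delta> = min (min \<delta>' D) \<eta>"
  have \<delta>: "\<delta> > 0" "\<delta> \<le> \<delta>'" "\<delta> \<le> D" "\<delta> \<le> \<eta>" using \<delta>'(1) D_pos \<eta> by (auto simp: \<delta>_def)
  obtain c C where cC: "c > 0" "C > 0" "\<forall>\<^sub>F d in Emp. nondegenerate (fst d) (snd d) c C"
    by (rule eventually_nondegenerate)
  have "\<forall>\<^sub>F d in Emp. (\<exists>\<theta>. is_ML (fst d) (snd d) \<theta>) \<and>
    (\<forall>\<theta>. is_ML (fst d) (snd d) \<theta> \<longrightarrow> dist (beta \<theta>) \<beta>0 < \<eta> \<and> coef_size (beta \<theta>) \<le> K * sample_dev d \<and>
       (\<forall>l. \<bar>info_factor l * coef_dev (beta \<theta>) l - score l d\<bar> \<le> K * (sample_dev d)\<^sup>2))"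
    using \<delta>'(2) cC(3) eventually_likelihood_separated[OF cC(1,2) \<delta>(1)] emp_filter_pos
  proof eventually_elim
    case (elim d)
    obtain n x where d: "d = (n, x)" by (cases d)
    have nd: "nondegenerate n x c C" and n: "n > 0" using elim(2,4) by (simp_all add: d)
    have sep: "dist (cbeta t) \<beta>0 < \<delta>" if "t \<in> cparam_box c C" "\<And>s. s \<in> cspace \<Longrightarrow> avg n x (lobs s) \<le> avg n x (lobs t)" for t
    proof (rule ccontr)
      assume "\<not> dist (cbeta t) \<beta>0 < \<delta>"
      hence "avg n x (lobs t) < avg n x (lobs (canon_param k D))"
        using elim(3) that(1) by (simp add: d cbeta_canon)
      with that(2)[OF canon_param_in_cspace[of k D]] show False by linarith
    qed
    have neq: "cmean t Class1 \<noteq> cmean t Class2" if "dist (cbeta t) \<beta>0 < \<delta>" for t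
    proof
      assume "cmean t Class1 = cmean t Class2"
      hence "snd (cbeta t) = 0" unfolding cbeta_def Let_def by (simp del: cmean.simps)
      hence "norm (snd (cbeta t) - snd \<beta>0) = D" using D_pos by (simp add: norm_axis_1)
      hence "D \<le> dist (cbeta t) \<beta>0" using dist_snd_le[of "cbeta t" "\<beta>0"] by (simp only: dist_norm)
      with that \<delta>(3) show False by linarith
    qed
    have ex: "\<exists>\<theta>. is_ML n x \<theta>"
    proof -
      obtain t where t: "t \<in> cparam_box c C" and mx: "\<And>s. s \<in> cspace \<Longrightarrow> avg n x (lobs s) \<le> avg n x (lobs t)"
        using maximizer_exists[OF nd cC(1,2)] by blast
      have tc: "t \<in> cspace" by (rule subsetD[OF cparam_box_subset[OF cC(1,2)] t])
      have p: "param_of t \<in> param_space" by (rule param_of_in_param_space[OF tc neq[OF sep[OF t mx]]])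
      have "\<not> (\<exists>\<theta>'. \<theta>' \<in> param_space \<and> log_lik_PC_ig n x \<theta>' > log_lik_PC_ig n x (param_of t))"
      proof
        assume "\<exists>\<theta>'. \<theta>' \<in> param_space \<and> log_lik_PC_ig n x \<theta>' > log_lik_PC_ig n x (param_of t)"
        then obtain \<theta>' where th: "\<theta>' \<in> param_space" "log_lik_PC_ig n x \<theta>' > log_lik_PC_ig n x (param_of t)" by blast
        have "avg n x (lobs (cparam_of \<theta>')) \<le> avg n x (lobs t)" by (rule mx[OF cparam_of_in_cspace[OF th(1)]])
        hence "real n * avg n x (lobs (cparam_of \<theta>')) \<le> real n * avg n x (lobs t)" by (rule mult_left_mono) simp
        thus False using th(2) unfolding log_lik_avg[OF th(1) n] log_lik_avg[OF p n] cparam_of_param_of[OF tc] by linarith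
      qed
      thus ?thesis using p unfolding is_arg_max_def by blast
    qed
    have "dist (beta \<theta>) \<beta>0 < \<delta> \<and> EM_equations n x (beta \<theta>)" if ml: "is_ML n x \<theta>" for \<theta>
    proof -
      have th: "\<theta> \<in> param_space" and mx0: "\<And>\<theta>'. \<theta>' \<in> param_space \<Longrightarrow> log_lik_PC_ig n x \<theta>' \<le> log_lik_PC_ig n x \<theta>"
        using ml unfolding is_arg_max_def not_ex de_Morgan_conj not_less by simp_all
      define t where "t = cparam_of \<theta>"
      have tc: "t \<in> cspace" unfolding t_def by (rule cparam_of_in_cspace[OF th])
      have mx: "avg n x (lobs s) \<le> avg n x (lobs t)" if s: "s \<in> cspace" for s
      proof (rule avg_lobs_le_of_param_space[OF _ s])
        fix s :: "'p cparam" assume s: "s \<in> cspace" "cmean s Class1 \<noteq> cmean s Class2"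
        have p: "param_of s \<in> param_space" by (rule param_of_in_param_space[OF s])
        have "real n * avg n x (lobs s) \<le> real n * avg n x (lobs t)"
          using mx0[OF p] unfolding log_lik_avg[OF p n] log_lik_avg[OF th n] cparam_of_param_of[OF s(1)] t_def .
        thus "avg n x (lobs s) \<le> avg n x (lobs t)" using n by simp
      qed
      note fp = maximizer_EM_fixed_point[OF nd cC(1,2) tc mx]
      have b: "beta \<theta> = cbeta t" by (simp add: t_def cbeta_cparam_of)
      have "EM_equations n x (cbeta t)"
      proof (rule EM_equations_of_fixed_point[OF n])
        show "weighted_sample.wprior n x (resp (cbeta t)) i > 0" for i
          using wprior_ge[OF nd cC(1,2), of "cbeta t" i] cC(1) by linarith
        show "pos_def_matrix (weighted_sample.wcov n x (resp (cbeta t)))" by (rule pos_def_wcov[OF nd cC(1,2)])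
        show "cbeta t = cbeta (weighted_sample.wparam n x (resp (cbeta t)))"
          using fp(1) by (rule arg_cong)
      qed
      thus ?thesis unfolding b using sep[OF fp(2) mx] by blast
    qed
    note ml = this
    show ?case
      unfolding d fst_conv snd_conv
    proof (intro conjI ex allI impI)
      fix \<theta> assume "is_ML n x \<theta>"
      note b = conjunct1[OF ml[OF this]] conjunct2[OF ml[OF this]]
      have "dist (beta \<theta>) \<beta>0 < \<delta>'" using b(1) \<delta>(2) by (rule less_le_trans)
      with elim(1) b(2) have *: "coef_size (beta \<theta>) \<le> K * sample_dev (n, x) \<and> (\<forall>l. \<bar>info_factor l * coef_dev (beta \<theta>) l - score l (n, x)\<bar> \<le> K * (sample_dev (n, x))\<^sup>2)"
        unfolding d fst_conv snd_conv by blast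
      show "dist (beta \<theta>) \<beta>0 < \<eta>" using b(1) \<delta>(4) by (rule less_le_trans)
      show "coef_size (beta \<theta>) \<le> K * sample_dev (n, x)" using * by blast
      show "\<bar>info_factor l * coef_dev (beta \<theta>) l - score l (n, x)\<bar> \<le> K * (sample_dev (n, x))\<^sup>2" for l using * by blast
    qed
  qed
  with K show thesis by (rule that)
qed

end

section \<open>Error rate near the optimal rule\<close>

lemma integrable_normal_bounded:
  assumes "h \<in> borel_measurable borel" "\<And>x. \<bar>h x\<bar> \<le> 1"
  shows "integrable lborel (\<lambda>x. normal_density m 1 x * h x)"
  by (rule integrable_normal_mult[where C = 1 and j = 0]) (use assms in auto)

lemma prod_normal_density:
  fixes m y :: "real^'p::finite"
  shows "(\<Prod>j\<in>UNIV. normal_density (m $ j) 1 (y $ j)) = exp (- (norm (y - m))\<^sup>2 / 2) / sqrt (2 * pi) ^ CARD('p)"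
proof -
  have "(\<Prod>j\<in>UNIV. normal_density (m $ j) 1 (y $ j)) = (\<Prod>j\<in>UNIV. exp (- ((y - m) $ j)\<^sup>2 / 2) / sqrt (2 * pi))"
    by (simp add: normal_density_def)
  also have "\<dots> = exp (\<Sum>j\<in>UNIV. - ((y - m) $ j)\<^sup>2 / 2) / sqrt (2 * pi) ^ CARD('p)"
    by (simp add: prod_dividef exp_sum)
  also have "(\<Sum>j\<in>UNIV. - ((y - m) $ j)\<^sup>2 / 2) = - (norm (y - m))\<^sup>2 / 2"
    unfolding dot_square_norm[symmetric] inner_vec_def by (simp add: power2_eq_square sum_negf sum_divide_distrib[symmetric])
  finally show ?thesis .
qed

text \<open>A rotation that takes a coordinate axis to \<open>v\<close> preserves Lebesgue measure
  and the form of the density, and turns the integrand into a product over coordinates, all but one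
  of whose factors integrate to 1.\<close>

lemma integral_normal_direction:
  fixes m v :: "real^'p::finite" and f :: "real \<Rightarrow> real"
  assumes v: "norm v = 1" and [measurable]: "f \<in> borel_measurable borel" and b: "\<And>x. \<bar>f x\<bar> \<le> 1"
  shows "(\<integral>y. (\<Prod>j\<in>UNIV. normal_density (m $ j) 1 (y $ j)) * f (v \<bullet> y) \<partial>lborel) = (\<integral>x. normal_density (v \<bullet> m) 1 x * f x \<partial>lborel)"
proof -
  obtain U :: "real^'p^'p" and k where U: "orthogonal_matrix U" "U *v axis k 1 = v"
    using orthogonal_matrix_exists_basis[OF v] by metis
  have UU: "U ** transpose U = mat 1" "transpose U ** U = mat 1" using U(1) by (simp_all add: orthogonal_matrix_def)
  have [measurable]: "(\<lambda>x. U *v x) \<in> borel_measurable borel"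
    by (intro borel_measurable_continuous_onI) (simp add: linear_continuous_on matrix_vector_mul_bounded_linear)
  have vU: "v \<bullet> (U *v w) = w $ k" for w
  proof -
    have "v \<bullet> (U *v w) = axis k 1 \<bullet> (transpose U *v (U *v w))" unfolding U(2)[symmetric]
      using inner_matrix_vector_transpose[of U "axis k 1" "U *v w"] .
    thus ?thesis by (simp add: matrix_vector_mul_assoc UU inner_axis')
  qed
  have mk: "(transpose U *v m) $ k = v \<bullet> m"
    using vU[of "transpose U *v m"] unfolding matrix_vector_mul_assoc UU matrix_vector_mul_lid by (rule sym)
  have nU: "norm (U *v w - m) = norm (w - transpose U *v m)" for w
  proof -
    have "U *v w - m = U *v (w - transpose U *v m)" unfolding matrix_vector_mult_diff_distrib matrix_vector_mul_assoc UU matrix_vector_mul_lid ..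
    moreover have "orthogonal_transformation ((*v) U)" using U(1) by (simp add: orthogonal_transformation_matrix)
    ultimately show ?thesis by (simp add: orthogonal_transformation_norm)
  qed
  have pn: "(\<Prod>j\<in>UNIV. normal_density (m $ j) 1 ((U *v w) $ j)) = (\<Prod>j\<in>UNIV. normal_density ((transpose U *v m) $ j) 1 (w $ j))" for w
    unfolding prod_normal_density nU ..
  have "(\<integral>y. (\<Prod>j\<in>UNIV. normal_density (m $ j) 1 (y $ j)) * f (v \<bullet> y) \<partial>lborel)
      = (\<integral>y. (\<Prod>j\<in>UNIV. normal_density (m $ j) 1 (y $ j)) * f (v \<bullet> y) \<partial>(distr lborel borel (\<lambda>x. U *v x)))"
    by (simp add: lborel_distr_orthogonal[OF U(1)])
  also have "\<dots> = (\<integral>w. (\<Prod>j\<in>UNIV. normal_density (m $ j) 1 ((U *v w) $ j)) * f (v \<bullet> (U *v w)) \<partial>lborel)"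
    by (rule integral_distr) auto
  also have "\<dots> = (\<integral>w. (\<Prod>j\<in>UNIV. normal_density ((transpose U *v m) $ j) 1 (w $ j)) * f (w $ k) \<partial>lborel)"
    unfolding pn vU ..
  also have "\<dots> = (\<integral>w. (\<Prod>j\<in>UNIV. normal_density ((transpose U *v m) $ j) 1 (w $ j) * (if j = k then f (w $ j) else 1)) \<partial>lborel)"
    by (simp add: prod.distrib prod.delta)
  also have "\<dots> = (\<Prod>j\<in>UNIV. \<integral>x. normal_density ((transpose U *v m) $ j) 1 x * (if j = k then f x else 1) \<partial>lborel)"
  proof (rule integral_lborel_prod_cart[of "\<lambda>j x. normal_density ((transpose U *v m) $ j) 1 x * (if j = k then f x else 1)"])
    show "integrable lborel (\<lambda>x. normal_density ((transpose U *v m) $ j) 1 x * (if j = k then f x else 1))" for j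
      by (rule integrable_normal_bounded) (use b in auto)
  qed
  also have "\<dots> = (\<Prod>j\<in>UNIV. if j = k then \<integral>x. normal_density (v \<bullet> m) 1 x * f x \<partial>lborel else 1)"
  proof (intro prod.cong refl)
    fix j
    show "(\<integral>x. normal_density ((transpose U *v m) $ j) 1 x * (if j = k then f x else 1) \<partial>lborel) =
      (if j = k then \<integral>x. normal_density (v \<bullet> m) 1 x * f x \<partial>lborel else 1)"
      using normal_moments(1)[of "(transpose U *v m) $ j"] by (simp add: mk del: transpose_matrix_vector)
  qed
  also have "\<dots> = (\<integral>x. normal_density (v \<bullet> m) 1 x * f x \<partial>lborel)" by (simp add: prod.delta)
  finally show ?thesis .
qed

text \<open>The standard normal distribution function.\<close>

definition gcdf :: "real \<Rightarrow> real" where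
  "gcdf s = (\<integral>x. std_normal_density x * of_bool (x < s) \<partial>lborel)"

lemma gcdf_upper: "(\<integral>x. std_normal_density x * of_bool (x > - s) \<partial>lborel) = gcdf s"
  unfolding gcdf_def
  by (subst lborel_integral_real_affine[of "-1" _ 0]) (simp_all add: std_normal_density_def)

lemma gcdf_shift:
  "(\<integral>x. normal_density m 1 x * of_bool (x > - s) \<partial>lborel) = gcdf (s + m)"
  "(\<integral>x. normal_density m 1 x * of_bool (x < - s) \<partial>lborel) = gcdf (- s - m)"
proof -
  have "(m + x > - s) = (x > - (s + m))" "(m + x < - s) = (x < - s - m)" for x by linarith+
  thus "(\<integral>x. normal_density m 1 x * of_bool (x > - s) \<partial>lborel) = gcdf (s + m)"
    "(\<integral>x. normal_density m 1 x * of_bool (x < - s) \<partial>lborel) = gcdf (- s - m)"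
    unfolding normal_shift[of m] gcdf_upper[of "s + m", symmetric] gcdf_def[of "- s - m"] by simp_all
qed

lemma gcdf_derivative: "(gcdf has_real_derivative std_normal_density t) (at t)"
proof -
  \<comment> \<open>The fundamental theorem of calculus is applied on a compact interval with
    \<open>t\<close> in its interior; \<open>gcdf (- N)\<close> accounts for the tail.\<close>
  define N where "N = \<bar>t\<bar> + 1"
  have c: "continuous_on S std_normal_density" for S unfolding normal_density_def by (intro continuous_intros) auto
  have e: "gcdf (- N) + integral {-N..s} std_normal_density = gcdf s" if s: "s \<in> {-N<..<N}" for s
  proof -
    have ib: "integrable lborel (\<lambda>x. std_normal_density x * of_bool (x < r))" for r
      by (rule integrable_normal_bounded) auto
    have "gcdf s - gcdf (-N) = (\<integral>x. std_normal_density x * of_bool (x < s) - std_normal_density x * of_bool (x < - N) \<partial>lborel)"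
      unfolding gcdf_def by (rule Bochner_Integration.integral_diff[symmetric, OF ib ib])
    also have "\<dots> = (\<integral>x. indicator {-N..<s} x *\<^sub>R std_normal_density x \<partial>lborel)"
      by (intro Bochner_Integration.integral_cong refl) (use s in \<open>auto simp: indicator_def\<close>)
    also have "\<dots> = (\<integral>x. indicator {-N..s} x *\<^sub>R std_normal_density x \<partial>lborel)"
    proof (rule integral_cong_AE)
      have "AE x in lborel. x \<noteq> s" by (rule AE_lborel_singleton)
      thus "AE x in lborel. indicator {-N..<s} x *\<^sub>R std_normal_density x = indicator {-N..s} x *\<^sub>R std_normal_density x"
        by eventually_elim (auto simp: indicator_def)
    qed auto
    also have "\<dots> = integral {-N..s} std_normal_density"
      using set_borel_integral_eq_integral(2)[OF borel_integrable_atLeastAtMost'[OF c[of "{-N..s}"]]]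
      by (simp add: set_lebesgue_integral_def)
    finally show ?thesis by simp
  qed
  have t: "t \<in> {-N<..<N}" by (auto simp: N_def)
  have tN: "at t within {-N..N} = at t" by (rule at_within_Icc_at) (auto simp: N_def)
  have "((\<lambda>s. gcdf (- N) + integral {-N..s} std_normal_density) has_real_derivative std_normal_density t) (at t within {-N..N})"
    using DERIV_add[OF DERIV_const integral_has_real_derivative[OF c, of t]] t by simp
  hence "((\<lambda>s. gcdf (- N) + integral {-N..s} std_normal_density) has_real_derivative std_normal_density t) (at t)"
    unfolding tN .
  thus ?thesis
    by (rule has_field_derivative_transform_within_open[OF _ open_greaterThanLessThan t e])
qed

lemma std_normal_density_derivative: "(std_normal_density has_real_derivative - t * std_normal_density t) (at t)"
proof -
  have "((\<lambda>x. 1 / sqrt (2 * pi) * exp (- x\<^sup>2 / 2)) has_real_derivative 1 / sqrt (2 * pi) * (exp (- t\<^sup>2 / 2) * (- (2 * t) / 2))) (at t)"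
    by (rule DERIV_cmult) (rule derivative_eq_intros refl | simp)+
  thus ?thesis unfolding std_normal_density_def by (rule DERIV_cong) simp
qed

lemma std_normal_second_derivative_bound: "\<bar>(t\<^sup>2 - 1) * std_normal_density t\<bar> \<le> 3"
proof -
  have e1: "exp (- t\<^sup>2 / 2) \<le> 1" by simp
  have "t\<^sup>2 / 2 \<le> exp (t\<^sup>2 / 2)" using exp_ge_add_one_self[of "t\<^sup>2/2"] by linarith
  hence "t\<^sup>2 / 2 * exp (- t\<^sup>2 / 2) \<le> exp (t\<^sup>2 / 2) * exp (- t\<^sup>2 / 2)" by (intro mult_right_mono) auto
  hence e2: "t\<^sup>2 * exp (- t\<^sup>2 / 2) \<le> 2" by (simp add: exp_add[symmetric])
  have s: "1 \<le> sqrt (2 * pi)" using pi_gt3 by simp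
  have "\<bar>t\<^sup>2 - 1\<bar> * exp (- t\<^sup>2 / 2) \<le> (t\<^sup>2 + 1) * exp (- t\<^sup>2 / 2)" by (intro mult_right_mono) (auto simp: abs_le_iff)
  also have "\<dots> \<le> 3" unfolding distrib_right using e1 e2 by linarith
  finally have "\<bar>t\<^sup>2 - 1\<bar> * exp (- t\<^sup>2 / 2) / sqrt (2 * pi) \<le> 3 / 1" using s by (intro frac_le) auto
  thus ?thesis by (simp add: std_normal_density_def abs_mult)
qed

text \<open>The third derivative is t^2 - 1 times the density and bounded by 3; the Taylor remainder
  then has the factor 3 / 6, which is below 1.\<close>

lemma gcdf_taylor: "\<bar>gcdf (a + s) - gcdf a - std_normal_density a * s + a * std_normal_density a * s\<^sup>2 / 2\<bar> \<le> \<bar>s\<bar> ^ 3"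
proof (cases "s = 0")
  case False
  define df where "df m t = (if m = 0 then gcdf t else if m = 1 then std_normal_density t else if m = 2 then - t * std_normal_density t
     else (t\<^sup>2 - 1) * std_normal_density t)" for m :: nat and t
  have d2: "((\<lambda>t. - t * std_normal_density t) has_real_derivative (t\<^sup>2 - 1) * std_normal_density t) (at t)" for t
    by (rule DERIV_cong[OF DERIV_mult[OF DERIV_minus[OF DERIV_ident] std_normal_density_derivative]]) (simp add: algebra_simps power2_eq_square)
  have D: "(df m has_real_derivative df (Suc m) t) (at t)" if "m < 3" for m t
  proof -
    have "m = 0 \<or> m = 1 \<or> m = 2" using that by linarith
    thus ?thesis
    proof (elim disjE)
      assume m: "m = 0" show ?thesis using gcdf_derivative[of t] by (simp add: m df_def[abs_def])
    next
      assume m: "m = 1" show ?thesis using std_normal_density_derivative[of t] by (simp add: m df_def[abs_def])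
    next
      assume m: "m = 2" show ?thesis using d2[of t] by (simp add: m df_def[abs_def])
    qed
  qed
  obtain t where t: "gcdf (a + s) = (\<Sum>m<3. df m a / fact m * (a + s - a) ^ m) + df 3 t / fact 3 * (a + s - a) ^ 3"
    using Taylor[of 3 df gcdf "min a (a + s)" "max a (a + s)" a "a + s"] D False by (auto simp: df_def[abs_def])
  have "gcdf (a + s) - gcdf a - std_normal_density a * s + a * std_normal_density a * s\<^sup>2 / 2 = df 3 t / 6 * s ^ 3"
    unfolding t by (simp add: df_def numeral_3_eq_3 fact_numeral numeral_2_eq_2)
  also have "\<bar>\<dots>\<bar> \<le> 1 * \<bar>s\<bar> ^ 3"
    unfolding abs_mult power_abs using std_normal_second_derivative_bound[of t] by (intro mult_right_mono) (auto simp: df_def)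
  finally show ?thesis by simp
qed simp

text \<open>Here \<open>r\<close> is the length of the slope, \<open>x\<close> its component along
  the axis, \<open>s\<close> the squared length of the rest and \<open>b\<close> the intercept. The
  identity 1 - x / r = s / (r (r + x)) avoids expanding a square root, and r (r + x) is close to 2
  D^2.\<close>

lemma direction_expansion:
  fixes D \<rho> r x s b :: real
  assumes D: "D > 0" and \<rho>: "0 \<le> \<rho>" "\<rho> \<le> D / 2" and r: "\<bar>r - D\<bar> \<le> \<rho>" and x: "\<bar>x - D\<bar> \<le> \<rho>"
    and s: "0 \<le> s" "s \<le> \<rho>\<^sup>2" and rs: "r\<^sup>2 = x\<^sup>2 + s" and b: "\<bar>b\<bar> \<le> \<rho>"
  shows "\<bar>1 - x / r - s / (2 * D\<^sup>2)\<bar> \<le> 5 / D ^ 3 * \<rho> ^ 3" "\<bar>1 - x / r\<bar> \<le> 2 / D\<^sup>2 * \<rho>\<^sup>2"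
    "\<bar>(b / r)\<^sup>2 - b\<^sup>2 / D\<^sup>2\<bar> \<le> 10 / D ^ 3 * \<rho> ^ 3" "\<bar>b / r\<bar> \<le> 2 / D * \<rho>"
proof -
  have r2: "r \<ge> D / 2" "r \<le> 3 * D / 2" and x2: "x \<ge> D / 2" "x \<le> 3 * D / 2" using r x \<rho> by linarith+
  have r0: "r > 0" and rx0: "r + x > 0" using r2 x2 D by linarith+
  have "D / 2 * D \<le> r * (r + x)" using r2 x2 D by (intro mult_mono) auto
  hence rx: "D\<^sup>2 / 2 \<le> r * (r + x)" by (simp add: power2_eq_square)
  have e: "1 - x / r = s / (r * (r + x))"
  proof -
    have "s = (r - x) * (r + x)" using rs by (simp add: algebra_simps power2_eq_square)
    hence "s / (r * (r + x)) = (r - x) / r" using rx0 by simp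
    thus ?thesis using r0 by (simp add: diff_divide_distrib)
  qed
  have dr2: "\<bar>r\<^sup>2 - D\<^sup>2\<bar> \<le> \<rho> * (5 * D / 2)"
  proof -
    have "\<bar>r\<^sup>2 - D\<^sup>2\<bar> = \<bar>r - D\<bar> * (r + D)" using r0 D by (simp add: power2_eq_square square_diff_square_factored abs_mult)
    also have "\<dots> \<le> \<rho> * (5 * D / 2)" using r r2 D r0 by (intro mult_mono) auto
    finally show ?thesis .
  qed
  have drx: "\<bar>r * x - D\<^sup>2\<bar> \<le> \<rho> * (5 * D / 2)"
  proof -
    have "r * x - D\<^sup>2 = (r - D) * x + D * (x - D)" by (simp add: algebra_simps power2_eq_square)
    also have "\<bar>\<dots>\<bar> \<le> \<bar>r - D\<bar> * x + D * \<bar>x - D\<bar>"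
      using abs_triangle_ineq[of "(r - D) * x" "D * (x - D)"] x2 D by (simp add: abs_mult)
    also have "\<dots> \<le> \<rho> * (3 * D / 2) + D * \<rho>" using r x x2 D \<rho> by (intro add_mono mult_mono mult_left_mono) auto
    finally show ?thesis by (simp add: algebra_simps)
  qed
  show "\<bar>1 - x / r - s / (2 * D\<^sup>2)\<bar> \<le> 5 / D ^ 3 * \<rho> ^ 3"
  proof -
    have "1 - x / r - s / (2 * D\<^sup>2) = s * ((2 * D\<^sup>2 - r * (r + x)) / (r * (r + x) * (2 * D\<^sup>2)))"
      unfolding e using r0 rx0 D by (simp add: divide_simps) (simp add: algebra_simps)
    also have "\<bar>\<dots>\<bar> = s * (\<bar>2 * D\<^sup>2 - r * (r + x)\<bar> / (r * (r + x) * (2 * D\<^sup>2)))"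
      using s r0 rx0 D by (simp add: abs_mult)
    also have "\<dots> \<le> \<rho>\<^sup>2 * ((5 * D * \<rho>) / (D\<^sup>2 / 2 * (2 * D\<^sup>2)))"
    proof (rule mult_mono[OF s(2) frac_le])
      show "\<bar>2 * D\<^sup>2 - r * (r + x)\<bar> \<le> 5 * D * \<rho>"
        using dr2 drx unfolding distrib_left power2_eq_square by (simp only: abs_le_iff) (simp add: algebra_simps)
      show "D\<^sup>2 / 2 * (2 * D\<^sup>2) \<le> r * (r + x) * (2 * D\<^sup>2)" using rx by (intro mult_right_mono) auto
    qed (use D \<rho> r0 rx0 in auto)
    also have "\<dots> = 5 / D ^ 3 * \<rho> ^ 3" using D by (simp add: field_simps power2_eq_square power3_eq_cube)
    finally show ?thesis .
  qed
  show "\<bar>1 - x / r\<bar> \<le> 2 / D\<^sup>2 * \<rho>\<^sup>2"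
  proof -
    have "\<bar>1 - x / r\<bar> = s / (r * (r + x))" unfolding e using s r0 rx0 by simp
    also have "\<dots> \<le> \<rho>\<^sup>2 / (D\<^sup>2 / 2)" using s rx D by (intro frac_le) auto
    finally show ?thesis by (simp add: mult.commute)
  qed
  show "\<bar>(b / r)\<^sup>2 - b\<^sup>2 / D\<^sup>2\<bar> \<le> 10 / D ^ 3 * \<rho> ^ 3"
  proof -
    have b2: "b\<^sup>2 \<le> \<rho>\<^sup>2" using b \<rho> by (simp add: abs_le_square_iff[symmetric])
    have "(b / r)\<^sup>2 - b\<^sup>2 / D\<^sup>2 = b\<^sup>2 * ((D\<^sup>2 - r\<^sup>2) / (r\<^sup>2 * D\<^sup>2))" using r0 D by (simp add: field_simps)
    also have "\<bar>\<dots>\<bar> = b\<^sup>2 * (\<bar>r\<^sup>2 - D\<^sup>2\<bar> / (r\<^sup>2 * D\<^sup>2))" by (simp add: abs_mult abs_minus_commute)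
    also have "\<dots> \<le> \<rho>\<^sup>2 * ((\<rho> * (5 * D / 2)) / ((D / 2)\<^sup>2 * D\<^sup>2))"
      using r2 D \<rho> by (intro mult_mono frac_le b2 dr2 mult_right_mono power_mono) auto
    also have "\<dots> = 10 / D ^ 3 * \<rho> ^ 3" using D by (simp add: field_simps power2_eq_square power3_eq_cube)
    finally show ?thesis .
  qed
  show "\<bar>b / r\<bar> \<le> 2 / D * \<rho>"
  proof -
    have "\<bar>b / r\<bar> = \<bar>b\<bar> / r" using r0 by simp
    also have "\<dots> \<le> \<rho> / (D / 2)" using b r2 D by (intro frac_le) auto
    finally show ?thesis by (simp add: mult.commute)
  qed
qed

definition cerr :: "'p::finite cparam \<Rightarrow> real \<times> (real^'p) \<Rightarrow> real" where
  "cerr t b = 1 - (\<Sum>i\<in>UNIV. \<integral>y. exp (lcomp t i y) * of_bool (bayes_rule b y = Some i) \<partial>lborel)"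

lemma bayes_rule_measurable: "Measurable.pred (borel \<Otimes>\<^sub>M borel) (\<lambda>p :: (real \<times> (real^'p::finite)) \<times> (real^'p). bayes_rule (fst p) (snd p) = Some (i :: label))"
proof -
  have d [measurable]: "(\<lambda>p :: (real \<times> (real^'p)) \<times> (real^'p). discr (fst p) (snd p)) \<in> borel_measurable (borel \<Otimes>\<^sub>M borel)"
    unfolding borel_prod discr_def by (intro borel_measurable_continuous_onI continuous_intros)
  have e: "(bayes_rule b y = Some i) = (if i = Class1 then discr b y > 0 else discr b y < 0)" for b :: "real \<times> (real^'p)" and y
    by (cases i) (auto simp: bayes_rule_def)
  show ?thesis unfolding e by (cases "i = Class1") simp_all
qed

lemma cerr_measurable: "cerr (t :: 'p::finite cparam) \<in> borel_measurable borel"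
proof -
  have "(\<lambda>b. \<integral>y. exp (lcomp t i y) * of_bool (bayes_rule b y = Some i) \<partial>lborel) \<in> borel_measurable borel" for i
  proof (rule sigma_finite_measure.borel_measurable_lebesgue_integral)
    show "sigma_finite_measure (lborel :: (real^'p) measure)" ..
    have [measurable]: "Measurable.pred (borel \<Otimes>\<^sub>M lborel) (\<lambda>p :: (real \<times> (real^'p)) \<times> (real^'p). bayes_rule (fst p) (snd p) = Some i)"
      using bayes_rule_measurable[of i] unfolding measurable_cong_sets[OF sets_pair_measure_cong[OF refl sets_lborel] refl] .
    show "(\<lambda>(b, y). exp (lcomp t i y) * of_bool (bayes_rule b y = Some i)) \<in> borel_measurable (borel \<Otimes>\<^sub>M lborel)"
      unfolding case_prod_beta by measurable
  qed
  thus ?thesis unfolding cerr_def[abs_def] by (intro borel_measurable_diff borel_measurable_sum borel_measurable_const)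
qed

lemma cerr_bounds:
  assumes t: "t \<in> cspace"
  shows "0 \<le> cerr t b" "cerr t b \<le> 1"
proof -
  have i: "integrable lborel (\<lambda>y. exp (lcomp t i y))" for i
    using integrable_exp_lcomp_moment[OF t, of i 0] by simp
  have le: "(\<integral>y. exp (lcomp t i y) * of_bool (bayes_rule b y = Some i) \<partial>lborel) \<le> cprior t i" for i
  proof -
    have "(\<integral>y. exp (lcomp t i y) * of_bool (bayes_rule b y = Some i) \<partial>lborel) \<le> (\<integral>y. exp (lcomp t i y) \<partial>lborel)"
      by (rule integral_mono'[OF i]) auto
    also have "\<dots> = cprior t i"
      using nn_integral_exp_lcomp[OF t, of i] cprior_pos[OF t, of i] by (simp add: integral_eq_nn_integral)
    finally show ?thesis .
  qed
  have "(\<Sum>i\<in>UNIV. \<integral>y. exp (lcomp t i y) * of_bool (bayes_rule b y = Some i) \<partial>lborel) \<le> (\<Sum>i\<in>UNIV. cprior t i)"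
    by (intro sum_mono le)
  thus "0 \<le> cerr t b" by (simp add: cerr_def sum_label)
  have "0 \<le> (\<Sum>i\<in>UNIV. \<integral>y. exp (lcomp t i y) * of_bool (bayes_rule b y = Some i) \<partial>lborel)"
    by (intro sum_nonneg integral_nonneg_AE) auto
  thus "cerr t b \<le> 1" by (simp add: cerr_def)
qed

lemma canon_lcomp_prod:
  "exp (lcomp (canon_param k D) i y) = 1/2 * (\<Prod>j\<in>UNIV. normal_density ((cmu D i *\<^sub>R axis k 1) $ j) 1 (y $ j))"
  unfolding canon_lcomp by (subst (2) prod.remove[of _ k]) (auto simp: axis_def intro!: prod.cong)

text \<open>Projecting on the unit normal of the decision hyperplane reduces each class to a
  one-dimensional normal law, whose mean is plus or minus D / 2 times the cosine of the angle
  between the normal and the axis.\<close>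

lemma cerr_canon:
  assumes b: "snd b \<noteq> 0"
  defines "r \<equiv> norm (snd b)"
  shows "cerr (canon_param k D) b = 1 - (gcdf (D / 2 * (snd b $ k / r) + fst b / r) + gcdf (D / 2 * (snd b $ k / r) - fst b / r)) / 2"
proof -
  have r: "r > 0" using b by (simp add: r_def)
  define v where "v = snd b /\<^sub>R r"
  have v: "norm v = 1" using r by (simp add: v_def r_def)
  have d: "discr b y = r * (v \<bullet> y + fst b / r)" for y
    using r by (simp add: v_def discr_def field_simps)
  have c1: "(bayes_rule b y = Some Class1) = (v \<bullet> y > - (fst b / r))"
    and c2: "(bayes_rule b y = Some Class2) = (v \<bullet> y < - (fst b / r))" for y
  proof -
    have "(discr b y > 0) = (v \<bullet> y > - (fst b / r))" "(discr b y < 0) = (v \<bullet> y < - (fst b / r))"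
      unfolding d zero_less_mult_iff mult_less_0_iff using r by linarith+
    thus "(bayes_rule b y = Some Class1) = (v \<bullet> y > - (fst b / r))" "(bayes_rule b y = Some Class2) = (v \<bullet> y < - (fst b / r))"
      by (auto simp: bayes_rule_def)
  qed
  have vm: "v \<bullet> (cmu D i *\<^sub>R axis k 1) = cmu D i * (snd b $ k / r)" for i
    by (simp add: v_def inner_axis divide_inverse)
  have I: "(\<integral>y. exp (lcomp (canon_param k D) i y) * f (v \<bullet> y) \<partial>lborel) = 1/2 * (\<integral>x. normal_density (cmu D i * (snd b $ k / r)) 1 x * f x \<partial>lborel)"
    if f: "f \<in> borel_measurable borel" "\<And>x. \<bar>f x\<bar> \<le> 1" for i and f :: "real \<Rightarrow> real"
    unfolding canon_lcomp_prod mult.assoc[of "1/2"] integral_mult_right_zero integral_normal_direction[OF v f] vm ..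
  have half: "1 - (x1 + x2) = 1 - (g1 + g2) / 2" if "x1 = 1/2 * g1" "x2 = 1/2 * g2" for x1 x2 g1 g2 :: real
    unfolding that by (simp add: add_divide_distrib)
  have "(\<integral>y. exp (lcomp (canon_param k D) Class1 y) * of_bool (bayes_rule b y = Some Class1) \<partial>lborel) = 1/2 * gcdf (D / 2 * (snd b $ k / r) + fst b / r)"
    unfolding c1 by (subst I) (simp_all only: gcdf_shift cmu.simps add.commute, simp_all)
  moreover have "(\<integral>y. exp (lcomp (canon_param k D) Class2 y) * of_bool (bayes_rule b y = Some Class2) \<partial>lborel) = 1/2 * gcdf (D / 2 * (snd b $ k / r) - fst b / r)"
    unfolding c2 by (subst I) (simp_all only: gcdf_shift cmu.simps, simp_all)
  ultimately show ?thesis unfolding cerr_def sum_label by (rule half)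
qed

context canon
begin

definition copt :: real where "copt = cerr (canon_param k D) \<beta>0"

text \<open>Tilt and shift of the hyperplane have the same cost. With f the standard normal density
  at D / 2, the tilt costs f (D / 2) / (2 D^2) per unit of squared off-axis slope, the shift f (D /
  4) / D^2 per unit of squared intercept. Both are f / (4 D).\<close>

definition kappa :: real where "kappa = std_normal_density (D / 2) / (4 * D)"

lemma copt_eq: "copt = 1 - gcdf (D / 2)"
  unfolding copt_def using D_pos by (subst cerr_canon) (simp_all add: axis_eq_0_iff)

lemma kappa_pos: "kappa > 0"
  using D_pos by (simp add: kappa_def normal_density_pos)

text \<open>The two classes evaluate the distribution function at D / 2 + v and D / 2 - v, both
  lowered by D / 2 times \<epsilon>, where the shift v is of first and the tilt \<epsilon> of second
  order. In the sum the linear terms in v cancel and a quadratic form remains.\<close>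

lemma cerr_expansion:
  obtains K where "K > 0" "\<And>b. coef_size b \<le> D / 2 \<Longrightarrow>
    \<bar>cerr (canon_param k D) b - copt - kappa * (\<Sum>l\<in>UNIV - {Some k}. (coef_dev b l)\<^sup>2)\<bar> \<le> K * coef_size b ^ 3"
proof -
  define \<phi> where "\<phi> = std_normal_density (D / 2)"
  have \<phi>: "\<phi> > 0" by (simp add: \<phi>_def normal_density_pos)
  \<comment> \<open>One summand for each remainder: that of the tilt, of the squared shift, of the
    squared tilt, and of the two Taylor expansions.\<close>
  define K where "K = \<phi> * (D / 2) * (5 / D ^ 3) + D / 2 * \<phi> / 2 * (10 / D ^ 3) + (D/2) ^ 3 * \<phi> / 2 * (2 / D\<^sup>2)\<^sup>2 * (D / 2) + (1/2 + 2 / D) ^ 3"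
  have K: "K > 0" unfolding K_def using D_pos \<phi> by (intro add_nonneg_pos zero_less_power) (auto intro: add_pos_pos)
  have "\<bar>cerr (canon_param k D) b - copt - kappa * (\<Sum>l\<in>UNIV - {Some k}. (coef_dev b l)\<^sup>2)\<bar> \<le> K * coef_size b ^ 3" if \<rho>: "coef_size b \<le> D / 2" for b
  proof -
    define \<rho> r x where "\<rho> = coef_size b" and "r = norm (snd b)" and "x = snd b $ k"
    define s where "s = (\<Sum>i\<in>UNIV - {k}. (snd b $ i)\<^sup>2)"
    have coef_size_eq: "coef_size b = \<bar>fst b\<bar> + (\<Sum>i\<in>UNIV. \<bar>(snd b - D *\<^sub>R axis k 1) $ i\<bar>)"
      unfolding coef_size_def sum_option by (simp add: coef_dev_def axis_def if_distrib[of "\<lambda>x. D * x"] cong: if_cong)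
    have n1: "(\<Sum>i\<in>UNIV. \<bar>(snd b - D *\<^sub>R axis k 1) $ i\<bar>) \<le> \<rho>" and b0: "\<bar>fst b\<bar> \<le> \<rho>" and \<rho>0: "0 \<le> \<rho>" "\<rho> \<le> D / 2"
      using coef_size_eq \<rho> sum_nonneg[of UNIV "\<lambda>i. \<bar>(snd b - D *\<^sub>R axis k 1) $ i\<bar>"] by (auto simp: \<rho>_def)
    have nn: "norm (snd b - D *\<^sub>R axis k 1) \<le> \<rho>" using norm_le_l1_cart n1 by (rule order_trans)
    have r: "\<bar>r - D\<bar> \<le> \<rho>"
      using norm_triangle_ineq3[of "snd b" "D *\<^sub>R axis k 1"] nn D_pos unfolding r_def by (simp add: norm_axis_1)
    have x: "\<bar>x - D\<bar> \<le> \<rho>"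
      using component_le_norm_cart[of "snd b - D *\<^sub>R axis k 1" k] nn by (simp add: x_def)
    have rs: "r\<^sup>2 = x\<^sup>2 + s"
      unfolding r_def x_def s_def power2_norm_eq_inner inner_vec_def by (subst sum.remove[of _ k]) (auto simp: power2_eq_square)
    have s0: "0 \<le> s" by (simp add: s_def sum_nonneg)
    have s1: "s \<le> \<rho>\<^sup>2"
    proof -
      have "s \<le> (\<Sum>i\<in>UNIV. ((snd b - D *\<^sub>R axis k 1) $ i)\<^sup>2)"
        unfolding s_def by (subst (2) sum.remove[of _ k]) (auto simp: axis_def)
      also have "\<dots> = (norm (snd b - D *\<^sub>R axis k 1))\<^sup>2" unfolding power2_norm_eq_inner inner_vec_def by (simp add: power2_eq_square)
      also have "\<dots> \<le> \<rho>\<^sup>2" using nn by (intro power_mono) auto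
      finally show ?thesis .
    qed
    note de = direction_expansion[OF D_pos \<rho>0 r x s0 s1 rs b0]
    have bne: "snd b \<noteq> 0" using r \<rho>0 D_pos by (auto simp: r_def)
    define \<epsilon> v where "\<epsilon> = 1 - x / r" and "v = fst b / r"
    have arg: "D / 2 * (x / r) + v = D / 2 + (v - D / 2 * \<epsilon>)" "D / 2 * (x / r) - v = D / 2 + (- v - D / 2 * \<epsilon>)"
      unfolding \<epsilon>_def right_diff_distrib by simp_all
    define T where "T u = gcdf (D / 2 + u) - gcdf (D / 2) - \<phi> * u + D / 2 * \<phi> * u\<^sup>2 / 2" for u
    have T: "\<bar>T u\<bar> \<le> \<bar>u\<bar> ^ 3" for u unfolding T_def \<phi>_def by (rule gcdf_taylor)
    have sq: "(\<Sum>l\<in>UNIV - {Some k}. (coef_dev b l)\<^sup>2) = (fst b)\<^sup>2 + s"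
    proof -
      have "(\<Sum>l\<in>UNIV - {Some k}. (coef_dev b l)\<^sup>2) = (\<Sum>l\<in>UNIV. (coef_dev b l)\<^sup>2) - (coef_dev b (Some k))\<^sup>2" by (simp add: sum_diff1)
      also have "\<dots> = (fst b)\<^sup>2 + ((\<Sum>i\<in>UNIV. (coef_dev b (Some i))\<^sup>2) - (coef_dev b (Some k))\<^sup>2)" unfolding sum_option by (simp add: coef_dev_def)
      also have "(\<Sum>i\<in>UNIV. (coef_dev b (Some i))\<^sup>2) - (coef_dev b (Some k))\<^sup>2 = s"
        unfolding s_def by (subst sum.remove[of _ k]) (auto simp: coef_dev_def)
      finally show ?thesis .
    qed
    have "cerr (canon_param k D) b - copt = (2 * gcdf (D / 2) - gcdf (D / 2 + (v - D / 2 * \<epsilon>)) - gcdf (D / 2 + (- v - D / 2 * \<epsilon>))) / 2"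
      unfolding copt_eq cerr_canon[OF bne] r_def[symmetric] x_def[symmetric] v_def[symmetric] arg by (simp add: field_simps)
    also have "\<dots> = \<phi> * (D / 2) * \<epsilon> + D / 2 * \<phi> / 2 * (v\<^sup>2 + (D / 2 * \<epsilon>)\<^sup>2) - (T (v - D / 2 * \<epsilon>) + T (- v - D / 2 * \<epsilon>)) / 2"
      unfolding T_def by (simp add: field_simps power2_eq_square)
    finally have H: "cerr (canon_param k D) b - copt = \<phi> * (D / 2) * \<epsilon> + D / 2 * \<phi> / 2 * (v\<^sup>2 + (D / 2 * \<epsilon>)\<^sup>2)
        - (T (v - D / 2 * \<epsilon>) + T (- v - D / 2 * \<epsilon>)) / 2" .
    define S B where "S = s / (2 * D\<^sup>2)" and "B = (fst b)\<^sup>2 / D\<^sup>2"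
    have kp: "kappa * ((fst b)\<^sup>2 + s) = \<phi> * (D / 2) * S + D / 2 * \<phi> / 2 * B"
      unfolding kappa_def \<phi>_def[symmetric] S_def B_def using D_pos by (simp add: field_simps power2_eq_square)
    have "cerr (canon_param k D) b - copt - kappa * ((fst b)\<^sup>2 + s) =
        \<phi> * (D / 2) * (\<epsilon> - S) + D / 2 * \<phi> / 2 * (v\<^sup>2 - B) + (D/2) ^ 3 * \<phi> / 2 * \<epsilon>\<^sup>2
         - (T (v - D / 2 * \<epsilon>) + T (- v - D / 2 * \<epsilon>)) / 2"
      unfolding kp H by (simp add: field_simps power2_eq_square power3_eq_cube)
    note this[unfolded S_def B_def]
    moreover have "\<bar>\<phi> * (D / 2) * (\<epsilon> - s / (2 * D\<^sup>2))\<bar> \<le> \<phi> * (D / 2) * (5 / D ^ 3) * \<rho> ^ 3"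
    proof -
      have "\<bar>\<phi> * (D / 2) * (\<epsilon> - s / (2 * D\<^sup>2))\<bar> = \<phi> * (D / 2) * \<bar>\<epsilon> - s / (2 * D\<^sup>2)\<bar>" using \<phi> D_pos by (simp add: abs_mult)
      also have "\<dots> \<le> \<phi> * (D / 2) * (5 / D ^ 3 * \<rho> ^ 3)" using \<phi> D_pos de(1) unfolding \<epsilon>_def by (intro mult_left_mono) auto
      finally show ?thesis by (simp only: mult.assoc)
    qed
    moreover have "\<bar>D / 2 * \<phi> / 2 * (v\<^sup>2 - (fst b)\<^sup>2 / D\<^sup>2)\<bar> \<le> D / 2 * \<phi> / 2 * (10 / D ^ 3) * \<rho> ^ 3"
    proof -
      have "\<bar>D / 2 * \<phi> / 2 * (v\<^sup>2 - (fst b)\<^sup>2 / D\<^sup>2)\<bar> = D / 2 * \<phi> / 2 * \<bar>v\<^sup>2 - (fst b)\<^sup>2 / D\<^sup>2\<bar>" using \<phi> D_pos by (simp add: abs_mult)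
      also have "\<dots> \<le> D / 2 * \<phi> / 2 * (10 / D ^ 3 * \<rho> ^ 3)" using \<phi> D_pos de(3) unfolding v_def by (intro mult_left_mono) auto
      finally show ?thesis by (simp only: mult.assoc)
    qed
    moreover have "\<bar>(D/2) ^ 3 * \<phi> / 2 * \<epsilon>\<^sup>2\<bar> \<le> (D/2) ^ 3 * \<phi> / 2 * (2 / D\<^sup>2)\<^sup>2 * (D / 2) * \<rho> ^ 3"
    proof -
      have "\<epsilon>\<^sup>2 = \<bar>\<epsilon>\<bar>\<^sup>2" by simp
      also have "\<dots> \<le> (2 / D\<^sup>2 * \<rho>\<^sup>2)\<^sup>2" using de(2) unfolding \<epsilon>_def by (intro power_mono) auto
      also have "\<dots> = (2 / D\<^sup>2)\<^sup>2 * (\<rho> * \<rho> ^ 3)" by (simp add: power_mult_distrib power2_eq_square power3_eq_cube)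
      also have "\<dots> \<le> (2 / D\<^sup>2)\<^sup>2 * (D / 2 * \<rho> ^ 3)" using \<rho>0 by (intro mult_left_mono mult_right_mono) auto
      finally have "(D/2) ^ 3 * \<phi> / 2 * \<epsilon>\<^sup>2 \<le> (D/2) ^ 3 * \<phi> / 2 * ((2 / D\<^sup>2)\<^sup>2 * (D / 2 * \<rho> ^ 3))" using \<phi> D_pos by (intro mult_left_mono) auto
      moreover have "0 \<le> (D/2) ^ 3 * \<phi> / 2 * \<epsilon>\<^sup>2" using \<phi> D_pos by simp
      ultimately show ?thesis by (simp only: mult.assoc abs_of_nonneg)
    qed
    moreover have "\<bar>(T (v - D / 2 * \<epsilon>) + T (- v - D / 2 * \<epsilon>)) / 2\<bar> \<le> (1/2 + 2 / D) ^ 3 * \<rho> ^ 3"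
    proof -
      have e: "D / 2 * \<bar>\<epsilon>\<bar> \<le> 1/2 * \<rho>"
      proof -
        have "D / 2 * \<bar>\<epsilon>\<bar> \<le> D / 2 * (2 / D\<^sup>2 * \<rho>\<^sup>2)" using de(2) D_pos unfolding \<epsilon>_def by (intro mult_left_mono) auto
        also have "\<dots> = (1 / D * \<rho>) * \<rho>" using D_pos by (simp add: field_simps power2_eq_square)
        also have "\<dots> \<le> 1/2 * \<rho>" using \<rho>0 D_pos by (intro mult_right_mono) (auto simp: field_simps)
        finally show ?thesis .
      qed
      have vb: "\<bar>v\<bar> \<le> 2 / D * \<rho>" using de(4) by (simp only: v_def)
      have ae: "\<bar>D / 2 * \<epsilon>\<bar> = D / 2 * \<bar>\<epsilon>\<bar>" using D_pos by (simp add: abs_mult)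
      have ub: "\<bar>v - D / 2 * \<epsilon>\<bar> \<le> (1/2 + 2 / D) * \<rho>" "\<bar>- v - D / 2 * \<epsilon>\<bar> \<le> (1/2 + 2 / D) * \<rho>"
        unfolding distrib_right using e vb ae by linarith+
      have "\<bar>T (v - D / 2 * \<epsilon>)\<bar> \<le> ((1/2 + 2 / D) * \<rho>) ^ 3" by (rule order_trans[OF T power_mono[OF ub(1) abs_ge_zero]])
      moreover have "\<bar>T (- v - D / 2 * \<epsilon>)\<bar> \<le> ((1/2 + 2 / D) * \<rho>) ^ 3" by (rule order_trans[OF T power_mono[OF ub(2) abs_ge_zero]])
      moreover have "\<bar>(p + q) / 2\<bar> \<le> c" if "\<bar>p\<bar> \<le> c" "\<bar>q\<bar> \<le> c" for p q c :: real using that abs_triangle_ineq[of p q] by simp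
      ultimately show ?thesis unfolding power_mult_distrib by blast
    qed
    ultimately show ?thesis unfolding sq \<rho>_def[symmetric] K_def distrib_right by linarith
  qed
  with K show thesis by (rule that)
qed

end

section \<open>Expected error rate\<close>

context canon
begin

definition score_term :: "'p option \<Rightarrow> 'p obs \<Rightarrow> real" where
  "score_term l a = psi (fst a $ k) (fst (snd a)) (snd (snd a)) * ext_coord l a"

lemma score_term_eq: "score_term l a = (4 + D\<^sup>2) * ((resp \<beta>0 a - 1/2) * ext_coord l a) - D * (ext_coord (Some k) a * ext_coord l a)"
  by (simp add: score_term_def psi_def resp_\<beta>0 ext_coord_def left_diff_distrib)

lemma score_eq: "l \<noteq> Some k \<Longrightarrow> score l d = avg' d (score_term l)"
  unfolding score_term_eq avg_diff avg_cmult score_def A0_def A_limit_def score_weight_def Ex_ext_coord_ext_coord by simp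

lemma score_term_poly_growth: "score_term l \<in> poly_growth"
  unfolding score_term_eq[abs_def]
  by (intro poly_growth_diff poly_growth_cmult subsetD[OF test_functions_poly_growth] test_functions_mem)

lemma Ex_score_term: "l \<noteq> Some k \<Longrightarrow> Ex (score_term l) = 0"
proof -
  assume l: "l \<noteq> Some k"
  have "integrable law (\<lambda>a. (resp \<beta>0 a - 1/2) * ext_coord l a)" "integrable law (\<lambda>a. ext_coord (Some k) a * ext_coord l a)"
    by (rule integral_law(1), rule subsetD[OF test_functions_poly_growth], rule test_functions_mem)+
  hence "Ex (score_term l) = (4 + D\<^sup>2) * Ex (\<lambda>a. (resp \<beta>0 a - 1/2) * ext_coord l a) - D * Ex (\<lambda>a. ext_coord (Some k) a * ext_coord l a)"
    unfolding score_term_eq by simp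
  thus ?thesis unfolding Ex_w0_ext_coord Ex_ext_coord_ext_coord using l by simp
qed

lemma Ex_score_term_squared: "l \<noteq> Some k \<Longrightarrow> Ex (\<lambda>a. (score_term l a)\<^sup>2) = (4 + D\<^sup>2) * info_factor l"
proof -
  assume l: "l \<noteq> Some k"
  have b: "\<bar>(psi x z m)\<^sup>2\<bar> \<le> (4 + D\<^sup>2 + D)\<^sup>2 * (1 + \<bar>x\<bar>) ^ 2" for x z m
  proof -
    have "\<bar>psi x z m\<bar>\<^sup>2 \<le> ((4 + D\<^sup>2 + D) * (1 + \<bar>x\<bar>) ^ 1)\<^sup>2" by (intro power_mono psi_bound) simp
    thus ?thesis by (simp add: power_mult_distrib)
  qed
  have m: "(\<lambda>x. (psi x z m)\<^sup>2) \<in> borel_measurable borel" for z m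
    using psi_measurable[of z m] by (rule borel_measurable_power)
  note C = Ex_component[of "\<lambda>x z m. (psi x z m)\<^sup>2", OF m b]
  have "Ex (\<lambda>a. (score_term l a)\<^sup>2) = E1 (\<lambda>x z m. (psi x z m)\<^sup>2)"
  proof (cases l)
    case None
    thus ?thesis using C(2) by (simp add: score_term_def ext_coord_def)
  next
    case (Some i)
    thus ?thesis using C(4)[of i] l by (simp add: score_term_def ext_coord_def power2_eq_square mult_ac)
  qed
  thus ?thesis using l by (simp add: E1_psi_squared info_factor_def score_weight_def info_loss_def)
qed

lemma sample_dev_tendsto: "(sample_dev \<longlongrightarrow> 0) Emp"
proof -
  have "((\<lambda>d. avg' d g - Ex g) \<longlongrightarrow> 0) Emp" if "g \<in> test_functions" for g
    using tendsto_diff[OF emp_filter_tendsto[OF subsetD[OF test_functions_poly_growth that], of law] tendsto_const[of "Ex g"]] by simp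
  hence "((\<lambda>d. \<Sum>g\<in>test_functions. \<bar>avg' d g - Ex g\<bar>) \<longlongrightarrow> (\<Sum>g\<in>test_functions. 0)) Emp"
    by (intro tendsto_sum tendsto_rabs_zero)
  thus ?thesis unfolding sample_dev_def[abs_def] by simp
qed

text \<open>The excess error predicted by the linearized equations. It is quadratic in averages of
  centred terms, so its expectation can be computed exactly for every sample size.\<close>

definition quad :: "nat \<times> (nat \<Rightarrow> 'p obs) \<Rightarrow> real" where
  "quad d = kappa * (\<Sum>l\<in>UNIV - {Some k}. (score l d / info_factor l)\<^sup>2)"

lemma quad_bound:
  obtains K where "K \<ge> 0" "\<And>d. \<bar>quad d\<bar> \<le> K * (sample_dev d)\<^sup>2"
proof
  let ?K = "kappa * (\<Sum>l\<in>UNIV - {Some k}. ((score_weight l + D) / info_factor l)\<^sup>2)"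
  show "?K \<ge> 0" using kappa_pos by (intro mult_nonneg_nonneg sum_nonneg) auto
  fix d
  have "(score l d / info_factor l)\<^sup>2 \<le> ((score_weight l + D) / info_factor l)\<^sup>2 * (sample_dev d)\<^sup>2" for l
  proof -
    have "\<bar>score l d / info_factor l\<bar> \<le> (score_weight l + D) / info_factor l * sample_dev d"
      using divide_right_mono[OF score_bound[of l d] less_imp_le[OF info_factor_pos[of l]]]
      unfolding abs_divide abs_of_pos[OF info_factor_pos] times_divide_eq_left .
    hence "\<bar>score l d / info_factor l\<bar>\<^sup>2 \<le> ((score_weight l + D) / info_factor l * sample_dev d)\<^sup>2" by (intro power_mono) auto
    thus ?thesis by (simp only: power_mult_distrib power2_abs)
  qed
  hence "(\<Sum>l\<in>UNIV - {Some k}. (score l d / info_factor l)\<^sup>2) \<le> (\<Sum>l\<in>UNIV - {Some k}. ((score_weight l + D) / info_factor l)\<^sup>2) * (sample_dev d)\<^sup>2"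
    unfolding sum_distrib_right by (intro sum_mono)
  hence "quad d \<le> ?K * (sample_dev d)\<^sup>2"
    unfolding quad_def mult.assoc using kappa_pos by (intro mult_left_mono) auto
  moreover have "0 \<le> quad d" unfolding quad_def using kappa_pos by (intro mult_nonneg_nonneg sum_nonneg) auto
  ultimately show "\<bar>quad d\<bar> \<le> ?K * (sample_dev d)\<^sup>2" by simp
qed

lemma coef_dev_quad_bound:
  assumes K: "K > 0" and R: "coef_size b \<le> K * sample_dev d" and e: "\<And>l. \<bar>info_factor l * coef_dev b l - score l d\<bar> \<le> K * (sample_dev d)\<^sup>2"
  shows "\<bar>kappa * (\<Sum>l\<in>UNIV - {Some k}. (coef_dev b l)\<^sup>2) - quad d\<bar>
      \<le> kappa * (\<Sum>l\<in>UNIV - {Some k}. K / info_factor l * (K + (score_weight l + D) / info_factor l)) * sample_dev d ^ 3"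
proof -
  have "\<bar>(coef_dev b l)\<^sup>2 - (score l d / info_factor l)\<^sup>2\<bar> \<le> K / info_factor l * (K + (score_weight l + D) / info_factor l) * sample_dev d ^ 3" for l
  proof -
    have h: "info_factor l > 0" by (rule info_factor_pos)
    have "coef_dev b l - score l d / info_factor l = (info_factor l * coef_dev b l - score l d) / info_factor l" using h by (simp add: diff_divide_distrib)
    hence 1: "\<bar>coef_dev b l - score l d / info_factor l\<bar> \<le> K / info_factor l * (sample_dev d)\<^sup>2"
      using divide_right_mono[OF e[of l] less_imp_le[OF h]]
      by (simp only: abs_divide abs_of_pos[OF h] times_divide_eq_left)
    have b: "\<bar>coef_dev b l\<bar> \<le> K * sample_dev d"
      using member_le_sum[of l UNIV "\<lambda>l. \<bar>coef_dev b l\<bar>"] R by (simp add: coef_size_def)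
    have s: "\<bar>score l d / info_factor l\<bar> \<le> (score_weight l + D) / info_factor l * sample_dev d"
      using divide_right_mono[OF score_bound[of l d] less_imp_le[OF h]]
      by (simp only: abs_divide abs_of_pos[OF h] times_divide_eq_left)
    have 2: "\<bar>coef_dev b l + score l d / info_factor l\<bar> \<le> (K + (score_weight l + D) / info_factor l) * sample_dev d"
      unfolding distrib_right by (rule order_trans[OF abs_triangle_ineq add_mono[OF b s]])
    have "\<bar>(coef_dev b l)\<^sup>2 - (score l d / info_factor l)\<^sup>2\<bar> = \<bar>coef_dev b l - score l d / info_factor l\<bar> * \<bar>coef_dev b l + score l d / info_factor l\<bar>"
      unfolding abs_mult[symmetric] by (simp only: power2_eq_square square_diff_square_factored mult.commute)
    also have "\<dots> \<le> (K / info_factor l * (sample_dev d)\<^sup>2) * ((K + (score_weight l + D) / info_factor l) * sample_dev d)"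
      by (rule mult_mono[OF 1 2]) (use h K in auto)
    also have "\<dots> = K / info_factor l * (K + (score_weight l + D) / info_factor l) * sample_dev d ^ 3" by (simp only: power2_eq_square power3_eq_cube mult_ac)
    finally show ?thesis .
  qed
  hence "\<bar>\<Sum>l\<in>UNIV - {Some k}. (coef_dev b l)\<^sup>2 - (score l d / info_factor l)\<^sup>2\<bar> \<le> (\<Sum>l\<in>UNIV - {Some k}. K / info_factor l * (K + (score_weight l + D) / info_factor l)) * sample_dev d ^ 3"
    unfolding sum_distrib_right by (intro order_trans[OF sum_abs] sum_mono)
  hence "kappa * \<bar>\<Sum>l\<in>UNIV - {Some k}. (coef_dev b l)\<^sup>2 - (score l d / info_factor l)\<^sup>2\<bar>
      \<le> kappa * ((\<Sum>l\<in>UNIV - {Some k}. K / info_factor l * (K + (score_weight l + D) / info_factor l)) * sample_dev d ^ 3)"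
    using kappa_pos by (intro mult_left_mono) auto
  moreover have "kappa * (\<Sum>l\<in>UNIV - {Some k}. (coef_dev b l)\<^sup>2) - quad d = kappa * (\<Sum>l\<in>UNIV - {Some k}. (coef_dev b l)\<^sup>2 - (score l d / info_factor l)\<^sup>2)"
    unfolding quad_def sum_subtractf right_diff_distrib ..
  ultimately show ?thesis using kappa_pos by (simp add: abs_mult mult.assoc)
qed

text \<open>The bound holds for every nonempty sample, without an exceptional event. If the averages
  over \<open>H\<close> are close to their expectations the expansions apply; otherwise the total
  deviation \<open>S\<close> is at least \<open>\<epsilon>\<close>, and a quantity bounded by 1 is
  dominated by (S / \<epsilon>)^3.\<close>

lemma error_expansion:
  obtains G K where "finite G" "G \<subseteq> poly_growth"
    "\<And>n x b. n > 0 \<Longrightarrow> ((\<exists>\<theta>. is_ML n x \<theta>) \<longrightarrow> (\<exists>\<theta>. is_ML n x \<theta> \<and> b = beta \<theta>)) \<Longrightarrow>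
      \<bar>cerr (canon_param k D) b - copt - quad (n, x)\<bar> \<le> K * (\<Sum>g\<in>G. \<bar>avg n x g - Ex g\<bar>) ^ 3"
proof -
  obtain K1 where K1: "K1 > 0" "\<And>b. coef_size b \<le> D / 2 \<Longrightarrow>
      \<bar>cerr (canon_param k D) b - copt - kappa * (\<Sum>l\<in>UNIV - {Some k}. (coef_dev b l)\<^sup>2)\<bar> \<le> K1 * coef_size b ^ 3"
    by (rule cerr_expansion) (rule that, assumption, blast)
  obtain K2 where K2: "K2 > 0" "\<forall>\<^sub>F d in Emp. (\<exists>\<theta>. is_ML (fst d) (snd d) \<theta>) \<and>
    (\<forall>\<theta>. is_ML (fst d) (snd d) \<theta> \<longrightarrow> dist (beta \<theta>) \<beta>0 < 1 \<and> coef_size (beta \<theta>) \<le> K2 * sample_dev d \<and>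
       (\<forall>l. \<bar>info_factor l * coef_dev (beta \<theta>) l - score l d\<bar> \<le> K2 * (sample_dev d)\<^sup>2))"
    by (rule estimator_expansion[OF zero_less_one])
  obtain K3 where K3: "K3 \<ge> 0" "\<And>d. \<bar>quad d\<bar> \<le> K3 * (sample_dev d)\<^sup>2" by (rule quad_bound) (rule that, assumption, blast)
  define K4 where "K4 = kappa * (\<Sum>l\<in>UNIV - {Some k}. K2 / info_factor l * (K2 + (score_weight l + D) / info_factor l))"
  have K4: "K4 \<ge> 0" unfolding K4_def using kappa_pos K2(1) info_factor_pos score_weight_pos D_pos
    by (intro mult_nonneg_nonneg sum_nonneg add_nonneg_nonneg divide_nonneg_nonneg less_imp_le) auto
  have "\<forall>\<^sub>F d in Emp. sample_dev d < D / 2 / K2" by (rule order_tendstoD(2)[OF sample_dev_tendsto]) (use D_pos K2(1) in simp)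
  from eventually_emp_filterD[OF eventually_conj[OF K2(2) this]]
  obtain H \<epsilon> where H: "finite H" "H \<subseteq> poly_growth" "\<epsilon> > 0"
    and ev: "\<And>n x. n > 0 \<Longrightarrow> (\<And>g. g \<in> H \<Longrightarrow> \<bar>avg n x g - Ex g\<bar> < \<epsilon>) \<Longrightarrow>
      ((\<exists>\<theta>. is_ML (fst (n, x)) (snd (n, x)) \<theta>) \<and>
    (\<forall>\<theta>. is_ML (fst (n, x)) (snd (n, x)) \<theta> \<longrightarrow> dist (beta \<theta>) \<beta>0 < 1 \<and> coef_size (beta \<theta>) \<le> K2 * sample_dev (n, x) \<and>
       (\<forall>l. \<bar>info_factor l * coef_dev (beta \<theta>) l - score l (n, x)\<bar> \<le> K2 * (sample_dev (n, x))\<^sup>2))) \<and> sample_dev (n, x) < D / 2 / K2"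
    by blast
  \<comment> \<open>With the union, one sum dominates both the deviation in the expansions and the
    deviation that witnesses their failure.\<close>
  define G where "G = H \<union> test_functions"
  have G: "finite G" "G \<subseteq> poly_growth" unfolding G_def using H finite_test_functions test_functions_poly_growth by auto
  define K where "K = K1 * K2 ^ 3 + K4 + (1 / \<epsilon> ^ 3 + K3 / \<epsilon>)"
  have bound: "\<bar>cerr (canon_param k D) b - copt - quad (n, x)\<bar> \<le> K * (\<Sum>g\<in>G. \<bar>avg n x g - Ex g\<bar>) ^ 3"
    if n: "n > 0" and ml: "(\<exists>\<theta>. is_ML n x \<theta>) \<longrightarrow> (\<exists>\<theta>. is_ML n x \<theta> \<and> b = beta \<theta>)" for n x b
  proof -
    define S where "S = (\<Sum>g\<in>G. \<bar>avg n x g - Ex g\<bar>)"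
    have S0: "0 \<le> S" unfolding S_def by (intro sum_nonneg) simp
    have SdS: "sample_dev (n, x) \<le> S" unfolding S_def sample_dev_def fst_conv snd_conv using G by (intro sum_mono2) (auto simp: G_def)
    have Sd0: "0 \<le> sample_dev (n, x)" by (rule sample_dev_nonneg)
    have c1: "K1 * K2 ^ 3 * S ^ 3 \<ge> 0" "K4 * S ^ 3 \<ge> 0" "(1 / \<epsilon> ^ 3 + K3 / \<epsilon>) * S ^ 3 \<ge> 0"
      using K1(1) K2(1) K3(1) K4 H(3) S0 by simp_all
    have "\<bar>cerr (canon_param k D) b - copt - quad (n, x)\<bar> \<le> K * S ^ 3"
    proof (cases "\<forall>g\<in>H. \<bar>avg n x g - Ex g\<bar> < \<epsilon>")
      case True
      note E = ev[OF n bspec[OF True]]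
      obtain \<theta> where th: "is_ML n x \<theta>" "b = beta \<theta>" using E ml unfolding fst_conv snd_conv by blast
      have R: "coef_size b \<le> K2 * sample_dev (n, x)" and e: "\<And>l. \<bar>info_factor l * coef_dev b l - score l (n, x)\<bar> \<le> K2 * (sample_dev (n, x))\<^sup>2"
        using E th unfolding fst_conv snd_conv by blast+
      have "K2 * sample_dev (n, x) \<le> D / 2" using E K2(1) by (simp add: pos_less_divide_eq mult.commute)
      with R have "coef_size b \<le> D / 2" by (rule order_trans)
      from K1(2)[OF this]
      have 1: "\<bar>cerr (canon_param k D) b - copt - kappa * (\<Sum>l\<in>UNIV - {Some k}. (coef_dev b l)\<^sup>2)\<bar> \<le> K1 * coef_size b ^ 3" .
      have "coef_size b \<le> K2 * S" using R mult_left_mono[OF SdS less_imp_le[OF K2(1)]] by (rule order_trans)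
      hence "coef_size b ^ 3 \<le> (K2 * S) ^ 3" by (rule power_mono[OF _ coef_size_nonneg])
      hence "K1 * coef_size b ^ 3 \<le> K1 * (K2 * S) ^ 3" using K1(1) by (intro mult_left_mono) auto
      hence 2: "K1 * coef_size b ^ 3 \<le> K1 * K2 ^ 3 * S ^ 3" by (simp only: power_mult_distrib mult.assoc)
      have "sample_dev (n, x) ^ 3 \<le> S ^ 3" by (rule power_mono[OF SdS Sd0])
      hence "K4 * sample_dev (n, x) ^ 3 \<le> K4 * S ^ 3" by (rule mult_left_mono[OF _ K4])
      with coef_dev_quad_bound[OF K2(1) R e] have 3: "\<bar>kappa * (\<Sum>l\<in>UNIV - {Some k}. (coef_dev b l)\<^sup>2) - quad (n, x)\<bar> \<le> K4 * S ^ 3"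
        unfolding K4_def by (rule order_trans)
      show ?thesis unfolding K_def distrib_right[of "_ + _"] distrib_right[of "K1 * K2 ^ 3"] using 1 2 3 c1 by linarith
    next
      case False
      then obtain g where g: "g \<in> H" "\<epsilon> \<le> \<bar>avg n x g - Ex g\<bar>" by (auto simp: not_less)
      have "\<bar>avg n x g - Ex g\<bar> \<le> S" unfolding S_def using G g(1) by (intro member_le_sum) (auto simp: G_def)
      hence \<epsilon>S: "\<epsilon> \<le> S" using g(2) by linarith
      have "\<epsilon> ^ 3 \<le> S ^ 3" using \<epsilon>S H(3) by (intro power_mono) auto
      hence 1: "1 \<le> 1 / \<epsilon> ^ 3 * S ^ 3" using H(3) by (simp add: pos_le_divide_eq)
      have 2: "\<bar>cerr (canon_param k D) b - copt\<bar> \<le> 1"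
        using cerr_bounds[OF canon_param_in_cspace, of k D b] cerr_bounds[OF canon_param_in_cspace, of k D \<beta>0]
        unfolding copt_def by linarith
      have "\<bar>quad (n, x)\<bar> \<le> K3 * (sample_dev (n, x))\<^sup>2" by (rule K3(2))
      \<comment> \<open>The factor S / \<epsilon> is at least 1 and raises the quadratic bound to a
        cubic one.\<close>
      also have "\<dots> \<le> K3 * (S\<^sup>2 * (S / \<epsilon>))"
      proof (rule mult_left_mono[OF _ K3(1)])
        have "(sample_dev (n, x))\<^sup>2 * 1 \<le> S\<^sup>2 * (S / \<epsilon>)" using SdS Sd0 \<epsilon>S H(3) by (intro mult_mono power_mono) auto
        thus "(sample_dev (n, x))\<^sup>2 \<le> S\<^sup>2 * (S / \<epsilon>)" by simp
      qed
      also have "\<dots> = K3 / \<epsilon> * S ^ 3" by (simp add: power2_eq_square power3_eq_cube)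
      finally have 3: "\<bar>quad (n, x)\<bar> \<le> K3 / \<epsilon> * S ^ 3" .
      show ?thesis unfolding K_def distrib_right[of "_ + _"] distrib_right[of "1 / _"] distrib_right[of "K1 * K2 ^ 3"] using 1 2 3 c1 by linarith
    qed
    thus ?thesis unfolding S_def .
  qed
  from that[OF G bound] show thesis .
qed

theorem expected_error_expansion:
  fixes P :: "'w measure" and b :: "nat \<Rightarrow> 'w \<Rightarrow> real \<times> (real^'p)"
  assumes iid: "iid_sample P X law" and mle: "\<And>n. is_mle_beta P (\<lambda>\<omega>. log_lik_PC_ig n (\<lambda>j. X j \<omega>)) (b n)"
  shows "first_order_expansion (\<lambda>n. \<integral>\<omega>. cerr (canon_param k D) (b n \<omega>) \<partial>P)
     (\<lambda>n. copt + kappa * real CARD('p) * ((4 + D\<^sup>2) / (1 - (4 + D\<^sup>2) * I0)) / real n)"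
proof -
  interpret iid_sample P X law by (rule iid)
  define c where "c = kappa * real CARD('p) * ((4 + D\<^sup>2) / (1 - (4 + D\<^sup>2) * I0))"
  define e where "e n = (\<integral>\<omega>. cerr (canon_param k D) (b n \<omega>) \<partial>P)" for n
  have bm [measurable]: "b n \<in> borel_measurable P" for n using mle[of n] by (simp add: is_mle_beta_def)
  have cm [measurable]: "(\<lambda>\<omega>. cerr (canon_param k D) (b n \<omega>)) \<in> borel_measurable P" for n
    by (rule measurable_compose[OF bm cerr_measurable])
  have ci: "integrable P (\<lambda>\<omega>. cerr (canon_param k D) (b n \<omega>))" for n
  proof (rule integrable_const_bound[where B = 1])
    show "AE \<omega> in P. norm (cerr (canon_param k D) (b n \<omega>)) \<le> 1"
      using cerr_bounds[OF canon_param_in_cspace, of k D] by (intro AE_I2) (simp only: real_norm_def abs_of_nonneg)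
  qed (rule cm)
  obtain G K where G: "finite G" "G \<subseteq> poly_growth" and K: "\<And>n x b. n > 0 \<Longrightarrow> ((\<exists>\<theta>. is_ML n x \<theta>) \<longrightarrow> (\<exists>\<theta>. is_ML n x \<theta> \<and> b = beta \<theta>)) \<Longrightarrow>
      \<bar>cerr (canon_param k D) b - copt - quad (n, x)\<bar> \<le> K * (\<Sum>g\<in>G. \<bar>avg n x g - Ex g\<bar>) ^ 3"
    by (rule error_expansion) (rule that, assumption, assumption, blast)
  have pg4: "g \<in> borel_measurable law" "integrable law (\<lambda>a. g a ^ 4)" if "g \<in> poly_growth" for g
    unfolding borel_measurable_law using that by (auto intro: poly_growth_measurable integral_law(1) poly_growth_power)
  have G4: "G \<subseteq> {g \<in> borel_measurable law. integrable law (\<lambda>a. g a ^ 4)}" using G(2) pg4 by blast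
  note dc = dev_cube[OF G(1) G4]
  have sq: "integrable P (\<lambda>\<omega>. (score l (n, \<lambda>j. X j \<omega>) / info_factor l)\<^sup>2)"
    "expectation (\<lambda>\<omega>. (score l (n, \<lambda>j. X j \<omega>) / info_factor l)\<^sup>2) = ((4 + D\<^sup>2) / (1 - (4 + D\<^sup>2) * I0)) / real n" if l: "l \<noteq> Some k" and n: "n > 0" for l n
  proof -
    have h: "info_factor l > 0" by (rule info_factor_pos)
    have hl: "info_factor l = 1 - (4 + D\<^sup>2) * I0" using l by (simp add: info_factor_def score_weight_def info_loss_def)
    have am [measurable]: "(\<lambda>\<omega>. avg n (\<lambda>j. X j \<omega>) (score_term l)) \<in> borel_measurable P"
      unfolding avg_def using pg4(1)[OF score_term_poly_growth] by (intro borel_measurable_divide borel_measurable_sum borel_measurable_const measurable_compose[OF X_measurable])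
    have i4: "integrable P (\<lambda>\<omega>. avg n (\<lambda>j. X j \<omega>) (score_term l) ^ 4)"
      using avg_moments(1)[OF pg4[OF score_term_poly_growth[of l]], of n] by (simp add: Ex_score_term[OF l])
    have i2: "integrable P (\<lambda>\<omega>. (avg n (\<lambda>j. X j \<omega>) (score_term l))\<^sup>2)" using integrable_power_le_4[OF am i4, of 2] by simp
    show "integrable P (\<lambda>\<omega>. (score l (n, \<lambda>j. X j \<omega>) / info_factor l)\<^sup>2)"
      unfolding score_eq[OF l] fst_conv snd_conv power_divide using i2 by simp
    have "expectation (\<lambda>\<omega>. (avg n (\<lambda>j. X j \<omega>) (score_term l))\<^sup>2) = (4 + D\<^sup>2) * info_factor l / real n"
      using avg_moments(3)[OF pg4[OF score_term_poly_growth[of l]] n] by (simp add: Ex_score_term[OF l] Ex_score_term_squared[OF l])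
    hence "expectation (\<lambda>\<omega>. (score l (n, \<lambda>j. X j \<omega>) / info_factor l)\<^sup>2) = (4 + D\<^sup>2) * info_factor l / real n / (info_factor l)\<^sup>2"
      unfolding score_eq[OF l] fst_conv snd_conv power_divide by simp
    also have "\<dots> = ((4 + D\<^sup>2) / info_factor l) / real n" using h by (simp add: power2_eq_square)
    finally show "expectation (\<lambda>\<omega>. (score l (n, \<lambda>j. X j \<omega>) / info_factor l)\<^sup>2) = ((4 + D\<^sup>2) / (1 - (4 + D\<^sup>2) * I0)) / real n" unfolding hl .
  qed
  \<comment> \<open>The intercept and the coordinates other than \<open>k\<close>; the dimension
    enters the leading term only through this count.\<close>
  have card: "card (UNIV - {Some k} :: 'p option set) = CARD('p)" by (simp add: card_Diff_singleton)
  have qi: "integrable P (\<lambda>\<omega>. quad (n, \<lambda>j. X j \<omega>))" if "n > 0" for n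
    unfolding quad_def by (intro integrable_mult_right Bochner_Integration.integrable_sum sq(1)) (use that in auto)
  have qe: "expectation (\<lambda>\<omega>. quad (n, \<lambda>j. X j \<omega>)) = c / real n" if n: "n > 0" for n
  proof -
    have "expectation (\<lambda>\<omega>. quad (n, \<lambda>j. X j \<omega>)) = kappa * (\<Sum>l\<in>UNIV - {Some k}. expectation (\<lambda>\<omega>. (score l (n, \<lambda>j. X j \<omega>) / info_factor l)\<^sup>2))"
      unfolding quad_def by (subst integral_mult_right_zero, subst Bochner_Integration.integral_sum) (use sq(1) n in auto)
    also have "\<dots> = kappa * (\<Sum>l\<in>UNIV - {Some k :: 'p option}. ((4 + D\<^sup>2) / (1 - (4 + D\<^sup>2) * I0)) / real n)"
      using sq(2)[OF _ n] by (intro arg_cong2[where f = "(*)"] refl sum.cong) auto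
    also have "\<dots> = c / real n" by (simp add: c_def card)
    finally show ?thesis .
  qed
  have main: "\<bar>e n - (copt + c / real n)\<bar> \<le> K * expectation (\<lambda>\<omega>. dev G n \<omega> ^ 3)" if n: "n > 0" for n
  proof -
    have ii: "integrable P (\<lambda>\<omega>. cerr (canon_param k D) (b n \<omega>) - copt - quad (n, \<lambda>j. X j \<omega>))" using ci[of n] qi[OF n] by simp
    have "e n - (copt + c / real n) = expectation (\<lambda>\<omega>. cerr (canon_param k D) (b n \<omega>) - copt - quad (n, \<lambda>j. X j \<omega>))"
      using ci[of n] qi[OF n] by (simp add: qe[OF n] e_def prob_space)
    also have "\<bar>\<dots>\<bar> \<le> expectation (\<lambda>\<omega>. \<bar>cerr (canon_param k D) (b n \<omega>) - copt - quad (n, \<lambda>j. X j \<omega>)\<bar>)" by (rule integral_abs_bound)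
    also have "\<dots> \<le> expectation (\<lambda>\<omega>. K * dev G n \<omega> ^ 3)"
    proof (rule integral_mono_AE)
      show "integrable P (\<lambda>\<omega>. \<bar>cerr (canon_param k D) (b n \<omega>) - copt - quad (n, \<lambda>j. X j \<omega>)\<bar>)" by (rule integrable_abs[OF ii])
      show "integrable P (\<lambda>\<omega>. K * dev G n \<omega> ^ 3)" by (rule integrable_mult_right[OF dc(1)])
      have "AE \<omega> in P. (\<exists>\<theta>. is_ML n (\<lambda>j. X j \<omega>) \<theta>) \<longrightarrow> (\<exists>\<theta>. is_ML n (\<lambda>j. X j \<omega>) \<theta> \<and> b n \<omega> = beta \<theta>)"
        using mle[of n] by (simp only: is_mle_beta_def)
      thus "AE \<omega> in P. \<bar>cerr (canon_param k D) (b n \<omega>) - copt - quad (n, \<lambda>j. X j \<omega>)\<bar> \<le> K * dev G n \<omega> ^ 3"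
        unfolding dev_def by eventually_elim (rule K[OF n])
    qed
    also have "\<dots> = K * expectation (\<lambda>\<omega>. dev G n \<omega> ^ 3)" by (rule integral_mult_right_zero)
    finally show ?thesis .
  qed
  have lim: "(\<lambda>n. real n * (e n - (copt + c / real n))) \<longlonglongrightarrow> 0"
  proof (rule Lim_null_comparison)
    show "\<forall>\<^sub>F n in sequentially. norm (real n * (e n - (copt + c / real n))) \<le> K * (real n * expectation (\<lambda>\<omega>. dev G n \<omega> ^ 3))"
      using eventually_gt_at_top[of 0]
    proof eventually_elim
      case (elim n)
      from mult_left_mono[OF main[OF elim] of_nat_0_le_iff[of n]] show ?case by (simp add: abs_mult mult_ac)
    qed
    show "(\<lambda>n. K * (real n * expectation (\<lambda>\<omega>. dev G n \<omega> ^ 3))) \<longlonglongrightarrow> 0" using tendsto_mult_left[OF dc(2), of K] by simp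
  qed
  have "(\<lambda>n. e n - (copt + c / real n)) \<in> o(\<lambda>n. 1 / real n)"
  proof (rule smalloI_tendsto)
    show "(\<lambda>n. (e n - (copt + c / real n)) / (1 / real n)) \<longlonglongrightarrow> 0" using lim by (simp add: mult.commute)
    show "\<forall>\<^sub>F n in sequentially. 1 / real n \<noteq> 0" using eventually_gt_at_top[of 0] by eventually_elim simp
  qed
  thus ?thesis unfolding first_order_expansion_def c_def[symmetric] e_def by blast
qed

end

section \<open>Affine maps of the feature space\<close>

definition affine_params :: "real^'p^'p \<Rightarrow> real^'p \<Rightarrow> 'p::finite params \<Rightarrow> 'p params" where
  "affine_params B c \<theta> = Params (prior1 \<theta>) (B *v mean1 \<theta> + c) (B *v mean2 \<theta> + c) (B ** cov \<theta> ** transpose B)"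

definition affine_obs :: "real^'p^'p \<Rightarrow> real^'p \<Rightarrow> 'p::finite obs \<Rightarrow> 'p obs" where
  "affine_obs B c = (\<lambda>(y, z, m). (B *v y + c, z, m))"

text \<open>Chosen so that the new discriminant at \<open>B *v y + c\<close> equals the old one at
  \<open>y\<close>; hence the inverse transpose on the slope.\<close>

definition affine_rule :: "real^'p^'p \<Rightarrow> real^'p \<Rightarrow> real \<times> (real^'p::finite) \<Rightarrow> real \<times> (real^'p)" where
  "affine_rule B c b = (let b1 = transpose (matrix_inv B) *v snd b in (fst b - b1 \<bullet> c, b1))"

lemma prior_affine [simp]: "prior (affine_params B c \<theta>) i = prior \<theta> i"
  by (cases i) (simp_all add: affine_params_def)

lemma mean_affine [simp]: "mean (affine_params B c \<theta>) i = B *v mean \<theta> i + c"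
  by (cases i) (simp_all add: affine_params_def)

lemma cov_affine [simp]: "cov (affine_params B c \<theta>) = B ** cov \<theta> ** transpose B"
  by (simp add: affine_params_def)

lemma pos_def_affine:
  fixes B :: "real^'p^'p"
  assumes "invertible B" "pos_def_matrix S"
  shows "pos_def_matrix (B ** S ** transpose B)"
  using pos_def_congruence[OF assms(2), of "transpose B"] assms(1) by (simp add: invertible_det_nz det_transpose)

lemma matrix_inv_affine:
  fixes B :: "real^'p^'p"
  assumes B: "invertible B" and S: "pos_def_matrix S"
  shows "matrix_inv (B ** S ** transpose B) = transpose (matrix_inv B) ** matrix_inv S ** matrix_inv B"
proof (rule matrix_inv_unique)
  have t: "transpose B ** transpose (matrix_inv B) = mat 1"
    using arg_cong[OF matrix_inv_left[OF B], of transpose] by (simp add: matrix_transpose_mul transpose_mat)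
  have "(B ** S ** transpose B) ** (transpose (matrix_inv B) ** matrix_inv S ** matrix_inv B)
      = B ** (S ** (transpose B ** transpose (matrix_inv B)) ** matrix_inv S) ** matrix_inv B"
    by (simp only: matrix_mul_assoc)
  also have "\<dots> = mat 1"
    by (simp only: t matrix_mul_rid matrix_inv_right[OF pos_def_matrix_invertible[OF S]] matrix_inv_right[OF B])
  finally show "(B ** S ** transpose B) ** (transpose (matrix_inv B) ** matrix_inv S ** matrix_inv B) = mat 1" .
qed

lemma invertible_matrix_inv:
  fixes B :: "real^'p^'p"
  assumes "invertible B"
  shows "invertible (matrix_inv B)"
  unfolding invertible_def using matrix_inv_left[OF assms] matrix_inv_right[OF assms] by blast

lemma inv_mult_vec:
  fixes B :: "real^'p^'p"
  assumes "invertible B"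
  shows "matrix_inv B *v (B *v y) = y" "B *v (matrix_inv B *v y) = y"
  by (simp_all only: matrix_vector_mul_assoc matrix_inv_left[OF assms] matrix_inv_right[OF assms] matrix_vector_mul_lid)

lemma mvn_density_affine:
  fixes B :: "real^'p^'p"
  assumes B: "invertible B" and S: "pos_def_matrix S"
  shows "mvn_density (B *v m + c) (B ** S ** transpose B) (B *v y + c) = mvn_density m S y / \<bar>det B\<bar>"
proof -
  have d: "B *v y + c - (B *v m + c) = B *v (y - m)" by (simp add: matrix_vector_mult_diff_distrib)
  have q: "(B *v v) \<bullet> (matrix_inv (B ** S ** transpose B) *v (B *v v)) = v \<bullet> (matrix_inv S *v v)" for v
  proof -
    have "(B *v v) \<bullet> (matrix_inv (B ** S ** transpose B) *v (B *v v))
       = (B *v v) \<bullet> (transpose (matrix_inv B) *v (matrix_inv S *v (matrix_inv B *v (B *v v))))"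
      unfolding matrix_inv_affine[OF B S] by (simp only: matrix_vector_mul_assoc[symmetric])
    also have "\<dots> = (matrix_inv B *v (B *v v)) \<bullet> (matrix_inv S *v (matrix_inv B *v (B *v v)))"
      by (rule inner_matrix_vector_transpose[symmetric])
    finally show ?thesis by (simp only: inv_mult_vec[OF B])
  qed
  have "sqrt ((2 * pi) ^ CARD('p) * det (B ** S ** transpose B)) = \<bar>det B\<bar> * sqrt ((2 * pi) ^ CARD('p) * det S)"
  proof -
    have "(2 * pi) ^ CARD('p) * det (B ** S ** transpose B) = (det B)\<^sup>2 * ((2 * pi) ^ CARD('p) * det S)"
      by (simp add: det_mul det_transpose power2_eq_square)
    thus ?thesis by (simp add: real_sqrt_mult)
  qed
  thus ?thesis unfolding mvn_density_def d q by simp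
qed

lemma det_invertible: "invertible (B :: real^'p^'p) \<Longrightarrow> \<bar>det B\<bar> > 0"
  by (simp add: invertible_det_nz)

lemma affine_params_in_param_space:
  assumes B: "invertible B" and th: "\<theta> \<in> param_space"
  shows "affine_params B c \<theta> \<in> param_space"
proof -
  have "B *v mean \<theta> Class1 \<noteq> B *v mean \<theta> Class2"
    using th inv_mult_vec(1)[OF B] unfolding param_space_def mem_Collect_eq by metis
  thus ?thesis using th pos_def_affine[OF B, of "cov \<theta>"] by (simp add: param_space_def del: prior.simps mean.simps)
qed

lemma affine_params_inverse:
  assumes B: "invertible B"
  shows "affine_params B c (affine_params (matrix_inv B) (- (matrix_inv B *v c)) \<theta>) = \<theta>"
proof -
  have t: "transpose (matrix_inv B) ** transpose B = mat 1"
    using arg_cong[OF matrix_inv_right[OF B], of transpose] by (simp add: matrix_transpose_mul transpose_mat)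
  have "B ** (matrix_inv B ** S ** transpose (matrix_inv B)) ** transpose B = S" for S
  proof -
    have "B ** (matrix_inv B ** S ** transpose (matrix_inv B)) ** transpose B
        = (B ** matrix_inv B) ** S ** (transpose (matrix_inv B) ** transpose B)" by (simp only: matrix_mul_assoc)
    thus ?thesis by (simp only: t matrix_inv_right[OF B] matrix_mul_lid matrix_mul_rid)
  qed
  moreover have "B *v (matrix_inv B *v v + - (matrix_inv B *v c)) + c = v" for v
    unfolding add_uminus_conv_diff matrix_vector_mult_diff_distrib inv_mult_vec[OF B] by simp
  ultimately show ?thesis by (cases \<theta>) (simp add: affine_params_def)
qed

text \<open>Every class density is divided by \<open>\<bar>det B\<bar>\<close>, and so is the
  mixture for an unlabelled observation. The log-likelihoods thus differ by a constant independent
  of the parameter, and their maximizers correspond.\<close>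

lemma log_lik_affine:
  assumes B: "invertible B" and th: "\<theta> \<in> param_space"
  shows "log_lik_PC_ig n (\<lambda>j. affine_obs B c (x j)) (affine_params B c \<theta>) = log_lik_PC_ig n x \<theta> - real n * ln \<bar>det B\<bar>"
proof -
  have pr: "prior \<theta> i > 0" and S: "pos_def_matrix (cov \<theta>)" for i using th by (auto simp: param_space_def)
  have dB: "\<bar>det B\<bar> > 0" by (rule det_invertible[OF B])
  have e: "exp (lcomp (cparam_of (affine_params B c \<theta>)) i (B *v y + c)) = exp (lcomp (cparam_of \<theta>) i y - ln \<bar>det B\<bar>)" for i y
  proof -
    have "exp (lcomp (cparam_of (affine_params B c \<theta>)) i (B *v y + c)) = prior \<theta> i * class_density \<theta> i y / \<bar>det B\<bar>"
      using ln_prior_class_density[of "affine_params B c \<theta>" i "B *v y + c"] pr[of i] pos_def_affine[OF B S] mvn_density_affine[OF B S]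
      by (simp del: prior.simps mean.simps)
    also have "\<dots> = exp (lcomp (cparam_of \<theta>) i y) / exp (ln \<bar>det B\<bar>)"
      using dB by (simp only: exp_ln ln_prior_class_density[OF pr S])
    finally show ?thesis by (simp only: exp_diff)
  qed
  hence l: "lcomp (cparam_of (affine_params B c \<theta>)) i (B *v y + c) = lcomp (cparam_of \<theta>) i y - ln \<bar>det B\<bar>" for i y by simp
  have "lobs (cparam_of (affine_params B c \<theta>)) (affine_obs B c a) = lobs (cparam_of \<theta>) a - ln \<bar>det B\<bar>" for a
  proof (cases a)
    case (fields y z m)
    have "exp (lcomp (cparam_of \<theta>) Class1 y - ln \<bar>det B\<bar>) + exp (lcomp (cparam_of \<theta>) Class2 y - ln \<bar>det B\<bar>) =
      (exp (lcomp (cparam_of \<theta>) Class1 y) + exp (lcomp (cparam_of \<theta>) Class2 y)) / \<bar>det B\<bar>"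
      using dB by (simp only: exp_diff exp_ln add_divide_distrib)
    moreover have "ln ((exp u + exp v) / \<bar>det B\<bar>) = ln (exp u + exp v) - ln \<bar>det B\<bar>" for u v :: real
      using add_pos_pos[OF exp_gt_zero exp_gt_zero, of u v] dB by (simp add: ln_div)
    ultimately show ?thesis unfolding fields affine_obs_def lobs_def by (simp only: prod.case l split: if_split) simp
  qed
  thus ?thesis
    unfolding log_lik_eq_lobs[OF th] log_lik_eq_lobs[OF affine_params_in_param_space[OF B th]]
    by (simp add: sum_subtractf)
qed

lemma beta_affine:
  assumes B: "invertible B" and th: "\<theta> \<in> param_space"
  shows "beta (affine_params B c \<theta>) = affine_rule B c (beta \<theta>)"
proof -
  have S: "pos_def_matrix (cov \<theta>)" using th by (simp add: param_space_def)
  define b1 where "b1 = matrix_inv (cov \<theta>) *v (mean \<theta> Class1 - mean \<theta> Class2)"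
  define b1' where "b1' = transpose (matrix_inv B) *v b1"
  have d: "B *v mean \<theta> Class1 + c - (B *v mean \<theta> Class2 + c) = B *v (mean \<theta> Class1 - mean \<theta> Class2)"
    by (simp add: matrix_vector_mult_diff_distrib del: mean.simps)
  have 1: "matrix_inv (cov (affine_params B c \<theta>)) *v (mean (affine_params B c \<theta>) Class1 - mean (affine_params B c \<theta>) Class2) = b1'"
    unfolding cov_affine mean_affine d matrix_inv_affine[OF B S] b1'_def b1_def
    by (simp only: matrix_vector_mul_assoc[symmetric] inv_mult_vec[OF B])
  have Bb: "(B *v v) \<bullet> b1' = v \<bullet> b1" for v
    unfolding b1'_def inner_matrix_vector_transpose[symmetric] inv_mult_vec[OF B] ..
  have 2: "(mean (affine_params B c \<theta>) Class1 + mean (affine_params B c \<theta>) Class2) \<bullet> b1' =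
      (mean \<theta> Class1 + mean \<theta> Class2) \<bullet> b1 + 2 * (b1' \<bullet> c)"
    unfolding mean_affine inner_add_left Bb by (simp add: inner_commute del: mean.simps)
  show ?thesis
    unfolding beta_def Let_def 1 2 affine_rule_def fst_conv snd_conv b1_def[symmetric] b1'_def[symmetric] prior_affine
    by (simp add: field_simps del: prior.simps mean.simps)
qed

lemma discr_affine:
  assumes B: "invertible B"
  shows "discr (affine_rule B c b) (B *v y + c) = discr b y"
proof -
  have "(transpose (matrix_inv B) *v snd b) \<bullet> (B *v y) = snd b \<bullet> y"
    using inner_matrix_vector_transpose[of "matrix_inv B" "B *v y" "snd b"] unfolding inv_mult_vec[OF B] by (simp only: inner_commute)
  thus ?thesis by (simp add: discr_def affine_rule_def Let_def inner_add_right del: transpose_matrix_vector)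
qed

lemma affine_rule_measurable: "affine_rule B c \<in> borel_measurable borel"
  unfolding affine_rule_def Let_def by (intro borel_measurable_continuous_onI continuous_intros)

lemma affine_obs_measurable: "affine_obs B c \<in> measurable obs_space obs_space"
proof -
  have [measurable]: "(\<lambda>y. B *v y + c) \<in> borel_measurable borel"
    by (intro borel_measurable_continuous_onI continuous_intros)
  show ?thesis unfolding affine_obs_def by measurable
qed

lemma err_eq_cerr:
  assumes th: "\<theta> \<in> param_space"
  shows "err \<theta> b = cerr (cparam_of \<theta>) b"
proof -
  have pr: "prior \<theta> i > 0" and S: "pos_def_matrix (cov \<theta>)" for i using th by (auto simp: param_space_def)
  have "prior \<theta> i * measure (mvn (mean \<theta> i) (cov \<theta>)) {y. bayes_rule b y = Some i} =
      (\<integral>y. exp (lcomp (cparam_of \<theta>) i y) * of_bool (bayes_rule b y = Some i) \<partial>lborel)" for i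
  proof -
    have [measurable]: "Measurable.pred borel (\<lambda>y. bayes_rule b y = Some i)"
      using measurable_compose[OF measurable_Pair1'[of b borel borel] bayes_rule_measurable[of i]] by simp
    have cd: "class_density \<theta> i y = exp (lcomp (cparam_of \<theta>) i y) / prior \<theta> i" for y
      using ln_prior_class_density[OF pr S, of i y] pr[of i] by (simp add: field_simps)
    have dm [measurable]: "(\<lambda>y. class_density \<theta> i y) \<in> borel_measurable borel" unfolding cd by measurable
    have d0: "class_density \<theta> i y \<ge> 0" for y unfolding cd using pr[of i] by simp
    have "measure (mvn (mean \<theta> i) (cov \<theta>)) {y. bayes_rule b y = Some i} =
        (\<integral>y. of_bool (bayes_rule b y = Some i) \<partial>(mvn (mean \<theta> i) (cov \<theta>)))"
    proof -
      have "(\<lambda>y. of_bool (bayes_rule b y = Some i) :: real) = indicator {y. bayes_rule b y = Some i}" by (auto simp: indicator_def)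
      thus ?thesis by (simp add: mvn_def)
    qed
    also have "\<dots> = (\<integral>y. class_density \<theta> i y *\<^sub>R of_bool (bayes_rule b y = Some i) \<partial>lborel)"
      unfolding mvn_def by (rule integral_density) (use d0 in auto)
    finally have "prior \<theta> i * measure (mvn (mean \<theta> i) (cov \<theta>)) {y. bayes_rule b y = Some i} =
       (\<integral>y. prior \<theta> i * (class_density \<theta> i y * of_bool (bayes_rule b y = Some i)) \<partial>lborel)" by simp
    also have "\<dots> = (\<integral>y. exp (lcomp (cparam_of \<theta>) i y) * of_bool (bayes_rule b y = Some i) \<partial>lborel)"
      unfolding mult.assoc[symmetric] ln_prior_class_density[OF pr S] ..
    finally show ?thesis .
  qed
  thus ?thesis unfolding err_def cerr_def by simp
qed

lemma err_affine:
  assumes B: "invertible B" and th: "\<theta> \<in> param_space"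
  shows "err (affine_params B c \<theta>) (affine_rule B c b) = err \<theta> b"
proof -
  have S: "pos_def_matrix (cov \<theta>)" using th by (simp add: param_space_def)
  have r: "bayes_rule (affine_rule B c b) (B *v y + c) = bayes_rule b y" for y
    unfolding bayes_rule_def discr_affine[OF B] ..
  have "measure (mvn (B *v mean \<theta> i + c) (B ** cov \<theta> ** transpose B)) {y. bayes_rule (affine_rule B c b) y = Some i}
      = measure (mvn (mean \<theta> i) (cov \<theta>)) {y. bayes_rule b y = Some i}" for i
  proof -
    have pm: "{y. bayes_rule b y = Some i} \<in> sets borel" for b :: "real \<times> (real^'a)"
      using measurable_compose[OF measurable_Pair1'[of b borel borel] bayes_rule_measurable[of i]] by (simp add: pred_def)
    have dm: "(\<lambda>y. ennreal (mvn_density m Q y)) \<in> borel_measurable borel" for m and Q :: "real^'a^'a"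
      unfolding mvn_density_def by (intro measurable_compose[OF _ measurable_ennreal] borel_measurable_divide borel_measurable_const)
        (intro borel_measurable_continuous_onI continuous_intros)
    have "emeasure (mvn (B *v mean \<theta> i + c) (B ** cov \<theta> ** transpose B)) {y. bayes_rule (affine_rule B c b) y = Some i}
       = (\<integral>\<^sup>+y. ennreal (mvn_density (B *v mean \<theta> i + c) (B ** cov \<theta> ** transpose B) y) * indicator {y. bayes_rule (affine_rule B c b) y = Some i} y \<partial>lborel)"
      unfolding mvn_def by (rule emeasure_density) (use dm pm in auto)
    also have "\<dots> = ennreal \<bar>det B\<bar> * (\<integral>\<^sup>+y. ennreal (mvn_density (B *v mean \<theta> i + c) (B ** cov \<theta> ** transpose B) (c + B *v y)) *
         indicator {y. bayes_rule (affine_rule B c b) y = Some i} (c + B *v y) \<partial>lborel)"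
      by (rule nn_integral_lborel_affine[OF B]) (intro borel_measurable_times_ennreal dm borel_measurable_indicator pm)
    also have "\<dots> = ennreal \<bar>det B\<bar> * (\<integral>\<^sup>+y. ennreal (class_density \<theta> i y / \<bar>det B\<bar>) * indicator {y. bayes_rule b y = Some i} y \<partial>lborel)"
      unfolding add.commute[of c] mvn_density_affine[OF B S] by (simp add: indicator_def r)
    also have "\<dots> = (\<integral>\<^sup>+y. ennreal \<bar>det B\<bar> * (ennreal (class_density \<theta> i y / \<bar>det B\<bar>) * indicator {y. bayes_rule b y = Some i} y) \<partial>lborel)"
    proof (rule nn_integral_cmult[symmetric])
      have "(\<lambda>y. class_density \<theta> i y / \<bar>det B\<bar>) \<in> borel_measurable borel"
        unfolding mvn_density_def by (intro borel_measurable_divide borel_measurable_const) (intro borel_measurable_continuous_onI continuous_intros)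
      thus "(\<lambda>y. ennreal (class_density \<theta> i y / \<bar>det B\<bar>) * indicator {y. bayes_rule b y = Some i} y) \<in> borel_measurable lborel"
        using pm[of b] by simp
    qed
    also have "\<dots> = (\<integral>\<^sup>+y. ennreal (class_density \<theta> i y) * indicator {y. bayes_rule b y = Some i} y \<partial>lborel)"
    proof (rule nn_integral_cong)
      fix y
      have "ennreal \<bar>det B\<bar> * ennreal (class_density \<theta> i y / \<bar>det B\<bar>) = ennreal (class_density \<theta> i y)"
        using det_invertible[OF B] by (simp add: ennreal_mult'[symmetric])
      thus "ennreal \<bar>det B\<bar> * (ennreal (class_density \<theta> i y / \<bar>det B\<bar>) * indicator {y. bayes_rule b y = Some i} y) =
          ennreal (class_density \<theta> i y) * indicator {y. bayes_rule b y = Some i} y" by (simp only: mult.assoc[symmetric])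
    qed
    also have "\<dots> = emeasure (mvn (mean \<theta> i) (cov \<theta>)) {y. bayes_rule b y = Some i}"
      unfolding mvn_def by (rule emeasure_density[symmetric]) (use dm pm in auto)
    finally show ?thesis unfolding measure_def by (rule arg_cong)
  qed
  thus ?thesis unfolding err_def prior_affine mean_affine cov_affine by (simp del: prior.simps mean.simps)
qed

lemma is_arg_max_affine:
  assumes B: "invertible B" and th: "\<theta> \<in> param_space"
  shows "is_arg_max (log_lik_PC_ig n (\<lambda>j. affine_obs B c (x j))) (\<lambda>\<theta>. \<theta> \<in> param_space) (affine_params B c \<theta>)
     \<longleftrightarrow> is_arg_max (log_lik_PC_ig n x) (\<lambda>\<theta>. \<theta> \<in> param_space) \<theta>"
proof -
  let ?B = "affine_params B c" and ?L = "log_lik_PC_ig n (\<lambda>j. affine_obs B c (x j))"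
  have Bi: "invertible (matrix_inv B)" by (rule invertible_matrix_inv[OF B])
  have "(\<exists>s. s \<in> param_space \<and> ?L s > ?L (?B \<theta>)) \<longleftrightarrow> (\<exists>s. s \<in> param_space \<and> log_lik_PC_ig n x s > log_lik_PC_ig n x \<theta>)"
  proof
    assume "\<exists>s. s \<in> param_space \<and> ?L s > ?L (?B \<theta>)"
    then obtain s where s: "s \<in> param_space" "?L s > ?L (?B \<theta>)" by blast
    let ?s = "affine_params (matrix_inv B) (- (matrix_inv B *v c)) s"
    have p: "?s \<in> param_space" by (rule affine_params_in_param_space[OF Bi s(1)])
    have "?L (?B ?s) > ?L (?B \<theta>)" unfolding affine_params_inverse[OF B] by (rule s(2))
    hence "log_lik_PC_ig n x ?s > log_lik_PC_ig n x \<theta>" unfolding log_lik_affine[OF B p] log_lik_affine[OF B th] by simp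
    with p show "\<exists>s. s \<in> param_space \<and> log_lik_PC_ig n x s > log_lik_PC_ig n x \<theta>" by blast
  next
    assume "\<exists>s. s \<in> param_space \<and> log_lik_PC_ig n x s > log_lik_PC_ig n x \<theta>"
    then obtain s where s: "s \<in> param_space" "log_lik_PC_ig n x s > log_lik_PC_ig n x \<theta>" by blast
    have "?L (?B s) > ?L (?B \<theta>)" unfolding log_lik_affine[OF B s(1)] log_lik_affine[OF B th] using s(2) by simp
    with affine_params_in_param_space[OF B s(1)] show "\<exists>s. s \<in> param_space \<and> ?L s > ?L (?B \<theta>)" by blast
  qed
  thus ?thesis unfolding is_arg_max_def using th affine_params_in_param_space[OF B th] by blast
qed

text \<open>A maximizer for the transformed sample is pulled back by the inverse map. The estimator
  may follow a different maximizer of the original likelihood, but the image of that one is a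
  maximizer again.\<close>

lemma is_mle_beta_affine:
  assumes B: "invertible B" and b: "is_mle_beta P (\<lambda>\<omega>. log_lik_PC_ig n (x \<omega>)) b"
  shows "is_mle_beta P (\<lambda>\<omega>. log_lik_PC_ig n (\<lambda>j. affine_obs B c (x \<omega> j))) (\<lambda>\<omega>. affine_rule B c (b \<omega>))"
  unfolding is_mle_beta_def
proof
  have bm: "b \<in> borel_measurable P" and ae: "AE \<omega> in P. (\<exists>\<theta>. is_arg_max (log_lik_PC_ig n (x \<omega>)) (\<lambda>\<theta>. \<theta> \<in> param_space) \<theta>) \<longrightarrow>
        (\<exists>\<theta>. is_arg_max (log_lik_PC_ig n (x \<omega>)) (\<lambda>\<theta>. \<theta> \<in> param_space) \<theta> \<and> b \<omega> = beta \<theta>)"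
    using b by (simp_all only: is_mle_beta_def)
  show "(\<lambda>\<omega>. affine_rule B c (b \<omega>)) \<in> borel_measurable P" by (rule measurable_compose[OF bm affine_rule_measurable])
  have Bi: "invertible (matrix_inv B)" by (rule invertible_matrix_inv[OF B])
  show "AE \<omega> in P. (\<exists>\<theta>. is_arg_max (log_lik_PC_ig n (\<lambda>j. affine_obs B c (x \<omega> j))) (\<lambda>\<theta>. \<theta> \<in> param_space) \<theta>) \<longrightarrow>
        (\<exists>\<theta>. is_arg_max (log_lik_PC_ig n (\<lambda>j. affine_obs B c (x \<omega> j))) (\<lambda>\<theta>. \<theta> \<in> param_space) \<theta> \<and> affine_rule B c (b \<omega>) = beta \<theta>)"
    using ae
  proof eventually_elim
    case (elim \<omega>)
    show ?case
    proof
      assume "\<exists>\<theta>. is_arg_max (log_lik_PC_ig n (\<lambda>j. affine_obs B c (x \<omega> j))) (\<lambda>\<theta>. \<theta> \<in> param_space) \<theta>"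
      then obtain s where s: "is_arg_max (log_lik_PC_ig n (\<lambda>j. affine_obs B c (x \<omega> j))) (\<lambda>\<theta>. \<theta> \<in> param_space) s" by blast
      hence sp: "s \<in> param_space" by (simp add: is_arg_max_def)
      let ?s = "affine_params (matrix_inv B) (- (matrix_inv B *v c)) s"
      have p: "?s \<in> param_space" by (rule affine_params_in_param_space[OF Bi sp])
      have "is_arg_max (log_lik_PC_ig n (\<lambda>j. affine_obs B c (x \<omega> j))) (\<lambda>\<theta>. \<theta> \<in> param_space) (affine_params B c ?s)"
        unfolding affine_params_inverse[OF B] by (rule s)
      hence "is_arg_max (log_lik_PC_ig n (x \<omega>)) (\<lambda>\<theta>. \<theta> \<in> param_space) ?s" unfolding is_arg_max_affine[OF B p] .
      with elim obtain t where t: "is_arg_max (log_lik_PC_ig n (x \<omega>)) (\<lambda>\<theta>. \<theta> \<in> param_space) t" "b \<omega> = beta t" by blast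
      hence tp: "t \<in> param_space" by (simp add: is_arg_max_def)
      have "is_arg_max (log_lik_PC_ig n (\<lambda>j. affine_obs B c (x \<omega> j))) (\<lambda>\<theta>. \<theta> \<in> param_space) (affine_params B c t)"
        unfolding is_arg_max_affine[OF B tp] by (rule t(1))
      moreover have "affine_rule B c (b \<omega>) = beta (affine_params B c t)" unfolding t(2) beta_affine[OF B tp] ..
      ultimately show "\<exists>\<theta>. is_arg_max (log_lik_PC_ig n (\<lambda>j. affine_obs B c (x \<omega> j))) (\<lambda>\<theta>. \<theta> \<in> param_space) \<theta> \<and> affine_rule B c (b \<omega>) = beta \<theta>" by blast
    qed
  qed
qed

text \<open>Presents the completely classified likelihood as the partially classified likelihood of
  a modified sample, so that one expansion serves both estimators.\<close>

definition drop_missing :: "'p::finite obs \<Rightarrow> 'p obs" where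
  "drop_missing = (\<lambda>(y, z, m). (y, z, False))"

lemma drop_missing_measurable: "drop_missing \<in> measurable (obs_space :: 'p::finite obs measure) obs_space"
  unfolding drop_missing_def by measurable

lemma emeasure_distr_density_obs:
  fixes \<phi> :: "'p::finite obs \<Rightarrow> 'p obs"
  assumes N: "sets N = sets obs_space" and \<phi>: "\<phi> \<in> measurable obs_space obs_space" and S: "S \<in> sets obs_space"
    and [measurable]: "g \<in> borel_measurable obs_space"
  shows "emeasure (distr (density obs_space (\<lambda>a. ennreal (g a))) N \<phi>) S
      = (\<Sum>z\<in>UNIV. \<Sum>m\<in>UNIV. \<integral>\<^sup>+y. ennreal (g (y, z, m)) * indicator S (\<phi> (y, z, m)) \<partial>lborel)"
proof -
  have \<phi>N: "\<phi> \<in> measurable (density obs_space (\<lambda>a. ennreal (g a))) N"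
    using \<phi> by (simp add: measurable_cong_sets[OF sets_density N])
  have SN: "S \<in> sets N" using S N by simp
  have im: "(\<lambda>a. indicator S (\<phi> a) :: ennreal) \<in> borel_measurable obs_space"
    by (rule measurable_compose[OF \<phi> borel_measurable_indicator[OF S]])
  have "emeasure (distr (density obs_space (\<lambda>a. ennreal (g a))) N \<phi>) S
      = (\<integral>\<^sup>+a. indicator S a \<partial>distr (density obs_space (\<lambda>a. ennreal (g a))) N \<phi>)"
    using SN by simp
  also have "\<dots> = (\<integral>\<^sup>+a. indicator S (\<phi> a) \<partial>density obs_space (\<lambda>a. ennreal (g a)))"
    by (rule nn_integral_distr[OF \<phi>N]) (simp only: measurable_distr_eq1 borel_measurable_indicator[OF SN])
  also have "\<dots> = (\<integral>\<^sup>+a. ennreal (g a) * indicator S (\<phi> a) \<partial>obs_space)"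
    by (rule nn_integral_density[OF _ im]) simp
  also have "\<dots> = (\<Sum>z\<in>UNIV. \<Sum>m\<in>UNIV. \<integral>\<^sup>+y. ennreal (g (y, z, m)) * indicator S (\<phi> (y, z, m)) \<partial>lborel)"
    by (rule nn_integral_obs_space) (intro borel_measurable_times_ennreal im, simp)
  finally show ?thesis .
qed

lemma (in missing_model) emeasure_law:
  assumes S: "S \<in> sets obs_space"
  shows "emeasure law S = (\<Sum>z\<in>UNIV. \<Sum>m\<in>UNIV. \<integral>\<^sup>+y. ennreal (dens (y, z, m)) * indicator S (y, z, m) \<partial>lborel)"
proof -
  have "emeasure law S = (\<integral>\<^sup>+a. ennreal (dens a) * indicator S a \<partial>obs_space)"
    unfolding law_def by (rule emeasure_density[OF _ S]) simp
  also have "\<dots> = (\<Sum>z\<in>UNIV. \<Sum>m\<in>UNIV. \<integral>\<^sup>+y. ennreal (dens (y, z, m)) * indicator S (y, z, m) \<partial>lborel)"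
    by (rule nn_integral_obs_space) (intro borel_measurable_times_ennreal borel_measurable_indicator S, simp)
  finally show ?thesis .
qed

text \<open>The factor \<open>\<bar>det B\<bar>\<close> in the densities cancels against the
  Jacobian of the change of variables, and the missing probability is carried along
  unchanged.\<close>

lemma (in missing_model) distr_affine_obs:
  assumes B: "invertible B" and th: "\<theta> \<in> param_space" and t0: "cparam_of (affine_params B c \<theta>) = t0"
    and q: "\<And>y. missing_prob \<theta> \<xi> y = q (B *v y + c)"
    and X: "distributed P obs_space X (\<lambda>x. ennreal (obs_density \<theta> \<xi> x))"
  shows "distr P law (\<lambda>\<omega>. affine_obs B c (X \<omega>)) = law"
proof (rule measure_eqI)
  show "sets (distr P law (\<lambda>\<omega>. affine_obs B c (X \<omega>))) = sets law" by simp
  fix S assume "S \<in> sets (distr P law (\<lambda>\<omega>. affine_obs B c (X \<omega>)))"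
  hence S: "S \<in> sets obs_space" by (simp add: sets_law)
  have pr: "prior \<theta> i > 0" and C: "pos_def_matrix (cov \<theta>)" for i using th by (auto simp: param_space_def)
  have dB: "\<bar>det B\<bar> > 0" by (rule det_invertible[OF B])
  have od: "obs_density \<theta> \<xi> (y, z, m) = \<bar>det B\<bar> * dens (B *v y + c, z, m)" for y z m
  proof -
    have "exp (lcomp t0 z (B *v y + c)) = prior \<theta> z * (class_density \<theta> z y / \<bar>det B\<bar>)"
      using ln_prior_class_density[of "affine_params B c \<theta>" z "B *v y + c"] pr[of z] pos_def_affine[OF B C] mvn_density_affine[OF B C]
      by (simp add: t0 del: prior.simps mean.simps)
    hence "\<bar>det B\<bar> * exp (lcomp t0 z (B *v y + c)) = prior \<theta> z * class_density \<theta> z y" using dB by (simp del: prior.simps mean.simps)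
    thus ?thesis by (simp add: obs_density_def dens_def q mult.assoc[symmetric] del: prior.simps mean.simps)
  qed
  have om: "obs_density \<theta> \<xi> \<in> borel_measurable obs_space"
  proof (rule obs_measurableI)
    have [measurable]: "(\<lambda>y. B *v y + c) \<in> borel_measurable borel"
      by (intro borel_measurable_continuous_onI continuous_intros)
    show "(\<lambda>y. obs_density \<theta> \<xi> (y, z, m)) \<in> borel_measurable borel" for z m
      unfolding od by (intro borel_measurable_times borel_measurable_const measurable_compose[OF _ obs_measurableD[OF dens_measurable]]) simp
  qed
  have Xm: "X \<in> measurable P obs_space" and dX: "distr P obs_space X = density obs_space (\<lambda>x. ennreal (obs_density \<theta> \<xi> x))"
    using X by (simp_all only: distributed_def)
  have "distr P law (\<lambda>\<omega>. affine_obs B c (X \<omega>)) = distr (density obs_space (\<lambda>x. ennreal (obs_density \<theta> \<xi> x))) law (affine_obs B c)"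
    using affine_obs_measurable[of B c] unfolding dX[symmetric]
    by (subst distr_distr[OF _ Xm]) (simp_all add: measurable_cong_sets[OF refl sets_law] comp_def)
  hence "emeasure (distr P law (\<lambda>\<omega>. affine_obs B c (X \<omega>))) S =
     (\<Sum>z\<in>UNIV. \<Sum>m\<in>UNIV. \<integral>\<^sup>+y. ennreal (obs_density \<theta> \<xi> (y, z, m)) * indicator S (affine_obs B c (y, z, m)) \<partial>lborel)"
    by (simp only: emeasure_distr_density_obs[OF sets_law affine_obs_measurable S om])
  also have "\<dots> = (\<Sum>z\<in>UNIV. \<Sum>m\<in>UNIV. \<integral>\<^sup>+y. ennreal (dens (y, z, m)) * indicator S (y, z, m) \<partial>lborel)"
  proof (intro sum.cong refl)
    fix z m
    have dm: "(\<lambda>y. ennreal (dens (y, z, m)) * indicator S (y, z, m)) \<in> borel_measurable borel"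
      by (rule obs_measurableD) (intro borel_measurable_times_ennreal borel_measurable_indicator S, simp)
    have am: "(\<lambda>y. c + B *v y) \<in> borel_measurable borel"
      by (intro borel_measurable_continuous_onI continuous_intros)
    have "(\<integral>\<^sup>+y. ennreal (dens (y, z, m)) * indicator S (y, z, m) \<partial>lborel)
        = ennreal \<bar>det B\<bar> * (\<integral>\<^sup>+y. ennreal (dens (c + B *v y, z, m)) * indicator S (c + B *v y, z, m) \<partial>lborel)"
      by (rule nn_integral_lborel_affine[OF B dm])
    also have "\<dots> = (\<integral>\<^sup>+y. ennreal \<bar>det B\<bar> * (ennreal (dens (c + B *v y, z, m)) * indicator S (c + B *v y, z, m)) \<partial>lborel)"
      using measurable_compose[OF am dm] by (intro nn_integral_cmult[symmetric]) simp
    also have "\<dots> = (\<integral>\<^sup>+y. ennreal (obs_density \<theta> \<xi> (y, z, m)) * indicator S (affine_obs B c (y, z, m)) \<partial>lborel)"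
      unfolding od by (intro nn_integral_cong) (simp add: affine_obs_def ennreal_mult' mult.assoc add.commute)
    finally show "(\<integral>\<^sup>+y. ennreal (obs_density \<theta> \<xi> (y, z, m)) * indicator S (affine_obs B c (y, z, m)) \<partial>lborel)
       = (\<integral>\<^sup>+y. ennreal (dens (y, z, m)) * indicator S (y, z, m) \<partial>lborel)" ..
  qed
  also have "\<dots> = emeasure law S" by (rule emeasure_law[OF S, symmetric])
  finally show "emeasure (distr P law (\<lambda>\<omega>. affine_obs B c (X \<omega>))) S = emeasure law S" .
qed

lemma canon_no_missing: "D > 0 \<Longrightarrow> canon D (\<lambda>_. 0)"
  by unfold_locales auto

text \<open>Summing over the indicator adds \<open>Q\<close> and \<open>1 - Q\<close> and leaves the
  joint law of feature and label, which is the observed law when nothing is missing.\<close>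

lemma (in canon) distr_drop_missing:
  "distr law (missing_model.law (canon_param k D) (\<lambda>y. 0)) drop_missing = missing_model.law (canon_param k D) (\<lambda>y. 0)"
proof -
  interpret Z: canon k D "\<lambda>_. 0" by (rule canon_no_missing[OF D_pos])
  show ?thesis
  proof (rule measure_eqI)
    show "sets (distr law Z.law drop_missing) = sets Z.law" by simp
    fix S assume "S \<in> sets (distr law Z.law drop_missing)"
    hence S: "S \<in> sets obs_space" by (simp add: Z.sets_law)
    have "emeasure (distr law Z.law drop_missing) S =
       (\<Sum>z\<in>UNIV. \<Sum>m\<in>UNIV. \<integral>\<^sup>+y. ennreal (dens (y, z, m)) * indicator S (drop_missing (y, z, m)) \<partial>lborel)"
      unfolding law_def by (rule emeasure_distr_density_obs[OF Z.sets_law drop_missing_measurable S dens_measurable])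
    also have "\<dots> = (\<Sum>z\<in>UNIV. \<Sum>m\<in>UNIV. \<integral>\<^sup>+y. ennreal (Z.dens (y, z, m)) * indicator S (y, z, m) \<partial>lborel)"
    proof (rule sum.cong[OF refl])
      fix z
      have "(\<lambda>y. ennreal (dens (y, z, m)) * indicator S (y, z, False)) \<in> borel_measurable borel" for m
        by (intro borel_measurable_times_ennreal measurable_compose[OF _ measurable_ennreal] obs_measurableD[OF dens_measurable]
          obs_measurableD[OF borel_measurable_indicator[OF S]])
      hence dm: "(\<lambda>y. ennreal (dens (y, z, m)) * indicator S (y, z, False)) \<in> borel_measurable lborel" for m by simp
      have "(\<Sum>m\<in>UNIV. \<integral>\<^sup>+y. ennreal (dens (y, z, m)) * indicator S (drop_missing (y, z, m)) \<partial>lborel)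
         = (\<integral>\<^sup>+y. ennreal (dens (y, z, False)) * indicator S (y, z, False) + ennreal (dens (y, z, True)) * indicator S (y, z, False) \<partial>lborel)"
        unfolding drop_missing_def UNIV_bool by (subst nn_integral_add[OF dm dm]) simp
      also have "\<dots> = (\<integral>\<^sup>+y. ennreal (Z.dens (y, z, False)) * indicator S (y, z, False) \<partial>lborel)"
      proof (rule nn_integral_cong)
        fix y
        have "ennreal (dens (y, z, False)) + ennreal (dens (y, z, True)) = ennreal (Z.dens (y, z, False))"
          unfolding ennreal_plus[OF dens_nonneg dens_nonneg, symmetric] by (simp add: dens_def Z.dens_def algebra_simps)
        thus "ennreal (dens (y, z, False)) * indicator S (y, z, False) + ennreal (dens (y, z, True)) * indicator S (y, z, False)
           = ennreal (Z.dens (y, z, False)) * indicator S (y, z, False)" by (simp only: distrib_right[symmetric])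
      qed
      also have "\<dots> = (\<Sum>m\<in>UNIV. \<integral>\<^sup>+y. ennreal (Z.dens (y, z, m)) * indicator S (y, z, m) \<partial>lborel)"
        unfolding UNIV_bool by (simp add: Z.dens_def)
      finally show "(\<Sum>m\<in>UNIV. \<integral>\<^sup>+y. ennreal (dens (y, z, m)) * indicator S (drop_missing (y, z, m)) \<partial>lborel)
         = (\<Sum>m\<in>UNIV. \<integral>\<^sup>+y. ennreal (Z.dens (y, z, m)) * indicator S (y, z, m) \<partial>lborel)" .
    qed
    also have "\<dots> = emeasure Z.law S" by (rule Z.emeasure_law[OF S, symmetric])
    finally show "emeasure (distr law Z.law drop_missing) S = emeasure Z.law S" .
  qed
qed

lemma iid_sample_compose:
  assumes iid: "iid_sample P X L" and \<phi>: "\<phi> \<in> measurable L N" and N: "distr L N \<phi> = N"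
  shows "iid_sample P (\<lambda>j \<omega>. \<phi> (X j \<omega>)) N"
proof -
  interpret iid_sample P X L by (rule iid)
  show ?thesis
  proof
    show "indep_vars (\<lambda>_. N) (\<lambda>j \<omega>. \<phi> (X j \<omega>)) UNIV" by (rule indep_vars_compose2[OF indep_X \<phi>])
    show "distr P N (\<lambda>\<omega>. \<phi> (X j \<omega>)) = N" for j
      using distr_distr[OF \<phi> X_measurable[of j]] unfolding distr_X N comp_def by simp
  qed
qed

text \<open>Whitening with the inverse of \<open>R\<close> makes the covariance the identity. A
  rotation then takes the whitened mean difference, whose length is the Mahalanobis distance, to a
  coordinate axis, and \<open>c\<close> moves the midpoint of the means to 0.\<close>

lemma canonical_form:
  fixes \<theta> :: "'p::finite params"
  assumes th: "\<theta> \<in> param_space" and eq: "prior \<theta> Class1 = prior \<theta> Class2"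
  obtains B c and k :: 'p where "invertible B" "mahalanobis \<theta> > 0" "cparam_of (affine_params B c \<theta>) = canon_param k (mahalanobis \<theta>)"
proof -
  define \<delta> where "\<delta> = mean1 \<theta> - mean2 \<theta>"
  define D where "D = mahalanobis \<theta>"
  have S: "pos_def_matrix (cov \<theta>)" and \<delta>0: "\<delta> \<noteq> 0" using th by (auto simp: param_space_def \<delta>_def)
  obtain R :: "real^'p^'p" where R: "cov \<theta> = R ** transpose R" "invertible R" using pos_def_matrix_sqrt[OF S] .
  define w where "w = matrix_inv R *v \<delta>"
  have I1: "matrix_inv (mat 1) = (mat 1 :: real^'p^'p)" by (rule matrix_inv_unique) simp
  have "matrix_inv (cov \<theta>) = transpose (matrix_inv R) ** matrix_inv R"
    using matrix_inv_affine[OF R(2) pos_def_mat_1] unfolding I1 R(1) matrix_mul_rid .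
  hence "\<delta> \<bullet> (matrix_inv (cov \<theta>) *v \<delta>) = w \<bullet> w"
    unfolding w_def inner_matrix_vector_transpose by (simp only: matrix_vector_mul_assoc)
  hence nw: "norm w = D" unfolding D_def mahalanobis_def norm_eq_sqrt_inner by (simp add: \<delta>_def)
  have "w \<noteq> 0" using inv_mult_vec(2)[OF R(2), of \<delta>] \<delta>0 unfolding w_def by (metis matrix_vector_mult_0_right)
  hence D: "D > 0" using nw by auto
  have nv: "norm (w /\<^sub>R D) = 1" using nw D by simp
  obtain U :: "real^'p^'p" and k where U: "orthogonal_matrix U" "U *v axis k 1 = w /\<^sub>R D"
    using orthogonal_matrix_exists_basis[OF nv] by metis
  have UU: "U ** transpose U = mat 1" "transpose U ** U = mat 1" using U(1) by (simp_all add: orthogonal_matrix_def)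
  define B where "B = transpose U ** matrix_inv R"
  have Ui: "invertible (transpose U)" unfolding invertible_def using UU by blast
  have B: "invertible B" unfolding B_def by (rule invertible_mult[OF Ui invertible_matrix_inv[OF R(2)]])
  have B\<delta>: "B *v \<delta> = D *\<^sub>R axis k 1"
  proof -
    have "B *v \<delta> = transpose U *v (D *\<^sub>R (U *v axis k 1))"
      unfolding B_def U(2) matrix_vector_mul_assoc[symmetric] w_def[symmetric] using D by simp
    also have "\<dots> = D *\<^sub>R axis k 1"
      unfolding matrix_vector_mult_scaleR matrix_vector_mul_assoc UU matrix_vector_mul_lid ..
    finally show ?thesis .
  qed
  have rr: "transpose R ** transpose (matrix_inv R) = mat 1"
    using arg_cong[OF matrix_inv_left[OF R(2)], of transpose] by (simp add: matrix_transpose_mul transpose_mat)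
  have BSB: "B ** cov \<theta> ** transpose B = mat 1"
  proof -
    have "B ** cov \<theta> ** transpose B = transpose U ** (matrix_inv R ** R) ** (transpose R ** transpose (matrix_inv R)) ** U"
      unfolding B_def R(1) matrix_transpose_mul transpose_transpose by (simp only: matrix_mul_assoc)
    thus ?thesis by (simp only: rr matrix_inv_left[OF R(2)] matrix_mul_rid UU)
  qed
  define c where "c = - (1/2) *\<^sub>R (B *v (mean1 \<theta> + mean2 \<theta>))"
  have m: "B *v mean1 \<theta> + c = (1/2) *\<^sub>R (B *v \<delta>)" "B *v mean2 \<theta> + c = - (1/2) *\<^sub>R (B *v \<delta>)"
  proof -
    have e: "u + - (1/2) *\<^sub>R (u + v) = (1/2) *\<^sub>R (u - v)" "v + - (1/2) *\<^sub>R (u + v) = - (1/2) *\<^sub>R (u - v)" for u v :: "real^'p"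
      by (simp_all add: vec_eq_iff field_simps)
    show "B *v mean1 \<theta> + c = (1/2) *\<^sub>R (B *v \<delta>)" "B *v mean2 \<theta> + c = - (1/2) *\<^sub>R (B *v \<delta>)"
      unfolding c_def \<delta>_def matrix_vector_right_distrib matrix_vector_mult_diff_distrib by (rule e)+
  qed
  have p: "prior1 \<theta> = 1/2" using eq by simp
  have "cparam_of (affine_params B c \<theta>) = canon_param k D"
    unfolding cparam_of_def affine_params_def params.sel p m B\<delta> BSB I1 canon_param_def by simp
  with that[OF B] D show thesis unfolding D_def by blast
qed

section \<open>The missingness model and the constants of the formula in canonical
  coordinates\<close>

lemma q1_pos: "q1 D \<xi> y > 0"
  by (simp add: q1_def add_pos_pos)

lemma canon_q1: "D > 0 \<Longrightarrow> canon D (q1 D \<xi>)"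
proof
  show "q1 D \<xi> \<in> borel_measurable borel" unfolding q1_def[abs_def] by measurable
  show "0 \<le> q1 D \<xi> x" "q1 D \<xi> (- x) = q1 D \<xi> x" for x using q1_pos[of D \<xi> x] by (simp_all add: q1_def)
  show "q1 D \<xi> x < 1" for x by (simp add: q1_def divide_less_eq add_pos_pos)
qed

lemma gamma_mult_d0:
  assumes D: "D > 0"
  shows "gamma D \<xi> * d0 D \<xi> = canon.I0 D (q1 D \<xi>)"
proof -
  \<comment> \<open>\<open>I0\<close> is a one-dimensional integral that does not involve
    \<open>k\<close>, so any coordinate serves.\<close>
  interpret canon undefined D "q1 D \<xi>" by (rule canon_q1[OF D])
  have i: "integrable lborel (\<lambda>x. fy1 D x * q1 D \<xi> x)"
    by (rule integrable_fy1_mult[where C = 1 and j = 0]) (use Q_nonneg Q_less_1 in \<open>auto intro: less_imp_le\<close>)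
  \<comment> \<open>The inverse of \<open>gamma\<close> in \<open>d0\<close> cancels only if
    \<open>gamma\<close> is nonzero; its integrand is strictly positive.\<close>
  have "gamma D \<xi> \<noteq> 0"
  proof
    assume "gamma D \<xi> = 0"
    hence "(\<integral>x. fy1 D x * q1 D \<xi> x \<partial>lborel) = 0" by (simp add: gamma_def mult.commute)
    moreover have "AE x in lborel. 0 \<le> fy1 D x * q1 D \<xi> x"
      using fy1_pos q1_pos by (intro AE_I2 mult_nonneg_nonneg less_imp_le)
    ultimately have "AE x in lborel. fy1 D x * q1 D \<xi> x = 0" using integral_nonneg_eq_0_iff_AE[OF i] by blast
    hence "AE x :: real in lborel. False"
    proof eventually_elim
      case (elim x)
      thus ?case using fy1_pos[of D x] q1_pos[of D \<xi> x] by simp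
    qed
    hence "UNIV \<in> null_sets (lborel :: real measure)" by (simp add: AE_iff_null_sets)
    thus False by (simp add: null_sets_def emeasure_lborel_UNIV)
  qed
  moreover have "d0 D \<xi> = (\<integral>x. inverse (gamma D \<xi>) * (fy1 D x * (q1 D \<xi> x * (sigmoid (D * x) * (1 - sigmoid (D * x))) * x ^ 0)) \<partial>lborel)"
    unfolding d0_def tau_eq_sigmoid by (intro Bochner_Integration.integral_cong refl) (simp only: power_0 mult_1_right mult_ac)
  ultimately show ?thesis unfolding I0_def integral_mult_right_zero by simp
qed

lemma (in canon) Ex_missing: "Ex (\<lambda>a. Q (fst a $ k)) = (\<integral>x. Q x * fy1 D x \<partial>lborel)"
proof -
  have b: "\<bar>Q x\<bar> \<le> 1 * (1 + \<bar>x\<bar>) ^ 0" for x using Q_nonneg[of x] Q_less_1[of x] by simp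
  have "Ex (\<lambda>a. Q (fst a $ k)) = E1 (\<lambda>x z m. Q x)"
    by (rule Ex_component(2)[OF Q_measurable b])
  also have "\<dots> = (\<integral>x. Q x * fy1 D x \<partial>lborel)"
    unfolding E1_eq[OF Q_measurable b] by (intro Bochner_Integration.integral_cong refl) (simp add: algebra_simps)
  finally show ?thesis .
qed

theorem theorem3:
  fixes P :: "'w measure"
    and X :: "nat \<Rightarrow> 'w \<Rightarrow> ('p :: finite) obs"
    and \<theta> :: "'p params"
    and \<xi> :: "real \<times> real"
    and b_CC b_PC :: "nat \<Rightarrow> 'w \<Rightarrow> real \<times> (real ^ 'p)"
    and \<Delta> :: real
  assumes "prob_space P"
    and "\<theta> \<in> param_space"
    and "prior \<theta> Class1 = prior \<theta> Class2"
    and "\<Delta> = mahalanobis \<theta>"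
    and "prob_space.indep_vars P (\<lambda>_. obs_space) X UNIV"
    and "\<And>j. distributed P obs_space (X j) (\<lambda>x. ennreal (obs_density \<theta> \<xi> x))"
    and "\<And>n. is_mle_beta P (\<lambda>\<omega>. log_lik_CC n (\<lambda>j. X j \<omega>)) (b_CC n)"
    and "\<And>n. is_mle_beta P (\<lambda>\<omega>. log_lik_PC_ig n (\<lambda>j. X j \<omega>)) (b_PC n)"
  shows "(\<forall>j. (\<integral>\<omega>. missing_prob \<theta> \<xi> (fst (X j \<omega>)) \<partial>P) = gamma \<Delta> \<xi>) \<and>
    has_ARE (\<lambda>n. \<integral>\<omega>. err \<theta> (b_CC n \<omega>) \<partial>P) (\<lambda>n. \<integral>\<omega>. err \<theta> (b_PC n \<omega>) \<partial>P) (opt_err \<theta>)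
      (1 - (\<Delta>\<^sup>2 + 4) * gamma \<Delta> \<xi> * d0 \<Delta> \<xi>)"
proof -
  note th = assms(2)
  obtain B c and k :: 'p where B: "invertible B" and D: "\<Delta> > 0" and can: "cparam_of (affine_params B c \<theta>) = canon_param k \<Delta>"
    unfolding assms(4) by (rule canonical_form[OF th assms(3)])
  interpret prob_space P by (rule assms(1))
  interpret PC: canon k \<Delta> "q1 \<Delta> \<xi>" by (rule canon_q1[OF D])
  interpret CC: canon k \<Delta> "\<lambda>_. 0" by (rule canon_no_missing[OF D])
  have beta0: "affine_rule B c (beta \<theta>) = (0, \<Delta> *\<^sub>R axis k 1)"
    using cbeta_cparam_of[of "affine_params B c \<theta>"] unfolding can PC.cbeta_canon beta_affine[OF B th] by (rule sym)
  have miss_eq: "missing_prob \<theta> \<xi> y = q1 \<Delta> \<xi> ((B *v y + c) $ k)" for y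
  proof -
    have "discr (beta \<theta>) y = \<Delta> * (B *v y + c) $ k"
      unfolding discr_affine[OF B, of c "beta \<theta>" y, symmetric] beta0 by (simp add: discr_def inner_axis')
    thus ?thesis by (simp add: missing_prob_def q1_def Let_def power_mult_distrib mult.assoc)
  qed
  have err_can: "err \<theta> b = cerr (canon_param k \<Delta>) (affine_rule B c b)" for b
    using err_affine[OF B th, of c b] unfolding err_eq_cerr[OF affine_params_in_param_space[OF B th]] can by (rule sym)
  have opt: "opt_err \<theta> = PC.copt" unfolding opt_err_def err_can beta0 PC.copt_def ..
  have am: "affine_obs B c \<in> measurable obs_space PC.law"
    using affine_obs_measurable[of B c] by (simp only: measurable_cong_sets[OF refl PC.sets_law])
  have iidPC: "iid_sample P (\<lambda>j \<omega>. affine_obs B c (X j \<omega>)) PC.law"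
  proof
    show "indep_vars (\<lambda>_. PC.law) (\<lambda>j \<omega>. affine_obs B c (X j \<omega>)) UNIV" by (rule indep_vars_compose2[OF assms(5) am])
    show "distr P PC.law (\<lambda>\<omega>. affine_obs B c (X j \<omega>)) = PC.law" for j by (rule PC.distr_affine_obs[OF B th can miss_eq assms(6)])
  qed
  have dm: "drop_missing \<in> measurable PC.law CC.law"
    using drop_missing_measurable by (simp only: measurable_cong_sets[OF PC.sets_law CC.sets_law])
  have comm: "drop_missing (affine_obs B c a) = affine_obs B c (drop_missing a)" for a
    by (cases a) (simp add: drop_missing_def affine_obs_def)
  have iidCC: "iid_sample P (\<lambda>j \<omega>. affine_obs B c (drop_missing (X j \<omega>))) CC.law"
    using iid_sample_compose[OF iidPC dm PC.distr_drop_missing] unfolding comm .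
  have mlePC: "is_mle_beta P (\<lambda>\<omega>. log_lik_PC_ig n (\<lambda>j. affine_obs B c (X j \<omega>))) (\<lambda>\<omega>. affine_rule B c (b_PC n \<omega>))" for n
    by (rule is_mle_beta_affine[OF B assms(8)])
  have "is_mle_beta P (\<lambda>\<omega>. log_lik_PC_ig n (\<lambda>j. drop_missing (X j \<omega>))) (b_CC n)" for n
    using assms(7)[of n] unfolding log_lik_CC_def drop_missing_def .
  hence mleCC: "is_mle_beta P (\<lambda>\<omega>. log_lik_PC_ig n (\<lambda>j. affine_obs B c (drop_missing (X j \<omega>)))) (\<lambda>\<omega>. affine_rule B c (b_CC n \<omega>))" for n
    by (rule is_mle_beta_affine[OF B])
  \<comment> \<open>In the completely classified model no label variance is lost, so the denominator
    of its leading term is 1.\<close>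
  have I0CC: "CC.I0 = 0" by (simp add: CC.I0_def)
  note exPC = PC.expected_error_expansion[OF iidPC mlePC, folded err_can]
  note exCC = CC.expected_error_expansion[OF iidCC mleCC, folded err_can]
  have h: "1 - (4 + \<Delta>\<^sup>2) * PC.I0 > 0" using PC.I0_bound by simp
  have ARE: "has_ARE (\<lambda>n. \<integral>\<omega>. err \<theta> (b_CC n \<omega>) \<partial>P) (\<lambda>n. \<integral>\<omega>. err \<theta> (b_PC n \<omega>) \<partial>P) (opt_err \<theta>) (1 - (4 + \<Delta>\<^sup>2) * PC.I0)"
    unfolding has_ARE_def
  proof (intro exI conjI allI impI)
    show "first_order_expansion (\<lambda>n. \<integral>\<omega>. err \<theta> (b_CC n \<omega>) \<partial>P)
       (\<lambda>n. PC.copt + PC.kappa * real CARD('p) * ((4 + \<Delta>\<^sup>2) / (1 - (4 + \<Delta>\<^sup>2) * CC.I0)) / real n)" by (rule exCC)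
    show "first_order_expansion (\<lambda>n. \<integral>\<omega>. err \<theta> (b_PC n \<omega>) \<partial>P)
       (\<lambda>n. PC.copt + PC.kappa * real CARD('p) * ((4 + \<Delta>\<^sup>2) / (1 - (4 + \<Delta>\<^sup>2) * PC.I0)) / real n)" by (rule exPC)
    fix n :: nat assume n: "n > 0"
    \<comment> \<open>The common factor of both leading terms; it contains the dimension, which
      therefore cancels in the ratio.\<close>
    define u where "u = PC.kappa * real CARD('p) * (4 + \<Delta>\<^sup>2)"
    have "u > 0" unfolding u_def using PC.kappa_pos by (intro mult_pos_pos add_pos_nonneg) auto
    moreover have r: "PC.copt + PC.kappa * real CARD('p) * ((4 + \<Delta>\<^sup>2) / (1 - (4 + \<Delta>\<^sup>2) * i)) / real n - opt_err \<theta> = u / (1 - (4 + \<Delta>\<^sup>2) * i) / real n" for i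
      unfolding opt u_def by simp
    ultimately show "PC.copt + PC.kappa * real CARD('p) * ((4 + \<Delta>\<^sup>2) / (1 - (4 + \<Delta>\<^sup>2) * PC.I0)) / real n - opt_err \<theta> \<noteq> 0"
      "(PC.copt + PC.kappa * real CARD('p) * ((4 + \<Delta>\<^sup>2) / (1 - (4 + \<Delta>\<^sup>2) * CC.I0)) / real n - opt_err \<theta>) /
       (PC.copt + PC.kappa * real CARD('p) * ((4 + \<Delta>\<^sup>2) / (1 - (4 + \<Delta>\<^sup>2) * PC.I0)) / real n - opt_err \<theta>) = 1 - (4 + \<Delta>\<^sup>2) * PC.I0"
      unfolding r I0CC using n h by simp_all
  qed
  have "(\<integral>\<omega>. missing_prob \<theta> \<xi> (fst (X j \<omega>)) \<partial>P) = gamma \<Delta> \<xi>" for j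
  proof -
    interpret iid_sample P "\<lambda>j \<omega>. affine_obs B c (X j \<omega>)" PC.law by (rule iidPC)
    have e: "missing_prob \<theta> \<xi> (fst a) = q1 \<Delta> \<xi> (fst (affine_obs B c a) $ k)" for a
      unfolding miss_eq affine_obs_def by (cases a) simp
    have m: "(\<lambda>a. q1 \<Delta> \<xi> (fst a $ k)) \<in> borel_measurable PC.law"
      unfolding PC.borel_measurable_law by (rule obs_measurableI) (use PC.Q_measurable in simp)
    have "(\<integral>\<omega>. missing_prob \<theta> \<xi> (fst (X j \<omega>)) \<partial>P) = PC.Ex (\<lambda>a. q1 \<Delta> \<xi> (fst a $ k))"
      unfolding e by (rule expectation_X(1)[OF m])
    thus ?thesis by (simp only: PC.Ex_missing gamma_def)
  qed
  moreover have "(4 + \<Delta>\<^sup>2) * PC.I0 = (\<Delta>\<^sup>2 + 4) * gamma \<Delta> \<xi> * d0 \<Delta> \<xi>"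
    unfolding gamma_mult_d0[OF D, symmetric] by (simp add: algebra_simps)
  ultimately show ?thesis using ARE by simp
qed

end
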